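(* Let $\Omega=C_0(\mathbb{R}_+,\mathbb{R}^d)$ be the Wiener space with Wiener measure and canonical Brownian motion $W_t(\omega)=\omega(t)$. Let $b:\mathbb{R}^m\to\mathbb{R}^m$ and $\sigma:\mathbb{R}^m\to\mathcal{M}_{m,d}(\mathbb{R})$ be globally Lipschitz ($|b(x)-b(y)|\le K_0|x-y|$, $\|\sigma(x)-\sigma(y)\|\le K_0|x-y|$), and for each $h>0$ let $\eta^{(h)}:\mathbb{R}^m\times\mathbb{R}^d\to\mathbb{R}^m$ be measurable with $|\eta^{(h)}(x,y)|\le K_2(h^\alpha|x|+|y|)$ for some $\alpha\in(0,+\infty]$, $K_2$ and all $h,x,y$. Suppose that the repeated-interaction dynamics with time step $h$ acts on the system component through \[U^{(h)}(x,y)=x+\sigma(x)y+hb(x)+h\eta^{(h)}(x,y),\] i.e. for an initial state $x_0\in\mathbb{R}^m$ the system evolves by $X^h_0=x_0$, $X^h_{(n+1)h}=U^{(h)}(X^h_{nh},W_{(n+1)h}-W_{nh})$, and let $\overline{X}^h_t=X^h_{\lfloor t/h\rfloor h}+\frac{t-\lfloor t/h\rfloor h}{h}\{X^h_{(\lfloor t/h\rfloor+1)h}-X^h_{\lfloor t/h\rfloor h}\}$ be its linear interpolation (the first component of the embedded continuous-time dynamics). For $\tau>0$ let $(X^{x_0}_t)$ be the solution on $[0,\tau]$ of $dX^{x_0}_t=b(X^{x_0}_t)dt+\sigma(X^{x_0}_t)dW_t$, $X^{x_0}_0=x_0$. Then $(\overline{X}^h_t)$ converges to $(X^{x_0}_t)$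 in $L^p$ on $[0,\tau]$ for all $p>2$ as $h\to0$, and the convergence is also almost sure on $[0,\tau]$.
   Context: $|\cdot|$ is the Euclidean norm; $\|\cdot\|$ is the Hilbert–Schmidt norm on $m\times d$ real matrices. When $\alpha=+\infty$, $h^\alpha$ is interpreted as $0$. Convergence in $L^p$ on $[0,\tau]$ means $\mathbb{E}[(\sup_{t\in[0,\tau]}|X^{x_0}_t-\overline{X}^h_t|)^p]\to0$. *)

theory Defs
  imports "HOL-Probability.Probability"
begin

text \<open>Paths in C_0(R_+, R^d), represented as functions on the reals which are
continuous on [0,oo), vanish at 0, and are extended by 0 to negative times
(so that the representation is unique).\<close>

definition wiener_paths :: "(real \<Rightarrow> real^'d) set" where
  "wiener_paths = {\<omega>. continuous_on {0..} \<omega> \<and> \<omega> 0 = 0 \<and> (\<forall>t<0. \<omega> t = 0)}"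

definition cyl_sets :: "real set \<Rightarrow> (real \<Rightarrow> real^'d) set set" where
  "cyl_sets T = {{\<omega> \<in> wiener_paths. \<omega> s \<in> A} | s A. s \<in> T \<and> A \<in> sets borel}"

definition nat_filtration :: "real \<Rightarrow> (real \<Rightarrow> real^'d) measure" where
  "nat_filtration t = sigma wiener_paths (cyl_sets {..t})"

text \<open>M is the Wiener measure: the probability measure on the canonical space
with the cylinder sigma algebra under which the coordinate process has
independent increments, each coordinate of W_t - W_s being N(0, t - s),
and the coordinates of each increment independent.  (These finite
dimensional distributions determine the measure uniquely.)\<close>

definition is_wiener_measure :: "(real \<Rightarrow> real^'d) measure \<Rightarrow> bool" where
  "is_wiener_measure M \<longleftrightarrow>
     prob_space M \<and> space M = wiener_paths \<and>
     sets M = sigma_sets wiener_paths (cyl_sets {0..}) \<and>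
     (\<forall>(n::nat) (ts :: nat \<Rightarrow> real). 0 \<le> ts 0 \<longrightarrow> (\<forall>k<n. ts k < ts (Suc k)) \<longrightarrow>
        prob_space.indep_vars M (\<lambda>_. borel)
           (\<lambda>(k, i) \<omega>. (\<omega> (ts (Suc k)) - \<omega> (ts k)) $ i) ({..<n} \<times> (UNIV :: 'd set)) \<and>
        (\<forall>k<n. \<forall>i. distributed M lborel (\<lambda>\<omega>. (\<omega> (ts (Suc k)) - \<omega> (ts k)) $ i)
              (\<lambda>x. ennreal (normal_density 0 (sqrt (ts (Suc k) - ts k)) x))))"

definition hpow :: "real \<Rightarrow> ereal \<Rightarrow> real" where
  "hpow h \<alpha> = (if \<alpha> = \<infinity> then 0 else h powr real_of_ereal \<alpha>)"

definition U_step ::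
  "(real^'m \<Rightarrow> real^'m) \<Rightarrow> (real^'m \<Rightarrow> real^'d^'m) \<Rightarrow>
   (real \<Rightarrow> real^'m \<Rightarrow> real^'d \<Rightarrow> real^'m) \<Rightarrow> real \<Rightarrow> real^'m \<Rightarrow> real^'d \<Rightarrow> real^'m" where
  "U_step b \<sigma> \<eta> h x y = x + \<sigma> x *v y + h *\<^sub>R b x + h *\<^sub>R \<eta> h x y"

primrec Xgrid ::
  "(real^'m \<Rightarrow> real^'m) \<Rightarrow> (real^'m \<Rightarrow> real^'d^'m) \<Rightarrow>
   (real \<Rightarrow> real^'m \<Rightarrow> real^'d \<Rightarrow> real^'m) \<Rightarrow> real \<Rightarrow> real^'m \<Rightarrow> (real \<Rightarrow> real^'d) \<Rightarrow> nat \<Rightarrow> real^'m" where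
  "Xgrid b \<sigma> \<eta> h x0 \<omega> 0 = x0"
| "Xgrid b \<sigma> \<eta> h x0 \<omega> (Suc n) =
     U_step b \<sigma> \<eta> h (Xgrid b \<sigma> \<eta> h x0 \<omega> n) (\<omega> (real (Suc n) * h) - \<omega> (real n * h))"

definition Xbar ::
  "(real^'m \<Rightarrow> real^'m) \<Rightarrow> (real^'m \<Rightarrow> real^'d^'m) \<Rightarrow>
   (real \<Rightarrow> real^'m \<Rightarrow> real^'d \<Rightarrow> real^'m) \<Rightarrow> real \<Rightarrow> real^'m \<Rightarrow> (real \<Rightarrow> real^'d) \<Rightarrow> real \<Rightarrow> real^'m" where
  "Xbar b \<sigma> \<eta> h x0 \<omega> t =
     (let k = nat \<lfloor>t / h\<rfloor> in
        Xgrid b \<sigma> \<eta> h x0 \<omega> k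
        + ((t - real k * h) / h) *\<^sub>R (Xgrid b \<sigma> \<eta> h x0 \<omega> (Suc k) - Xgrid b \<sigma> \<eta> h x0 \<omega> k))"

definition conv_in_prob :: "'a measure \<Rightarrow> (nat \<Rightarrow> 'a \<Rightarrow> 'b::real_normed_vector) \<Rightarrow> ('a \<Rightarrow> 'b) \<Rightarrow> bool" where
  "conv_in_prob M S Y \<longleftrightarrow>
     (\<forall>e>0. (\<lambda>n. measure M {\<omega> \<in> space M. e < norm (S n \<omega> - Y \<omega>)}) \<longlonglongrightarrow> 0)"

text \<open>Left-point Riemann sums of int_0^t H_s dW_s along the uniform partition with n
pieces.  For continuous adapted integrands the Ito integral is the limit in
probability of these sums.\<close>

definition ito_riemann_sum ::
  "(real \<Rightarrow> (real \<Rightarrow> real^'d) \<Rightarrow> real^'d^'m) \<Rightarrow> real \<Rightarrow> nat \<Rightarrow> (real \<Rightarrow> real^'d) \<Rightarrow> real^'m" where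
  "ito_riemann_sum H t n \<omega> =
     (\<Sum>k<n. H (real k * t / real n) \<omega> *v
        (\<omega> (real (Suc k) * t / real n) - \<omega> (real k * t / real n)))"

text \<open>X is a (strong) solution on [0,tau] of dX = b(X)dt + sigma(X)dW, X_0 = x0:
measurable, continuous paths, adapted to the (augmented) Brownian filtration,
and X_t = x0 + int_0^t b(X_s) ds + int_0^t sigma(X_s) dW_s a.s. for each t.\<close>

definition sde_solution ::
  "(real \<Rightarrow> real^'d) measure \<Rightarrow> (real^'m \<Rightarrow> real^'m) \<Rightarrow> (real^'m \<Rightarrow> real^'d^'m) \<Rightarrow>
   real^'m \<Rightarrow> real \<Rightarrow> (real \<Rightarrow> (real \<Rightarrow> real^'d) \<Rightarrow> real^'m) \<Rightarrow> bool" where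
  "sde_solution M b \<sigma> x0 \<tau> X \<longleftrightarrow>
     (\<forall>t\<in>{0..\<tau>}. X t \<in> borel_measurable M) \<and>
     (\<forall>\<omega>\<in>space M. continuous_on {0..\<tau>} (\<lambda>t. X t \<omega>)) \<and>
     (\<forall>t\<in>{0..\<tau>}. \<exists>Y. Y \<in> borel_measurable (nat_filtration t) \<and> (AE \<omega> in M. X t \<omega> = Y \<omega>)) \<and>
     (\<forall>t\<in>{0..\<tau>}. conv_in_prob M (ito_riemann_sum (\<lambda>s \<omega>. \<sigma> (X s \<omega>)) t)
         (\<lambda>\<omega>. X t \<omega> - x0 - integral {0..t} (\<lambda>s. b (X s \<omega>))))"

end

theory Submission
  imports Defs
begin

text \<open>
  All moment estimates come from one inequality. If \<open>e\<close> is adapted and \<open>e' = e + A *v y + r\<close>, where \<open>y\<close> is the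
  Brownian increment over the next step of length \<open>\<delta>\<close>, \<open>norm A \<le> B\<close> and
  \<open>norm r \<le> \<delta> * B * (1 + norm y / sqrt \<delta>)\<close>, then the term linear in \<open>y\<close> has mean zero and the \<open>2q\<close>-th moment of
  \<open>e'\<close> is at most \<open>1 + C\<delta>\<close> times that of \<open>e\<close> plus \<open>C\<delta>\<close> times that of \<open>B\<close>. Iterating it bounds the scheme, its refinement
  error, the effect of \<open>\<eta>\<close> and the dependence on the initial point. Maxima over the grid are replaced by sums: the loss of a
  factor \<open>1/h\<close> is absorbed by a large \<open>q\<close>, so that no maximal inequality for martingales is needed.

  For the almost sure statement, \<open>h\<close> runs through a continuum and \<open>\<eta>\<close> may depend on \<open>h\<close> in an arbitrary way, so the
  scheme is compared pathwise with unperturbed Euler schemes along a countable net of step sizes. Both \<open>\<eta>\<close> and the change of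
  step size are treated as adversarial perturbations of each step, controlled by the stability of the Euler flow between
  the points of a spatial grid; as there are only polynomially many grid points, a union bound suffices.
\<close>

text \<open>The notion of solution provides neither moments of \<open>X\<close> nor an isometry for
  the integral, only limits in probability of left-point sums. \<open>X\<close> is therefore
  recognised as a limit of Euler schemes and inherits every quantitative property from them.

  For the almost sure part a pathwise Gronwall bound is useless: Brownian increments over a step
  have size about \<open>sqrt h\<close>, so the product of the Lipschitz constants of
  \<open>1/h\<close> steps explodes. What does hold almost surely, for small steps of the net, is a
  Lipschitz constant \<open>h powr (-\<gamma>/2)\<close> of the Euler flow between finitely many
  deterministic points. Local errors are of order \<open>h powr (1 + \<gamma>)\<close>;
  \<open>1/h\<close> of them, amplified by that constant, add up to order
  \<open>h powr (\<gamma>/2)\<close>.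

  This dictates the other exponents. Paths are \<open>1/8\<close>-Hoelder, so step sizes that differ
  by order \<open>h^17\<close> have grid times within order \<open>h^16\<close> and path values
  within order \<open>h^2\<close>, which is below the local error; the spatial mesh is
  \<open>h^2\<close> for the same reason.\<close>

lemma vec_norm_mult_le: "norm (A *v x) \<le> norm A * norm (x :: real^'n)" for A :: "real^'n^'m"
proof -
  have "norm (A *v x) \<le> L2_set (\<lambda>i. norm (A $ i) * norm x) UNIV"
    unfolding norm_vec_def[of "A *v x"]
    by (rule L2_set_mono)
       (auto simp: matrix_vector_mul_component intro: Cauchy_Schwarz_ineq2)
  also have "\<dots> = norm A * norm x"
    by (simp add: L2_set_left_distrib norm_vec_def[of A])
  finally show ?thesis .
qed

text \<open>Once \<open>A *v x\<close> is known to be bounded bilinear, its continuity, Borel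
  measurability and limits in both arguments come from the general theory. The norm of a matrix type
  is the Hilbert-Schmidt norm, which dominates the operator norm, so the constant is 1.\<close>

lemma bounded_bilinear_matrix_vector:
  "bounded_bilinear (\<lambda>(A :: real^'n^'m) x. A *v x)"
proof (rule bounded_bilinear.intro)
  show "\<exists>K. \<forall>(A :: real^'n^'m) x. norm (A *v x) \<le> norm A * norm x * K"
    by (intro exI[of _ 1]) (simp add: vec_norm_mult_le)
qed (auto simp: algebra_simps matrix_vector_mult_def vec_eq_iff sum.distrib sum_distrib_left)

lemma borel_measurable_matrix_vector [measurable (raw)]:
  assumes "f \<in> borel_measurable N" "g \<in> borel_measurable N"
  shows "(\<lambda>\<omega>. (f \<omega> :: real^'n^'m) *v g \<omega>) \<in> borel_measurable N"
  by (rule borel_measurable_continuous_Pair[OF assms])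
     (intro bounded_bilinear.continuous_on[OF bounded_bilinear_matrix_vector] continuous_intros)

lemma borel_measurable_vecI:
  fixes f :: "'a \<Rightarrow> real^'n"
  assumes "\<And>i. (\<lambda>x. f x $ i) \<in> borel_measurable N"
  shows "f \<in> borel_measurable N"
proof (rule iffD2[OF borel_measurable_euclidean_space], rule ballI)
  fix i :: "real^'n" assume "i \<in> Basis"
  then obtain j where "i = axis j 1" by (auto simp: Basis_vec_def)
  then show "(\<lambda>x. f x \<bullet> i) \<in> borel_measurable N"
    using assms[of j] by (simp add: inner_axis)
qed

section \<open>Brownian increments and the natural filtration\<close>

lemma wiener_path_nonpos: "\<omega> \<in> wiener_paths \<Longrightarrow> u \<le> 0 \<Longrightarrow> \<omega> u = 0"
  by (cases "u = 0") (auto simp: wiener_paths_def)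

lemma space_nat_filtration [simp]: "space (nat_filtration t) = wiener_paths"
  unfolding nat_filtration_def by (rule space_measure_of) (auto simp: cyl_sets_def)

lemma sets_nat_filtration: "sets (nat_filtration t) = sigma_sets wiener_paths (cyl_sets {..t})"
  unfolding nat_filtration_def by (rule sets_measure_of) (auto simp: cyl_sets_def)

lemma nat_filtration_eval:
  assumes "u \<le> t"
  shows "(\<lambda>\<omega>. \<omega> u) \<in> borel_measurable (nat_filtration t)"
proof (rule measurableI)
  fix A :: "(real^'d) set" assume "A \<in> sets borel"
  then have "{\<omega> \<in> wiener_paths. \<omega> u \<in> A} \<in> cyl_sets {..t}"
    using assms by (auto simp: cyl_sets_def)
  moreover have "(\<lambda>\<omega>. \<omega> u) -` A \<inter> space (nat_filtration t) = {\<omega> \<in> wiener_paths. \<omega> u \<in> A}"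
    by auto
  ultimately show "(\<lambda>\<omega>. \<omega> u) -` A \<inter> space (nat_filtration t) \<in> sets (nat_filtration t)"
    unfolding sets_nat_filtration by auto
qed auto

lemma nat_filtration_mono:
  assumes "s \<le> t" shows "sets (nat_filtration s) \<subseteq> sets (nat_filtration t)"
  unfolding sets_nat_filtration by (rule sigma_sets_mono') (use assms in \<open>force simp: cyl_sets_def\<close>)

lemma measurable_nat_filtration_mono:
  assumes "f \<in> measurable (nat_filtration s) N" "s \<le> t"
  shows "f \<in> measurable (nat_filtration t) N"
  using assms nat_filtration_mono[OF assms(2)] unfolding measurable_def by auto

locale wiener_space =
  fixes M :: "(real \<Rightarrow> real^'d::finite) measure"
  assumes wiener: "is_wiener_measure M"
begin

sublocale prob_space M
  using wiener by (simp add: is_wiener_measure_def)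

lemma space_M [simp]: "space M = wiener_paths"
  using wiener by (simp add: is_wiener_measure_def)

lemma sets_M: "sets M = sigma_sets wiener_paths (cyl_sets {0..})"
  using wiener by (simp add: is_wiener_measure_def)

text \<open>\<open>sets M\<close> is generated by nonnegative times only; at negative times the
  convention that paths vanish there makes the coordinate constant. Admitting every real
  \<open>u\<close> spares later measurability goals a side condition.\<close>

lemma eval_measurable [measurable]: "(\<lambda>\<omega>. \<omega> u) \<in> borel_measurable M"
proof (cases "u \<ge> 0")
  case True
  show ?thesis
  proof (rule measurableI)
    fix A :: "(real^'d) set" assume "A \<in> sets borel"
    then have "{\<omega> \<in> wiener_paths. \<omega> u \<in> A} \<in> cyl_sets {0..}"
      using True by (auto simp: cyl_sets_def)
    moreover have "(\<lambda>\<omega>. \<omega> u) -` A \<inter> space M = {\<omega> \<in> wiener_paths. \<omega> u \<in> A}"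
      by auto
    ultimately show "(\<lambda>\<omega>. \<omega> u) -` A \<inter> space M \<in> sets M"
      unfolding sets_M by auto
  qed auto
next
  case False
  then show ?thesis
    by (subst measurable_cong[where g = "\<lambda>_. 0"]) (auto simp: wiener_path_nonpos)
qed

lemma nat_filtration_sub: "sets (nat_filtration t) \<subseteq> sets M"
proof -
  have "cyl_sets {..t} \<subseteq> sets M"
  proof
    fix S :: "(real \<Rightarrow> real^'d) set" assume "S \<in> cyl_sets {..t}"
    then obtain u A where S: "S = {\<omega> \<in> wiener_paths. \<omega> u \<in> A}" "A \<in> sets borel"
      by (auto simp: cyl_sets_def)
    have "S = (\<lambda>\<omega>. \<omega> u) -` A \<inter> space M" using S by auto
    then show "S \<in> sets M" using measurable_sets[OF eval_measurable S(2)] by simp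
  qed
  then show ?thesis
    unfolding sets_nat_filtration using sets.sigma_sets_subset[of _ M] by simp
qed

lemma measurable_from_filtration:
  "f \<in> measurable (nat_filtration t) N \<Longrightarrow> f \<in> measurable M N"
  using nat_filtration_sub unfolding measurable_def by auto

lemma id_measurable: "(\<lambda>\<omega>. \<omega>) \<in> measurable M (nat_filtration t)"
  by (rule measurable_from_filtration) (rule measurable_ident[unfolded id_def])

text \<open>A pi-system that generates \<open>nat_filtration s\<close>; the one-time sets in
  \<open>cyl_sets\<close> are not closed under intersection.\<close>

definition finite_cylinders :: "real \<Rightarrow> (real \<Rightarrow> real^'d) set set" where
  "finite_cylinders s = {{\<omega> \<in> wiener_paths. \<forall>u\<in>J. \<omega> u \<in> A u} | J A.
      finite J \<and> J \<subseteq> {..s} \<and> (\<forall>u. A u \<in> sets borel)}"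

lemma Int_stable_finite_cylinders: "Int_stable (finite_cylinders s)"
proof (rule Int_stableI)
  fix P Q assume "P \<in> finite_cylinders s" "Q \<in> finite_cylinders s"
  then obtain J A J' A' where
    P: "P = {\<omega> \<in> wiener_paths. \<forall>u\<in>J. \<omega> u \<in> A u}" "finite J" "J \<subseteq> {..s}" "\<forall>u. A u \<in> sets borel" and
    Q: "Q = {\<omega> \<in> wiener_paths. \<forall>u\<in>J'. \<omega> u \<in> A' u}" "finite J'" "J' \<subseteq> {..s}" "\<forall>u. A' u \<in> sets borel"
    unfolding finite_cylinders_def by blast
  define B where "B u = (if u \<in> J then A u else UNIV) \<inter> (if u \<in> J' then A' u else UNIV)" for u
  have "P \<inter> Q = {\<omega> \<in> wiener_paths. \<forall>u\<in>J \<union> J'. \<omega> u \<in> B u}"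
    unfolding P Q B_def by auto
  moreover have "\<forall>u. B u \<in> sets borel" using P Q by (auto simp: B_def)
  moreover have "finite (J \<union> J')" "J \<union> J' \<subseteq> {..s}" using P Q by auto
  ultimately show "P \<inter> Q \<in> finite_cylinders s"
    unfolding finite_cylinders_def mem_Collect_eq
    by - (rule exI[of _ "J \<union> J'"], rule exI[of _ B], intro conjI; assumption)
qed

text \<open>The Wiener property speaks of increments along one increasing sequence of times. Both
  events are expressed through a sequence that runs through the cylinder times and ends with
  \<open>s\<close> and \<open>t\<close>: the cylinder depends on the increments up to
  \<open>s\<close>, the other event on the last increment, and disjoint blocks of independent
  variables are independent.\<close>

lemma finite_cylinder_indep:
  assumes st: "0 \<le> s" "s < t" and g: "g \<in> finite_cylinders s" and C: "C \<in> sets borel"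
  shows "prob (g \<inter> {\<omega> \<in> space M. \<omega> t - \<omega> s \<in> C}) = prob g * prob {\<omega> \<in> space M. \<omega> t - \<omega> s \<in> C}"
proof -
  obtain J A where J: "g = {\<omega> \<in> wiener_paths. \<forall>u\<in>J. \<omega> u \<in> A u}" "finite J" "J \<subseteq> {..s}"
    and A: "\<And>u. A u \<in> sets borel"
    using g unfolding finite_cylinders_def by blast
  \<comment> \<open>Time 0 is added so that path values are sums of increments starting from
    \<open>\<omega> 0 = 0\<close>, and \<open>s\<close> so that the increment after the last listed
    time is the one from \<open>s\<close> to \<open>t\<close>. Negative cylinder times are left out,
    since all paths vanish there.\<close>
  define xs where "xs = sorted_list_of_set (insert 0 (insert s (J \<inter> {0..})))"
  define n where "n = length xs - 1"
  have fin: "finite (insert 0 (insert s (J \<inter> {0..})))" using J by auto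
  have set_xs: "set xs = insert 0 (insert s (J \<inter> {0..}))" unfolding xs_def using fin by (rule set_sorted_list_of_set)
  have sd: "sorted xs" "distinct xs" unfolding xs_def by auto
  then have ssd: "sorted_wrt (<) xs" by (simp add: strict_sorted_iff)
  have len: "length xs = Suc n" using set_xs unfolding n_def by (cases xs) auto
  define ts where "ts k = (if k \<le> n then xs ! k else t)" for k
  have in_xs: "ts k \<in> set xs" if "k \<le> n" for k using that len by (auto simp: ts_def)
  have bounds: "0 \<le> ts k \<and> ts k \<le> s" if "k \<le> n" for k
    using in_xs[OF that] set_xs st J(3) by auto
  have inc: "ts k < ts (Suc k)" if "k < Suc n" for k
  proof (cases "k < n")
    case True
    then show ?thesis using ssd len by (auto simp: ts_def sorted_wrt_iff_nth_less)
  next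
    case False
    then have "k = n" using that by simp
    then show ?thesis using bounds[of n] st by (simp add: ts_def)
  qed
  have ts0: "ts 0 = 0"
  proof -
    obtain k where k: "k \<le> n" "xs ! k = 0" using set_xs len by (metis in_set_conv_nth insertI1 less_Suc_eq_le)
    have "xs ! 0 \<le> xs ! k" using sd(1) k len by (intro sorted_nth_mono) auto
    then show ?thesis using bounds[of 0] k by (simp add: ts_def)
  qed
  have tsn: "ts n = s"
  proof -
    obtain k where k: "k \<le> n" "xs ! k = s" using set_xs len
      by (metis in_set_conv_nth insertI1 insertI2 less_Suc_eq_le)
    have "xs ! k \<le> xs ! n" using sd(1) k len by (intro sorted_nth_mono) auto
    then show ?thesis using bounds[of n] k by (simp add: ts_def)
  qed
  have tsS: "ts (Suc n) = t" by (simp add: ts_def)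
  define D where "D = (\<lambda>(k, i) (\<omega> :: real \<Rightarrow> real^'d). (\<omega> (ts (Suc k)) - \<omega> (ts k)) $ (i::'d))"
  have "indep_vars (\<lambda>_. borel) D ({..<Suc n} \<times> UNIV)"
    using wiener ts0 inc unfolding is_wiener_measure_def D_def by auto
  then have ind: "indep_var
      (PiM ({..<n} \<times> UNIV) (\<lambda>_. borel)) (\<lambda>\<omega>. restrict (\<lambda>i. D i \<omega>) ({..<n} \<times> UNIV))
      (PiM ({n} \<times> UNIV) (\<lambda>_. borel)) (\<lambda>\<omega>. restrict (\<lambda>i. D i \<omega>) ({n} \<times> UNIV))"
    by (rule indep_var_restrict) auto
  \<comment> \<open>Position of \<open>u\<close> in the sorted list; a negative \<open>u\<close> is
    represented by time 0, where the path has the same value.\<close>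
  define idx where "idx u = (SOME k. k \<le> n \<and> ts k = max u 0)" for u
  have idx: "idx u \<le> n \<and> ts (idx u) = max u 0" if "u \<in> J" for u
  proof -
    have "max u 0 \<in> set xs" using that set_xs by (auto simp: max_def)
    then obtain k where "k < length xs" "xs ! k = max u 0" by (auto simp: in_set_conv_nth)
    then have "\<exists>k. k \<le> n \<and> ts k = max u 0" using len by (auto simp: ts_def intro!: exI[of _ k])
    then show ?thesis unfolding idx_def by (rule someI_ex)
  qed
  \<comment> \<open>Recovers the path value at \<open>ts k\<close> from the increments by
    telescoping, so that the cylinder becomes the preimage of a measurable set \<open>Q\<close> of
    increments.\<close>
  define Wv where "Wv k v = (\<chi> i::'d. \<Sum>j<k. v (j, i))" for k :: nat and v :: "nat \<times> 'd \<Rightarrow> real"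
  have WvD: "Wv k (restrict (\<lambda>i. D i \<omega>) ({..<n} \<times> UNIV)) = \<omega> (ts k)"
    if "k \<le> n" "\<omega> \<in> wiener_paths" for k \<omega>
  proof -
    have "(\<Sum>j<k. restrict (\<lambda>i. D i \<omega>) ({..<n} \<times> UNIV) (j, i)) = (\<Sum>j<k. \<omega> (ts (Suc j)) $ i - \<omega> (ts j) $ i)" for i
      using that by (intro sum.cong) (auto simp: D_def)
    also have "\<dots> i = \<omega> (ts k) $ i" for i
      using that(2) ts0 wiener_path_nonpos[of \<omega> 0] by (subst sum_lessThan_telescope) auto
    finally show ?thesis by (simp add: Wv_def vec_eq_iff)
  qed
  define Q where "Q = {v \<in> space (PiM ({..<n} \<times> (UNIV::'d set)) (\<lambda>_. borel)). \<forall>u\<in>J. Wv (idx u) v \<in> A u}"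
  have Wv_meas: "Wv k \<in> borel_measurable (PiM ({..<n} \<times> (UNIV::'d set)) (\<lambda>_. borel))" if "k \<le> n" for k
    unfolding Wv_def using that
    by (intro borel_measurable_vecI) (auto intro!: borel_measurable_sum measurable_component_singleton)
  have Q: "Q \<in> sets (PiM ({..<n} \<times> UNIV) (\<lambda>_. borel))"
    unfolding Q_def
  proof (rule sets.sets_Collect_finite_All[OF _ J(2)])
    fix u assume u: "u \<in> J"
    have "Wv (idx u) -` A u \<inter> space (PiM ({..<n} \<times> (UNIV::'d set)) (\<lambda>_. borel)) \<in> sets (PiM ({..<n} \<times> UNIV) (\<lambda>_. borel))"
      using Wv_meas idx[OF u] A by (intro measurable_sets) auto
    then show "{v \<in> space (PiM ({..<n} \<times> (UNIV::'d set)) (\<lambda>_. borel)). Wv (idx u) v \<in> A u}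
         \<in> sets (PiM ({..<n} \<times> UNIV) (\<lambda>_. borel))"
      by (simp add: vimage_def Int_def conj_commute)
  qed
  define last where "last v = (\<chi> i::'d. v (n, i))" for v :: "nat \<times> 'd \<Rightarrow> real"
  have last_meas: "last \<in> borel_measurable (PiM ({n} \<times> (UNIV::'d set)) (\<lambda>_. borel))"
    unfolding last_def by (intro borel_measurable_vecI) (auto intro!: measurable_component_singleton)
  define L where "L = last -` C \<inter> space (PiM ({n} \<times> (UNIV::'d set)) (\<lambda>_. borel))"
  have L: "L \<in> sets (PiM ({n} \<times> UNIV) (\<lambda>_. borel))"
    unfolding L_def using last_meas C by (rule measurable_sets)
  have gQ: "(\<lambda>\<omega>. restrict (\<lambda>i. D i \<omega>) ({..<n} \<times> UNIV)) -` Q \<inter> space M = g"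
  proof -
    have "\<omega> (max u 0) = \<omega> u" if "\<omega> \<in> wiener_paths" for \<omega> u
      using wiener_path_nonpos[OF that, of u] wiener_path_nonpos[OF that, of 0] by (auto simp: max_def)
    then have "Wv (idx u) (restrict (\<lambda>i. D i \<omega>) ({..<n} \<times> UNIV)) = \<omega> u"
      if "\<omega> \<in> wiener_paths" "u \<in> J" for \<omega> u
      using WvD[OF _ that(1), of "idx u"] idx[OF that(2)] that(1) by simp
    then show ?thesis
      unfolding Q_def J(1) by (auto simp: space_PiM)
  qed
  have CL: "(\<lambda>\<omega>. restrict (\<lambda>i. D i \<omega>) ({n} \<times> UNIV)) -` L \<inter> space M = {\<omega> \<in> space M. \<omega> t - \<omega> s \<in> C}"
  proof -
    have "last (restrict (\<lambda>i. D i \<omega>) ({n} \<times> UNIV)) = \<omega> t - \<omega> s" for \<omega>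
      unfolding last_def D_def by (simp add: vec_eq_iff tsn tsS)
    then show ?thesis unfolding L_def by (auto simp: space_PiM)
  qed
  have "(\<lambda>\<omega>. (restrict (\<lambda>i. D i \<omega>) ({..<n} \<times> UNIV), restrict (\<lambda>i. D i \<omega>) ({n} \<times> UNIV))) -` (Q \<times> L) \<inter> space M
      = g \<inter> {\<omega> \<in> space M. \<omega> t - \<omega> s \<in> C}"
    unfolding gQ[symmetric] CL[symmetric] by blast
  then show ?thesis
    using indep_varD[OF ind Q L] unfolding gQ CL by (simp only:)
qed

text \<open>The product formula on two pi-systems extends to the sigma algebras they generate; the
  events of the increment already form a sigma algebra, those of the past are generated by
  \<open>finite_cylinders\<close>.\<close>

lemma indep_increment:
  assumes st: "0 \<le> s" "s < t"
  shows "indep_set (sets (nat_filtration s)) {(\<lambda>\<omega>. \<omega> t - \<omega> s) -` A \<inter> space M | A. A \<in> sets borel}"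
proof -
  let ?B = "{(\<lambda>\<omega>. \<omega> t - \<omega> s) -` A \<inter> space M | A. A \<in> sets borel}"
  have cyl: "cyl_sets {..s} \<subseteq> finite_cylinders s"
  proof
    fix S :: "(real \<Rightarrow> real^'d) set" assume "S \<in> cyl_sets {..s}"
    then obtain u A where S: "S = {\<omega> \<in> wiener_paths. \<omega> u \<in> A}" "A \<in> sets borel" "u \<le> s"
      by (auto simp: cyl_sets_def)
    then have "S = {\<omega> \<in> wiener_paths. \<forall>v\<in>{u}. \<omega> v \<in> A}" by simp
    moreover have "finite {u}" "{u} \<subseteq> {..s}" "\<forall>v::real. A \<in> sets borel" using S by auto
    ultimately show "S \<in> finite_cylinders s"
      unfolding finite_cylinders_def mem_Collect_eq
      by - (rule exI[of _ "{u}"], rule exI[of _ "\<lambda>_. A"], intro conjI; assumption)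
  qed
  have events: "finite_cylinders s \<subseteq> sets M"
  proof
    fix g assume "g \<in> finite_cylinders s"
    then obtain J A where J: "g = {\<omega> \<in> wiener_paths. \<forall>u\<in>J. \<omega> u \<in> A u}" "finite J"
      and A: "\<And>u. A u \<in> sets borel"
      unfolding finite_cylinders_def by blast
    have "{\<omega> \<in> space M. \<forall>u\<in>J. \<omega> u \<in> A u} \<in> sets M"
    proof (rule sets.sets_Collect_finite_All[OF _ J(2)])
      fix u
      have "(\<lambda>\<omega>. \<omega> u) -` A u \<inter> space M \<in> sets M"
        by (rule measurable_sets[OF eval_measurable A])
      then show "{\<omega> \<in> space M. \<omega> u \<in> A u} \<in> sets M"
        by (simp add: vimage_def Int_def conj_commute)
    qed
    then show "g \<in> sets M" using J by simp
  qed
  have inc: "(\<lambda>\<omega>. \<omega> t - \<omega> s) \<in> borel_measurable M"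
    by (intro borel_measurable_diff eval_measurable)
  have B_events: "?B \<subseteq> sets M"
    using measurable_sets[OF inc] by auto
  have B_stable: "Int_stable ?B"
  proof (rule Int_stableI)
    fix P Q assume "P \<in> ?B" "Q \<in> ?B"
    then obtain A A' where "P = (\<lambda>\<omega>. \<omega> t - \<omega> s) -` A \<inter> space M" "Q = (\<lambda>\<omega>. \<omega> t - \<omega> s) -` A' \<inter> space M"
      "A \<in> sets borel" "A' \<in> sets borel" by blast
    then have "P \<inter> Q = (\<lambda>\<omega>. \<omega> t - \<omega> s) -` (A \<inter> A') \<inter> space M" "A \<inter> A' \<in> sets borel" by auto
    then show "P \<inter> Q \<in> ?B" by blast
  qed
  have "indep_set (finite_cylinders s) ?B"
  proof (rule indep_setI[OF events B_events])
    fix a b assume a: "a \<in> finite_cylinders s" and "b \<in> ?B"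
    then obtain C where C: "C \<in> sets borel" "b = (\<lambda>\<omega>. \<omega> t - \<omega> s) -` C \<inter> space M" by blast
    then have b: "b = {\<omega> \<in> space M. \<omega> t - \<omega> s \<in> C}" by auto
    show "prob (a \<inter> b) = prob a * prob b"
      unfolding b by (rule finite_cylinder_indep[OF st a C(1)])
  qed
  then have "indep_set (sigma_sets (space M) (finite_cylinders s)) (sigma_sets (space M) ?B)"
    by (rule indep_set_sigma_sets[OF _ Int_stable_finite_cylinders B_stable])
  moreover have "sets (nat_filtration s) \<subseteq> sigma_sets (space M) (finite_cylinders s)"
    unfolding sets_nat_filtration space_M using cyl by (rule sigma_sets_mono')
  ultimately show ?thesis
    unfolding indep_set_def by - (erule indep_sets_mono_sets, auto split: bool.split)
qed

definition incr :: "real \<Rightarrow> real \<Rightarrow> (real^'d) measure" where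
  "incr s t = distr M borel (\<lambda>\<omega>. \<omega> t - \<omega> s)"

lemma sets_incr [simp, measurable_cong]: "sets (incr s t) = sets borel"
  by (simp add: incr_def)

lemma space_incr [simp]: "space (incr s t) = UNIV"
  by (simp add: incr_def)

lemma prob_space_incr: "prob_space (incr s t)"
  unfolding incr_def by (rule prob_space_distr) (intro borel_measurable_diff eval_measurable)

text \<open>Freezing of the past: by independence, the joint law of the path seen through
  \<open>nat_filtration s\<close> and of the increment is a product measure, and Tonelli applies.
  This takes the place of conditional expectations everywhere below; with nonnegative integrals no
  integrability conditions arise.\<close>

lemma nn_integral_increment:
  assumes st: "0 \<le> s" "s < t" and f: "(\<lambda>(\<omega>, y). f \<omega> y) \<in> borel_measurable (nat_filtration s \<Otimes>\<^sub>M borel)"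
  shows "(\<integral>\<^sup>+ \<omega>. f \<omega> (\<omega> t - \<omega> s) \<partial>M) = (\<integral>\<^sup>+ \<omega>. (\<integral>\<^sup>+ y. f \<omega> y \<partial>incr s t) \<partial>M)"
proof -
  interpret I: prob_space "incr s t" by (rule prob_space_incr)
  have m: "(\<lambda>\<omega>. (\<omega>, \<omega> t - \<omega> s)) \<in> measurable M (nat_filtration s \<Otimes>\<^sub>M borel)"
    by (intro measurable_Pair id_measurable borel_measurable_diff eval_measurable)
  interpret F: prob_space "distr M (nat_filtration s) (\<lambda>\<omega>. \<omega>)"
    by (rule prob_space_distr[OF id_measurable])
  have inc: "(\<lambda>\<omega>. \<omega> t - \<omega> s) \<in> borel_measurable M"
    by (intro borel_measurable_diff eval_measurable)
  have pair: "distr M (nat_filtration s) (\<lambda>\<omega>. \<omega>) \<Otimes>\<^sub>M incr s t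
      = distr M (nat_filtration s \<Otimes>\<^sub>M borel) (\<lambda>\<omega>. (\<omega>, \<omega> t - \<omega> s))"
  proof (rule pair_measure_eqI)
    fix A and B :: "(real^'d) set"
    assume "A \<in> sets (distr M (nat_filtration s) (\<lambda>\<omega>. \<omega>))" "B \<in> sets (incr s t)"
    then have A: "A \<in> sets (nat_filtration s)" and B: "B \<in> sets borel" by simp_all
    let ?B = "(\<lambda>\<omega>. \<omega> t - \<omega> s) -` B \<inter> space M"
    have AM: "A \<subseteq> space M" using sets.sets_into_space[OF A] by simp
    have "prob (A \<inter> ?B) = prob A * prob ?B"
      by (rule indep_setD[OF indep_increment[OF st] A]) (use B in blast)
    moreover have "emeasure (distr M (nat_filtration s) (\<lambda>\<omega>. \<omega>)) A = prob A"
      using A AM by (subst emeasure_distr[OF id_measurable]) (auto simp: emeasure_eq_measure Int_absorb2)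
    moreover have "emeasure (incr s t) B = prob ?B"
      unfolding incr_def using B by (subst emeasure_distr[OF inc]) (auto simp: emeasure_eq_measure)
    moreover have "emeasure (distr M (nat_filtration s \<Otimes>\<^sub>M borel) (\<lambda>\<omega>. (\<omega>, \<omega> t - \<omega> s))) (A \<times> B) = prob (A \<inter> ?B)"
    proof -
      have "(\<lambda>\<omega>. (\<omega>, \<omega> t - \<omega> s)) -` (A \<times> B) \<inter> space M = A \<inter> ?B" using AM by auto
      then show ?thesis using A B by (subst emeasure_distr[OF m]) (auto simp: emeasure_eq_measure)
    qed
    ultimately show "emeasure (distr M (nat_filtration s) (\<lambda>\<omega>. \<omega>)) A * emeasure (incr s t) B
        = emeasure (distr M (nat_filtration s \<Otimes>\<^sub>M borel) (\<lambda>\<omega>. (\<omega>, \<omega> t - \<omega> s))) (A \<times> B)"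
      by (simp add: ennreal_mult)
  next
    show "sets (distr M (nat_filtration s) (\<lambda>\<omega>. \<omega>) \<Otimes>\<^sub>M incr s t)
        = sets (distr M (nat_filtration s \<Otimes>\<^sub>M borel) (\<lambda>\<omega>. (\<omega>, \<omega> t - \<omega> s)))"
      by (simp cong: sets_pair_measure_cong)
  qed (unfold_locales)
  have fm: "(\<lambda>(\<omega>, y). f \<omega> y) \<in> borel_measurable (distr M (nat_filtration s) (\<lambda>\<omega>. \<omega>) \<Otimes>\<^sub>M incr s t)"
    using f by (subst measurable_cong_sets[OF sets_pair_measure_cong refl]) auto
  have fi: "(\<lambda>\<omega>. \<integral>\<^sup>+ y. f \<omega> y \<partial>incr s t) \<in> borel_measurable (nat_filtration s)"
    using I.borel_measurable_nn_integral[of "\<lambda>\<omega> y. f \<omega> y" "nat_filtration s"] f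
    by (simp add: measurable_cong_sets[OF sets_pair_measure_cong[OF refl sets_incr] refl])
  have "(\<integral>\<^sup>+ \<omega>. f \<omega> (\<omega> t - \<omega> s) \<partial>M)
      = (\<integral>\<^sup>+ p. (\<lambda>(\<omega>, y). f \<omega> y) p \<partial>distr M (nat_filtration s \<Otimes>\<^sub>M borel) (\<lambda>\<omega>. (\<omega>, \<omega> t - \<omega> s)))"
    by (subst nn_integral_distr[OF m]) (use f in simp_all)
  also have "\<dots> = (\<integral>\<^sup>+ \<omega>. (\<integral>\<^sup>+ y. f \<omega> y \<partial>incr s t) \<partial>distr M (nat_filtration s) (\<lambda>\<omega>. \<omega>))"
    unfolding pair[symmetric] using I.nn_integral_fst[OF fm] by simp
  also have "\<dots> = (\<integral>\<^sup>+ \<omega>. (\<integral>\<^sup>+ y. f \<omega> y \<partial>incr s t) \<partial>M)"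
    by (subst nn_integral_distr[OF id_measurable]) (use fi in simp_all)
  finally show ?thesis .
qed

lemma incr_component:
  assumes st: "0 \<le> s" "s < t"
  shows "distr (incr s t) borel (\<lambda>y. y $ i) = density lborel (\<lambda>x. ennreal (normal_density 0 (sqrt (t - s)) x))"
proof -
  define ts where "ts = (\<lambda>k::nat. if k = 0 then s else t)"
  have "distributed M lborel (\<lambda>\<omega>. (\<omega> (ts (Suc 0)) - \<omega> (ts 0)) $ i)
              (\<lambda>x. ennreal (normal_density 0 (sqrt (ts (Suc 0) - ts 0)) x))"
    using wiener st unfolding is_wiener_measure_def
    by (elim conjE allE[of _ 1] allE[of _ ts]) (auto simp: ts_def)
  then have "distr M lborel (\<lambda>\<omega>. (\<omega> t - \<omega> s) $ i) = density lborel (\<lambda>x. ennreal (normal_density 0 (sqrt (t - s)) x))"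
    unfolding distributed_def ts_def by simp
  moreover have "distr (incr s t) borel (\<lambda>y. y $ i) = distr M borel ((\<lambda>y. y $ i) \<circ> (\<lambda>\<omega>. \<omega> t - \<omega> s))"
    unfolding incr_def
    by (rule distr_distr) (auto intro!: borel_measurable_diff eval_measurable
        borel_measurable_continuous_onI continuous_intros)
  moreover have "\<dots> = distr M lborel (\<lambda>\<omega>. (\<omega> t - \<omega> s) $ i)"
    by (rule distr_cong) auto
  ultimately show ?thesis by simp
qed

end

section \<open>Moments of Euler-type recursions\<close>

lemma sqrt_le_self: "1 \<le> T \<Longrightarrow> sqrt T \<le> T"
  by (intro real_le_lsqrt) (auto simp: power2_eq_square)

lemma power_sum3_le:
  fixes a b c :: real
  assumes "0 \<le> a" "0 \<le> b" "0 \<le> c"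
  shows "(a + b + c) ^ n \<le> 3 ^ n * (a ^ n + b ^ n + c ^ n)"
proof -
  define m where "m = max a (max b c)"
  have "a + b + c \<le> 3 * m" unfolding m_def by auto
  then have "(a + b + c) ^ n \<le> (3 * m) ^ n" using assms by (intro power_mono) auto
  also have "\<dots> = 3 ^ n * m ^ n" by (simp add: power_mult_distrib)
  also have "m ^ n \<le> a ^ n + b ^ n + c ^ n"
    using assms unfolding m_def by (auto simp: max_def add_nonneg_nonneg)
  finally show ?thesis by simp
qed

lemma power_sum2_le:
  fixes a b :: real
  assumes "0 \<le> a" "0 \<le> b"
  shows "(a + b) ^ n \<le> 3 ^ n * (a ^ n + b ^ n)"
proof (cases "n = 0")
  case False
  then show ?thesis using power_sum3_le[OF assms order_refl, of n] by (simp add: power_0_left)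
qed auto

text \<open>Young's inequality without weights: the larger of \<open>u\<close> and \<open>w\<close>
  dominates both factors.\<close>

lemma young_power:
  fixes u w :: real
  assumes "0 \<le> u" "0 \<le> w"
  shows "u ^ a * w ^ b \<le> u ^ (a + b) + w ^ (a + b)"
proof (cases "u \<le> w")
  case True
  then have "u ^ a * w ^ b \<le> w ^ a * w ^ b" using assms by (intro mult_right_mono power_mono) auto
  then show ?thesis using assms by (simp add: power_add add_increasing)
next
  case False
  then have "u ^ a * w ^ b \<le> u ^ a * u ^ b" using assms by (intro mult_left_mono power_mono) auto
  then show ?thesis using assms by (simp add: power_add add_increasing2)
qed

text \<open>A monomial that contains at least \<open>w\<^sup>2\<close> lies below the sum of the two
  extreme ones; these are the only remainders kept in the Taylor bound that follows.\<close>

lemma monomial_le: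
  fixes u w :: real
  assumes "0 \<le> u" "0 \<le> w"
  shows "u ^ a * w ^ (b + 2) \<le> u ^ (a + b) * w\<^sup>2 + w ^ (a + b + 2)"
  using mult_right_mono[OF young_power[OF assms, of a b], of "w\<^sup>2"]
  by (simp add: power_add power2_eq_square algebra_simps)

text \<open>A second-order Taylor bound for the power \<open>2 * Suc r\<close> of the norm. The
  linear term is kept exactly, because its expectation will vanish when \<open>v\<close> is a
  Brownian increment; bounding its absolute value would leave order \<open>sqrt \<delta>\<close>
  where order \<open>\<delta>\<close> is wanted. The induction multiplies the bound by the explicit
  quadratic expression for \<open>(norm (e + v))\<^sup>2\<close>.\<close>

lemma norm_add_power_le:
  "\<exists>C\<ge>0. \<forall>e v :: 'a :: real_inner.
     norm (e + v) ^ (2 * Suc r) \<le> norm e ^ (2 * Suc r) + 2 * real (Suc r) * norm e ^ (2 * r) * (e \<bullet> v)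
       + C * (norm e ^ (2 * r) * (norm v)\<^sup>2 + norm v ^ (2 * Suc r))"
proof (induction r)
  case 0
  have "(norm (e + v))\<^sup>2 = (norm e)\<^sup>2 + 2 * (e \<bullet> v) + (norm v)\<^sup>2" for e v :: 'a
    by (simp add: power2_norm_eq_inner inner_simps inner_commute)
  then show ?case by (intro exI[of _ 1]) auto
next
  case (Suc r)
  then obtain C where C: "C \<ge> 0" and IH: "\<And>e v :: 'a. norm (e + v) ^ (2 * Suc r) \<le> norm e ^ (2 * Suc r)
      + 2 * real (Suc r) * norm e ^ (2 * r) * (e \<bullet> v)
       + C * (norm e ^ (2 * r) * (norm v)\<^sup>2 + norm v ^ (2 * Suc r))" by blast
  define q where "q = real (Suc r)"
  have q: "q \<ge> 1" by (simp add: q_def)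
  show ?case
  proof (intro exI[of _ "8 * C + 8 * q + 1"] conjI allI)
    show "0 \<le> 8 * C + 8 * q + 1" using C q by auto
    fix e v :: 'a
    define u w p N where "u = norm e" and "w = norm v" and "p = e \<bullet> v" and "N = u ^ (2 * r)"
    have uw: "0 \<le> u" "0 \<le> w" "0 \<le> N" by (auto simp: u_def w_def N_def)
    have p: "\<bar>p\<bar> \<le> u * w" unfolding p_def u_def w_def by (rule Cauchy_Schwarz_ineq2)
    \<comment> \<open>The target remainder. Every mixed product that arises has degree
      \<open>2 * r + 4\<close> and contains \<open>w\<close> at least twice, hence is at most
      \<open>R\<close>.\<close>
    define R where "R = u ^ (2 * Suc r) * w\<^sup>2 + w ^ (2 * Suc (Suc r))"
    have sq: "(norm (e + v))\<^sup>2 = u\<^sup>2 + 2 * p + w\<^sup>2"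
      by (simp add: u_def w_def p_def power2_norm_eq_inner inner_simps inner_commute)
    have sq_le: "(norm (e + v))\<^sup>2 \<le> 2 * u\<^sup>2 + 2 * w\<^sup>2"
      using p sum_squares_bound[of u w] unfolding sq by (simp add: abs_le_iff)
    have R1: "N * w ^ 4 \<le> R"
      using monomial_le[OF uw(1,2), of "2 * r" 2] by (simp add: R_def N_def)
    have R2: "u\<^sup>2 * w ^ (2 * Suc r) \<le> R"
      using monomial_le[OF uw(1,2), of "2" "2 * r"] by (simp add: R_def)
    have R3: "N * (u * w) * w\<^sup>2 \<le> R"
      using monomial_le[OF uw(1,2), of "2 * r + 1" "1"] by (simp add: R_def N_def power3_eq_cube power2_eq_square algebra_simps)
    have R4: "N * u\<^sup>2 * w\<^sup>2 \<le> R" using uw by (simp add: R_def N_def power_add power2_eq_square algebra_simps)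
    have R5: "w ^ (2 * Suc (Suc r)) \<le> R" using uw by (simp add: R_def)
    have R0: "0 \<le> R" using uw by (simp add: R_def)
    have "norm (e + v) ^ (2 * Suc (Suc r)) = norm (e + v) ^ (2 * Suc r) * (norm (e + v))\<^sup>2"
      by (simp add: power_add power2_eq_square)
    also have "\<dots> \<le> (u ^ (2 * Suc r) + 2 * q * N * p + C * (N * w\<^sup>2 + w ^ (2 * Suc r))) * (norm (e + v))\<^sup>2"
      using IH[of e v] unfolding u_def w_def p_def N_def q_def by (intro mult_right_mono) auto
    also have "\<dots> = (u ^ (2 * Suc r) + 2 * q * N * p) * (u\<^sup>2 + 2 * p + w\<^sup>2)
        + C * (N * w\<^sup>2 + w ^ (2 * Suc r)) * (norm (e + v))\<^sup>2"
      unfolding sq by (simp add: algebra_simps)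
    also have "C * (N * w\<^sup>2 + w ^ (2 * Suc r)) * (norm (e + v))\<^sup>2
        \<le> C * (N * w\<^sup>2 + w ^ (2 * Suc r)) * (2 * u\<^sup>2 + 2 * w\<^sup>2)"
      using sq_le C uw by (intro mult_left_mono) auto
    also have "\<dots> = C * (2 * (N * u\<^sup>2 * w\<^sup>2) + 2 * (N * w ^ 4) + 2 * (u\<^sup>2 * w ^ (2 * Suc r)) + 2 * w ^ (2 * Suc (Suc r)))"
      by (simp add: algebra_simps power_add power2_eq_square power4_eq_xxxx)
    also have "\<dots> \<le> C * (8 * R)"
      using R1 R2 R4 R5 C by (intro mult_left_mono) auto
    \<comment> \<open>The two linear contributions, \<open>2 * p * u ^ (2 * Suc r)\<close> and
      \<open>2 * q * N * p * u\<^sup>2\<close>, merge into the coefficient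
      \<open>2 * (q + 1)\<close> of the next exponent; all other terms are at least quadratic in
      \<open>v\<close>.\<close>
    also have "(u ^ (2 * Suc r) + 2 * q * N * p) * (u\<^sup>2 + 2 * p + w\<^sup>2)
       = u ^ (2 * Suc (Suc r)) + 2 * (q + 1) * u ^ (2 * Suc r) * p
         + (u ^ (2 * Suc r) * w\<^sup>2 + 4 * q * (N * p\<^sup>2) + 2 * q * (N * p * w\<^sup>2))"
      by (simp add: algebra_simps power_add power2_eq_square N_def)
    also have "u ^ (2 * Suc r) * w\<^sup>2 \<le> R" using uw by (simp add: R_def)
    also have "N * p\<^sup>2 \<le> R"
    proof -
      have "p\<^sup>2 \<le> (u * w)\<^sup>2" using p by (meson abs_le_square_iff abs_of_nonneg abs_ge_self order_trans mult_nonneg_nonneg uw(1) uw(2))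
      then have "N * p\<^sup>2 \<le> N * (u\<^sup>2 * w\<^sup>2)" using uw by (intro mult_left_mono) (auto simp: power_mult_distrib)
      then show ?thesis using R4 by (simp add: mult.assoc)
    qed
    also have "N * p * w\<^sup>2 \<le> R"
    proof -
      have "N * p * w\<^sup>2 \<le> N * (u * w) * w\<^sup>2" using p uw by (intro mult_right_mono mult_left_mono) auto
      then show ?thesis using R3 by linarith
    qed
    finally have "norm (e + v) ^ (2 * Suc (Suc r)) \<le> u ^ (2 * Suc (Suc r)) + 2 * (q + 1) * u ^ (2 * Suc r) * p
        + (R + 4 * q * R + 2 * q * R) + C * (8 * R)"
      using q by (simp add: mult_left_mono)
    also have "\<dots> \<le> u ^ (2 * Suc (Suc r)) + 2 * (q + 1) * u ^ (2 * Suc r) * p + (8 * C + 8 * q + 1) * R"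
      using q R0 by (simp add: algebra_simps)
    finally show "norm (e + v) ^ (2 * Suc (Suc r))
       \<le> norm e ^ (2 * Suc (Suc r)) + 2 * real (Suc (Suc r)) * norm e ^ (2 * Suc r) * (e \<bullet> v) +
          (8 * C + 8 * q + 1) * (norm e ^ (2 * Suc r) * (norm v)\<^sup>2 + norm v ^ (2 * Suc (Suc r)))"
      unfolding R_def u_def w_def p_def q_def by (simp add: add.commute)
  qed
qed

text \<open>One step of size \<open>\<delta>\<close> of an Euler-type scheme with increment \<open>y\<close>: every contribution
  except the martingale term \<open>e \<bullet> (A *v y)\<close> is of order \<open>\<delta>\<close>.\<close>

lemma euler_step_pointwise:
  assumes q: "q \<ge> 1" and T: "T \<ge> 1"
  shows "\<exists>C\<ge>0. \<forall>(e :: real^'m) (A :: real^'n^'m) B \<delta> y r. 0 < \<delta> \<longrightarrow> \<delta> \<le> T \<longrightarrow> norm A \<le> B \<longrightarrow>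
     norm r \<le> \<delta> * B * (1 + norm y / sqrt \<delta>) \<longrightarrow>
     norm (e + A *v y + r) ^ (2 * q) \<le> norm e ^ (2 * q) + 2 * real q * norm e ^ (2 * q - 2) * (e \<bullet> (A *v y))
       + C * \<delta> * (norm e ^ (2 * q) + B ^ (2 * q)) * (1 + norm y / sqrt \<delta>) ^ (2 * q)"
proof -
  obtain k where qk: "q = Suc k" using q by (cases q) auto
  obtain C0 where C0: "C0 \<ge> 0" and pw: "\<And>e v :: real^'m.
     norm (e + v) ^ (2 * q) \<le> norm e ^ (2 * q) + 2 * real q * norm e ^ (2 * q - 2) * (e \<bullet> v)
       + C0 * (norm e ^ (2 * q - 2) * (norm v)\<^sup>2 + norm v ^ (2 * q))"
    using norm_add_power_le[where 'a = "real^'m", of k] unfolding qk by auto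
  \<comment> \<open>One summand for each of \<open>t1\<close>, \<open>t2\<close>, \<open>t3\<close>
    below: the remainder \<open>r\<close> in the linear term, the quadratic term, and the pure power
    of \<open>v\<close>. In the last one \<open>\<delta> ^ q\<close> is split into
    \<open>\<delta> * \<delta> ^ k\<close>, and the spare factors are bounded by
    \<open>T ^ k\<close>.\<close>
  define C where "C = 2 * real q + C0 * (4 * T\<^sup>2 + (2 * T) ^ (2 * q) * T ^ k)"
  show ?thesis
  proof (intro exI[of _ C] conjI allI impI)
    show "0 \<le> C" using C0 T by (auto simp: C_def)
    fix e r :: "real^'m" and A :: "real^'n^'m" and B \<delta> :: real and y :: "real^'n"
    assume \<delta>: "0 < \<delta>" "\<delta> \<le> T" and AB: "norm A \<le> B"
      and r: "norm r \<le> \<delta> * B * (1 + norm y / sqrt \<delta>)"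
    define z where "z = 1 + norm y / sqrt \<delta>"
    define v where "v = A *v y + r"
    define u where "u = norm e"
    have z: "z \<ge> 1" using \<delta> by (simp add: z_def)
    have B0: "0 \<le> B" using AB norm_ge_zero order_trans by blast
    have u0: "0 \<le> u" by (simp add: u_def)
    have zpow: "z ^ n \<le> z ^ (2 * q)" if "n \<le> 2 * q" for n using z that by (intro power_increasing) auto
    have y: "norm y = sqrt \<delta> * (z - 1)" using \<delta> by (simp add: z_def)
    have "norm v \<le> norm A * norm y + norm r"
      unfolding v_def by (rule order_trans[OF norm_triangle_ineq add_right_mono[OF vec_norm_mult_le]])
    also have "norm A * norm y \<le> B * norm y" using AB by (intro mult_right_mono) auto
    also have "B * norm y \<le> B * (sqrt \<delta> * z)" unfolding y using B0 \<delta> by (intro mult_left_mono) auto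
    also have "norm r \<le> sqrt \<delta> * (T * B * z)"
    proof -
      have "sqrt \<delta> \<le> T" using sqrt_le_self[OF T] \<delta> by (meson order_trans real_sqrt_le_iff)
      then have "sqrt \<delta> * sqrt \<delta> * (B * z) \<le> sqrt \<delta> * T * (B * z)"
        using \<delta> B0 z by (intro mult_right_mono mult_left_mono) auto
      then show ?thesis using r \<delta> unfolding z_def[symmetric] by (simp add: mult.assoc)
    qed
    also have "B * (sqrt \<delta> * z) + sqrt \<delta> * (T * B * z) \<le> sqrt \<delta> * (2 * T * B * z)"
    proof -
      have "1 * (sqrt \<delta> * B * z) \<le> T * (sqrt \<delta> * B * z)" using T \<delta> B0 z by (intro mult_right_mono) auto
      then show ?thesis by (simp add: algebra_simps)
    qed
    \<comment> \<open>Each factor \<open>v\<close> contributes only \<open>sqrt \<delta>\<close>;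
      order \<open>\<delta>\<close> is reached because the remainder contains \<open>v\<close> at
      least twice.\<close>
    finally have v: "norm v \<le> sqrt \<delta> * (2 * T * B * z)" by simp
    have t1: "u ^ (2 * q - 2) * (e \<bullet> r) \<le> \<delta> * (u ^ (2 * q) + B ^ (2 * q)) * z ^ (2 * q)"
    proof -
      have "u ^ (2 * q - 2) * (e \<bullet> r) \<le> u ^ (2 * q - 2) * (u * (\<delta> * B * z))"
      proof (intro mult_left_mono)
        have "norm e * norm r \<le> norm e * (\<delta> * B * z)"
          using r unfolding z_def[symmetric] by (intro mult_left_mono) auto
        then show "e \<bullet> r \<le> u * (\<delta> * B * z)" using norm_cauchy_schwarz[of e r] unfolding u_def by linarith
      qed (use u0 in simp)
      also have "\<dots> = \<delta> * (u ^ (2 * q - 1) * B ^ 1) * z ^ 1" unfolding qk by simp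
      also have "\<dots> \<le> \<delta> * (u ^ (2 * q - 1 + 1) + B ^ (2 * q - 1 + 1)) * z ^ (2 * q)"
        using \<delta> z q by (intro mult_mono mult_left_mono young_power u0 B0 zpow) (auto simp: u0 B0)
      also have "2 * q - 1 + 1 = 2 * q" using q by simp
      finally show ?thesis .
    qed
    have t2: "u ^ (2 * q - 2) * (norm v)\<^sup>2 \<le> 4 * T\<^sup>2 * (\<delta> * (u ^ (2 * q) + B ^ (2 * q)) * z ^ (2 * q))"
    proof -
      have "(norm v)\<^sup>2 \<le> (sqrt \<delta> * (2 * T * B * z))\<^sup>2" using v by (intro power_mono) auto
      also have "\<dots> = 4 * T\<^sup>2 * \<delta> * B\<^sup>2 * z\<^sup>2" using \<delta> by (simp add: power_mult_distrib)
      finally have "u ^ (2 * q - 2) * (norm v)\<^sup>2 \<le> u ^ (2 * q - 2) * (4 * T\<^sup>2 * \<delta> * B\<^sup>2 * z\<^sup>2)"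
        using u0 by (intro mult_left_mono) auto
      also have "\<dots> = 4 * T\<^sup>2 * (\<delta> * (u ^ (2 * q - 2) * B\<^sup>2) * z\<^sup>2)" by simp
      also have "\<dots> \<le> 4 * T\<^sup>2 * (\<delta> * (u ^ (2 * q - 2 + 2) + B ^ (2 * q - 2 + 2)) * z ^ (2 * q))"
        using \<delta> z q by (intro mult_left_mono mult_mono young_power u0 B0 zpow) (auto simp: u0 B0)
      also have "2 * q - 2 + 2 = 2 * q" using q by simp
      finally show ?thesis .
    qed
    have t3: "norm v ^ (2 * q) \<le> (2 * T) ^ (2 * q) * T ^ k * (\<delta> * (u ^ (2 * q) + B ^ (2 * q)) * z ^ (2 * q))"
    proof -
      have "norm v ^ (2 * q) \<le> (sqrt \<delta> * (2 * T * B * z)) ^ (2 * q)" using v by (intro power_mono) auto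
      also have "\<dots> = (2 * T) ^ (2 * q) * (sqrt \<delta> ^ (2 * q) * B ^ (2 * q) * z ^ (2 * q))"
        by (simp add: power_mult_distrib)
      also have "sqrt \<delta> ^ (2 * q) = \<delta> * \<delta> ^ k" using \<delta> unfolding qk power_mult by simp
      also have "(2 * T) ^ (2 * q) * (\<delta> * \<delta> ^ k * B ^ (2 * q) * z ^ (2 * q))
          \<le> (2 * T) ^ (2 * q) * (\<delta> * T ^ k * (u ^ (2 * q) + B ^ (2 * q)) * z ^ (2 * q))"
        using \<delta> T z by (intro mult_left_mono mult_mono power_mono) (auto simp: u0 B0)
      finally show ?thesis by (simp add: algebra_simps)
    qed
    have "norm (e + v) ^ (2 * q) \<le> u ^ (2 * q) + 2 * real q * u ^ (2 * q - 2) * (e \<bullet> (A *v y))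
       + (2 * real q * (u ^ (2 * q - 2) * (e \<bullet> r)) + C0 * (u ^ (2 * q - 2) * (norm v)\<^sup>2 + norm v ^ (2 * q)))"
      using pw[of e v] unfolding v_def u_def by (simp add: inner_add_right algebra_simps)
    also have "2 * real q * (u ^ (2 * q - 2) * (e \<bullet> r)) + C0 * (u ^ (2 * q - 2) * (norm v)\<^sup>2 + norm v ^ (2 * q))
       \<le> 2 * real q * (\<delta> * (u ^ (2 * q) + B ^ (2 * q)) * z ^ (2 * q))
         + C0 * (4 * T\<^sup>2 * (\<delta> * (u ^ (2 * q) + B ^ (2 * q)) * z ^ (2 * q))
              + (2 * T) ^ (2 * q) * T ^ k * (\<delta> * (u ^ (2 * q) + B ^ (2 * q)) * z ^ (2 * q)))"
      by (intro add_mono mult_left_mono t1 t2 t3 C0) auto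
    also have "\<dots> = C * \<delta> * (u ^ (2 * q) + B ^ (2 * q)) * z ^ (2 * q)"
      by (simp add: C_def algebra_simps)
    finally show "norm (e + A *v y + r) ^ (2 * q) \<le> norm e ^ (2 * q) + 2 * real q * norm e ^ (2 * q - 2) * (e \<bullet> (A *v y))
       + C * \<delta> * (norm e ^ (2 * q) + B ^ (2 * q)) * (1 + norm y / sqrt \<delta>) ^ (2 * q)"
      unfolding z_def u_def v_def by (simp add: add.assoc)
  qed
qed


text \<open>A process \<open>e\<close> that follows an Euler-type recursion with martingale
  coefficient \<open>A\<close> and forcing \<open>g\<close>. The bounds also admit
  \<open>norm (e 0 \<omega>)\<close>, because inside a block the coefficients may be frozen at its
  left end. The factor \<open>1 + norm y / sqrt \<delta>\<close> in the remainder, with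
  \<open>y\<close> the increment of the step, leaves room for terms proportional to
  \<open>\<delta> * norm y\<close>, such as those that come from \<open>\<eta>\<close>.\<close>

definition euler_type ::
  "real \<Rightarrow> real \<Rightarrow> real \<Rightarrow> nat \<Rightarrow> (nat \<Rightarrow> (real \<Rightarrow> real^'d) \<Rightarrow> real^'m) \<Rightarrow>
    (nat \<Rightarrow> (real \<Rightarrow> real^'d) \<Rightarrow> real^'d^'m) \<Rightarrow> (nat \<Rightarrow> (real \<Rightarrow> real^'d) \<Rightarrow> real) \<Rightarrow> bool" where
  "euler_type L s \<delta> N e A g \<longleftrightarrow>
     (\<forall>a\<le>N. e a \<in> borel_measurable (nat_filtration (s + real a * \<delta>))) \<and>
     (\<forall>a<N. A a \<in> borel_measurable (nat_filtration (s + real a * \<delta>)) \<and>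
            g a \<in> borel_measurable (nat_filtration (s + real a * \<delta>)) \<and>
       (\<forall>\<omega>\<in>wiener_paths. 0 \<le> g a \<omega> \<and>
          norm (A a \<omega>) \<le> L * (norm (e a \<omega>) + norm (e 0 \<omega>) + g a \<omega>) \<and>
          norm (e (Suc a) \<omega> - e a \<omega> - A a \<omega> *v (\<omega> (s + real (Suc a) * \<delta>) - \<omega> (s + real a * \<delta>)))
            \<le> \<delta> * (L * (norm (e a \<omega>) + norm (e 0 \<omega>) + g a \<omega>))
               * (1 + norm (\<omega> (s + real (Suc a) * \<delta>) - \<omega> (s + real a * \<delta>)) / sqrt \<delta>)))"

lemma euler_typeI:
  assumes L: "0 \<le> L" and \<delta>: "0 < \<delta>"
    and "\<And>a. a \<le> N \<Longrightarrow> e a \<in> borel_measurable (nat_filtration (s + real a * \<delta>))"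
    and "\<And>a. a < N \<Longrightarrow> A a \<in> borel_measurable (nat_filtration (s + real a * \<delta>))"
    and "\<And>a. a < N \<Longrightarrow> g a \<in> borel_measurable (nat_filtration (s + real a * \<delta>))"
    and g: "\<And>a \<omega>. a < N \<Longrightarrow> \<omega> \<in> wiener_paths \<Longrightarrow> 0 \<le> g a \<omega>"
    and "\<And>a \<omega>. a < N \<Longrightarrow> \<omega> \<in> wiener_paths \<Longrightarrow> norm (A a \<omega>) \<le> L * (norm (e a \<omega>) + norm (e 0 \<omega>) + g a \<omega>)"
    and rec: "\<And>a \<omega>. a < N \<Longrightarrow> \<omega> \<in> wiener_paths \<Longrightarrow>
       e (Suc a) \<omega> = e a \<omega> + A a \<omega> *v (\<omega> (s + real (Suc a) * \<delta>) - \<omega> (s + real a * \<delta>)) + \<delta> *\<^sub>R c a \<omega>"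
    and c: "\<And>a \<omega>. a < N \<Longrightarrow> \<omega> \<in> wiener_paths \<Longrightarrow> norm (c a \<omega>) \<le> L * (norm (e a \<omega>) + norm (e 0 \<omega>) + g a \<omega>)
         * (1 + norm (\<omega> (s + real (Suc a) * \<delta>) - \<omega> (s + real a * \<delta>)) / sqrt \<delta>)"
  shows "euler_type L s \<delta> N e A g"
proof -
  have "norm (e (Suc a) \<omega> - e a \<omega> - A a \<omega> *v (\<omega> (s + real (Suc a) * \<delta>) - \<omega> (s + real a * \<delta>)))
            \<le> \<delta> * (L * (norm (e a \<omega>) + norm (e 0 \<omega>) + g a \<omega>))
               * (1 + norm (\<omega> (s + real (Suc a) * \<delta>) - \<omega> (s + real a * \<delta>)) / sqrt \<delta>)"
    if "a < N" "\<omega> \<in> wiener_paths" for a \<omega>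
    using mult_left_mono[OF c[OF that], of \<delta>] \<delta> unfolding rec[OF that] by (simp add: mult.assoc)
  then show ?thesis unfolding euler_type_def using assms by blast
qed

lemma le_mult_one_plus:
  "(x::real) \<le> y \<Longrightarrow> 0 \<le> y \<Longrightarrow> 0 \<le> z \<Longrightarrow> x \<le> y * (1 + z)"
  by (simp add: distrib_left add_increasing2)

context wiener_space
begin

lemma incr_component_moments:
  assumes st: "0 \<le> s" "s < t"
  shows "integrable (incr s t) (\<lambda>y. (y $ i) ^ n)" "(\<integral>y. y $ i \<partial>incr s t) = 0"
    "(\<integral>y. (y $ i) ^ (2 * k) \<partial>incr s t) = fact (2 * k) / (2 ^ k * fact k) * (t - s) ^ k"
proof -
  have pos: "0 < sqrt (t - s)" using st by simp
  have m: "(\<lambda>y. y $ i) \<in> borel_measurable (incr s t)"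
    unfolding incr_def by (auto intro!: borel_measurable_continuous_onI continuous_intros)
  have int: "integrable (incr s t) (\<lambda>y. f (y $ i)) \<longleftrightarrow> integrable lborel (\<lambda>x. normal_density 0 (sqrt (t - s)) x * f x)"
    and eq: "(\<integral>y. f (y $ i) \<partial>incr s t) = (\<integral>x. normal_density 0 (sqrt (t - s)) x * f x \<partial>lborel)"
    if f: "f \<in> borel_measurable borel" for f :: "real \<Rightarrow> real"
  proof -
    have "integrable (distr (incr s t) borel (\<lambda>y. y $ i)) f \<longleftrightarrow> integrable (incr s t) (\<lambda>y. f (y $ i))"
      by (rule integrable_distr_eq[OF m f])
    moreover have "integrable (density lborel (\<lambda>x. ennreal (normal_density 0 (sqrt (t - s)) x))) f
        \<longleftrightarrow> integrable lborel (\<lambda>x. normal_density 0 (sqrt (t - s)) x * f x)"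
      using f by (subst integrable_density) auto
    ultimately show "integrable (incr s t) (\<lambda>y. f (y $ i)) \<longleftrightarrow> integrable lborel (\<lambda>x. normal_density 0 (sqrt (t - s)) x * f x)"
      unfolding incr_component[OF st] by simp
    have "integral\<^sup>L (distr (incr s t) borel (\<lambda>y. y $ i)) f = (\<integral>y. f (y $ i) \<partial>incr s t)"
      by (rule integral_distr[OF m f])
    moreover have "integral\<^sup>L (density lborel (\<lambda>x. ennreal (normal_density 0 (sqrt (t - s)) x))) f
        = (\<integral>x. normal_density 0 (sqrt (t - s)) x * f x \<partial>lborel)"
      using f by (subst integral_density) auto
    ultimately show "(\<integral>y. f (y $ i) \<partial>incr s t) = (\<integral>x. normal_density 0 (sqrt (t - s)) x * f x \<partial>lborel)"
      unfolding incr_component[OF st] by simp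
  qed
  show "integrable (incr s t) (\<lambda>y. (y $ i) ^ n)"
    using int[of "\<lambda>x. x ^ n"] integrable_normal_moment[OF pos, of 0 n] by simp
  show "(\<integral>y. y $ i \<partial>incr s t) = 0"
    using eq[of "\<lambda>x. x"] integral_normal_moment_nz_1[OF pos, of 0] by simp
  have "(\<integral>y. (y $ i) ^ (2 * k) \<partial>incr s t) = fact (2 * k) / ((2 / (sqrt (t - s))\<^sup>2) ^ k * fact k)"
    using eq[of "\<lambda>x. x ^ (2 * k)"] integral_normal_moment_even[OF pos, of 0 k] by simp
  also have "(sqrt (t - s))\<^sup>2 = t - s" using st by simp
  also have "fact (2 * k) / ((2 / (t - s)) ^ k * fact k) = fact (2 * k) / (2 ^ k * fact k) * (t - s) ^ k"
    using st by (simp add: power_divide field_simps)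
  finally show "(\<integral>y. (y $ i) ^ (2 * k) \<partial>incr s t) = fact (2 * k) / (2 ^ k * fact k) * (t - s) ^ k" .
qed

lemma norm_power_le_components:
  fixes y :: "real^'d"
  shows "norm y ^ (2 * q) \<le> real CARD('d) ^ (2 * q) * (\<Sum>i\<in>UNIV. (y $ i) ^ (2 * q))"
proof -
  define m where "m = Max (range (\<lambda>i. \<bar>y $ i\<bar>))"
  have "m \<in> range (\<lambda>i. \<bar>y $ i\<bar>)" unfolding m_def by (rule Max_in) auto
  then obtain j where j: "m = \<bar>y $ j\<bar>" by auto
  have "norm y \<le> (\<Sum>i\<in>UNIV. \<bar>y $ i\<bar>)" by (rule norm_le_l1_cart)
  also have "\<dots> \<le> real CARD('d) * m"
    unfolding m_def by (rule sum_bounded_above[of UNIV, simplified]) (auto intro: Max_ge)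
  finally have "norm y ^ (2 * q) \<le> (real CARD('d) * m) ^ (2 * q)" by (intro power_mono) auto
  also have "\<dots> = real CARD('d) ^ (2 * q) * (y $ j) ^ (2 * q)"
    unfolding j by (simp add: power_mult_distrib power_even_abs)
  also have "(y $ j) ^ (2 * q) \<le> (\<Sum>i\<in>UNIV. (y $ i) ^ (2 * q))"
    by (rule member_le_sum) auto
  finally show ?thesis by (simp add: mult_left_mono)
qed

text \<open>Brownian scaling: the moment of order \<open>2 * q\<close> of each component is a
  constant times \<open>(t - s) ^ q\<close>, so dividing by \<open>sqrt (t - s)\<close> leaves a
  bound uniform in \<open>s\<close> and \<open>t\<close>.\<close>

lemma incr_norm_moment:
  "\<exists>C\<ge>0. \<forall>s t. 0 \<le> s \<longrightarrow> s < t \<longrightarrow>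
     integrable (incr s t) (\<lambda>y. (1 + norm y / sqrt (t - s)) ^ (2 * q)) \<and>
     (\<integral>y. (1 + norm y / sqrt (t - s)) ^ (2 * q) \<partial>incr s t) \<le> C"
proof -
  define c where "c = (fact (2 * q) / (2 ^ q * fact q) :: real)"
  define C where "C = 3 ^ (2 * q) * (1 + real CARD('d) ^ (2 * q) * (real CARD('d) * c))"
  have c: "c \<ge> 0" by (simp add: c_def)
  show ?thesis
  proof (intro exI[of _ C] conjI allI impI)
    show "0 \<le> C" using c by (simp add: C_def)
    fix s t :: real assume st: "0 \<le> s" "s < t"
    interpret I: prob_space "incr s t" by (rule prob_space_incr)
    let ?f = "\<lambda>y::real^'d. (1 + norm y / sqrt (t - s)) ^ (2 * q)"
    let ?g = "\<lambda>y::real^'d. 3 ^ (2 * q) * (1 + real CARD('d) ^ (2 * q) * (\<Sum>i\<in>UNIV. (y $ i) ^ (2 * q)) / (t - s) ^ q)"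
    have le: "?f y \<le> ?g y" for y
    proof -
      have "?f y \<le> 3 ^ (2 * q) * (1 ^ (2 * q) + (norm y / sqrt (t - s)) ^ (2 * q))"
        using st by (intro power_sum2_le) auto
      also have "(norm y / sqrt (t - s)) ^ (2 * q) = norm y ^ (2 * q) / (t - s) ^ q"
        using st by (simp add: power_divide power_mult)
      also have "\<dots> \<le> real CARD('d) ^ (2 * q) * (\<Sum>i\<in>UNIV. (y $ i) ^ (2 * q)) / (t - s) ^ q"
        using st by (intro divide_right_mono norm_power_le_components) auto
      finally show ?thesis by simp
    qed
    have gi: "integrable (incr s t) ?g"
      by (intro integrable_mult_right Bochner_Integration.integrable_add integrable_divide Bochner_Integration.integrable_sum
          incr_component_moments[OF st] I.integrable_const)
    have fm: "?f \<in> borel_measurable (incr s t)"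
      unfolding incr_def by (auto intro!: borel_measurable_continuous_onI continuous_intros simp: st)
    have f0: "0 \<le> ?f y" for y using st by simp
    show fi: "integrable (incr s t) ?f"
      using le by (intro Bochner_Integration.integrable_bound[OF gi fm]) (auto intro!: AE_I2 order_trans[OF le] simp: f0 abs_ge_self)
    have "integral\<^sup>L (incr s t) ?f \<le> integral\<^sup>L (incr s t) ?g"
      by (rule integral_mono[OF fi gi le])
    also have "\<dots> = 3 ^ (2 * q) * (1 + real CARD('d) ^ (2 * q) * (\<Sum>i\<in>UNIV. (\<integral>y. (y $ i) ^ (2 * q) \<partial>incr s t)) / (t - s) ^ q)"
      by (simp add: incr_component_moments(1)[OF st] I.prob_space[unfolded space_incr])
    also have "\<dots> = C"
      unfolding incr_component_moments(3)[OF st] C_def c_def using st by simp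
    finally show "integral\<^sup>L (incr s t) ?f \<le> C" .
  qed
qed

text \<open>The martingale property of a single step. It removes the first-order term of
  \<open>euler_step_pointwise\<close>.\<close>

lemma incr_linear_form:
  fixes A :: "real^'d^'m::finite"
  assumes st: "0 \<le> s" "s < t"
  shows "integrable (incr s t) (\<lambda>y. e \<bullet> (A *v y))" "(\<integral>y. e \<bullet> (A *v y) \<partial>incr s t) = 0"
proof -
  have eq: "e \<bullet> (A *v y) = (\<Sum>i\<in>UNIV. (e v* A) $ i * y $ i)" for y
    using dot_lmul_matrix[of e A y] by (simp add: inner_vec_def)
  have i: "integrable (incr s t) (\<lambda>y. y $ i)" for i
    using incr_component_moments(1)[OF st, of i 1] by simp
  show "integrable (incr s t) (\<lambda>y. e \<bullet> (A *v y))"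
    unfolding eq by (intro Bochner_Integration.integrable_sum integrable_mult_right i)
  show "(\<integral>y. e \<bullet> (A *v y) \<partial>incr s t) = 0"
    unfolding eq by (simp add: i incr_component_moments(2)[OF st])
qed

abbreviation moment :: "nat \<Rightarrow> ((real \<Rightarrow> real^'d) \<Rightarrow> 'b::real_normed_vector) \<Rightarrow> ennreal" where
  "moment n f \<equiv> (\<integral>\<^sup>+ \<omega>. ennreal (norm (f \<omega>) ^ n) \<partial>M)"

text \<open>Integrating \<open>euler_step_pointwise\<close> over the increment with the past frozen
  removes the linear term and leaves a gain of order \<open>\<delta>\<close>. Moments are
  \<open>ennreal\<close> values, so infinite ones need no separate treatment.\<close>

lemma moment_step:
  assumes q: "q \<ge> 1" and T: "T \<ge> 1"
  shows "\<exists>C\<ge>0. \<forall>s t (e :: _ \<Rightarrow> real^'m::finite) A B e'. 0 \<le> s \<longrightarrow> s < t \<longrightarrow> t - s \<le> T \<longrightarrow>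
     e \<in> borel_measurable (nat_filtration s) \<longrightarrow> A \<in> borel_measurable (nat_filtration s) \<longrightarrow>
     B \<in> borel_measurable (nat_filtration s) \<longrightarrow>
     (\<forall>\<omega>\<in>space M. norm (A \<omega>) \<le> B \<omega>) \<longrightarrow>
     (\<forall>\<omega>\<in>space M. norm (e' \<omega> - e \<omega> - A \<omega> *v (\<omega> t - \<omega> s)) \<le> (t - s) * B \<omega> * (1 + norm (\<omega> t - \<omega> s) / sqrt (t - s))) \<longrightarrow>
     moment (2 * q) e'
       \<le> ennreal (1 + C * (t - s)) * moment (2 * q) e
         + ennreal (C * (t - s)) * (\<integral>\<^sup>+ \<omega>. ennreal (B \<omega> ^ (2 * q)) \<partial>M)"
proof -
  obtain C1 where C1: "C1 \<ge> 0" and step: "\<And>(e :: real^'m) (A :: real^'d^'m) B \<delta> y r. 0 < \<delta> \<Longrightarrow> \<delta> \<le> T \<Longrightarrow> norm A \<le> B \<Longrightarrow>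
     norm r \<le> \<delta> * B * (1 + norm y / sqrt \<delta>) \<Longrightarrow>
     norm (e + A *v y + r) ^ (2 * q) \<le> norm e ^ (2 * q) + 2 * real q * norm e ^ (2 * q - 2) * (e \<bullet> (A *v y))
       + C1 * \<delta> * (norm e ^ (2 * q) + B ^ (2 * q)) * (1 + norm y / sqrt \<delta>) ^ (2 * q)"
    using euler_step_pointwise[OF q T, where 'm = 'm and 'n = 'd] by blast
  obtain C2 where C2: "C2 \<ge> 0" and mom: "\<And>s t. 0 \<le> s \<Longrightarrow> s < t \<Longrightarrow>
     integrable (incr s t) (\<lambda>y. (1 + norm y / sqrt (t - s)) ^ (2 * q)) \<and>
     (\<integral>y. (1 + norm y / sqrt (t - s)) ^ (2 * q) \<partial>incr s t) \<le> C2"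
    using incr_norm_moment[of q] by blast
  show ?thesis
  proof (intro exI[of _ "C1 * C2"] conjI allI impI)
    show "0 \<le> C1 * C2" using C1 C2 by simp
    fix s t :: real and e :: "(real \<Rightarrow> real^'d) \<Rightarrow> real^'m" and A B e'
    assume st: "0 \<le> s" "s < t" and T': "t - s \<le> T"
      and em: "e \<in> borel_measurable (nat_filtration s)"
      and Am: "A \<in> borel_measurable (nat_filtration s)"
      and Bm: "B \<in> borel_measurable (nat_filtration s)"
      and AB: "\<forall>\<omega>\<in>space M. norm (A \<omega>) \<le> B \<omega>"
      and e': "\<forall>\<omega>\<in>space M. norm (e' \<omega> - e \<omega> - A \<omega> *v (\<omega> t - \<omega> s)) \<le> (t - s) * B \<omega> * (1 + norm (\<omega> t - \<omega> s) / sqrt (t - s))"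
    define \<delta> where "\<delta> = t - s"
    have \<delta>: "0 < \<delta>" "\<delta> \<le> T" using st T' by (auto simp: \<delta>_def)
    define F where "F = (\<lambda>\<omega> y. norm (e \<omega>) ^ (2 * q) + 2 * real q * norm (e \<omega>) ^ (2 * q - 2) * (e \<omega> \<bullet> (A \<omega> *v y))
       + C1 * \<delta> * (norm (e \<omega>) ^ (2 * q) + B \<omega> ^ (2 * q)) * (1 + norm y / sqrt \<delta>) ^ (2 * q))"
    have B0: "0 \<le> B \<omega>" if "\<omega> \<in> space M" for \<omega> using AB that norm_ge_zero order_trans by blast
    \<comment> \<open>\<open>F\<close> contains a linear term of either sign, but it dominates an
      even power of a norm. This sign is what makes the integral of
      \<open>ennreal (F \<omega> y)\<close> equal to the ordinary integral of \<open>F\<close>, in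
      which the linear term cancels.\<close>
    have F0: "0 \<le> F \<omega> y" if w: "\<omega> \<in> space M" for \<omega> y
    proof -
      have "norm (e \<omega> + A \<omega> *v y + 0) ^ (2 * q) \<le> F \<omega> y"
        unfolding F_def by (rule step[OF \<delta>]) (use AB w B0[OF w] \<delta> in auto)
      then show ?thesis by (rule order_trans[rotated]) simp
    qed
    have le: "norm (e' \<omega>) ^ (2 * q) \<le> F \<omega> (\<omega> t - \<omega> s)" if w: "\<omega> \<in> space M" for \<omega>
    proof -
      have "norm (e \<omega> + A \<omega> *v (\<omega> t - \<omega> s) + (e' \<omega> - e \<omega> - A \<omega> *v (\<omega> t - \<omega> s))) ^ (2 * q) \<le> F \<omega> (\<omega> t - \<omega> s)"
        unfolding F_def by (rule step[OF \<delta>]) (use AB e' w in \<open>auto simp: \<delta>_def\<close>)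
      then show ?thesis by simp
    qed
    note [measurable] = em Am Bm
    have Fm: "(\<lambda>(\<omega>, y). ennreal (F \<omega> y)) \<in> borel_measurable (nat_filtration s \<Otimes>\<^sub>M borel)"
      unfolding F_def by measurable
    have "moment (2 * q) e' \<le> (\<integral>\<^sup>+ \<omega>. ennreal (F \<omega> (\<omega> t - \<omega> s)) \<partial>M)"
      by (intro nn_integral_mono ennreal_leI le)
    also have "\<dots> = (\<integral>\<^sup>+ \<omega>. (\<integral>\<^sup>+ y. ennreal (F \<omega> y) \<partial>incr s t) \<partial>M)"
      by (rule nn_integral_increment[OF st Fm])
    also have "\<dots> \<le> (\<integral>\<^sup>+ \<omega>. ennreal (1 + C1 * C2 * \<delta>) * ennreal (norm (e \<omega>) ^ (2 * q))
        + ennreal (C1 * C2 * \<delta>) * ennreal (B \<omega> ^ (2 * q)) \<partial>M)"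
    proof (rule nn_integral_mono)
      fix \<omega> assume w: "\<omega> \<in> space M"
      let ?I = "\<integral>y. (1 + norm y / sqrt \<delta>) ^ (2 * q) \<partial>incr s t"
      interpret I: prob_space "incr s t" by (rule prob_space_incr)
      have i3: "integrable (incr s t) (\<lambda>y. (1 + norm y / sqrt \<delta>) ^ (2 * q))" and I_le: "?I \<le> C2"
        using mom[OF st] by (auto simp: \<delta>_def)
      have Fi: "integrable (incr s t) (F \<omega>)"
        unfolding F_def
        by (intro Bochner_Integration.integrable_add integrable_mult_right incr_linear_form[OF st] i3 I.integrable_const)
      have "integral\<^sup>L (incr s t) (F \<omega>) = norm (e \<omega>) ^ (2 * q) + C1 * \<delta> * (norm (e \<omega>) ^ (2 * q) + B \<omega> ^ (2 * q)) * ?I"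
        unfolding F_def by (simp add: i3 incr_linear_form[OF st] I.prob_space[unfolded space_incr])
      also have "\<dots> \<le> norm (e \<omega>) ^ (2 * q) + C1 * \<delta> * (norm (e \<omega>) ^ (2 * q) + B \<omega> ^ (2 * q)) * C2"
        using I_le C1 \<delta> B0[OF w] by (intro add_left_mono mult_left_mono) auto
      also have "\<dots> = (1 + C1 * C2 * \<delta>) * norm (e \<omega>) ^ (2 * q) + C1 * C2 * \<delta> * B \<omega> ^ (2 * q)"
        by (simp add: algebra_simps)
      finally have "ennreal (integral\<^sup>L (incr s t) (F \<omega>)) \<le> ennreal ((1 + C1 * C2 * \<delta>) * norm (e \<omega>) ^ (2 * q) + C1 * C2 * \<delta> * B \<omega> ^ (2 * q))"
        by (rule ennreal_leI)
      also have "\<dots> = ennreal (1 + C1 * C2 * \<delta>) * ennreal (norm (e \<omega>) ^ (2 * q))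
        + ennreal (C1 * C2 * \<delta>) * ennreal (B \<omega> ^ (2 * q))"
        using C1 C2 \<delta> B0[OF w] by (simp add: ennreal_plus[symmetric] ennreal_mult[symmetric] del: ennreal_plus)
      finally show "(\<integral>\<^sup>+ y. ennreal (F \<omega> y) \<partial>incr s t) \<le> ennreal (1 + C1 * C2 * \<delta>) * ennreal (norm (e \<omega>) ^ (2 * q))
        + ennreal (C1 * C2 * \<delta>) * ennreal (B \<omega> ^ (2 * q))"
        by (subst nn_integral_eq_integral[OF Fi]) (auto simp: F0[OF w])
    qed
    also have "\<dots> = ennreal (1 + C1 * C2 * (t - s)) * moment (2 * q) e
         + ennreal (C1 * C2 * (t - s)) * (\<integral>\<^sup>+ \<omega>. ennreal (B \<omega> ^ (2 * q)) \<partial>M)"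
    proof -
      note [measurable] = measurable_from_filtration[OF em] measurable_from_filtration[OF Bm]
      show ?thesis unfolding \<delta>_def by (subst nn_integral_add) (auto simp: nn_integral_cmult)
    qed
    finally show "moment (2 * q) e' \<le> \<dots>" .
  qed
qed

text \<open>A discrete Gronwall argument. Carrying \<open>\<gamma>\<close> on both sides makes the
  affine recursion multiplicative: no subtraction in \<open>ennreal\<close> occurs, and estimates
  over consecutive blocks can be chained by multiplying exponentials, whereas an additive error per
  block would grow with the number of blocks.\<close>

lemma moment_iterate:
  assumes q: "q \<ge> 1" and T: "T \<ge> 1" and L: "L \<ge> 0"
  shows "\<exists>C\<ge>0. \<forall>s \<delta> N (e :: nat \<Rightarrow> _ \<Rightarrow> real^'m::finite) A g \<gamma> a. 0 \<le> s \<longrightarrow> 0 < \<delta> \<longrightarrow> \<delta> \<le> T \<longrightarrow>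
     euler_type L s \<delta> N e A g \<longrightarrow> (\<forall>a<N. (\<integral>\<^sup>+ \<omega>. ennreal (g a \<omega> ^ (2 * q)) \<partial>M) \<le> \<gamma>) \<longrightarrow> a \<le> N \<longrightarrow>
     moment (2 * q) (e a) + \<gamma>
        \<le> ennreal (exp (C * (real a * \<delta>))) * (moment (2 * q) (e 0) + \<gamma>)"
proof -
  obtain C1 where C1: "C1 \<ge> 0" and step: "\<And>s t (e :: _ \<Rightarrow> real^'m) A B e'. 0 \<le> s \<Longrightarrow> s < t \<Longrightarrow> t - s \<le> T \<Longrightarrow>
     e \<in> borel_measurable (nat_filtration s) \<Longrightarrow> A \<in> borel_measurable (nat_filtration s) \<Longrightarrow>
     B \<in> borel_measurable (nat_filtration s) \<Longrightarrow>
     (\<forall>\<omega>\<in>space M. norm (A \<omega>) \<le> B \<omega>) \<Longrightarrow>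
     (\<forall>\<omega>\<in>space M. norm (e' \<omega> - e \<omega> - A \<omega> *v (\<omega> t - \<omega> s)) \<le> (t - s) * B \<omega> * (1 + norm (\<omega> t - \<omega> s) / sqrt (t - s))) \<Longrightarrow>
     moment (2 * q) e'
       \<le> ennreal (1 + C1 * (t - s)) * moment (2 * q) e
         + ennreal (C1 * (t - s)) * (\<integral>\<^sup>+ \<omega>. ennreal (B \<omega> ^ (2 * q)) \<partial>M)"
    using moment_step[OF q T, where 'm = 'm] by blast
  \<comment> \<open>\<open>(3 * L) ^ (2 * q)\<close> comes from the power of the three-term bound in
    \<open>euler_type\<close>; the summand 1 gives
    \<open>C1 * \<delta> \<le> C1 * K * \<delta>\<close>. The recursion gains a factor
    \<open>1 + 2 * x\<close> per step with \<open>x = 2 * C1 * K * \<delta>\<close>, which explains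
    the 4 in the next constant.\<close>
  define K where "K = 1 + (3 * L) ^ (2 * q)"
  define C where "C = 4 * C1 * K"
  have K: "K \<ge> 1" using L by (simp add: K_def)
  show ?thesis
  proof (intro exI[of _ C] conjI allI impI)
    show "0 \<le> C" using C1 K by (simp add: C_def)
    fix s \<delta> :: real and N a and e :: "nat \<Rightarrow> (real \<Rightarrow> real^'d) \<Rightarrow> real^'m" and A g \<gamma>
    assume s: "0 \<le> s" and \<delta>: "0 < \<delta>" "\<delta> \<le> T"
      and et: "euler_type L s \<delta> N e A g"
      and \<gamma>: "\<forall>a<N. (\<integral>\<^sup>+ \<omega>. ennreal (g a \<omega> ^ (2 * q)) \<partial>M) \<le> \<gamma>"
      and aN: "a \<le> N"
    have em: "\<forall>a\<le>N. e a \<in> borel_measurable (nat_filtration (s + real a * \<delta>))"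
      and Am: "\<forall>a<N. A a \<in> borel_measurable (nat_filtration (s + real a * \<delta>))"
      and gm: "\<forall>a<N. g a \<in> borel_measurable (nat_filtration (s + real a * \<delta>))"
      and g0: "\<forall>a<N. \<forall>\<omega>\<in>space M. 0 \<le> g a \<omega>"
      and A: "\<forall>a<N. \<forall>\<omega>\<in>space M. norm (A a \<omega>) \<le> L * (norm (e a \<omega>) + norm (e 0 \<omega>) + g a \<omega>)"
      and r: "\<forall>a<N. \<forall>\<omega>\<in>space M. norm (e (Suc a) \<omega> - e a \<omega> - A a \<omega> *v (\<omega> (s + real (Suc a) * \<delta>) - \<omega> (s + real a * \<delta>)))
        \<le> \<delta> * (L * (norm (e a \<omega>) + norm (e 0 \<omega>) + g a \<omega>))
           * (1 + norm (\<omega> (s + real (Suc a) * \<delta>) - \<omega> (s + real a * \<delta>)) / sqrt \<delta>)"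
      using et unfolding euler_type_def space_M by blast+
    define E where "E a = moment (2 * q) (e a)" for a
    define y x where "y = C1 * K * \<delta>" and "x = 2 * y"
    have y: "0 \<le> y" using C1 K \<delta> by (simp add: y_def)
    have x: "0 \<le> x" using y by (simp add: x_def)
    have rec: "E (Suc k) + \<gamma> \<le> ennreal (1 + x) * (E k + \<gamma>) + ennreal x * (E 0 + \<gamma>)" if k: "k < N" for k
    proof -
      define B where "B \<omega> = L * (norm (e k \<omega>) + norm (e 0 \<omega>) + g k \<omega>)" for \<omega>
      have ekm: "e k \<in> borel_measurable (nat_filtration (s + real k * \<delta>))" using em k by simp
      have e0m: "e 0 \<in> borel_measurable (nat_filtration (s + real k * \<delta>))"
        using em[rule_format, of 0] \<delta> by (auto intro: measurable_nat_filtration_mono)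
      have gkm: "g k \<in> borel_measurable (nat_filtration (s + real k * \<delta>))" using gm k by simp
      have Bm: "B \<in> borel_measurable (nat_filtration (s + real k * \<delta>))"
        unfolding B_def using ekm e0m gkm by measurable
      have EB: "(\<integral>\<^sup>+ \<omega>. ennreal (B \<omega> ^ (2 * q)) \<partial>M) \<le> ennreal K * (E k + E 0 + \<gamma>)"
      proof -
        note [measurable] = measurable_from_filtration[OF ekm] measurable_from_filtration[OF e0m] measurable_from_filtration[OF gkm]
        have "B \<omega> ^ (2 * q) \<le> K * (norm (e k \<omega>) ^ (2 * q) + norm (e 0 \<omega>) ^ (2 * q) + g k \<omega> ^ (2 * q))"
          if "\<omega> \<in> space M" for \<omega>
        proof -
          have "(norm (e k \<omega>) + norm (e 0 \<omega>) + g k \<omega>) ^ (2 * q)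
              \<le> 3 ^ (2 * q) * (norm (e k \<omega>) ^ (2 * q) + norm (e 0 \<omega>) ^ (2 * q) + g k \<omega> ^ (2 * q))"
            using g0 k that by (intro power_sum3_le) auto
          then have "B \<omega> ^ (2 * q) \<le> L ^ (2 * q) * (3 ^ (2 * q) * (norm (e k \<omega>) ^ (2 * q) + norm (e 0 \<omega>) ^ (2 * q) + g k \<omega> ^ (2 * q)))"
            unfolding B_def power_mult_distrib using L by (intro mult_left_mono) auto
          also have "\<dots> \<le> K * (norm (e k \<omega>) ^ (2 * q) + norm (e 0 \<omega>) ^ (2 * q) + g k \<omega> ^ (2 * q))"
            using g0 k that unfolding mult.assoc[symmetric] K_def power_mult_distrib
            by (intro mult_right_mono) auto
          finally show ?thesis .
        qed
        then have "(\<integral>\<^sup>+ \<omega>. ennreal (B \<omega> ^ (2 * q)) \<partial>M)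
            \<le> (\<integral>\<^sup>+ \<omega>. ennreal (K * (norm (e k \<omega>) ^ (2 * q) + norm (e 0 \<omega>) ^ (2 * q) + g k \<omega> ^ (2 * q))) \<partial>M)"
          by (intro nn_integral_mono ennreal_leI) auto
        also have "\<dots> = (\<integral>\<^sup>+ \<omega>. ennreal K * (ennreal (norm (e k \<omega>) ^ (2 * q)) + ennreal (norm (e 0 \<omega>) ^ (2 * q)) + ennreal (g k \<omega> ^ (2 * q))) \<partial>M)"
          using K g0 k by (intro nn_integral_cong) (auto simp: ennreal_mult ennreal_plus)
        also have "\<dots> = ennreal K * (E k + E 0 + (\<integral>\<^sup>+ \<omega>. ennreal (g k \<omega> ^ (2 * q)) \<partial>M))"
          unfolding E_def by (simp add: nn_integral_cmult nn_integral_add)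
        also have "\<dots> \<le> ennreal K * (E k + E 0 + \<gamma>)"
          using \<gamma> k by (intro mult_left_mono add_mono order_refl) auto
        finally show ?thesis .
      qed
      have d: "s + real (Suc k) * \<delta> - (s + real k * \<delta>) = \<delta>" by (simp add: algebra_simps)
      have "E (Suc k) \<le> ennreal (1 + C1 * \<delta>) * E k + ennreal (C1 * \<delta>) * (\<integral>\<^sup>+ \<omega>. ennreal (B \<omega> ^ (2 * q)) \<partial>M)"
        unfolding E_def
        by (rule step[of "s + real k * \<delta>" "s + real (Suc k) * \<delta>" "e k" "A k" B "e (Suc k)", unfolded d])
           (use s \<delta> A r k ekm Am Bm in \<open>auto simp: B_def\<close>)
      also have "\<dots> \<le> ennreal (1 + y) * E k + ennreal y * (E k + E 0 + \<gamma>)"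
      proof (intro add_mono)
        have "C1 * \<delta> * 1 \<le> C1 * \<delta> * K" using C1 K \<delta> by (intro mult_left_mono) auto
        then show "ennreal (1 + C1 * \<delta>) * E k \<le> ennreal (1 + y) * E k"
          by (intro mult_right_mono ennreal_leI) (auto simp: y_def mult_ac)
        have "ennreal (C1 * \<delta>) * (\<integral>\<^sup>+ \<omega>. ennreal (B \<omega> ^ (2 * q)) \<partial>M) \<le> ennreal (C1 * \<delta>) * (ennreal K * (E k + E 0 + \<gamma>))"
          by (intro mult_left_mono EB) auto
        also have "\<dots> = ennreal y * (E k + E 0 + \<gamma>)"
          using C1 K \<delta> unfolding y_def mult.assoc[symmetric] by (simp add: ennreal_mult[symmetric] mult_ac)
        finally show "ennreal (C1 * \<delta>) * (\<integral>\<^sup>+ \<omega>. ennreal (B \<omega> ^ (2 * q)) \<partial>M) \<le> ennreal y * (E k + E 0 + \<gamma>)" .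
      qed
      finally have "E (Suc k) + \<gamma> \<le> ennreal (1 + y) * E k + ennreal y * (E k + E 0 + \<gamma>) + \<gamma>"
        by (rule add_right_mono)
      also have "\<dots> \<le> ennreal (1 + y) * (E k + \<gamma>) + ennreal y * (E k + \<gamma>) + ennreal y * (E 0 + \<gamma>)"
      proof -
        have "ennreal (1 + y) = 1 + ennreal y" using y by simp
        then have "ennreal (1 + y) * (E k + \<gamma>) + ennreal y * (E k + \<gamma>) + ennreal y * (E 0 + \<gamma>)
            = (ennreal (1 + y) * E k + ennreal y * (E k + E 0 + \<gamma>) + \<gamma>) + (ennreal y * \<gamma> + ennreal y * \<gamma>)"
          by (simp add: distrib_left distrib_right add_ac)
        then show ?thesis unfolding le_iff_add by metis
      qed
      also have "\<dots> = ennreal (1 + x) * (E k + \<gamma>) + ennreal y * (E 0 + \<gamma>)"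
        using y by (auto simp add: x_def ennreal_plus[symmetric] distrib_right[symmetric] add.commute simp del: ennreal_plus)
      also have "\<dots> \<le> ennreal (1 + x) * (E k + \<gamma>) + ennreal x * (E 0 + \<gamma>)"
        using y by (intro add_left_mono mult_right_mono ennreal_leI) (auto simp: x_def)
      finally show ?thesis .
    qed
    have ind: "E k + \<gamma> \<le> ennreal ((1 + 2 * x) ^ k) * (E 0 + \<gamma>)" if "k \<le> N" for k
      using that
    proof (induction k)
      case (Suc k)
      have "E (Suc k) + \<gamma> \<le> ennreal (1 + x) * (E k + \<gamma>) + ennreal x * (E 0 + \<gamma>)"
        by (rule rec) (use Suc in simp)
      also have "\<dots> \<le> ennreal (1 + x) * (ennreal ((1 + 2 * x) ^ k) * (E 0 + \<gamma>)) + ennreal x * (ennreal ((1 + 2 * x) ^ k) * (E 0 + \<gamma>))"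
      proof (intro add_mono mult_left_mono)
        show "E k + \<gamma> \<le> ennreal ((1 + 2 * x) ^ k) * (E 0 + \<gamma>)" using Suc by simp
        have "ennreal 1 * (E 0 + \<gamma>) \<le> ennreal ((1 + 2 * x) ^ k) * (E 0 + \<gamma>)"
          using x by (intro mult_right_mono ennreal_leI one_le_power) auto
        then show "E 0 + \<gamma> \<le> ennreal ((1 + 2 * x) ^ k) * (E 0 + \<gamma>)" by simp
      qed auto
      also have "\<dots> = (ennreal (1 + x) + ennreal x) * ennreal ((1 + 2 * x) ^ k) * (E 0 + \<gamma>)"
        by (simp only: distrib_right mult.assoc)
      also have "(ennreal (1 + x) + ennreal x) * ennreal ((1 + 2 * x) ^ k) = ennreal ((1 + 2 * x) ^ Suc k)"
        using x by (simp add: ennreal_plus[symmetric] ennreal_mult[symmetric] del: ennreal_plus)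
      finally show ?case .
    qed simp
    have "(1 + 2 * x) ^ a \<le> exp (2 * x) ^ a" using x by (intro power_mono) auto
    also have "\<dots> = exp (C * (real a * \<delta>))" by (simp add: exp_of_nat_mult[symmetric] C_def x_def y_def mult_ac)
    finally have "ennreal ((1 + 2 * x) ^ a) * (E 0 + \<gamma>) \<le> ennreal (exp (C * (real a * \<delta>))) * (E 0 + \<gamma>)"
      by (intro mult_right_mono ennreal_leI) auto
    then show "E a + \<gamma> \<le> ennreal (exp (C * (real a * \<delta>))) * (E 0 + \<gamma>)"
      using ind[OF aN] by (rule order_trans[rotated])
  qed
qed

end

section \<open>The Euler scheme\<close>

text \<open>The flow of the Euler scheme: \<open>j\<close> steps from the state \<open>x\<close> at
  time \<open>k * h\<close>. The starting index stays free because the stability argument restarts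
  the scheme at every grid time.\<close>

primrec euler ::
  "(real^'m \<Rightarrow> real^'m) \<Rightarrow> (real^'m \<Rightarrow> real^'d^'m) \<Rightarrow> real \<Rightarrow> (real \<Rightarrow> real^'d) \<Rightarrow> nat \<Rightarrow> real^'m \<Rightarrow> nat \<Rightarrow> real^'m" where
  "euler b \<sigma> h \<omega> k x 0 = x"
| "euler b \<sigma> h \<omega> k x (Suc j) = euler b \<sigma> h \<omega> k x j
     + \<sigma> (euler b \<sigma> h \<omega> k x j) *v (\<omega> (real (Suc (k + j)) * h) - \<omega> (real (k + j) * h))
     + h *\<^sub>R b (euler b \<sigma> h \<omega> k x j)"

locale lipschitz_sde = wiener_space M for M :: "(real \<Rightarrow> real^'d::finite) measure" +
  fixes b :: "real^'m::finite \<Rightarrow> real^'m" and \<sigma> :: "real^'m \<Rightarrow> real^'d^'m"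
    and K :: real and x0 :: "real^'m"
  assumes K1: "1 \<le> K"
    and b_lip: "norm (b x - b y) \<le> K * norm (x - y)"
    and \<sigma>_lip: "norm (\<sigma> x - \<sigma> y) \<le> K * norm (x - y)"
    and b_growth: "norm (b x) \<le> K * (1 + norm x)"
    and \<sigma>_growth: "norm (\<sigma> x) \<le> K * (1 + norm x)"
begin

abbreviation eul :: "real \<Rightarrow> (real \<Rightarrow> real^'d) \<Rightarrow> nat \<Rightarrow> real^'m" where
  "eul h \<omega> k \<equiv> euler b \<sigma> h \<omega> 0 x0 k"

lemma continuous_b: "continuous_on S b"
  by (rule lipschitz_on_continuous_on[of K])
     (auto simp: lipschitz_on_def dist_norm b_lip intro: order_trans[OF zero_le_one K1])

lemma continuous_\<sigma>: "continuous_on S \<sigma>"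
  by (rule lipschitz_on_continuous_on[of K])
     (auto simp: lipschitz_on_def dist_norm \<sigma>_lip intro: order_trans[OF zero_le_one K1])

lemma b_measurable [measurable]: "b \<in> borel_measurable borel"
  by (rule borel_measurable_continuous_onI[OF continuous_b])

lemma \<sigma>_measurable [measurable]: "\<sigma> \<in> borel_measurable borel"
  by (rule borel_measurable_continuous_onI[OF continuous_\<sigma>])

lemma euler_measurable:
  assumes h: "0 \<le> h"
  shows "(\<lambda>\<omega>. euler b \<sigma> h \<omega> k x j) \<in> borel_measurable (nat_filtration (real (k + j) * h))"
proof (induction j)
  case (Suc j)
  have [measurable]: "(\<lambda>\<omega>. euler b \<sigma> h \<omega> k x j) \<in> borel_measurable (nat_filtration (real (k + Suc j) * h))"
    by (rule measurable_nat_filtration_mono[OF Suc]) (use h in \<open>simp add: mult_right_mono\<close>)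
  have [measurable]: "(\<lambda>\<omega>. \<omega> (real (Suc (k + j)) * h)) \<in> borel_measurable (nat_filtration (real (k + Suc j) * h))"
    "(\<lambda>\<omega>. \<omega> (real (k + j) * h)) \<in> borel_measurable (nat_filtration (real (k + Suc j) * h))"
    using h by (auto intro!: nat_filtration_eval mult_right_mono)
  show ?case unfolding euler.simps by measurable
qed simp

lemma euler_measurable_M: "0 \<le> h \<Longrightarrow> (\<lambda>\<omega>. euler b \<sigma> h \<omega> k x j) \<in> borel_measurable M"
  by (rule measurable_from_filtration[OF euler_measurable])

text \<open>The scheme itself is of Euler type: linear growth of the coefficients amounts to the
  constant forcing 1.\<close>

lemma euler_moments:
  assumes q: "q \<ge> 1" and T: "T \<ge> 1"
  shows "\<exists>C\<ge>0. \<forall>h j. 0 < h \<longrightarrow> h \<le> T \<longrightarrow> real j * h \<le> T \<longrightarrow>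
     moment (2 * q) (\<lambda>\<omega>. eul h \<omega> j) \<le> ennreal C"
proof -
  have K0: "0 \<le> K" using K1 by simp
  obtain C where C: "C \<ge> 0" and it: "\<And>s \<delta> N (e :: nat \<Rightarrow> _ \<Rightarrow> real^'m) A g \<gamma> a. 0 \<le> s \<Longrightarrow> 0 < \<delta> \<Longrightarrow> \<delta> \<le> T \<Longrightarrow>
     euler_type K s \<delta> N e A g \<Longrightarrow> (\<forall>a<N. (\<integral>\<^sup>+ \<omega>. ennreal (g a \<omega> ^ (2 * q)) \<partial>M) \<le> \<gamma>) \<Longrightarrow> a \<le> N \<Longrightarrow>
     moment (2 * q) (e a) + \<gamma>
        \<le> ennreal (exp (C * (real a * \<delta>))) * (moment (2 * q) (e 0) + \<gamma>)"
    using moment_iterate[OF q T K0, where 'm = 'm] by blast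
  show ?thesis
  proof (intro exI[of _ "exp (C * T) * (norm x0 ^ (2 * q) + 1)"] conjI allI impI)
    show "0 \<le> exp (C * T) * (norm x0 ^ (2 * q) + 1)" by (simp add: add_nonneg_nonneg)
    fix h :: real and j assume h: "0 < h" "h \<le> T" "real j * h \<le> T"
    have et: "euler_type K 0 h j (\<lambda>a \<omega>. eul h \<omega> a) (\<lambda>a \<omega>. \<sigma> (eul h \<omega> a)) (\<lambda>_ _. 1)"
    proof (rule euler_typeI[OF K0 h(1), where c = "\<lambda>a \<omega>. b (eul h \<omega> a)"])
      fix a
      show "(\<lambda>\<omega>. eul h \<omega> a) \<in> borel_measurable (nat_filtration (0 + real a * h))"
        using euler_measurable[of h 0 x0 a] h by simp
      show "(\<lambda>\<omega>. \<sigma> (eul h \<omega> a)) \<in> borel_measurable (nat_filtration (0 + real a * h))"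
        using measurable_compose[OF euler_measurable[of h 0 x0 a] \<sigma>_measurable] h by simp
      fix \<omega> :: "real \<Rightarrow> real^'d"
      have le: "K * (1 + norm (eul h \<omega> a)) \<le> K * (norm (eul h \<omega> a) + norm (eul h \<omega> 0) + 1)"
        using K0 by (intro mult_left_mono) auto
      show "norm (\<sigma> (eul h \<omega> a)) \<le> K * (norm (eul h \<omega> a) + norm (eul h \<omega> 0) + 1)"
        by (rule order_trans[OF \<sigma>_growth le])
      show "norm (b (eul h \<omega> a)) \<le> K * (norm (eul h \<omega> a) + norm (eul h \<omega> 0) + 1)
          * (1 + norm (\<omega> (0 + real (Suc a) * h) - \<omega> (0 + real a * h)) / sqrt h)"
        by (rule le_mult_one_plus[OF order_trans[OF b_growth le]]) (use h K0 in auto)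
    qed (use h in auto)
    have "moment (2 * q) (\<lambda>\<omega>. eul h \<omega> j) + 1
      \<le> ennreal (exp (C * (real j * h))) * (moment (2 * q) (\<lambda>\<omega>. eul h \<omega> 0) + 1)"
      by (rule it[OF _ h(1,2) et]) (auto simp: emeasure_space_1[unfolded space_M])
    also have "\<dots> = ennreal (exp (C * (real j * h)) * (norm x0 ^ (2 * q) + 1))"
      by (simp add: emeasure_space_1[unfolded space_M] ennreal_mult)
    also have "\<dots> \<le> ennreal (exp (C * T) * (norm x0 ^ (2 * q) + 1))"
      using h C by (intro ennreal_leI mult_right_mono) (auto intro!: mult_left_mono add_nonneg_nonneg)
    finally show "moment (2 * q) (\<lambda>\<omega>. eul h \<omega> j) \<le> ennreal (exp (C * T) * (norm x0 ^ (2 * q) + 1))"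
      by (rule order_trans[rotated]) simp
  qed
qed

text \<open>Two Euler flows are observed from time \<open>(k + 1) * h\<close> on, one restarted
  there at \<open>z'\<close>, the other started at \<open>z\<close> a step earlier. Their distance
  at that time is random but already known, so dividing by it keeps the recursion adapted, and the
  quotient starts below 1. The floor \<open>r\<close> keeps the denominator positive; it will be the
  mesh of the spatial grid.\<close>

lemma euler_flow_lipschitz:
  assumes q: "q \<ge> 1" and T: "T \<ge> 1"
  shows "\<exists>C\<ge>0. \<forall>h k j z z' r. 0 < h \<longrightarrow> h \<le> T \<longrightarrow> real j * h \<le> T \<longrightarrow> 0 < r \<longrightarrow>
     (\<integral>\<^sup>+ \<omega>. ennreal ((norm (euler b \<sigma> h \<omega> (Suc k) z' j - euler b \<sigma> h \<omega> k z (Suc j))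
          / max (norm (z' - euler b \<sigma> h \<omega> k z 1)) r) ^ (2 * q)) \<partial>M) \<le> ennreal C"
proof -
  have K0: "0 \<le> K" using K1 by simp
  obtain C where C: "C \<ge> 0" and it: "\<And>s \<delta> N (e :: nat \<Rightarrow> _ \<Rightarrow> real^'m) A g \<gamma> a. 0 \<le> s \<Longrightarrow> 0 < \<delta> \<Longrightarrow> \<delta> \<le> T \<Longrightarrow>
     euler_type K s \<delta> N e A g \<Longrightarrow> (\<forall>a<N. (\<integral>\<^sup>+ \<omega>. ennreal (g a \<omega> ^ (2 * q)) \<partial>M) \<le> \<gamma>) \<Longrightarrow> a \<le> N \<Longrightarrow>
     moment (2 * q) (e a) + \<gamma>
        \<le> ennreal (exp (C * (real a * \<delta>))) * (moment (2 * q) (e 0) + \<gamma>)"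
    using moment_iterate[OF q T K0, where 'm = 'm] by blast
  show ?thesis
  proof (intro exI[of _ "exp (C * T)"] conjI allI impI)
    show "0 \<le> exp (C * T)" by simp
    fix h r :: real and k j and z z' :: "real^'m"
    assume h: "0 < h" "h \<le> T" "real j * h \<le> T" and r: "0 < r"
    define s where "s = real (Suc k) * h"
    have s: "0 \<le> s" using h by (simp add: s_def)
    have times: "s + real a * h = real (Suc k + a) * h" for a by (simp add: s_def algebra_simps)
    \<comment> \<open>Being measurable at time \<open>s\<close>, the weight multiplies states,
      coefficients and drift alike, and the recursion for the weighted difference keeps the constant
      \<open>K\<close>.\<close>
    define w where "w \<omega> = 1 / max (norm (z' - euler b \<sigma> h \<omega> k z 1)) r" for \<omega>
    have w: "0 < w \<omega>" for \<omega> using r by (auto simp: w_def)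
    define P where "P a \<omega> = euler b \<sigma> h \<omega> (Suc k) z' a" for a \<omega>
    define Q where "Q a \<omega> = euler b \<sigma> h \<omega> k z (Suc a)" for a \<omega>
    have Pm: "P a \<in> borel_measurable (nat_filtration (s + real a * h))" for a
      unfolding P_def times using h by (intro euler_measurable) auto
    have Qm: "Q a \<in> borel_measurable (nat_filtration (s + real a * h))" for a
      unfolding Q_def times using euler_measurable[of h k z "Suc a"] h by (simp del: euler.simps)
    have "(\<lambda>\<omega>. euler b \<sigma> h \<omega> k z 1) \<in> borel_measurable (nat_filtration s)"
      unfolding s_def using euler_measurable[of h k z 1] h by (simp del: euler.simps)
    then have "w \<in> borel_measurable (nat_filtration s)"
      unfolding w_def by measurable
    then have wm: "w \<in> borel_measurable (nat_filtration (s + real a * h))" for a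
      by (rule measurable_nat_filtration_mono) (use h in simp)
    define e where "e a \<omega> = w \<omega> *\<^sub>R (P a \<omega> - Q a \<omega>)" for a \<omega>
    have et: "euler_type K s h j e (\<lambda>a \<omega>. w \<omega> *\<^sub>R (\<sigma> (P a \<omega>) - \<sigma> (Q a \<omega>))) (\<lambda>_ _. 0)"
    proof (rule euler_typeI[OF K0 h(1), where c = "\<lambda>a \<omega>. w \<omega> *\<^sub>R (b (P a \<omega>) - b (Q a \<omega>))"])
      fix a
      note [measurable] = Pm[of a] Qm[of a] wm[of a]
      show "e a \<in> borel_measurable (nat_filtration (s + real a * h))"
        unfolding e_def by measurable
      show "(\<lambda>\<omega>. w \<omega> *\<^sub>R (\<sigma> (P a \<omega>) - \<sigma> (Q a \<omega>))) \<in> borel_measurable (nat_filtration (s + real a * h))"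
        by measurable
      fix \<omega> :: "real \<Rightarrow> real^'d"
      have "w \<omega> * norm (\<sigma> (P a \<omega>) - \<sigma> (Q a \<omega>)) \<le> w \<omega> * (K * norm (P a \<omega> - Q a \<omega>))"
        using w[of \<omega>] by (intro mult_left_mono \<sigma>_lip) auto
      also have "\<dots> = K * norm (e a \<omega>)" using w[of \<omega>] by (simp add: e_def)
      also have "\<dots> \<le> K * (norm (e a \<omega>) + norm (e 0 \<omega>) + 0)" using K0 by (intro mult_left_mono) auto
      finally show "norm (w \<omega> *\<^sub>R (\<sigma> (P a \<omega>) - \<sigma> (Q a \<omega>))) \<le> K * (norm (e a \<omega>) + norm (e 0 \<omega>) + 0)"
        using w[of \<omega>] by simp
      have "w \<omega> * norm (b (P a \<omega>) - b (Q a \<omega>)) \<le> w \<omega> * (K * norm (P a \<omega> - Q a \<omega>))"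
        using w[of \<omega>] by (intro mult_left_mono b_lip) auto
      also have "\<dots> = K * norm (e a \<omega>)" using w[of \<omega>] by (simp add: e_def)
      also have "\<dots> \<le> K * (norm (e a \<omega>) + norm (e 0 \<omega>) + 0)" using K0 by (intro mult_left_mono) auto
      finally show "norm (w \<omega> *\<^sub>R (b (P a \<omega>) - b (Q a \<omega>))) \<le> K * (norm (e a \<omega>) + norm (e 0 \<omega>) + 0)
          * (1 + norm (\<omega> (s + real (Suc a) * h) - \<omega> (s + real a * h)) / sqrt h)"
        using w[of \<omega>] h K0 by (intro le_mult_one_plus) auto
      show "e (Suc a) \<omega> = e a \<omega> + w \<omega> *\<^sub>R (\<sigma> (P a \<omega>) - \<sigma> (Q a \<omega>)) *v (\<omega> (s + real (Suc a) * h) - \<omega> (s + real a * h))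
         + h *\<^sub>R w \<omega> *\<^sub>R (b (P a \<omega>) - b (Q a \<omega>))"
      proof -
        have P: "P (Suc a) \<omega> = P a \<omega> + \<sigma> (P a \<omega>) *v (\<omega> (s + real (Suc a) * h) - \<omega> (s + real a * h)) + h *\<^sub>R b (P a \<omega>)"
          unfolding P_def times by simp
        have Q: "Q (Suc a) \<omega> = Q a \<omega> + \<sigma> (Q a \<omega>) *v (\<omega> (s + real (Suc a) * h) - \<omega> (s + real a * h)) + h *\<^sub>R b (Q a \<omega>)"
          unfolding Q_def times by (subst euler.simps(2)) (simp del: euler.simps)
        show ?thesis unfolding e_def P Q
          by (simp add: algebra_simps scaleR_matrix_vector_assoc[symmetric])
      qed
    qed auto
    have "moment (2 * q) (e j) + 0
      \<le> ennreal (exp (C * (real j * h))) * (moment (2 * q) (e 0) + 0)"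
      by (rule it[OF s h(1,2) et]) (use q in \<open>auto simp: power_0_left\<close>)
    also have "\<dots> \<le> ennreal (exp (C * T)) * (1 + 0)"
    proof (intro mult_mono add_mono ennreal_leI)
      have "norm (e 0 \<omega>) \<le> 1" for \<omega>
        using r unfolding e_def P_def Q_def w_def by (simp add: divide_le_eq max_def del: euler.simps(2))
      then have "moment (2 * q) (e 0) \<le> (\<integral>\<^sup>+ \<omega>. 1 \<partial>M)"
        by (intro nn_integral_mono) (auto intro: power_le_one)
      then show "moment (2 * q) (e 0) \<le> 1"
        by (simp add: emeasure_space_1[unfolded space_M])
    qed (use C h in \<open>auto intro!: mult_left_mono\<close>)
    finally show "(\<integral>\<^sup>+ \<omega>. ennreal ((norm (euler b \<sigma> h \<omega> (Suc k) z' j - euler b \<sigma> h \<omega> k z (Suc j))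
          / max (norm (z' - euler b \<sigma> h \<omega> k z 1)) r) ^ (2 * q)) \<partial>M) \<le> ennreal (exp (C * T))"
      unfolding e_def P_def Q_def w_def using r by (simp add: less_max_iff_disj del: euler.simps)
  qed
qed

lemma increment_moment:
  "\<exists>C\<ge>0. \<forall>s t. 0 \<le> s \<longrightarrow> s < t \<longrightarrow>
     (\<integral>\<^sup>+ \<omega>. ennreal ((1 + norm (\<omega> t - \<omega> s) / sqrt (t - s)) ^ (2 * q)) \<partial>M) \<le> ennreal C"
proof -
  obtain C where C: "C \<ge> 0" and mom: "\<And>s t. 0 \<le> s \<Longrightarrow> s < t \<Longrightarrow>
     integrable (incr s t) (\<lambda>y. (1 + norm y / sqrt (t - s)) ^ (2 * q)) \<and>
     (\<integral>y. (1 + norm y / sqrt (t - s)) ^ (2 * q) \<partial>incr s t) \<le> C"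
    using incr_norm_moment[of q] by blast
  show ?thesis
  proof (intro exI[of _ C] conjI allI impI C)
    fix s t :: real assume st: "0 \<le> s" "s < t"
    have "(\<integral>\<^sup>+ \<omega>. ennreal ((1 + norm (\<omega> t - \<omega> s) / sqrt (t - s)) ^ (2 * q)) \<partial>M)
        = (\<integral>\<^sup>+ y. ennreal ((1 + norm y / sqrt (t - s)) ^ (2 * q)) \<partial>incr s t)"
      unfolding incr_def by (subst nn_integral_distr) (auto intro!: borel_measurable_diff eval_measurable)
    also have "\<dots> = ennreal (\<integral>y. (1 + norm y / sqrt (t - s)) ^ (2 * q) \<partial>incr s t)"
      using mom[OF st] st by (intro nn_integral_eq_integral) auto
    also have "\<dots> \<le> ennreal C" using mom[OF st] by (intro ennreal_leI) auto
    finally show "(\<integral>\<^sup>+ \<omega>. ennreal ((1 + norm (\<omega> t - \<omega> s) / sqrt (t - s)) ^ (2 * q)) \<partial>M) \<le> ennreal C" .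
  qed
qed

lemma displacement_pointwise:
  assumes T: "1 \<le> T" and \<delta>: "0 < \<delta>" "\<delta> \<le> T"
  shows "norm (\<sigma> x *v y + \<delta> *\<^sub>R b x) \<le> sqrt \<delta> * (K * T * (1 + norm x)) * (1 + norm y / sqrt \<delta>)"
proof -
  have K0: "0 \<le> K" using K1 by simp
  have "sqrt \<delta> \<le> T" using \<delta> sqrt_le_self[OF T] by (meson order_trans real_sqrt_le_iff)
  then have d: "\<delta> \<le> sqrt \<delta> * T" using \<delta> mult_left_mono[of "sqrt \<delta>" T "sqrt \<delta>"] by simp
  have "norm (\<sigma> x *v y + \<delta> *\<^sub>R b x) \<le> norm (\<sigma> x) * norm y + \<delta> * norm (b x)"
    by (rule order_trans[OF norm_triangle_ineq add_mono[OF vec_norm_mult_le]]) (use \<delta> in simp)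
  also have "\<dots> \<le> K * (1 + norm x) * norm y + \<delta> * (K * (1 + norm x))"
    using \<delta> by (intro add_mono mult_left_mono mult_right_mono \<sigma>_growth b_growth) auto
  also have "\<dots> = K * (1 + norm x) * (norm y + \<delta>)" by (simp add: algebra_simps)
  also have "K * (1 + norm x) * (norm y + \<delta>) \<le> K * (1 + norm x) * (sqrt \<delta> * T * (1 + norm y / sqrt \<delta>))"
  proof (rule mult_left_mono)
    show "norm y + \<delta> \<le> sqrt \<delta> * T * (1 + norm y / sqrt \<delta>)"
      using T d \<delta> mult_right_mono[OF T, of "norm y"] by (simp add: algebra_simps)
  qed (use K0 in simp)
  finally show ?thesis by (simp add: mult_ac)
qed

text \<open>\<open>Z\<close> may depend on the increment, so the product of the two is separated by
  \<open>young_power\<close>; this is why the moment of \<open>Z\<close> on the right has double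
  order.\<close>

lemma displacement_moment:
  assumes T: "T \<ge> 1"
  shows "\<exists>C\<ge>0. \<forall>s t (Z :: _ \<Rightarrow> real^'m) . 0 \<le> s \<longrightarrow> s < t \<longrightarrow> t - s \<le> T \<longrightarrow> Z \<in> borel_measurable M \<longrightarrow>
     moment (2 * q) (\<lambda>\<omega>. \<sigma> (Z \<omega>) *v (\<omega> t - \<omega> s) + (t - s) *\<^sub>R b (Z \<omega>))
       \<le> ennreal (C * (t - s) ^ q) * (1 + moment (2 * (2 * q)) Z)"
proof -
  obtain C where C: "C \<ge> 0" and mom: "\<And>s t. 0 \<le> s \<Longrightarrow> s < t \<Longrightarrow>
     (\<integral>\<^sup>+ \<omega>. ennreal ((1 + norm (\<omega> t - \<omega> s) / sqrt (t - s)) ^ (2 * (2 * q))) \<partial>M) \<le> ennreal C"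
    using increment_moment[of "2 * q"] by blast
  define D where "D = (K * T) ^ (2 * q)"
  define c where "c = (3 ^ (2 * (2 * q)) :: real)"
  have D: "0 \<le> D" and c: "0 \<le> c" using K1 T by (auto simp: D_def c_def)
  show ?thesis
  proof (intro exI[of _ "D * (c + C)"] conjI allI impI)
    show "0 \<le> D * (c + C)" using C D c by simp
    fix s t :: real and Z :: "(real \<Rightarrow> real^'d) \<Rightarrow> real^'m"
    assume st: "0 \<le> s" "s < t" "t - s \<le> T" and [measurable]: "Z \<in> borel_measurable M"
    define \<delta> where "\<delta> = t - s"
    have \<delta>: "0 < \<delta>" "\<delta> \<le> T" using st by (auto simp: \<delta>_def)
    define z where "z \<omega> = 1 + norm (\<omega> t - \<omega> s) / sqrt \<delta>" for \<omega> :: "real \<Rightarrow> real^'d"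
    have z0: "0 \<le> z \<omega>" for \<omega> using \<delta> by (simp add: z_def)
    have zm [measurable]: "z \<in> borel_measurable M"
      unfolding z_def by (intro borel_measurable_add borel_measurable_const borel_measurable_divide
         borel_measurable_norm[THEN measurable_compose[rotated]] borel_measurable_diff eval_measurable)
    have pw: "norm (\<sigma> (Z \<omega>) *v (\<omega> t - \<omega> s) + \<delta> *\<^sub>R b (Z \<omega>)) ^ (2 * q)
       \<le> D * \<delta> ^ q * (c * (1 + norm (Z \<omega>) ^ (2 * (2 * q))) + z \<omega> ^ (2 * (2 * q)))" for \<omega>
    proof -
      have "norm (\<sigma> (Z \<omega>) *v (\<omega> t - \<omega> s) + \<delta> *\<^sub>R b (Z \<omega>)) ^ (2 * q)
         \<le> (sqrt \<delta> * (K * T * (1 + norm (Z \<omega>))) * z \<omega>) ^ (2 * q)"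
        unfolding z_def by (intro power_mono displacement_pointwise T \<delta>) auto
      also have "\<dots> = D * \<delta> ^ q * ((1 + norm (Z \<omega>)) ^ (2 * q) * z \<omega> ^ (2 * q))"
        using \<delta> by (simp add: power_mult_distrib D_def power_mult)
      also have "\<dots> \<le> D * \<delta> ^ q * ((1 + norm (Z \<omega>)) ^ (2 * q + 2 * q) + z \<omega> ^ (2 * q + 2 * q))"
        using D \<delta> z0 by (intro mult_left_mono young_power) auto
      also have "2 * q + 2 * q = 2 * (2 * q)" by simp
      also have "(1 + norm (Z \<omega>)) ^ (2 * (2 * q)) \<le> c * (1 ^ (2 * (2 * q)) + norm (Z \<omega>) ^ (2 * (2 * q)))"
        unfolding c_def by (rule power_sum2_le) auto
      finally show ?thesis using D \<delta> by (simp add: mult_left_mono)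
    qed
    have "moment (2 * q) (\<lambda>\<omega>. \<sigma> (Z \<omega>) *v (\<omega> t - \<omega> s) + \<delta> *\<^sub>R b (Z \<omega>))
       \<le> (\<integral>\<^sup>+ \<omega>. ennreal (D * \<delta> ^ q * (c * (1 + norm (Z \<omega>) ^ (2 * (2 * q))) + z \<omega> ^ (2 * (2 * q)))) \<partial>M)"
      by (intro nn_integral_mono ennreal_leI pw)
    also have "\<dots> = (\<integral>\<^sup>+ \<omega>. ennreal (D * \<delta> ^ q) * (ennreal c * (1 + ennreal (norm (Z \<omega>) ^ (2 * (2 * q)))) + ennreal (z \<omega> ^ (2 * (2 * q)))) \<partial>M)"
      using D \<delta> c z0 by (intro nn_integral_cong) (simp add: ennreal_mult ennreal_plus)
    also have "\<dots> = ennreal (D * \<delta> ^ q) * (ennreal c * (1 + moment (2 * (2 * q)) Z) + (\<integral>\<^sup>+ \<omega>. ennreal (z \<omega> ^ (2 * (2 * q))) \<partial>M))"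
      by (simp add: nn_integral_cmult nn_integral_add emeasure_space_1[unfolded space_M])
    also have "\<dots> \<le> ennreal (D * \<delta> ^ q) * (ennreal c * (1 + moment (2 * (2 * q)) Z) + ennreal C * (1 + moment (2 * (2 * q)) Z))"
    proof (intro mult_left_mono add_left_mono)
      have "(\<integral>\<^sup>+ \<omega>. ennreal (z \<omega> ^ (2 * (2 * q))) \<partial>M) \<le> ennreal C * 1"
        unfolding z_def \<delta>_def using mom[OF st(1,2)] by simp
      also have "\<dots> \<le> ennreal C * (1 + moment (2 * (2 * q)) Z)"
        by (intro mult_left_mono) auto
      finally show "(\<integral>\<^sup>+ \<omega>. ennreal (z \<omega> ^ (2 * (2 * q))) \<partial>M) \<le> ennreal C * (1 + moment (2 * (2 * q)) Z)" .
    qed auto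
    also have "\<dots> = ennreal (D * (c + C) * \<delta> ^ q) * (1 + moment (2 * (2 * q)) Z)"
    proof -
      have "ennreal (D * (c + C) * \<delta> ^ q) = ennreal (D * \<delta> ^ q) * (ennreal c + ennreal C)"
        using D c C \<delta> by (simp add: ennreal_mult[symmetric] ennreal_plus[symmetric] mult_ac del: ennreal_plus)
      then show ?thesis by (simp only: distrib_right mult.assoc)
    qed
    finally show "moment (2 * q) (\<lambda>\<omega>. \<sigma> (Z \<omega>) *v (\<omega> t - \<omega> s) + (t - s) *\<^sub>R b (Z \<omega>))
       \<le> ennreal (D * (c + C) * (t - s) ^ q) * (1 + moment (2 * (2 * q)) Z)"
      unfolding \<delta>_def .
  qed
qed

text \<open>Over one coarse step the fine scheme \<open>P\<close> is compared with the coarse value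
  \<open>Y\<close> plus the displacement \<open>D\<close> with coefficients frozen at the left end.
  The error \<open>e = P - (Y + D)\<close> is of Euler type with forcing \<open>norm D\<close>, and
  at the right end it is the difference of the two schemes. The moment of \<open>D\<close> is of
  order \<open>h ^ q\<close> whatever \<open>l\<close> is, so all refinements stay at that distance
  from the scheme with step \<open>h\<close>.\<close>

lemma euler_refinement:
  assumes q: "q \<ge> 1" and T: "T \<ge> 1"
  shows "\<exists>C\<ge>0. \<forall>h l k. 0 < h \<longrightarrow> h \<le> T \<longrightarrow> 1 \<le> l \<longrightarrow> real k * h \<le> T \<longrightarrow>
     moment (2 * q) (\<lambda>\<omega>. eul (h / real l) \<omega> (k * l) - eul h \<omega> k)
       \<le> ennreal (C * h ^ q)"
proof -
  have K0: "0 \<le> K" using K1 by simp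
  obtain C where C: "C \<ge> 0" and it: "\<And>s \<delta> N (e :: nat \<Rightarrow> _ \<Rightarrow> real^'m) A g \<gamma> a. 0 \<le> s \<Longrightarrow> 0 < \<delta> \<Longrightarrow> \<delta> \<le> T \<Longrightarrow>
     euler_type K s \<delta> N e A g \<Longrightarrow> (\<forall>a<N. (\<integral>\<^sup>+ \<omega>. ennreal (g a \<omega> ^ (2 * q)) \<partial>M) \<le> \<gamma>) \<Longrightarrow> a \<le> N \<Longrightarrow>
     moment (2 * q) (e a) + \<gamma>
        \<le> ennreal (exp (C * (real a * \<delta>))) * (moment (2 * q) (e 0) + \<gamma>)"
    using moment_iterate[OF q T K0, where 'm = 'm] by blast
  obtain C1 where C1: "C1 \<ge> 0" and mom: "\<And>h j. 0 < h \<Longrightarrow> h \<le> T \<Longrightarrow> real j * h \<le> T \<Longrightarrow>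
     moment (2 * (2 * q)) (\<lambda>\<omega>. eul h \<omega> j) \<le> ennreal C1"
    using euler_moments[of "2 * q" T] q T by auto
  obtain C2 where C2: "C2 \<ge> 0" and disp: "\<And>s t (Z :: _ \<Rightarrow> real^'m). 0 \<le> s \<Longrightarrow> s < t \<Longrightarrow> t - s \<le> T \<Longrightarrow> Z \<in> borel_measurable M \<Longrightarrow>
     moment (2 * q) (\<lambda>\<omega>. \<sigma> (Z \<omega>) *v (\<omega> t - \<omega> s) + (t - s) *\<^sub>R b (Z \<omega>))
       \<le> ennreal (C2 * (t - s) ^ q) * (1 + moment (2 * (2 * q)) Z)"
    using displacement_moment[OF T, of q] by blast
  define C3 where "C3 = C2 * (1 + C1)"
  have C3: "0 \<le> C3" using C1 C2 by (simp add: C3_def)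
  show ?thesis
  proof (intro exI[of _ "exp (C * T) * C3"] conjI allI impI)
    show "0 \<le> exp (C * T) * C3" using C3 by simp
    fix h :: real and l k :: nat assume h: "0 < h" "h \<le> T" and l: "1 \<le> l" and kh: "real k * h \<le> T"
    define \<delta> where "\<delta> = h / real l"
    define \<gamma> where "\<gamma> = ennreal (C3 * h ^ q)"
    have \<delta>: "0 < \<delta>" "\<delta> \<le> T" and l\<delta>: "real l * \<delta> = h"
    proof -
      show "0 < \<delta>" "real l * \<delta> = h" using h l by (auto simp: \<delta>_def)
      have "h / real l \<le> h" using h l by (simp add: divide_le_eq mult_left_le)
      then show "\<delta> \<le> T" using h by (simp add: \<delta>_def)
    qed
    define E where "E k = moment (2 * q) (\<lambda>\<omega>. euler b \<sigma> \<delta> \<omega> 0 x0 (k * l) - eul h \<omega> k)" for k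
    have block: "E (Suc k) + \<gamma> \<le> ennreal (exp (C * h)) * (E k + \<gamma>)" if kh: "real (Suc k) * h \<le> T" for k
    proof -
      define s where "s = real k * h"
      have s: "0 \<le> s" using h by (simp add: s_def)
      have times: "s + real a * \<delta> = real (k * l + a) * \<delta>" for a
        by (simp add: s_def l\<delta>[symmetric] algebra_simps)
      have sh: "real (Suc k) * h = s + real l * \<delta>" by (simp only: s_def l\<delta>) (simp add: algebra_simps)
      define Y where "Y \<omega> = eul h \<omega> k" for \<omega>
      define P where "P a \<omega> = euler b \<sigma> \<delta> \<omega> 0 x0 (k * l + a)" for a \<omega>
      define D where "D a \<omega> = \<sigma> (Y \<omega>) *v (\<omega> (s + real a * \<delta>) - \<omega> s) + (real a * \<delta>) *\<^sub>R b (Y \<omega>)" for a and \<omega> :: "real \<Rightarrow> real^'d"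
      define e where "e a \<omega> = P a \<omega> - (Y \<omega> + D a \<omega>)" for a \<omega>
      have Pm: "P a \<in> borel_measurable (nat_filtration (s + real a * \<delta>))" for a
        unfolding P_def times using euler_measurable[of \<delta> 0 x0 "k * l + a"] \<delta> by simp
      have Ys: "Y \<in> borel_measurable (nat_filtration s)"
        unfolding Y_def s_def using euler_measurable[of h 0 x0 k] h by simp
      then have Ym: "Y \<in> borel_measurable (nat_filtration (s + real a * \<delta>))" for a
        by (rule measurable_nat_filtration_mono) (use \<delta> in simp)
      have Dm: "D a \<in> borel_measurable (nat_filtration (s + real a * \<delta>))" for a
      proof -
        note [measurable] = Ym[of a]
        have [measurable]: "(\<lambda>\<omega>. \<omega> (s + real a * \<delta>)) \<in> borel_measurable (nat_filtration (s + real a * \<delta>))"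
          "(\<lambda>\<omega>. \<omega> s) \<in> borel_measurable (nat_filtration (s + real a * \<delta>))"
          using \<delta> by (auto intro!: nat_filtration_eval)
        show ?thesis unfolding D_def by measurable
      qed
      have et: "euler_type K s \<delta> l e (\<lambda>a \<omega>. \<sigma> (P a \<omega>) - \<sigma> (Y \<omega>)) (\<lambda>a \<omega>. norm (D a \<omega>))"
      proof (rule euler_typeI[OF K0 \<delta>(1), where c = "\<lambda>a \<omega>. b (P a \<omega>) - b (Y \<omega>)"])
        fix a
        note [measurable] = Pm[of a] Ym[of a] Dm[of a]
        show "e a \<in> borel_measurable (nat_filtration (s + real a * \<delta>))" unfolding e_def by measurable
        show "(\<lambda>\<omega>. \<sigma> (P a \<omega>) - \<sigma> (Y \<omega>)) \<in> borel_measurable (nat_filtration (s + real a * \<delta>))" by measurable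
        show "(\<lambda>\<omega>. norm (D a \<omega>)) \<in> borel_measurable (nat_filtration (s + real a * \<delta>))" by measurable
        fix \<omega> :: "real \<Rightarrow> real^'d"
        have "norm (P a \<omega> - Y \<omega>) \<le> norm (e a \<omega>) + norm (D a \<omega>)"
          using norm_triangle_ineq[of "e a \<omega>" "D a \<omega>"] by (simp add: e_def)
        then have le: "K * norm (P a \<omega> - Y \<omega>) \<le> K * (norm (e a \<omega>) + norm (e 0 \<omega>) + norm (D a \<omega>))"
          using K0 by (intro mult_left_mono) (auto intro: order_trans)
        show "norm (\<sigma> (P a \<omega>) - \<sigma> (Y \<omega>)) \<le> K * (norm (e a \<omega>) + norm (e 0 \<omega>) + norm (D a \<omega>))"
          by (rule order_trans[OF \<sigma>_lip le])
        show "norm (b (P a \<omega>) - b (Y \<omega>)) \<le> K * (norm (e a \<omega>) + norm (e 0 \<omega>) + norm (D a \<omega>))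
            * (1 + norm (\<omega> (s + real (Suc a) * \<delta>) - \<omega> (s + real a * \<delta>)) / sqrt \<delta>)"
          by (rule le_mult_one_plus[OF order_trans[OF b_lip le]]) (use \<delta> K0 in auto)
        have P: "P (Suc a) \<omega> = P a \<omega> + \<sigma> (P a \<omega>) *v (\<omega> (s + real (Suc a) * \<delta>) - \<omega> (s + real a * \<delta>)) + \<delta> *\<^sub>R b (P a \<omega>)"
          unfolding P_def times by simp
        show "e (Suc a) \<omega> = e a \<omega> + (\<sigma> (P a \<omega>) - \<sigma> (Y \<omega>)) *v (\<omega> (s + real (Suc a) * \<delta>) - \<omega> (s + real a * \<delta>))
            + \<delta> *\<^sub>R (b (P a \<omega>) - b (Y \<omega>))"
          unfolding e_def P D_def by (simp add: algebra_simps)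
      qed auto
      have g: "\<forall>a<l. moment (2 * q) (D a) \<le> \<gamma>"
      proof (intro allI impI)
        fix a assume a: "a < l"
        show "moment (2 * q) (D a) \<le> \<gamma>"
        proof (cases "a = 0")
          case True
          then show ?thesis using q by (simp add: D_def power_0_left)
        next
          case False
          have al: "real a * \<delta> \<le> h" using a \<delta> unfolding l\<delta>[symmetric] by (intro mult_right_mono) auto
          have "moment (2 * q) (D a)
              \<le> ennreal (C2 * (s + real a * \<delta> - s) ^ q) * (1 + moment (2 * (2 * q)) Y)"
            using disp[OF s, of "s + real a * \<delta>" Y] False \<delta> al h measurable_from_filtration[OF Ys] by (simp add: D_def)
          also have "\<dots> \<le> ennreal (C2 * h ^ q) * (1 + ennreal C1)"
            using al \<delta> h C2 kh unfolding Y_def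
            by (intro mult_mono add_left_mono ennreal_leI mult_left_mono power_mono mom) (auto simp: algebra_simps)
          also have "\<dots> = \<gamma>" using C1 C2 h by (simp add: \<gamma>_def C3_def ennreal_mult ennreal_plus mult_ac)
          finally show ?thesis .
        qed
      qed
      have "moment (2 * q) (e l) + \<gamma>
        \<le> ennreal (exp (C * (real l * \<delta>))) * (moment (2 * q) (e 0) + \<gamma>)"
        by (rule it[OF s \<delta> et g order_refl])
      moreover have "e 0 \<omega> = euler b \<sigma> \<delta> \<omega> 0 x0 (k * l) - eul h \<omega> k" for \<omega>
        by (simp add: e_def P_def D_def Y_def)
      moreover have "e l \<omega> = euler b \<sigma> \<delta> \<omega> 0 x0 (Suc k * l) - eul h \<omega> (Suc k)" for \<omega>
        proof -
        have Dl: "D l \<omega> = \<sigma> (Y \<omega>) *v (\<omega> (real (Suc k) * h) - \<omega> (real k * h)) + h *\<^sub>R b (Y \<omega>)"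
          unfolding D_def sh l\<delta> s_def by (rule refl)
        show ?thesis
          unfolding e_def Dl P_def Y_def mult_Suc add.commute[of l]
          by (simp only: euler.simps add_0 add.assoc)
      qed
      ultimately show ?thesis by (simp add: E_def l\<delta> del: euler.simps)
    qed
    have "E k + \<gamma> \<le> ennreal (exp (C * (real k * h))) * \<gamma>"
      using kh
    proof (induction k)
      case 0
      then show ?case using q by (simp add: E_def power_0_left)
    next
      case (Suc k)
      then have k: "real k * h \<le> T" using h by (simp add: algebra_simps)
      have "E (Suc k) + \<gamma> \<le> ennreal (exp (C * h)) * (E k + \<gamma>)" by (rule block) (use Suc in simp)
      also have "\<dots> \<le> ennreal (exp (C * h)) * (ennreal (exp (C * (real k * h))) * \<gamma>)"
        by (intro mult_left_mono Suc.IH k) auto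
      also have "\<dots> = ennreal (exp (C * (real (Suc k) * h))) * \<gamma>"
      proof -
        have "exp (C * h) * exp (C * (real k * h)) = exp (C * (real (Suc k) * h))"
          by (simp add: exp_add[symmetric] algebra_simps)
        then show ?thesis by (simp only: mult.assoc[symmetric] ennreal_mult[symmetric] exp_ge_zero)
      qed
      finally show ?case .
    qed
    also have "\<dots> \<le> ennreal (exp (C * T)) * \<gamma>"
      using C kh by (intro mult_right_mono ennreal_leI) (auto intro!: mult_left_mono)
    also have "\<dots> = ennreal (exp (C * T) * C3 * h ^ q)"
      using C3 h by (simp add: \<gamma>_def ennreal_mult[symmetric] mult.assoc)
    finally show "moment (2 * q) (\<lambda>\<omega>. eul (h / real l) \<omega> (k * l) - eul h \<omega> k)
       \<le> ennreal (exp (C * T) * C3 * h ^ q)"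
      unfolding E_def \<delta>_def by (rule order_trans[rotated]) simp
  qed
qed

end

section \<open>Identifying the solution with the limit of Euler schemes\<close>

lemma uniform_riemann_sum_tendsto:
  fixes f :: "real \<Rightarrow> 'a::banach"
  assumes cont: "continuous_on {0..t} f" and t: "0 \<le> t"
  shows "(\<lambda>n. \<Sum>k<n. (t / real n) *\<^sub>R f (real k * t / real n)) \<longlonglongrightarrow> integral {0..t} f"
proof (rule LIMSEQ_I)
  fix r :: real assume r: "0 < r"
  define e where "e = r / (2 * (t + 1))"
  have e: "0 < e" using r t by (simp add: e_def)
  have "uniformly_continuous_on {0..t} f"
    using cont by (intro compact_uniformly_continuous) auto
  then obtain d where d: "0 < d" "\<And>x y. x \<in> {0..t} \<Longrightarrow> y \<in> {0..t} \<Longrightarrow> dist y x < d \<Longrightarrow> dist (f y) (f x) < e"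
    unfolding uniformly_continuous_on_def using e by metis
  obtain N :: nat where N: "t / d < real N" using reals_Archimedean2 by blast
  show "\<exists>no. \<forall>n\<ge>no. norm ((\<Sum>k<n. (t / real n) *\<^sub>R f (real k * t / real n)) - integral {0..t} f) < r"
  proof (intro exI[of _ "Suc N"] allI impI)
    fix n assume n: "Suc N \<le> n"
    define h where "h = t / real n"
    have n0: "0 < real n" using n by simp
    have h: "0 \<le> h" "h < d" "real n * h = t"
    proof -
      show "0 \<le> h" "real n * h = t" using t n0 by (auto simp: h_def)
      have "t / d < real n" using N n by linarith
      then show "h < d" using d(1) n0 by (simp add: h_def field_simps)
    qed
    have sub: "real k * h \<le> t" if "k \<le> n" for k
      using that h unfolding h(3)[symmetric] by (intro mult_right_mono) auto
    have cf: "continuous_on {x..y} f" if "0 \<le> x" "y \<le> t" for x y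
      using that by (intro continuous_on_subset[OF cont]) auto
    have piece: "norm (h *\<^sub>R f (real k * h) - integral {real k * h..real (Suc k) * h} f) \<le> e * h" if k: "k < n" for k
    proof -
      have b: "0 \<le> real k * h" "real (Suc k) * h \<le> t" "real k * h \<le> real (Suc k) * h" "real (Suc k) * h - real k * h = h"
        using sub[of "Suc k"] k h by (auto simp: algebra_simps)
      have int: "f integrable_on {real k * h..real (Suc k) * h}"
        using cf[OF b(1,2)] by (rule integrable_continuous_real)
      have "integral {real k * h..real (Suc k) * h} (\<lambda>x. f x - f (real k * h))
          = integral {real k * h..real (Suc k) * h} f - h *\<^sub>R f (real k * h)"
        using int b(3,4) by (subst Henstock_Kurzweil_Integration.integral_diff) auto
      moreover have "norm (integral {real k * h..real (Suc k) * h} (\<lambda>x. f x - f (real k * h))) \<le> e * (real (Suc k) * h - real k * h)"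
      proof (rule integral_bound[OF b(3)])
        show "continuous_on {real k * h..real (Suc k) * h} (\<lambda>x. f x - f (real k * h))"
          using cf[OF b(1,2)] by (intro continuous_intros)
        fix x assume x: "x \<in> {real k * h..real (Suc k) * h}"
        then have "dist x (real k * h) < d" using b(4) h(2) by (auto simp: dist_real_def)
        moreover have "0 \<le> x" "x \<le> t"
          using x b(1,2) by (auto intro: order_trans simp del: of_nat_Suc)
        ultimately have "dist (f x) (f (real k * h)) < e"
          using b(1,2,3) by (intro d(2)) (auto intro: order_trans simp del: of_nat_Suc)
        then show "norm (f x - f (real k * h)) \<le> e" by (simp add: dist_norm)
      qed
      ultimately show ?thesis using b(4) by (simp add: norm_minus_commute)
    qed
    have comb: "integral {0..real j * h} f = (\<Sum>k<j. integral {real k * h..real (Suc k) * h} f)" if "j \<le> n" for j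
      using that
    proof (induction j)
      case (Suc j)
      have "integral {0..real j * h} f + integral {real j * h..real (Suc j) * h} f = integral {0..real (Suc j) * h} f"
        using sub[of "Suc j"] Suc.prems h
        by (intro Henstock_Kurzweil_Integration.integral_combine integrable_continuous_real cf) (auto simp: algebra_simps)
      then show ?case using Suc by simp
    qed simp
    have "norm ((\<Sum>k<n. (t / real n) *\<^sub>R f (real k * t / real n)) - integral {0..t} f)
        = norm (\<Sum>k<n. h *\<^sub>R f (real k * h) - integral {real k * h..real (Suc k) * h} f)"
      using comb[of n] h(3) by (simp add: sum_subtractf h_def)
    also have "\<dots> \<le> (\<Sum>k<n. e * h)" using piece by (intro sum_norm_le) auto
    also have "\<dots> = e * t" using h(3) by (simp add: mult.left_commute)
    also have "\<dots> < r" 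
    proof -
      have "e * t \<le> e * (t + 1)" using e by (intro mult_left_mono) auto
      also have "\<dots> = r / 2" using t by (simp add: e_def field_simps)
      finally show ?thesis using r by linarith
    qed
    finally show "norm ((\<Sum>k<n. (t / real n) *\<^sub>R f (real k * t / real n)) - integral {0..t} f) < r" .
  qed
qed

text \<open>Fatou's lemma, in the form that carries moment bounds of approximations over to almost
  everywhere limits.\<close>

lemma nn_integral_le_of_AE_tendsto:
  fixes u :: "nat \<Rightarrow> 'a \<Rightarrow> ennreal"
  assumes [measurable]: "\<And>n. u n \<in> borel_measurable M"
    and lim: "AE x in M. (\<lambda>n. u n x) \<longlonglongrightarrow> v x"
    and le: "\<And>n. (\<integral>\<^sup>+ x. u n x \<partial>M) \<le> c"
  shows "(\<integral>\<^sup>+ x. v x \<partial>M) \<le> c"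
proof -
  have "(\<integral>\<^sup>+ x. v x \<partial>M) = (\<integral>\<^sup>+ x. liminf (\<lambda>n. u n x) \<partial>M)"
    using lim by (intro nn_integral_cong_AE) (auto elim!: eventually_mono simp: lim_imp_Liminf)
  also have "\<dots> \<le> liminf (\<lambda>n. \<integral>\<^sup>+ x. u n x \<partial>M)" by (rule nn_integral_liminf) simp
  also have "\<dots> \<le> c"
    using Liminf_mono[of "\<lambda>n. \<integral>\<^sup>+ x. u n x \<partial>M" "\<lambda>_. c" sequentially] le by (simp add: Liminf_const)
  finally show ?thesis .
qed

lemma conv_in_prob_subseq:
  assumes "conv_in_prob M S Y" "filterlim r at_top sequentially"
  shows "conv_in_prob M (\<lambda>n. S (r n)) Y"
  using assms unfolding conv_in_prob_def by (auto intro: filterlim_compose)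

context wiener_space
begin

text \<open>The distances truncated at 1 converge to 0 in mean, and so does their sum over the
  finite index set. A subsequence along which this sum converges almost surely serves all indices at
  once, as required for the block ends of a partition.\<close>

lemma conv_in_prob_AE_subseq:
  fixes S :: "'i \<Rightarrow> nat \<Rightarrow> (real \<Rightarrow> real^'d) \<Rightarrow> real^'m"
  assumes fin: "finite I"
    and conv: "\<And>i. i \<in> I \<Longrightarrow> conv_in_prob M (S i) (Y i)"
    and [measurable]: "\<And>i n. i \<in> I \<Longrightarrow> S i n \<in> borel_measurable M" "\<And>i. i \<in> I \<Longrightarrow> Y i \<in> borel_measurable M"
  shows "\<exists>r :: nat \<Rightarrow> nat. strict_mono r \<and> (AE \<omega> in M. \<forall>i\<in>I. (\<lambda>n. S i (r n) \<omega>) \<longlonglongrightarrow> Y i \<omega>)"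
proof -
  define m where "m i n \<omega> = min 1 (norm (S i n \<omega> - Y i \<omega>))" for i n \<omega>
  have mm [measurable]: "m i n \<in> borel_measurable M" if "i \<in> I" for i n
    using that unfolding m_def by measurable
  have mi: "integrable M (m i n)" if "i \<in> I" for i n
    by (rule integrable_const_bound[of _ 1]) (use that mm in \<open>auto simp: m_def\<close>)
  have m0: "0 \<le> m i n \<omega>" for i n \<omega> by (simp add: m_def)
  have lim: "(\<lambda>n. \<integral>\<omega>. m i n \<omega> \<partial>M) \<longlonglongrightarrow> 0" if i: "i \<in> I" for i
  proof (rule LIMSEQ_I)
    fix r :: real assume r: "0 < r"
    define e where "e = r / 2"
    have e: "0 < e" using r by (simp add: e_def)
    let ?A = "\<lambda>n. {\<omega> \<in> space M. e < norm (S i n \<omega> - Y i \<omega>)}"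
    have A: "?A n \<in> sets M" for n using i by measurable
    have "(\<lambda>n. measure M (?A n)) \<longlonglongrightarrow> 0"
      using conv[OF i] e unfolding conv_in_prob_def by blast
    then obtain no where no: "\<And>n. n \<ge> no \<Longrightarrow> norm (measure M (?A n) - 0) < e"
      using e LIMSEQ_D by blast
    show "\<exists>no. \<forall>n\<ge>no. norm ((\<integral>\<omega>. m i n \<omega> \<partial>M) - 0) < r"
    proof (intro exI[of _ no] allI impI)
      fix n assume n: "no \<le> n"
      have ind: "integrable M (indicat_real (?A n))"
        using A[of n] by (intro integrable_real_indicator) (auto simp: emeasure_eq_measure)
      have "(\<integral>\<omega>. m i n \<omega> \<partial>M) \<le> (\<integral>\<omega>. e + indicator (?A n) \<omega> \<partial>M)"
      proof (rule integral_mono[OF mi[OF i]])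
        show "integrable M (\<lambda>\<omega>. e + indicator (?A n) \<omega>)"
          by (intro Bochner_Integration.integrable_add integrable_const ind)
        show "m i n \<omega> \<le> e + indicator (?A n) \<omega>" if "\<omega> \<in> space M" for \<omega>
          using that e by (auto simp: m_def indicator_def)
      qed
      also have "\<dots> = (\<integral>\<omega>. e \<partial>M) + (\<integral>\<omega>. indicator (?A n) \<omega> \<partial>M)"
        by (intro Bochner_Integration.integral_add integrable_const ind)
      also have "\<dots> = e + measure M (?A n)"
        using A[of n] by (simp add: prob_space[unfolded space_M] Int_absorb2)
      also have "\<dots> < r" using no[OF n] by (simp add: e_def)
      finally show "norm ((\<integral>\<omega>. m i n \<omega> \<partial>M) - 0) < r" using m0 by simp
    qed
  qed
  have "(\<lambda>n. \<Sum>i\<in>I. \<integral>\<omega>. m i n \<omega> \<partial>M) \<longlonglongrightarrow> (\<Sum>i\<in>I. 0)"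
    by (intro tendsto_sum lim)
  then have "(\<lambda>n. \<integral>\<omega>. norm (\<Sum>i\<in>I. m i n \<omega>) \<partial>M) \<longlonglongrightarrow> 0"
    using mi m0 by (simp add: sum_nonneg)
  then obtain r :: "nat \<Rightarrow> nat" where r: "strict_mono r" and r_AE: "AE \<omega> in M. (\<lambda>n. \<Sum>i\<in>I. m i (r n) \<omega>) \<longlonglongrightarrow> 0"
    using tendsto_L1_AE_subseq[of M "\<lambda>n \<omega>. \<Sum>i\<in>I. m i n \<omega>"] mi by auto
  from r_AE have "AE \<omega> in M. \<forall>i\<in>I. (\<lambda>n. S i (r n) \<omega>) \<longlonglongrightarrow> Y i \<omega>"
  proof (rule eventually_mono, intro ballI)
    fix \<omega> i assume l: "(\<lambda>n. \<Sum>i\<in>I. m i (r n) \<omega>) \<longlonglongrightarrow> 0" and i: "i \<in> I"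
    have "(\<lambda>n. m i (r n) \<omega>) \<longlonglongrightarrow> 0"
    proof (rule tendsto_sandwich[OF _ _ tendsto_const l])
      show "\<forall>\<^sub>F n in sequentially. m i (r n) \<omega> \<le> (\<Sum>i\<in>I. m i (r n) \<omega>)"
        using member_le_sum[OF i, of "\<lambda>i. m i _ \<omega>"] fin m0 by (intro always_eventually) auto
    qed (use m0 in auto)
    have "(\<lambda>n. norm (S i (r n) \<omega> - Y i \<omega>)) \<longlonglongrightarrow> 0"
    proof (rule Lim_transform_eventually[OF \<open>(\<lambda>n. m i (r n) \<omega>) \<longlonglongrightarrow> 0\<close>])
      have "\<forall>\<^sub>F n in sequentially. m i (r n) \<omega> < 1"
        using \<open>(\<lambda>n. m i (r n) \<omega>) \<longlonglongrightarrow> 0\<close> by (rule order_tendstoD) simp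
      then show "\<forall>\<^sub>F n in sequentially. m i (r n) \<omega> = norm (S i (r n) \<omega> - Y i \<omega>)"
        by eventually_elim (simp add: m_def min_def split: if_splits)
    qed
    then show "(\<lambda>n. S i (r n) \<omega>) \<longlonglongrightarrow> Y i \<omega>"
      by (simp add: tendsto_norm_zero_iff LIM_zero_iff)
  qed
  then show ?thesis using r by blast
qed

end

text \<open>An Euler scheme whose step \<open>j\<close> receives the additional increment
  \<open>\<xi> j\<close>. The exact solution satisfies such a recursion in a limit, with
  \<open>\<xi> j\<close> the error made by freezing the coefficients over the step.\<close>

primrec noisy_euler ::
  "(real^'m \<Rightarrow> real^'m) \<Rightarrow> (real^'m \<Rightarrow> real^'d^'m) \<Rightarrow> real \<Rightarrow> (real \<Rightarrow> real^'d) \<Rightarrow> (nat \<Rightarrow> real^'m) \<Rightarrow> real^'m \<Rightarrow> nat \<Rightarrow> real^'m" where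
  "noisy_euler b \<sigma> h \<omega> \<xi> x 0 = x"
| "noisy_euler b \<sigma> h \<omega> \<xi> x (Suc j) = noisy_euler b \<sigma> h \<omega> \<xi> x j
     + \<sigma> (noisy_euler b \<sigma> h \<omega> \<xi> x j) *v (\<omega> (real (Suc j) * h) - \<omega> (real j * h))
     + h *\<^sub>R b (noisy_euler b \<sigma> h \<omega> \<xi> x j) + \<xi> j"

context lipschitz_sde
begin

text \<open>The noise of a coarse step is a sum of \<open>N\<close> adapted increments. Adding them
  one at a time interpolates between the differences at the two ends of the block, and the resulting
  process is of Euler type: its martingale coefficient is a frozen difference, controlled by
  \<open>e 0\<close>, plus \<open>G\<close>, bounded by \<open>\<epsilon>\<close>. The final bound
  is independent of \<open>N\<close>, so \<open>N\<close> may tend to infinity while the coarse step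
  is fixed.\<close>

lemma noisy_euler_close:
  assumes T: "T \<ge> 1"
  shows "\<exists>C\<ge>0. \<forall>h N l \<epsilon> G \<beta>. 0 < h \<longrightarrow> 1 \<le> N \<longrightarrow> real l * h \<le> T \<longrightarrow> 0 \<le> \<epsilon> \<longrightarrow>
     (\<forall>i a. G i a \<in> borel_measurable (nat_filtration (real i * h + real a * (h / real N)))) \<longrightarrow>
     (\<forall>i a. \<beta> i a \<in> borel_measurable (nat_filtration (real i * h + real a * (h / real N)))) \<longrightarrow>
     (\<forall>i a \<omega>. norm (G i a \<omega>) \<le> \<epsilon> \<and> norm (\<beta> i a \<omega>) \<le> \<epsilon>) \<longrightarrow>
     (\<lambda>\<omega>. noisy_euler b \<sigma> h \<omega> (\<lambda>i. \<Sum>a<N. G i a \<omega> *v (\<omega> (real i * h + real (Suc a) * (h / real N)) - \<omega> (real i * h + real a * (h / real N)))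
             + (h / real N) *\<^sub>R \<beta> i a \<omega>) x0 l) \<in> borel_measurable M \<and>
     (\<integral>\<^sup>+ \<omega>. ennreal (norm (noisy_euler b \<sigma> h \<omega> (\<lambda>i. \<Sum>a<N. G i a \<omega> *v (\<omega> (real i * h + real (Suc a) * (h / real N)) - \<omega> (real i * h + real a * (h / real N)))
             + (h / real N) *\<^sub>R \<beta> i a \<omega>) x0 l - eul h \<omega> l) ^ 2) \<partial>M)
       \<le> ennreal (C * \<epsilon>\<^sup>2)"
proof -
  have K0: "0 \<le> K" using K1 by simp
  obtain C where C: "C \<ge> 0" and it: "\<And>s \<delta> N (e :: nat \<Rightarrow> _ \<Rightarrow> real^'m) A g \<gamma> a. 0 \<le> s \<Longrightarrow> 0 < \<delta> \<Longrightarrow> \<delta> \<le> T \<Longrightarrow>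
     euler_type K s \<delta> N e A g \<Longrightarrow> (\<forall>a<N. (\<integral>\<^sup>+ \<omega>. ennreal (g a \<omega> ^ (2 * 1)) \<partial>M) \<le> \<gamma>) \<Longrightarrow> a \<le> N \<Longrightarrow>
     moment (2 * 1) (e a) + \<gamma>
        \<le> ennreal (exp (C * (real a * \<delta>))) * (moment (2 * 1) (e 0) + \<gamma>)"
    using moment_iterate[OF order_refl T K0, where 'm = 'm] by blast
  show ?thesis
  proof (intro exI[of _ "exp (C * T)"] conjI allI impI)
    show "0 \<le> exp (C * T)" by simp
    fix h :: real and N l :: nat and \<epsilon> and G :: "nat \<Rightarrow> nat \<Rightarrow> (real \<Rightarrow> real^'d) \<Rightarrow> real^'d^'m"
      and \<beta> :: "nat \<Rightarrow> nat \<Rightarrow> (real \<Rightarrow> real^'d) \<Rightarrow> real^'m"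
    assume h: "0 < h" and N: "1 \<le> N" and lh: "real l * h \<le> T" and \<epsilon>: "0 \<le> \<epsilon>"
      and Gm: "\<forall>i a. G i a \<in> borel_measurable (nat_filtration (real i * h + real a * (h / real N)))"
      and \<beta>m: "\<forall>i a. \<beta> i a \<in> borel_measurable (nat_filtration (real i * h + real a * (h / real N)))"
      and bd: "\<forall>i a \<omega>. norm (G i a \<omega>) \<le> \<epsilon> \<and> norm (\<beta> i a \<omega>) \<le> \<epsilon>"
    define \<delta> where "\<delta> = h / real N"
    have \<delta>: "0 < \<delta>" "real N * \<delta> = h" using h N by (auto simp: \<delta>_def)
    have \<delta>h: "\<delta> \<le> h" using h N by (simp add: \<delta>_def divide_le_eq mult_left_le)
    define \<xi> where "\<xi> i a \<omega> = (\<Sum>c<a. G i c \<omega> *v (\<omega> (real i * h + real (Suc c) * \<delta>) - \<omega> (real i * h + real c * \<delta>)) + \<delta> *\<^sub>R \<beta> i c \<omega>)"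
      for i a :: nat and \<omega>
    define Z where "Z i \<omega> = noisy_euler b \<sigma> h \<omega> (\<lambda>i. \<xi> i N \<omega>) x0 i" for i \<omega>
    define Y where "Y i \<omega> = eul h \<omega> i" for i \<omega>
    define E where "E i = moment 2 (\<lambda>\<omega>. Z i \<omega> - Y i \<omega>)" for i
    define \<gamma> where "\<gamma> = ennreal (\<epsilon>\<^sup>2)"
    have Ym: "Y i \<in> borel_measurable (nat_filtration (real i * h))" for i
      unfolding Y_def using euler_measurable[of h 0 x0 i] h by simp
    have \<xi>m: "\<xi> i a \<in> borel_measurable (nat_filtration (real i * h + real a * \<delta>))" for i a
      unfolding \<xi>_def
    proof (intro borel_measurable_sum)
      fix c assume c: "c \<in> {..<a}"
      have t: "real i * h + real c * \<delta> \<le> real i * h + real a * \<delta>" "real i * h + real (Suc c) * \<delta> \<le> real i * h + real a * \<delta>"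
        using c \<delta> by (auto intro!: mult_right_mono)
      have [measurable]: "G i c \<in> borel_measurable (nat_filtration (real i * h + real a * \<delta>))"
        "\<beta> i c \<in> borel_measurable (nat_filtration (real i * h + real a * \<delta>))"
        using measurable_nat_filtration_mono[OF _ t(1)] Gm \<beta>m unfolding \<delta>_def by blast+
      note [measurable] = nat_filtration_eval[OF t(1)] nat_filtration_eval[OF t(2)]
      show "(\<lambda>\<omega>. G i c \<omega> *v (\<omega> (real i * h + real (Suc c) * \<delta>) - \<omega> (real i * h + real c * \<delta>)) + \<delta> *\<^sub>R \<beta> i c \<omega>)
         \<in> borel_measurable (nat_filtration (real i * h + real a * \<delta>))"
        by measurable
    qed
    have sh: "real i * h + real N * \<delta> = real (Suc i) * h" for i by (simp only: \<delta>(2)) (simp add: algebra_simps)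
    have Zm: "Z i \<in> borel_measurable (nat_filtration (real i * h))" for i
    proof (induction i)
      case (Suc i)
      have t: "real i * h \<le> real (Suc i) * h" using h by (intro mult_right_mono) auto
      note [measurable] = measurable_nat_filtration_mono[OF Suc t] \<xi>m[of i N, unfolded sh]
        nat_filtration_eval[OF t] nat_filtration_eval[OF order_refl[of "real (Suc i) * h"]]
      have *: "Z (Suc i) = (\<lambda>\<omega>. Z i \<omega> + \<sigma> (Z i \<omega>) *v (\<omega> (real (Suc i) * h) - \<omega> (real i * h)) + h *\<^sub>R b (Z i \<omega>) + \<xi> i N \<omega>)"
        by (simp add: Z_def fun_eq_iff)
      show ?case unfolding * by measurable
    qed (simp add: Z_def)
    have block: "E (Suc i) + \<gamma> \<le> ennreal (exp (C * h)) * (E i + \<gamma>)" if hT: "h \<le> T" for i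
    proof -
      define s where "s = real i * h"
      have s: "0 \<le> s" using h by (simp add: s_def)
      define D where "D a \<omega> = (\<sigma> (Z i \<omega>) - \<sigma> (Y i \<omega>)) *v (\<omega> (s + real a * \<delta>) - \<omega> s) + (real a * \<delta>) *\<^sub>R (b (Z i \<omega>) - b (Y i \<omega>))"
        for a and \<omega> :: "real \<Rightarrow> real^'d"
      define e where "e a \<omega> = Z i \<omega> - Y i \<omega> + D a \<omega> + \<xi> i a \<omega>" for a \<omega>
      have e0: "e 0 \<omega> = Z i \<omega> - Y i \<omega>" for \<omega> by (simp add: e_def D_def \<xi>_def)
      have et: "euler_type K s \<delta> N e (\<lambda>a \<omega>. \<sigma> (Z i \<omega>) - \<sigma> (Y i \<omega>) + G i a \<omega>) (\<lambda>_ _. \<epsilon>)"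
      proof (rule euler_typeI[OF K0 \<delta>(1), where c = "\<lambda>a \<omega>. b (Z i \<omega>) - b (Y i \<omega>) + \<beta> i a \<omega>"])
        fix a
        have t: "real i * h \<le> s + real a * \<delta>" "s \<le> s + real a * \<delta>" using \<delta> by (auto simp: s_def)
        note [measurable] = measurable_nat_filtration_mono[OF Ym t(1)] measurable_nat_filtration_mono[OF Zm t(1)]
          \<xi>m[of i a, folded s_def] nat_filtration_eval[OF t(2)] nat_filtration_eval[OF order_refl[of "s + real a * \<delta>"]]
          Gm[rule_format, of i a, folded \<delta>_def s_def]
        show "e a \<in> borel_measurable (nat_filtration (s + real a * \<delta>))" unfolding e_def D_def by measurable
        show "(\<lambda>\<omega>. \<sigma> (Z i \<omega>) - \<sigma> (Y i \<omega>) + G i a \<omega>) \<in> borel_measurable (nat_filtration (s + real a * \<delta>))" by measurable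
        fix \<omega> :: "real \<Rightarrow> real^'d"
        have "\<epsilon> \<le> K * \<epsilon>" using K1 \<epsilon> by (simp add: mult_le_cancel_right1)
        then have le: "K * norm (Z i \<omega> - Y i \<omega>) + \<epsilon> \<le> K * (norm (e a \<omega>) + norm (e 0 \<omega>) + \<epsilon>)"
          unfolding e0 distrib_left using K0 by (simp add: add_increasing)
        show "norm (\<sigma> (Z i \<omega>) - \<sigma> (Y i \<omega>) + G i a \<omega>) \<le> K * (norm (e a \<omega>) + norm (e 0 \<omega>) + \<epsilon>)"
          by (rule order_trans[OF norm_triangle_ineq order_trans[OF add_mono[OF \<sigma>_lip] le]]) (use bd in auto)
        have "norm (b (Z i \<omega>) - b (Y i \<omega>) + \<beta> i a \<omega>) \<le> K * (norm (e a \<omega>) + norm (e 0 \<omega>) + \<epsilon>)"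
          by (rule order_trans[OF norm_triangle_ineq order_trans[OF add_mono[OF b_lip] le]]) (use bd in auto)
        then show "norm (b (Z i \<omega>) - b (Y i \<omega>) + \<beta> i a \<omega>) \<le> K * (norm (e a \<omega>) + norm (e 0 \<omega>) + \<epsilon>)
            * (1 + norm (\<omega> (s + real (Suc a) * \<delta>) - \<omega> (s + real a * \<delta>)) / sqrt \<delta>)"
          by (rule le_mult_one_plus) (use \<delta> K0 \<epsilon> in auto)
        show "e (Suc a) \<omega> = e a \<omega> + (\<sigma> (Z i \<omega>) - \<sigma> (Y i \<omega>) + G i a \<omega>) *v (\<omega> (s + real (Suc a) * \<delta>) - \<omega> (s + real a * \<delta>))
            + \<delta> *\<^sub>R (b (Z i \<omega>) - b (Y i \<omega>) + \<beta> i a \<omega>)"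
          unfolding e_def D_def \<xi>_def s_def[symmetric] by (simp add: algebra_simps)
      qed (use \<epsilon> in auto)
      have "moment (2 * 1) (e N) + \<gamma>
        \<le> ennreal (exp (C * (real N * \<delta>))) * (moment (2 * 1) (e 0) + \<gamma>)"
        by (rule it[OF s \<delta>(1) _ et _ order_refl]) (use \<delta>h hT in \<open>auto simp: emeasure_space_1[unfolded space_M] \<gamma>_def\<close>)
      moreover have "e N \<omega> = Z (Suc i) \<omega> - Y (Suc i) \<omega>" for \<omega>
      proof -
        have DN: "D N \<omega> = (\<sigma> (Z i \<omega>) - \<sigma> (Y i \<omega>)) *v (\<omega> (real (Suc i) * h) - \<omega> (real i * h)) + h *\<^sub>R (b (Z i \<omega>) - b (Y i \<omega>))"
          unfolding D_def sh[symmetric] \<delta>(2) s_def by (rule refl)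
        show ?thesis
          unfolding e_def DN Z_def Y_def by (simp add: algebra_simps)
      qed
      ultimately show ?thesis by (simp add: E_def \<delta>(2) e0)
    qed
    have "E l + \<gamma> \<le> ennreal (exp (C * (real l * h))) * \<gamma>"
      using lh
    proof (induction l)
      case 0
      then show ?case by (simp add: E_def Z_def Y_def)
    next
      case (Suc l)
      have "0 \<le> real l * h" "real (Suc l) * h = real l * h + h" using h by (simp_all add: distrib_right)
      then have l: "real l * h \<le> T" "h \<le> T" using Suc.prems h by linarith+
      have "E (Suc l) + \<gamma> \<le> ennreal (exp (C * h)) * (E l + \<gamma>)" by (rule block[OF l(2)])
      also have "\<dots> \<le> ennreal (exp (C * h)) * (ennreal (exp (C * (real l * h))) * \<gamma>)"
        by (intro mult_left_mono Suc.IH l) auto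
      also have "\<dots> = ennreal (exp (C * (real (Suc l) * h))) * \<gamma>"
      proof -
        have "exp (C * h) * exp (C * (real l * h)) = exp (C * (real (Suc l) * h))"
          by (simp add: exp_add[symmetric] algebra_simps)
        then show ?thesis by (simp only: mult.assoc[symmetric] ennreal_mult[symmetric] exp_ge_zero)
      qed
      finally show ?case .
    qed
    also have "\<dots> \<le> ennreal (exp (C * T)) * \<gamma>"
      using C lh by (intro mult_right_mono ennreal_leI) (auto intro!: mult_left_mono)
    also have "\<dots> = ennreal (exp (C * T) * \<epsilon>\<^sup>2)"
      by (simp add: \<gamma>_def ennreal_mult[symmetric])
    finally have El: "E l \<le> ennreal (exp (C * T) * \<epsilon>\<^sup>2)"
      by (rule order_trans[rotated]) simp
    show "(\<integral>\<^sup>+ \<omega>. ennreal (norm (noisy_euler b \<sigma> h \<omega> (\<lambda>i. \<Sum>a<N. G i a \<omega> *v (\<omega> (real i * h + real (Suc a) * (h / real N)) - \<omega> (real i * h + real a * (h / real N)))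
             + (h / real N) *\<^sub>R \<beta> i a \<omega>) x0 l - eul h \<omega> l) ^ 2) \<partial>M)
       \<le> ennreal (exp (C * T) * \<epsilon>\<^sup>2)"
      using El unfolding E_def Z_def Y_def \<xi>_def \<delta>_def .
    show "(\<lambda>\<omega>. noisy_euler b \<sigma> h \<omega> (\<lambda>i. \<Sum>a<N. G i a \<omega> *v (\<omega> (real i * h + real (Suc a) * (h / real N)) - \<omega> (real i * h + real a * (h / real N)))
             + (h / real N) *\<^sub>R \<beta> i a \<omega>) x0 l) \<in> borel_measurable M"
      using measurable_from_filtration[OF Zm[of l]] unfolding Z_def \<xi>_def \<delta>_def .
  qed
qed

end

section \<open>Solutions as limits of Euler schemes with truncated noise\<close>

lemma sum_lessThan_add:
  fixes f :: "nat \<Rightarrow> 'a::comm_monoid_add"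
  shows "(\<Sum>k<m + n. f k) = (\<Sum>k<m. f k) + (\<Sum>a<n. f (m + a))"
  by (induction n) (auto simp: add.assoc)

lemma matrix_vector_telescope:
  fixes A :: "real^'d^'m" and f :: "nat \<Rightarrow> real^'d"
  shows "(\<Sum>a<N. A *v (f (Suc a) - f a)) = A *v (f N - f 0)"
  by (induction N) (auto simp: algebra_simps)

locale sde_strong_solution = lipschitz_sde M b \<sigma> K x0
  for M :: "(real \<Rightarrow> real^'d::finite) measure" and b :: "real^'m::finite \<Rightarrow> real^'m" and \<sigma> and K and x0 +
  fixes \<tau> :: real and X :: "real \<Rightarrow> (real \<Rightarrow> real^'d) \<Rightarrow> real^'m"
  assumes \<tau>_pos: "0 < \<tau>" and sol: "sde_solution M b \<sigma> x0 \<tau> X"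
begin

lemma X_measurable: "0 \<le> t \<Longrightarrow> t \<le> \<tau> \<Longrightarrow> X t \<in> borel_measurable M"
  using sol by (auto simp: sde_solution_def)

lemma X_continuous: "\<omega> \<in> wiener_paths \<Longrightarrow> continuous_on {0..\<tau>} (\<lambda>t. X t \<omega>)"
  using sol unfolding sde_solution_def space_M by blast

lemma X_adapted_version:
  "\<exists>Xv. \<forall>t\<in>{0..\<tau>}. Xv t \<in> borel_measurable (nat_filtration t) \<and> (AE \<omega> in M. X t \<omega> = Xv t \<omega>)"
  using sol unfolding sde_solution_def by (intro bchoice) blast

lemma X_ito: "0 \<le> t \<Longrightarrow> t \<le> \<tau> \<Longrightarrow> conv_in_prob M (ito_riemann_sum (\<lambda>s \<omega>. \<sigma> (X s \<omega>)) t)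
         (\<lambda>\<omega>. X t \<omega> - x0 - integral {0..t} (\<lambda>s. b (X s \<omega>)))"
  using sol unfolding sde_solution_def by auto

lemma drift_riemann_tendsto:
  assumes "\<omega> \<in> wiener_paths" "0 \<le> t" "t \<le> \<tau>"
  shows "(\<lambda>n. \<Sum>k<n. (t / real n) *\<^sub>R b (X (real k * t / real n) \<omega>)) \<longlonglongrightarrow> integral {0..t} (\<lambda>s. b (X s \<omega>))"
proof (rule uniform_riemann_sum_tendsto)
  show "continuous_on {0..t} (\<lambda>s. b (X s \<omega>))"
    using assms
    by (intro continuous_on_compose2[OF continuous_b[of UNIV]] continuous_on_subset[OF X_continuous]) auto
qed fact

lemma grid_time_bounds:
  assumes "0 \<le> t" "k \<le> n" shows "0 \<le> real k * t / real n" "real k * t / real n \<le> t"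
proof -
  show "0 \<le> real k * t / real n" using assms by simp
  show "real k * t / real n \<le> t"
    using assms by (cases "n = 0") (auto simp: divide_le_eq mult.commute intro: mult_left_mono)
qed

text \<open>The drift integral is taken path by path; it is measurable in \<open>\<omega>\<close> as
  a limit of Riemann sums.\<close>

lemma integrand_measurable:
  assumes "0 \<le> t" "t \<le> \<tau>" shows "(\<lambda>\<omega>. integral {0..t} (\<lambda>s. b (X s \<omega>))) \<in> borel_measurable M"
proof (rule borel_measurable_LIMSEQ_metric)
  fix n
  have [measurable]: "X (real k * t / real n) \<in> borel_measurable M" if "k < n" for k
    using grid_time_bounds[of t k n] assms that by (intro X_measurable) auto
  show "(\<lambda>\<omega>. \<Sum>k<n. (t / real n) *\<^sub>R b (X (real k * t / real n) \<omega>)) \<in> borel_measurable M"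
    by (intro borel_measurable_sum) measurable
next
  fix \<omega> assume "\<omega> \<in> space M"
  then show "(\<lambda>n. \<Sum>k<n. (t / real n) *\<^sub>R b (X (real k * t / real n) \<omega>)) \<longlonglongrightarrow> integral {0..t} (\<lambda>s. b (X s \<omega>))"
    using assms by (intro drift_riemann_tendsto) auto
qed

lemma ito_sum_measurable:
  assumes "0 \<le> t" "t \<le> \<tau>"
  shows "ito_riemann_sum (\<lambda>s \<omega>. \<sigma> (X s \<omega>)) t n \<in> borel_measurable M"
proof -
  have [measurable]: "X (real k * t / real n) \<in> borel_measurable M" if "k < n" for k
    using grid_time_bounds[of t k n] assms that by (intro X_measurable) auto
  show ?thesis
    unfolding ito_riemann_sum_def
    by (intro borel_measurable_sum borel_measurable_matrix_vector borel_measurable_diff eval_measurable) measurable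
qed

lemma martingale_part_measurable:
  assumes "0 \<le> t" "t \<le> \<tau>"
  shows "(\<lambda>\<omega>. X t \<omega> - x0 - integral {0..t} (\<lambda>s. b (X s \<omega>))) \<in> borel_measurable M"
  by (intro borel_measurable_diff X_measurable integrand_measurable assms borel_measurable_const)

text \<open>The initial condition is contained in the integral equation at time 0, where the
  left-point sums and the drift integral vanish.\<close>

lemma X_initial: "AE \<omega> in M. X 0 \<omega> = x0"
proof -
  have "\<exists>r :: nat \<Rightarrow> nat. strict_mono r \<and> (AE \<omega> in M. \<forall>i\<in>{()}. (\<lambda>n. ito_riemann_sum (\<lambda>s \<omega>. \<sigma> (X s \<omega>)) 0 (r n) \<omega>)
      \<longlonglongrightarrow> X 0 \<omega> - x0 - integral {0..0} (\<lambda>s. b (X s \<omega>)))"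
    using \<tau>_pos by (intro conv_in_prob_AE_subseq X_ito ito_sum_measurable martingale_part_measurable) auto
  then show ?thesis
    by (auto simp: ito_riemann_sum_def LIMSEQ_const_iff)
qed

text \<open>Along these paths a time shift by the fraction \<open>1 / l\<close> of \<open>t\<close>
  changes both coefficients by at most \<open>\<epsilon>\<close>; this is the purpose of the factor
  \<open>K\<close>. All partition points are rational fractions of \<open>t\<close>, and
  countability makes the event measurable and gives a single null set for the adapted
  versions.\<close>

definition good_paths :: "real \<Rightarrow> real \<Rightarrow> nat \<Rightarrow> (real \<Rightarrow> real^'d) set" where
  "good_paths t \<epsilon> l = {\<omega> \<in> space M. \<forall>p\<in>\<rat> \<inter> {0..1}. \<forall>p'\<in>\<rat> \<inter> {0..1}. \<bar>p - p'\<bar> \<le> 1 / real l \<longrightarrow>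
      K * norm (X (p * t) \<omega> - X (p' * t) \<omega>) \<le> \<epsilon>}"

lemma countable_rat_unit: "countable (\<rat> \<inter> {0..1::real})"
  by (rule countable_subset[OF _ countable_rat]) auto

lemma unit_fraction_time:
  assumes "0 \<le> t" "t \<le> \<tau>" "p \<in> \<rat> \<inter> {0..1}" shows "p * t \<in> {0..\<tau>}"
proof -
  have "0 \<le> p * t" "p * t \<le> t" using assms by (auto intro: mult_left_le_one_le)
  then show ?thesis using assms by auto
qed

lemma good_paths_sets:
  assumes "0 \<le> t" "t \<le> \<tau>" shows "good_paths t \<epsilon> l \<in> sets M"
  unfolding good_paths_def
proof (intro sets.sets_Collect_countable_All' countable_rat_unit)
  fix p p' :: real assume "p \<in> \<rat> \<inter> {0..1}" "p' \<in> \<rat> \<inter> {0..1}"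
  then have "X (p * t) \<in> borel_measurable M" "X (p' * t) \<in> borel_measurable M"
    using unit_fraction_time[OF assms] by (auto intro!: X_measurable)
  note [measurable] = this
  show "{\<omega> \<in> space M. \<bar>p - p'\<bar> \<le> 1 / real l \<longrightarrow> K * norm (X (p * t) \<omega> - X (p' * t) \<omega>) \<le> \<epsilon>} \<in> sets M"
    by measurable
qed

text \<open>Paths are uniformly continuous on \<open>{0..\<tau>}\<close>, so the events increase to
  the whole space. The shift to \<open>Suc l\<close> avoids the scale \<open>1 / 0\<close>, which
  equals 0 and would break monotonicity.\<close>

lemma prob_good_paths_tendsto:
  assumes t: "0 \<le> t" "t \<le> \<tau>" and \<epsilon>: "0 < \<epsilon>"
  shows "(\<lambda>l. prob (good_paths t \<epsilon> (Suc l))) \<longlonglongrightarrow> 1"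
proof -
  have "incseq (\<lambda>l. good_paths t \<epsilon> (Suc l))"
  proof (rule incseq_SucI, rule subsetI)
    fix l \<omega> assume g: "\<omega> \<in> good_paths t \<epsilon> (Suc l)"
    have le: "1 / real (Suc (Suc l)) \<le> 1 / real (Suc l)" by (simp add: frac_le)
    show "\<omega> \<in> good_paths t \<epsilon> (Suc (Suc l))"
      using g order_trans[OF _ le] unfolding good_paths_def mem_Collect_eq by blast
  qed
  then have "(\<lambda>l. prob (good_paths t \<epsilon> (Suc l))) \<longlonglongrightarrow> prob (\<Union>l. good_paths t \<epsilon> (Suc l))"
    using good_paths_sets[OF t] by (intro finite_Lim_measure_incseq) auto
  moreover have "(\<Union>l. good_paths t \<epsilon> (Suc l)) = space M"
  proof (intro equalityI subsetI)
    fix \<omega> assume w: "\<omega> \<in> space M"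
    have "uniformly_continuous_on {0..\<tau>} (\<lambda>t. X t \<omega>)"
      using X_continuous w by (intro compact_uniformly_continuous) auto
    moreover have "0 < \<epsilon> / K" using \<epsilon> K1 by simp
    ultimately obtain d where d: "0 < d" "\<And>x y. x \<in> {0..\<tau>} \<Longrightarrow> y \<in> {0..\<tau>} \<Longrightarrow> dist y x < d \<Longrightarrow> dist (X y \<omega>) (X x \<omega>) < \<epsilon> / K"
      unfolding uniformly_continuous_on_def by blast
    obtain l :: nat where l: "t / d < real l" using reals_Archimedean2 by blast
    have "\<omega> \<in> good_paths t \<epsilon> (Suc l)"
      unfolding good_paths_def
    proof (intro CollectI conjI w ballI impI)
      fix p p' :: real assume p: "p \<in> \<rat> \<inter> {0..1}" "p' \<in> \<rat> \<inter> {0..1}" and pp: "\<bar>p - p'\<bar> \<le> 1 / real (Suc l)"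
      have in_t: "p * t \<in> {0..\<tau>}" "p' * t \<in> {0..\<tau>}"
        using p t by (auto intro!: unit_fraction_time simp del: atLeastAtMost_iff)
      have "dist (p * t) (p' * t) = \<bar>p - p'\<bar> * t" using t by (simp add: dist_real_def left_diff_distrib[symmetric] abs_mult)
      also have "\<dots> \<le> 1 / real (Suc l) * t" using pp t by (intro mult_right_mono) auto
      also have "\<dots> < d" using l d(1) by (simp add: field_simps)
      finally have "dist (X (p * t) \<omega>) (X (p' * t) \<omega>) < \<epsilon> / K" by (rule d(2)[OF in_t(2,1)])
      then show "K * norm (X (p * t) \<omega> - X (p' * t) \<omega>) \<le> \<epsilon>"
        using K1 by (simp add: dist_norm field_simps)
    qed
    then show "\<omega> \<in> (\<Union>l. good_paths t \<epsilon> (Suc l))" by blast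
  qed (auto simp: good_paths_def)
  ultimately show ?thesis by (simp only: prob_space)
qed

text \<open>On \<open>good_paths\<close> the integrand oscillates by at most \<open>\<epsilon>\<close> within each block of length \<open>t / l\<close>, so \<open>X\<close> is a
  limit of Euler schemes perturbed by noise whose integrands are truncated at \<open>\<epsilon>\<close>; the truncation makes moment
  bounds for \<open>X\<close> itself unnecessary.\<close>

lemma euler_close_on_good_paths:
  assumes T: "T \<ge> 1"
  shows "\<exists>C\<ge>0. \<forall>t l \<epsilon>. 0 < t \<longrightarrow> t \<le> \<tau> \<longrightarrow> t \<le> T \<longrightarrow> 1 \<le> l \<longrightarrow> 0 \<le> \<epsilon> \<longrightarrow>
    (\<integral>\<^sup>+ \<omega>. indicator (good_paths t \<epsilon> l) \<omega> * ennreal (norm (X t \<omega> - eul (t / real l) \<omega> l) ^ 2) \<partial>M) \<le> ennreal (C * \<epsilon>\<^sup>2)"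
proof -
  obtain C where C: "C \<ge> 0" and close: "\<And>h N l \<epsilon> G \<beta>. 0 < h \<Longrightarrow> 1 \<le> N \<Longrightarrow> real l * h \<le> T \<Longrightarrow> 0 \<le> \<epsilon> \<Longrightarrow>
     (\<And>i a. G i a \<in> borel_measurable (nat_filtration (real i * h + real a * (h / real N)))) \<Longrightarrow>
     (\<And>i a. \<beta> i a \<in> borel_measurable (nat_filtration (real i * h + real a * (h / real N)))) \<Longrightarrow>
     (\<And>i a \<omega>. norm (G i a \<omega>) \<le> \<epsilon> \<and> norm (\<beta> i a \<omega>) \<le> \<epsilon>) \<Longrightarrow>
     (\<lambda>\<omega>. noisy_euler b \<sigma> h \<omega> (\<lambda>i. \<Sum>a<N. G i a \<omega> *v (\<omega> (real i * h + real (Suc a) * (h / real N)) - \<omega> (real i * h + real a * (h / real N)))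
             + (h / real N) *\<^sub>R \<beta> i a \<omega>) x0 l) \<in> borel_measurable M \<and>
     (\<integral>\<^sup>+ \<omega>. ennreal (norm (noisy_euler b \<sigma> h \<omega> (\<lambda>i. \<Sum>a<N. G i a \<omega> *v (\<omega> (real i * h + real (Suc a) * (h / real N)) - \<omega> (real i * h + real a * (h / real N)))
             + (h / real N) *\<^sub>R \<beta> i a \<omega>) x0 l - eul h \<omega> l) ^ 2) \<partial>M)
       \<le> ennreal (C * \<epsilon>\<^sup>2)"
    using noisy_euler_close[OF T] by blast
  obtain Xv where Xv: "\<And>t. t \<in> {0..\<tau>} \<Longrightarrow> Xv t \<in> borel_measurable (nat_filtration t)"
    "\<And>t. t \<in> {0..\<tau>} \<Longrightarrow> AE \<omega> in M. X t \<omega> = Xv t \<omega>"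
    using X_adapted_version by blast
  show ?thesis
  proof (intro exI[of _ C] conjI allI impI C)
    fix t \<epsilon> :: real and l :: nat
    assume t: "0 < t" "t \<le> \<tau>" "t \<le> T" and l: "1 \<le> l" and \<epsilon>: "0 \<le> \<epsilon>"
    define h where "h = t / real l"
    have h: "0 < h" "real l * h = t" using t l by (auto simp: h_def)
    have ih: "0 \<le> real i * h" "real i * h \<le> \<tau>" "real i * h \<le> t" if "i \<le> l" for i
    proof -
      have "real i * h \<le> real l * h" using h that by (intro mult_right_mono) auto
      then show "0 \<le> real i * h" "real i * h \<le> \<tau>" "real i * h \<le> t" using h t by auto
    qed
    define tm where "tm N i a = real i * h + real a * (h / real N)" for N i a :: nat
    have tm_in: "tm N i a \<in> {0..\<tau>}" "\<exists>p\<in>\<rat> \<inter> {0..1}. tm N i a = p * t" "\<exists>p\<in>\<rat> \<inter> {0..1}. \<exists>p'\<in>\<rat> \<inter> {0..1}. tm N i a = p * t \<and> real i * h = p' * t \<and> \<bar>p - p'\<bar> \<le> 1 / real l"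
      if "i < l" "a \<le> N" "1 \<le> N" for N i a
    proof -
      define p where "p = (real i + real a / real N) / real l"
      define p' where "p' = real i / real l"
      have aN: "0 \<le> real a / real N" "real a / real N \<le> 1" using that by auto
      have il: "real i + 1 \<le> real l" using that by linarith
      have p: "p \<in> \<rat> \<inter> {0..1}" "p' \<in> \<rat> \<inter> {0..1}"
      proof -
        have "real i + real a / real N \<le> real l" using aN il by linarith
        then show "p \<in> \<rat> \<inter> {0..1}" using aN l unfolding p_def by (simp add: divide_le_eq_1)
        show "p' \<in> \<rat> \<inter> {0..1}" using il l unfolding p'_def by (simp add: divide_le_eq_1)
      qed
      have eq: "tm N i a = p * t" "real i * h = p' * t"
        using that l unfolding tm_def p_def p'_def h_def by (auto simp: field_simps)
      have d: "\<bar>p - p'\<bar> \<le> 1 / real l"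
      proof -
        have "p - p' = (real a / real N) / real l" unfolding p_def p'_def by (simp add: diff_divide_distrib[symmetric])
        then show ?thesis using aN l divide_right_mono[of "real a / real N" 1 "real l"] by simp
      qed
      show "\<exists>p\<in>\<rat> \<inter> {0..1}. tm N i a = p * t" using p eq by blast
      show "\<exists>p\<in>\<rat> \<inter> {0..1}. \<exists>p'\<in>\<rat> \<inter> {0..1}. tm N i a = p * t \<and> real i * h = p' * t \<and> \<bar>p - p'\<bar> \<le> 1 / real l"
        using p eq d by blast
      show "tm N i a \<in> {0..\<tau>}" unfolding eq using p t by (intro unit_fraction_time) auto
    qed
    \<comment> \<open>Built from the adapted versions \<open>Xv\<close>, so as to be measurable at
      time \<open>tm N i a\<close>, and replaced by 0 where it exceeds \<open>\<epsilon>\<close>.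
      Along good paths on which \<open>X\<close> and \<open>Xv\<close> agree at the rational
      fractions of \<open>t\<close>, the truncation is inactive.\<close>
    define G where "G N i a \<omega> = (if i < l \<and> a < N \<and> norm (\<sigma> (Xv (tm N i a) \<omega>) - \<sigma> (Xv (real i * h) \<omega>)) \<le> \<epsilon>
         then \<sigma> (Xv (tm N i a) \<omega>) - \<sigma> (Xv (real i * h) \<omega>) else 0)" for N i a \<omega>
    define \<beta> where "\<beta> N i a \<omega> = (if i < l \<and> a < N \<and> norm (b (Xv (tm N i a) \<omega>) - b (Xv (real i * h) \<omega>)) \<le> \<epsilon>
         then b (Xv (tm N i a) \<omega>) - b (Xv (real i * h) \<omega>) else 0)" for N i a \<omega>
    have meas: "G N i a \<in> borel_measurable (nat_filtration (real i * h + real a * (h / real N)))"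
      "\<beta> N i a \<in> borel_measurable (nat_filtration (real i * h + real a * (h / real N)))" if "1 \<le> N" for N i a
    proof -
      have "G N i a \<in> borel_measurable (nat_filtration (tm N i a)) \<and> \<beta> N i a \<in> borel_measurable (nat_filtration (tm N i a))"
      proof (cases "i < l \<and> a < N")
        case True
        have le: "real i * h \<le> tm N i a" using h by (simp add: tm_def)
        have [measurable]: "Xv (tm N i a) \<in> borel_measurable (nat_filtration (tm N i a))"
          using tm_in(1)[of i a N] True that by (intro Xv) auto
        have "Xv (real i * h) \<in> borel_measurable (nat_filtration (real i * h))"
          using ih[of i] True by (intro Xv) auto
        note [measurable] = measurable_nat_filtration_mono[OF this le]
        show ?thesis unfolding G_def \<beta>_def using True by (auto intro!: measurable_If)
      next
        case False
        then have "G N i a = (\<lambda>_. 0)" "\<beta> N i a = (\<lambda>_. 0)" by (auto simp: G_def \<beta>_def)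
        then show ?thesis by simp
      qed
      then show "G N i a \<in> borel_measurable (nat_filtration (real i * h + real a * (h / real N)))"
        "\<beta> N i a \<in> borel_measurable (nat_filtration (real i * h + real a * (h / real N)))"
        unfolding tm_def by auto
    qed
    have bd: "norm (G N i a \<omega>) \<le> \<epsilon> \<and> norm (\<beta> N i a \<omega>) \<le> \<epsilon>" for N i a \<omega>
      using \<epsilon> by (auto simp: G_def \<beta>_def)
    define \<xi> where "\<xi> N \<omega> i = (\<Sum>a<N. G N i a \<omega> *v (\<omega> (tm N i (Suc a)) - \<omega> (tm N i a)) + (h / real N) *\<^sub>R \<beta> N i a \<omega>)" for N \<omega> i
    define Z where "Z N i \<omega> = noisy_euler b \<sigma> h \<omega> (\<xi> N \<omega>) x0 i" for N i \<omega>
    have Z: "Z N l \<in> borel_measurable M"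
      "moment 2 (\<lambda>\<omega>. Z N l \<omega> - eul h \<omega> l) \<le> ennreal (C * \<epsilon>\<^sup>2)" if "1 \<le> N" for N
      using close[OF h(1) that _ \<epsilon>, of l "G N" "\<beta> N"] meas[OF that] bd h t unfolding Z_def \<xi>_def tm_def by auto
    \<comment> \<open>The sum for time \<open>i * h\<close> is taken with \<open>i * Suc n\<close>
      pieces, so that for every \<open>i\<close> it lives on the same mesh \<open>h / Suc n\<close>;
      one subsequence then serves all block ends.\<close>
    have "\<exists>r :: nat \<Rightarrow> nat. strict_mono r \<and> (AE \<omega> in M. \<forall>i\<in>{1..l}. (\<lambda>n. ito_riemann_sum (\<lambda>s \<omega>. \<sigma> (X s \<omega>)) (real i * h) (i * Suc (r n)) \<omega>)
        \<longlonglongrightarrow> X (real i * h) \<omega> - x0 - integral {0..real i * h} (\<lambda>s. b (X s \<omega>)))"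
    proof (rule conv_in_prob_AE_subseq)
      fix i assume i: "i \<in> {1..l}"
      have fl: "filterlim (\<lambda>n. i * Suc n) at_top sequentially"
        using i by (intro filterlim_subseq) (auto simp: strict_mono_def)
      show "conv_in_prob M (\<lambda>n. ito_riemann_sum (\<lambda>s \<omega>. \<sigma> (X s \<omega>)) (real i * h) (i * Suc n))
          (\<lambda>\<omega>. X (real i * h) \<omega> - x0 - integral {0..real i * h} (\<lambda>s. b (X s \<omega>)))"
        by (rule conv_in_prob_subseq[OF X_ito fl]) (use i ih in auto)
    qed (use ih in \<open>auto intro!: ito_sum_measurable martingale_part_measurable\<close>)
    then obtain r :: "nat \<Rightarrow> nat" where r: "strict_mono r" and ito: "AE \<omega> in M. \<forall>i\<in>{1..l}.
        (\<lambda>n. ito_riemann_sum (\<lambda>s \<omega>. \<sigma> (X s \<omega>)) (real i * h) (i * Suc (r n)) \<omega>)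
        \<longlonglongrightarrow> X (real i * h) \<omega> - x0 - integral {0..real i * h} (\<lambda>s. b (X s \<omega>))" by blast
    have vers: "AE \<omega> in M. \<forall>p\<in>\<rat> \<inter> {0..1}. X (p * t) \<omega> = Xv (p * t) \<omega>"
      unfolding AE_ball_countable[OF countable_rat_unit]
    proof
      fix p :: real assume "p \<in> \<rat> \<inter> {0..1}"
      then have "p * t \<in> {0..\<tau>}" using t by (intro unit_fraction_time) auto
      then show "AE \<omega> in M. X (p * t) \<omega> = Xv (p * t) \<omega>" by (rule Xv)
    qed
    have lim: "(\<lambda>n. Z (Suc (r n)) l \<omega>) \<longlonglongrightarrow> X t \<omega>"
      if w: "\<omega> \<in> wiener_paths" and good: "\<omega> \<in> good_paths t \<epsilon> l" and X0: "X 0 \<omega> = x0"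
        and ito: "\<forall>i\<in>{1..l}. (\<lambda>n. ito_riemann_sum (\<lambda>s \<omega>. \<sigma> (X s \<omega>)) (real i * h) (i * Suc (r n)) \<omega>)
        \<longlonglongrightarrow> X (real i * h) \<omega> - x0 - integral {0..real i * h} (\<lambda>s. b (X s \<omega>))"
        and vers: "\<forall>p\<in>\<rat> \<inter> {0..1}. X (p * t) \<omega> = Xv (p * t) \<omega>" for \<omega>
    proof -
      define F where "F N k = \<sigma> (X (real k * (h / real N)) \<omega>) *v (\<omega> (real (Suc k) * (h / real N)) - \<omega> (real k * (h / real N)))
          + (h / real N) *\<^sub>R b (X (real k * (h / real N)) \<omega>)" for N k :: nat
      \<comment> \<open>The left-point sums of the integral equation at time \<open>i * h\<close>.
        They converge to \<open>X\<close> there, and along good paths their increment over block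
        \<open>i\<close> is an Euler step with coefficients taken at \<open>X\<close> plus exactly
        the noise \<open>\<xi> N \<omega> i\<close>.\<close>
      define V where "V N i = x0 + (\<Sum>k<i * N. F N k)" for N i
      have V_lim: "(\<lambda>n. V (Suc (r n)) i) \<longlonglongrightarrow> X (real i * h) \<omega>" if i: "i \<le> l" for i
      proof (cases "i = 0")
        case True
        then show ?thesis using X0 by (simp add: V_def)
      next
        case False
        define N where "N n = Suc (r n)" for n
        have Veq: "V (N n) i = x0 + ito_riemann_sum (\<lambda>s \<omega>. \<sigma> (X s \<omega>)) (real i * h) (i * N n) \<omega>
           + (\<Sum>k<i * N n. (real i * h / real (i * N n)) *\<^sub>R b (X (real k * (real i * h) / real (i * N n)) \<omega>))" for n
        proof -
          have "x * (real i * h) / real (i * N n) = x * (h / real (N n))" "real i * h / real (i * N n) = h / real (N n)" for x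
            using False by simp_all
          then show ?thesis unfolding V_def F_def ito_riemann_sum_def by (simp add: sum.distrib del: of_nat_Suc)
        qed
        have "filterlim (\<lambda>n. i * N n) at_top sequentially"
          using False r by (intro filterlim_subseq) (auto simp: strict_mono_def N_def)
        then have "(\<lambda>n. \<Sum>k<i * N n. (real i * h / real (i * N n)) *\<^sub>R b (X (real k * (real i * h) / real (i * N n)) \<omega>))
            \<longlonglongrightarrow> integral {0..real i * h} (\<lambda>s. b (X s \<omega>))"
          using ih[OF i] by (intro filterlim_compose[OF drift_riemann_tendsto[OF w]]) auto
        moreover have "(\<lambda>n. ito_riemann_sum (\<lambda>s \<omega>. \<sigma> (X s \<omega>)) (real i * h) (i * N n) \<omega>)
            \<longlonglongrightarrow> X (real i * h) \<omega> - x0 - integral {0..real i * h} (\<lambda>s. b (X s \<omega>))"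
          using ito i False unfolding N_def by auto
        ultimately have "(\<lambda>n. V (N n) i) \<longlonglongrightarrow> x0 + (X (real i * h) \<omega> - x0 - integral {0..real i * h} (\<lambda>s. b (X s \<omega>)))
            + integral {0..real i * h} (\<lambda>s. b (X s \<omega>))"
          unfolding Veq by (intro tendsto_intros)
        then show ?thesis by (simp add: N_def)
      qed
      have V_step: "V N (Suc i) = V N i + \<sigma> (X (real i * h) \<omega>) *v (\<omega> (real (Suc i) * h) - \<omega> (real i * h))
          + h *\<^sub>R b (X (real i * h) \<omega>) + \<xi> N \<omega> i" if i: "i < l" and N: "1 \<le> N" for N i
      proof -
        have Feq: "F N (i * N + a) = \<sigma> (X (real i * h) \<omega>) *v (\<omega> (tm N i (Suc a)) - \<omega> (tm N i a)) + (h / real N) *\<^sub>R b (X (real i * h) \<omega>)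
            + (G N i a \<omega> *v (\<omega> (tm N i (Suc a)) - \<omega> (tm N i a)) + (h / real N) *\<^sub>R \<beta> N i a \<omega>)" if a: "a < N" for a
        proof -
          have tms: "real (i * N + c) * (h / real N) = tm N i c" for c
            using N by (simp add: tm_def field_simps)
          obtain p p' where p: "p \<in> \<rat> \<inter> {0..1}" "p' \<in> \<rat> \<inter> {0..1}" "tm N i a = p * t" "real i * h = p' * t" "\<bar>p - p'\<bar> \<le> 1 / real l"
            using tm_in(3)[of i a N] i a N by auto
          have Kn: "K * norm (X (tm N i a) \<omega> - X (real i * h) \<omega>) \<le> \<epsilon>"
            using good p unfolding good_paths_def by auto
          have Xeq: "Xv (tm N i a) \<omega> = X (tm N i a) \<omega>" "Xv (real i * h) \<omega> = X (real i * h) \<omega>"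
            using vers p by auto
          have GB: "G N i a \<omega> = \<sigma> (X (tm N i a) \<omega>) - \<sigma> (X (real i * h) \<omega>)" "\<beta> N i a \<omega> = b (X (tm N i a) \<omega>) - b (X (real i * h) \<omega>)"
            using i a order_trans[OF \<sigma>_lip Kn] order_trans[OF b_lip Kn] by (auto simp: G_def \<beta>_def Xeq)
          show ?thesis
            unfolding F_def tms add_Suc_right[symmetric] GB by (simp add: algebra_simps)
        qed
        have "V N (Suc i) = V N i + (\<Sum>a<N. F N (i * N + a))"
          unfolding V_def mult_Suc add.commute[of N] sum_lessThan_add by (simp add: add.assoc)
        also have "(\<Sum>a<N. F N (i * N + a)) = (\<Sum>a<N. \<sigma> (X (real i * h) \<omega>) *v (\<omega> (tm N i (Suc a)) - \<omega> (tm N i a)))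
            + (\<Sum>a<N. (h / real N) *\<^sub>R b (X (real i * h) \<omega>)) + \<xi> N \<omega> i"
          using Feq by (simp add: sum.distrib \<xi>_def)
        also have "(\<Sum>a<N. \<sigma> (X (real i * h) \<omega>) *v (\<omega> (tm N i (Suc a)) - \<omega> (tm N i a)))
            = \<sigma> (X (real i * h) \<omega>) *v (\<omega> (real (Suc i) * h) - \<omega> (real i * h))"
        proof -
          have "tm N i N = real (Suc i) * h" "tm N i 0 = real i * h" using N by (auto simp: tm_def algebra_simps)
          then show ?thesis using matrix_vector_telescope[of "\<sigma> (X (real i * h) \<omega>)" "\<lambda>a. \<omega> (tm N i a)" N] by simp
        qed
        also have "(\<Sum>a<N. (h / real N) *\<^sub>R b (X (real i * h) \<omega>)) = h *\<^sub>R b (X (real i * h) \<omega>)"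
          using N by (simp only: sum_constant_scaleR) simp
        finally show ?thesis by (simp add: add.assoc)
      qed
      have "(\<lambda>n. Z (Suc (r n)) i \<omega>) \<longlonglongrightarrow> X (real i * h) \<omega>" if "i \<le> l" for i
        using that
      proof (induction i)
        case 0
        then show ?case using X0 by (simp add: Z_def)
      next
        case (Suc i)
        define x where "x = X (real i * h) \<omega>"
        define \<Delta> where "\<Delta> = \<omega> (real (Suc i) * h) - \<omega> (real i * h)"
        have IH: "(\<lambda>n. Z (Suc (r n)) i \<omega>) \<longlonglongrightarrow> x" using Suc by (simp add: x_def)
        have Vi: "(\<lambda>n. V (Suc (r n)) i) \<longlonglongrightarrow> x" using V_lim[of i] Suc by (simp add: x_def)
        \<comment> \<open>\<open>Z\<close> evaluates the coefficients at its own value where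
          \<open>V\<close> evaluates them at \<open>X\<close>. The number of blocks is fixed, so
          continuity of the coefficients carries the convergence from one block to the next.\<close>
        have "Z (Suc (r n)) (Suc i) \<omega> = V (Suc (r n)) (Suc i) + (Z (Suc (r n)) i \<omega> - V (Suc (r n)) i)
            + (\<sigma> (Z (Suc (r n)) i \<omega>) - \<sigma> x) *v \<Delta> + h *\<^sub>R (b (Z (Suc (r n)) i \<omega>) - b x)" for n
          using V_step[of i "Suc (r n)"] Suc.prems unfolding Z_def noisy_euler.simps x_def[symmetric] \<Delta>_def[symmetric]
          by (simp add: algebra_simps)
        moreover have "(\<lambda>n. V (Suc (r n)) (Suc i) + (Z (Suc (r n)) i \<omega> - V (Suc (r n)) i)
            + (\<sigma> (Z (Suc (r n)) i \<omega>) - \<sigma> x) *v \<Delta> + h *\<^sub>R (b (Z (Suc (r n)) i \<omega>) - b x))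
            \<longlonglongrightarrow> X (real (Suc i) * h) \<omega> + (x - x) + (\<sigma> x - \<sigma> x) *v \<Delta> + h *\<^sub>R (b x - b x)"
          using Suc.prems
          by (intro tendsto_add tendsto_diff tendsto_scaleR tendsto_const V_lim IH Vi
              bounded_bilinear.tendsto[OF bounded_bilinear_matrix_vector]
              continuous_on_tendsto_compose[OF continuous_b[of UNIV]]
              continuous_on_tendsto_compose[OF continuous_\<sigma>[of UNIV]]) auto
        ultimately show ?case by simp
      qed
      from this[of l] show ?thesis by (simp add: h)
    qed
    show "(\<integral>\<^sup>+ \<omega>. indicator (good_paths t \<epsilon> l) \<omega> * ennreal (norm (X t \<omega> - eul (t / real l) \<omega> l) ^ 2) \<partial>M) \<le> ennreal (C * \<epsilon>\<^sup>2)"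
    proof (rule nn_integral_le_of_AE_tendsto)
      fix n
      let ?u = "\<lambda>\<omega>. indicator (good_paths t \<epsilon> l) \<omega> * ennreal (norm (Z (Suc (r n)) l \<omega> - eul (t / real l) \<omega> l) ^ 2)"
      have [measurable]: "good_paths t \<epsilon> l \<in> sets M" using t by (intro good_paths_sets) auto
      have [measurable]: "Z (Suc (r n)) l \<in> borel_measurable M" by (rule Z) simp
      have [measurable]: "(\<lambda>\<omega>. eul (t / real l) \<omega> l) \<in> borel_measurable M"
        using t by (intro euler_measurable_M) auto
      show "?u \<in> borel_measurable M" by measurable
      have "(\<integral>\<^sup>+ \<omega>. ?u \<omega> \<partial>M) \<le> moment 2 (\<lambda>\<omega>. Z (Suc (r n)) l \<omega> - eul h \<omega> l)"
        by (intro nn_integral_mono) (auto simp: h_def indicator_def)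
      also have "\<dots> \<le> ennreal (C * \<epsilon>\<^sup>2)" by (rule Z) simp
      finally show "(\<integral>\<^sup>+ \<omega>. ?u \<omega> \<partial>M) \<le> ennreal (C * \<epsilon>\<^sup>2)" .
    next
      show "AE \<omega> in M. (\<lambda>n. indicator (good_paths t \<epsilon> l) \<omega> * ennreal (norm (Z (Suc (r n)) l \<omega> - eul (t / real l) \<omega> l) ^ 2))
        \<longlonglongrightarrow> indicator (good_paths t \<epsilon> l) \<omega> * ennreal (norm (X t \<omega> - eul (t / real l) \<omega> l) ^ 2)"
        using X_initial ito vers AE_space
      proof eventually_elim
        case (elim \<omega>)
        show ?case
        proof (cases "\<omega> \<in> good_paths t \<epsilon> l")
          case True
          have "(\<lambda>n. Z (Suc (r n)) l \<omega>) \<longlonglongrightarrow> X t \<omega>" using elim True by (intro lim) auto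
          then have "(\<lambda>n. norm (Z (Suc (r n)) l \<omega> - eul (t / real l) \<omega> l) ^ 2) \<longlonglongrightarrow> norm (X t \<omega> - eul (t / real l) \<omega> l) ^ 2"
            by (intro tendsto_intros)
          then show ?thesis using True by (simp add: tendsto_ennrealI)
        qed simp
      qed
    qed
  qed
qed

text \<open>Chebyshev's inequality on the good paths, where the second moment of the error is of
  order \<open>\<epsilon>\<^sup>2\<close>, plus the small probability of the complement.
  \<open>\<epsilon>\<close> is fixed before \<open>l\<close>.\<close>

theorem euler_conv_in_prob:
  assumes t: "0 < t" "t \<le> \<tau>"
  shows "conv_in_prob M (\<lambda>l \<omega>. eul (t / real l) \<omega> l) (X t)"
proof -
  define T where "T = max 1 \<tau>"
  have T: "1 \<le> T" "t \<le> T" using t by (auto simp: T_def)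
  obtain C where C: "C \<ge> 0" and close: "\<And>t l \<epsilon>. 0 < t \<Longrightarrow> t \<le> \<tau> \<Longrightarrow> t \<le> T \<Longrightarrow> 1 \<le> l \<Longrightarrow> 0 \<le> \<epsilon> \<Longrightarrow>
    (\<integral>\<^sup>+ \<omega>. indicator (good_paths t \<epsilon> l) \<omega> * ennreal (norm (X t \<omega> - eul (t / real l) \<omega> l) ^ 2) \<partial>M) \<le> ennreal (C * \<epsilon>\<^sup>2)"
    using euler_close_on_good_paths[OF T(1)] by blast
  show ?thesis
    unfolding conv_in_prob_def
  proof (intro allI impI)
    fix c :: real assume c: "0 < c"
    let ?B = "\<lambda>l. {\<omega> \<in> space M. c < norm (eul (t / real l) \<omega> l - X t \<omega>)}"
    have B: "?B l \<in> sets M" for l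
    proof -
      have [measurable]: "X t \<in> borel_measurable M" "(\<lambda>\<omega>. eul (t / real l) \<omega> l) \<in> borel_measurable M"
        using t by (auto intro!: X_measurable euler_measurable_M)
      show ?thesis by measurable
    qed
    show "(\<lambda>l. prob (?B l)) \<longlonglongrightarrow> 0"
    proof (rule LIMSEQ_I)
      fix r :: real assume r: "0 < r"
      \<comment> \<open>Makes the Chebyshev bound \<open>C * \<epsilon>\<^sup>2 / c\<^sup>2\<close>
        at most \<open>r / 4\<close>; the summand in \<open>C + 1\<close> guards against division by
        0.\<close>
      define \<epsilon> where "\<epsilon> = sqrt (r * c\<^sup>2 / (4 * (C + 1)))"
      have \<epsilon>: "0 < \<epsilon>" "C * \<epsilon>\<^sup>2 / c\<^sup>2 \<le> r / 4"
      proof -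
        show "0 < \<epsilon>" using r c C by (simp add: \<epsilon>_def)
        have "\<epsilon>\<^sup>2 = r * c\<^sup>2 / (4 * (C + 1))" using r c C by (simp add: \<epsilon>_def)
        then have "C * \<epsilon>\<^sup>2 / c\<^sup>2 = r / 4 * (C / (C + 1))" using c by simp
        also have "\<dots> \<le> r / 4 * 1" using r C by (intro mult_left_mono) auto
        finally show "C * \<epsilon>\<^sup>2 / c\<^sup>2 \<le> r / 4" by simp
      qed
      have "(\<lambda>l. prob (good_paths t \<epsilon> (Suc l))) \<longlonglongrightarrow> 1"
        using t \<epsilon> by (intro prob_good_paths_tendsto) auto
      then have "\<exists>no. \<forall>l\<ge>no. norm (prob (good_paths t \<epsilon> (Suc l)) - 1) < r / 4"
        by (rule LIMSEQ_D) (use r in simp)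
      then obtain no where no: "\<And>l. l \<ge> no \<Longrightarrow> norm (prob (good_paths t \<epsilon> (Suc l)) - 1) < r / 4"
        by blast
      show "\<exists>no. \<forall>l\<ge>no. norm (prob (?B l) - 0) < r"
      proof (intro exI[of _ "Suc no"] allI impI)
        fix l assume l: "Suc no \<le> l"
        let ?G = "good_paths t \<epsilon> l"
        have G: "?G \<in> sets M" using t by (intro good_paths_sets) auto
        have pG: "1 - r / 4 < prob ?G" proof -
          have "norm (prob (good_paths t \<epsilon> (Suc (l - 1))) - 1) < r / 4" using l by (intro no) auto
          then have "\<bar>prob ?G - 1\<bar> < r / 4" using l by simp
          then show ?thesis by linarith
        qed
        have "ennreal (prob (?B l \<inter> ?G)) = (\<integral>\<^sup>+ \<omega>. indicator (?B l \<inter> ?G) \<omega> \<partial>M)"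
          using B[of l] G by (simp add: emeasure_eq_measure)
        also have "\<dots> \<le> (\<integral>\<^sup>+ \<omega>. ennreal (1 / c\<^sup>2) * (indicator ?G \<omega> * ennreal (norm (X t \<omega> - eul (t / real l) \<omega> l) ^ 2)) \<partial>M)"
        proof (rule nn_integral_mono)
          fix \<omega>
          show "indicator (?B l \<inter> ?G) \<omega> \<le> ennreal (1 / c\<^sup>2) * (indicator ?G \<omega> * ennreal (norm (X t \<omega> - eul (t / real l) \<omega> l) ^ 2))"
          proof (cases "\<omega> \<in> ?B l \<inter> ?G")
            case True
            then have "c\<^sup>2 \<le> norm (X t \<omega> - eul (t / real l) \<omega> l) ^ 2"
              using c by (intro power_mono) (auto simp: norm_minus_commute)
            then have "ennreal 1 \<le> ennreal (1 / c\<^sup>2 * norm (X t \<omega> - eul (t / real l) \<omega> l) ^ 2)"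
              using c by (intro ennreal_leI) (simp add: field_simps)
            also have "\<dots> = ennreal (1 / c\<^sup>2) * ennreal (norm (X t \<omega> - eul (t / real l) \<omega> l) ^ 2)"
              by (rule ennreal_mult) auto
            finally show ?thesis using True by simp
          qed simp
        qed
        also have "\<dots> = ennreal (1 / c\<^sup>2) * (\<integral>\<^sup>+ \<omega>. indicator ?G \<omega> * ennreal (norm (X t \<omega> - eul (t / real l) \<omega> l) ^ 2) \<partial>M)"
        proof (rule nn_integral_cmult)
          have [measurable]: "X t \<in> borel_measurable M" "(\<lambda>\<omega>. eul (t / real l) \<omega> l) \<in> borel_measurable M"
            using t by (auto intro!: X_measurable euler_measurable_M)
          note [measurable] = G
          show "(\<lambda>\<omega>. indicator ?G \<omega> * ennreal (norm (X t \<omega> - eul (t / real l) \<omega> l) ^ 2)) \<in> borel_measurable M"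
            by measurable
        qed
        also have "\<dots> \<le> ennreal (1 / c\<^sup>2) * ennreal (C * \<epsilon>\<^sup>2)"
          using t T l \<epsilon> by (intro mult_left_mono close) auto
        also have "\<dots> = ennreal (C * \<epsilon>\<^sup>2 / c\<^sup>2)" using C by (simp add: ennreal_mult[symmetric])
        finally have "prob (?B l \<inter> ?G) \<le> C * \<epsilon>\<^sup>2 / c\<^sup>2" using C by (simp add: ennreal_le_iff)
        then have "prob (?B l \<inter> ?G) \<le> r / 4" using \<epsilon>(2) by (rule order_trans)
        moreover have "prob (?B l) \<le> prob (?B l \<inter> ?G) + prob (space M - ?G)"
        proof -
          have Gc: "space M - ?G \<in> sets M" using G by (rule sets.compl_sets)
          have "prob (?B l) \<le> prob ((?B l \<inter> ?G) \<union> (space M - ?G))"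
            by (intro finite_measure_mono sets.Un sets.Int B G Gc) auto
          also have "\<dots> \<le> prob (?B l \<inter> ?G) + prob (space M - ?G)"
            by (intro measure_Un_le sets.Int B G Gc)
          finally show ?thesis .
        qed
        moreover have "prob (space M - ?G) = 1 - prob ?G" using G by (rule prob_compl)
        ultimately show "norm (prob (?B l) - 0) < r" using pG r by simp
      qed
    qed
  qed
qed

end

section \<open>Hoelder regularity of paths\<close>

lemma nn_integral_power_sum3:
  assumes [measurable]: "a \<in> borel_measurable M" "b \<in> borel_measurable M" "c \<in> borel_measurable M"
    and nn: "\<And>x. x \<in> space M \<Longrightarrow> 0 \<le> a x \<and> 0 \<le> b x \<and> 0 \<le> c x"
    and le: "AE x in M. 0 \<le> f x \<and> f x \<le> a x + b x + (c x :: real)"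
  shows "(\<integral>\<^sup>+ x. ennreal (f x ^ n) \<partial>M)
    \<le> ennreal (3 ^ n) * ((\<integral>\<^sup>+ x. ennreal (a x ^ n) \<partial>M) + (\<integral>\<^sup>+ x. ennreal (b x ^ n) \<partial>M) + (\<integral>\<^sup>+ x. ennreal (c x ^ n) \<partial>M))"
proof -
  have "(\<integral>\<^sup>+ x. ennreal (f x ^ n) \<partial>M) \<le> (\<integral>\<^sup>+ x. ennreal (3 ^ n) * (ennreal (a x ^ n) + ennreal (b x ^ n) + ennreal (c x ^ n)) \<partial>M)"
  proof (rule nn_integral_mono_AE)
    show "AE x in M. ennreal (f x ^ n) \<le> ennreal (3 ^ n) * (ennreal (a x ^ n) + ennreal (b x ^ n) + ennreal (c x ^ n))"
      using le AE_space
    proof eventually_elim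
      case (elim x)
      have "f x ^ n \<le> (a x + b x + c x) ^ n" using elim by (intro power_mono) auto
      also have "\<dots> \<le> 3 ^ n * (a x ^ n + b x ^ n + c x ^ n)" using nn[of x] elim by (intro power_sum3_le) auto
      finally have "ennreal (f x ^ n) \<le> ennreal (3 ^ n * (a x ^ n + b x ^ n + c x ^ n))" by (rule ennreal_leI)
      then show ?case using nn[of x] elim by (simp add: ennreal_mult ennreal_plus)
    qed
  qed
  then show ?thesis by (simp add: nn_integral_cmult nn_integral_add)
qed

lemma floor_doubling:
  fixes y :: real
  assumes "0 \<le> y"
  shows "nat \<lfloor>2 * y\<rfloor> = 2 * nat \<lfloor>y\<rfloor> \<or> nat \<lfloor>2 * y\<rfloor> = 2 * nat \<lfloor>y\<rfloor> + 1"
proof -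
  have "\<lfloor>2 * y\<rfloor> = 2 * \<lfloor>y\<rfloor> \<or> \<lfloor>2 * y\<rfloor> = 2 * \<lfloor>y\<rfloor> + 1" by linarith
  then show ?thesis using assms by (auto simp: nat_mult_distrib nat_add_distrib)
qed

text \<open>Chaining along dyadic points, with \<open>\<rho>\<^sup>n = (2\<^sup>-\<^sup>n) powr (1/8)\<close>.\<close>

lemma dyadic_hoelder:
  fixes T :: real
  assumes T: "0 < T"
  shows "\<exists>c\<ge>0. \<forall>(g :: real \<Rightarrow> 'a::real_normed_vector) S. continuous_on {0..T} g \<longrightarrow> 0 \<le> S \<longrightarrow>
    (\<forall>n k. k < 2 ^ n \<longrightarrow> norm (g (real (Suc k) * T / 2 ^ n) - g (real k * T / 2 ^ n)) \<le> S * (2 powr (-1/8)) ^ n) \<longrightarrow>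
    (\<forall>s\<in>{0..T}. \<forall>t\<in>{0..T}. norm (g t - g s) \<le> c * S * \<bar>t - s\<bar> powr (1/8))"
proof -
  define \<rho> :: real where "\<rho> = 2 powr (-1/8)"
  have \<rho>: "0 < \<rho>" "\<rho> < 1" unfolding \<rho>_def by (auto simp: powr_less_one)
  define c0 where "c0 = 1 + 2 * (\<rho> / (1 - \<rho>))"
  have c0: "0 \<le> c0" using \<rho> by (simp add: c0_def)
  define c where "c = 2 * c0 / T powr (1/8)"
  have c: "0 \<le> c" using c0 T by (simp add: c_def)
  have main: "norm (g t - g s) \<le> c * S * \<bar>t - s\<bar> powr (1/8)"
    if cont: "continuous_on {0..T} g" and S: "0 \<le> S" and st: "0 \<le> s" "s < t" "t \<le> T"
      and inc: "\<And>n k. k < 2 ^ n \<Longrightarrow> norm (g (real (Suc k) * T / 2 ^ n) - g (real k * T / 2 ^ n)) \<le> S * \<rho> ^ n"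
    for g :: "real \<Rightarrow> 'a" and S s t
  proof -
    \<comment> \<open>\<open>pt n x\<close> is the dyadic point of level \<open>n\<close> at or just
      below \<open>x\<close>. Passing to level \<open>n + 1\<close> moves it by at most one interval
      of the finer level.\<close>
    define k where "k n x = nat \<lfloor>x * 2 ^ n / T\<rfloor>" for n :: nat and x
    define pt where "pt n x = real (k n x) * T / 2 ^ n" for n x
    have k_le: "real (k n x) \<le> x * 2 ^ n / T" "x * 2 ^ n / T < real (k n x) + 1" if "0 \<le> x" for n x
    proof -
      have "0 \<le> x * 2 ^ n / T" using that T by simp
      then show "real (k n x) \<le> x * 2 ^ n / T" "x * 2 ^ n / T < real (k n x) + 1" unfolding k_def by linarith+
    qed
    have k_bound: "k n x \<le> 2 ^ n" if "0 \<le> x" "x \<le> T" for n x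
    proof -
      have "x * 2 ^ n / T \<le> 2 ^ n" using that T by (simp add: divide_le_eq)
      then have "real (k n x) \<le> 2 ^ n" using k_le(1)[OF that(1), of n] by linarith
      then show ?thesis by simp
    qed
    have pt_bounds: "0 \<le> pt n x" "pt n x \<le> x" "x - pt n x \<le> T / 2 ^ n" if "0 \<le> x" for n x
    proof -
      have x: "x = x * 2 ^ n / T * (T / 2 ^ n)" using T by simp
      show "0 \<le> pt n x" using T by (simp add: pt_def)
      have "real (k n x) * (T / 2 ^ n) \<le> x * 2 ^ n / T * (T / 2 ^ n)"
        using k_le(1)[OF that] T by (intro mult_right_mono) auto
      then show "pt n x \<le> x" using x by (simp add: pt_def)
      have "x * 2 ^ n / T * (T / 2 ^ n) \<le> (real (k n x) + 1) * (T / 2 ^ n)"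
        using k_le(2)[OF that, of n] T by (intro mult_right_mono) auto
      then have "x \<le> (real (k n x) + 1) * (T / 2 ^ n)" unfolding x[symmetric] .
      also have "\<dots> = pt n x + T / 2 ^ n" by (simp add: pt_def distrib_right add_divide_distrib)
      finally show "x - pt n x \<le> T / 2 ^ n" by linarith
    qed
    have step: "norm (g (pt (Suc n) x) - g (pt n x)) \<le> S * \<rho> ^ Suc n" if x: "0 \<le> x" "x \<le> T" for n x
    proof -
      have e: "x * 2 ^ Suc n / T = 2 * (x * 2 ^ n / T)" by simp
      have "k (Suc n) x = 2 * k n x \<or> k (Suc n) x = 2 * k n x + 1"
        unfolding k_def e by (rule floor_doubling) (use x T in simp)
      then show ?thesis
      proof
        assume "k (Suc n) x = 2 * k n x"
        then have "pt (Suc n) x = pt n x" by (simp add: pt_def)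
        then show ?thesis using S \<rho> by simp
      next
        assume eq: "k (Suc n) x = 2 * k n x + 1"
        then have "2 * k n x < 2 ^ Suc n" using k_bound[OF x, of "Suc n"] by simp
        from inc[OF this] show ?thesis by (simp add: pt_def eq)
      qed
    qed
    have chain: "norm (g (pt (n + j) x) - g (pt n x)) \<le> S * \<rho> ^ n * (\<Sum>i<j. \<rho> ^ Suc i)" if x: "0 \<le> x" "x \<le> T" for n j x
    proof (induction j)
      case (Suc j)
      have "norm (g (pt (n + Suc j) x) - g (pt n x)) \<le> norm (g (pt (Suc (n + j)) x) - g (pt (n + j) x)) + norm (g (pt (n + j) x) - g (pt n x))"
        using norm_triangle_ineq[of "g (pt (Suc (n + j)) x) - g (pt (n + j) x)" "g (pt (n + j) x) - g (pt n x)"] by simp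
      also have "\<dots> \<le> S * \<rho> ^ Suc (n + j) + S * \<rho> ^ n * (\<Sum>i<j. \<rho> ^ Suc i)"
        by (intro add_mono step Suc x)
      also have "\<dots> = S * \<rho> ^ n * (\<Sum>i<Suc j. \<rho> ^ Suc i)" by (simp add: power_add algebra_simps)
      finally show ?case .
    qed simp
    have geo: "(\<Sum>i<j. \<rho> ^ Suc i) \<le> \<rho> / (1 - \<rho>)" for j
    proof -
      have "(\<Sum>i<j. \<rho> ^ Suc i) = \<rho> * ((1 - \<rho> ^ j) / (1 - \<rho>))"
        using \<rho> by (simp add: sum_distrib_left[symmetric] sum_gp_strict)
      also have "\<dots> \<le> \<rho> * (1 / (1 - \<rho>))" using \<rho> by (intro mult_left_mono divide_right_mono) auto
      finally show ?thesis by simp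
    qed
    have near: "norm (g x - g (pt n x)) \<le> S * \<rho> ^ n * (\<rho> / (1 - \<rho>))" if x: "0 \<le> x" "x \<le> T" for n x
    proof (rule Lim_bounded)
      have "(\<lambda>j. pt (n + j) x) \<longlonglongrightarrow> x"
      proof (rule tendsto_sandwich[of "\<lambda>j. x - T / 2 ^ n * (1/2) ^ j" _ _ "\<lambda>_. x"])
        show "(\<lambda>j. x - T / 2 ^ n * (1/2) ^ j) \<longlonglongrightarrow> x"
          by (rule tendsto_eq_intros LIMSEQ_power_zero refl | simp)+
        show "\<forall>\<^sub>F j in sequentially. x - T / 2 ^ n * (1/2) ^ j \<le> pt (n + j) x"
        proof (intro always_eventually allI)
          fix j
          have "T / 2 ^ n * (1/2) ^ j = T / 2 ^ (n + j)" by (simp add: power_add power_divide)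
          then show "x - T / 2 ^ n * (1/2) ^ j \<le> pt (n + j) x" using pt_bounds(3)[OF x(1), of "n + j"] by linarith
        qed
      qed (use pt_bounds[OF x(1)] in auto)
      then have "(\<lambda>j. g (pt (n + j) x)) \<longlonglongrightarrow> g x"
      proof (rule continuous_on_tendsto_compose[OF cont])
        show "x \<in> {0..T}" using x by simp
        show "\<forall>\<^sub>F j in sequentially. pt (n + j) x \<in> {0..T}"
          using pt_bounds(1,2)[OF x(1)] x by (intro always_eventually allI) (auto intro: order_trans)
      qed
      then show "(\<lambda>j. norm (g (pt (n + j) x) - g (pt n x))) \<longlonglongrightarrow> norm (g x - g (pt n x))"
        by (intro tendsto_intros)
      show "\<forall>j\<ge>0. norm (g (pt (n + j) x) - g (pt n x)) \<le> S * \<rho> ^ n * (\<rho> / (1 - \<rho>))"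
        using chain[OF x] geo S \<rho> by (intro allI impI order_trans[OF chain[OF x]] mult_left_mono) auto
    qed
    \<comment> \<open>The level whose mesh is comparable to \<open>t - s\<close>: the dyadic points
      below \<open>s\<close> and \<open>t\<close> coincide or are neighbours there, so one increment
      of level \<open>n\<close> and two chains of finer increments remain.\<close>
    obtain n where n: "T / 2 ^ Suc n < t - s" "t - s \<le> T / 2 ^ n"
    proof -
      define P where "P n \<longleftrightarrow> T / 2 ^ n < t - s" for n :: nat
      have "\<exists>n. P n"
      proof -
        obtain n :: nat where "T / (t - s) < 2 ^ n" using real_arch_pow[of 2 "T / (t - s)"] by auto
        then have "P n" using st by (simp add: P_def field_simps)
        then show ?thesis by blast
      qed
      then have P: "P (LEAST n. P n)" by (rule LeastI_ex)
      moreover have "\<not> P 0" using st by (simp add: P_def)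
      ultimately obtain m where m: "(LEAST n. P n) = Suc m" by (cases "LEAST n. P n") auto
      then have "\<not> P m" using not_less_Least[of m P] by simp
      then show ?thesis using P m that[of m] by (simp add: P_def)
    qed
    define Q where "Q = S * \<rho> ^ n * (\<rho> / (1 - \<rho>))"
    have "norm (g (pt n t) - g (pt n s)) \<le> S * \<rho> ^ n"
    proof -
      have d: "t * 2 ^ n / T \<le> s * 2 ^ n / T + 1"
      proof -
        have "(t - s) * 2 ^ n / T \<le> 1" using n(2) T by (simp add: field_simps)
        then show ?thesis by (simp add: left_diff_distrib diff_divide_distrib)
      qed
      have "s * 2 ^ n / T \<le> t * 2 ^ n / T" using st T by (intro divide_right_mono mult_right_mono) auto
      then have "real (k n t) < real (k n s) + 2" "real (k n s) < real (k n t) + 1"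
        using k_le[of s n] k_le[of t n] st d by linarith+
      then have "k n t = k n s \<or> k n t = Suc (k n s)" by linarith
      then show ?thesis
      proof
        assume "k n t = k n s"
        then show ?thesis using S \<rho> by (simp add: pt_def)
      next
        assume eq: "k n t = Suc (k n s)"
        then have "k n s < 2 ^ n" using k_bound[of t n] st by simp
        from inc[OF this] show ?thesis by (simp add: pt_def eq)
      qed
    qed
    moreover have "norm (g t - g (pt n t)) \<le> Q" "norm (g s - g (pt n s)) \<le> Q" unfolding Q_def using near[of t n] near[of s n] st by auto
    moreover have "norm (g t - g s) \<le> norm (g t - g (pt n t)) + norm (g (pt n t) - g (pt n s)) + norm (g s - g (pt n s))"
    proof -
      have "g t - g s = (g t - g (pt n t)) + (g (pt n t) - g (pt n s)) - (g s - g (pt n s))" by simp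
      then show ?thesis by (metis norm_triangle_ineq norm_triangle_ineq4 order_trans add_right_mono)
    qed
    moreover have "S * \<rho> ^ n * c0 = S * \<rho> ^ n + 2 * Q" by (simp add: c0_def Q_def distrib_left)
    ultimately have "norm (g t - g s) \<le> S * \<rho> ^ n * c0" by linarith
    also have "\<rho> ^ n \<le> 2 * ((t - s) / T) powr (1/8)"
    proof -
      have "\<rho> ^ n = 2 powr (1/8) * (1 / 2 ^ Suc n) powr (1/8)"
      proof -
        have "\<rho> ^ n = 2 powr (- real n / 8)" unfolding \<rho>_def by (simp add: powr_realpow[symmetric] powr_powr)
        also have "\<dots> = 2 powr (1/8) * 2 powr (- real (Suc n) / 8)" by (simp add: powr_add[symmetric] field_simps)
        also have "2 powr (- real (Suc n) / 8) = (2 powr (- real (Suc n))) powr (1/8)" by (simp add: powr_powr)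
        also have "2 powr (- real (Suc n)) = 1 / 2 ^ Suc n"
          using powr_minus_divide[of 2 "real (Suc n)"] powr_realpow[of 2 "Suc n"] by simp
        finally show ?thesis .
      qed
      also have "\<dots> \<le> 2 * ((t - s) / T) powr (1/8)"
      proof (rule mult_mono)
        show "2 powr (1/8) \<le> (2::real)" using powr_mono[of "1/8" 1 "2::real"] by simp
        show "(1 / 2 ^ Suc n) powr (1/8) \<le> ((t - s) / T) powr (1/8)"
          using n(1) T by (intro powr_mono2) (auto simp: field_simps)
      qed auto
      finally show ?thesis .
    qed
    finally have "norm (g t - g s) \<le> S * (2 * ((t - s) / T) powr (1/8)) * c0"
      using S c0 by (simp add: mult_left_mono mult_right_mono)
    also have "\<dots> = c * S * \<bar>t - s\<bar> powr (1/8)"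
      using st T by (simp add: c_def powr_divide)
    finally show ?thesis .
  qed
  show ?thesis
  proof (intro exI[of _ c] conjI allI impI ballI c)
    fix g :: "real \<Rightarrow> 'a" and S s t
    assume a: "continuous_on {0..T} g" "0 \<le> S"
      "\<forall>n k. k < 2 ^ n \<longrightarrow> norm (g (real (Suc k) * T / 2 ^ n) - g (real k * T / 2 ^ n)) \<le> S * (2 powr (-1/8)) ^ n"
      and st: "s \<in> {0..T}" "t \<in> {0..T}"
    consider "s < t" | "t < s" | "s = t" by linarith
    then show "norm (g t - g s) \<le> c * S * \<bar>t - s\<bar> powr (1/8)"
    proof cases
      case 1 then show ?thesis using main[OF a(1,2)] a(3) st unfolding \<rho>_def by auto
    next
      case 2 then show ?thesis using main[OF a(1,2), of t s] a(3) st unfolding \<rho>_def by (auto simp: norm_minus_commute abs_minus_commute)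
    qed auto
  qed
qed

text \<open>Kolmogorov's continuity criterion with a moment bound for the random Hoelder constant.
  \<open>V\<close> sums the powers \<open>8 * p\<close> of all dyadic increments with weights
  \<open>2 ^ (n * p)\<close>. Level \<open>n\<close> has \<open>2 ^ n\<close> increments, each with
  a moment of order \<open>(1 / 2 ^ n) ^ (4 * p)\<close>, so its contribution is at most of order
  \<open>1 / 2 ^ n\<close>. Conversely every single increment is at most the root of
  \<open>V\<close> times \<open>2 powr (- n / 8)\<close>, whence the exponent
  \<open>1/8\<close>.\<close>

lemma kolmogorov_hoelder:
  fixes f :: "real \<Rightarrow> 'w \<Rightarrow> real^'m" and T C :: real and p :: nat
  assumes T: "0 < T" and p: "1 \<le> p" and C: "0 \<le> C"
    and meas: "\<And>t. 0 \<le> t \<Longrightarrow> t \<le> T \<Longrightarrow> f t \<in> borel_measurable M"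
    and cont: "\<And>\<omega>. \<omega> \<in> space M \<Longrightarrow> continuous_on {0..T} (\<lambda>t. f t \<omega>)"
    and mom: "\<And>n k. k < 2 ^ n \<Longrightarrow> (\<integral>\<^sup>+ \<omega>. ennreal (norm (f (real (Suc k) * T / 2 ^ n) \<omega> - f (real k * T / 2 ^ n) \<omega>) ^ (8 * p)) \<partial>M)
       \<le> ennreal (C * (1 / 2 ^ n) ^ (4 * p))"
  shows "\<exists>S C'. S \<in> borel_measurable M \<and> (\<forall>\<omega>. 0 \<le> S \<omega>) \<and> 0 \<le> C' \<and> (\<integral>\<^sup>+ \<omega>. ennreal (S \<omega> ^ (8 * p)) \<partial>M) \<le> ennreal C' \<and>
    (AE \<omega> in M. \<forall>s\<in>{0..T}. \<forall>t\<in>{0..T}. norm (f t \<omega> - f s \<omega>) \<le> S \<omega> * \<bar>t - s\<bar> powr (1/8))"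
proof -
  define D where "D n k \<omega> = norm (f (real (Suc k) * T / 2 ^ n) \<omega> - f (real k * T / 2 ^ n) \<omega>)" for n k :: nat and \<omega>
  have Dm [measurable]: "D n k \<in> borel_measurable M" if "k < 2 ^ n" for n k
  proof -
    have "real (Suc k) * T / 2 ^ n \<le> T" "real k * T / 2 ^ n \<le> T"
    proof -
      have "real (Suc k) \<le> real (2 ^ n)" using that by (intro of_nat_mono) simp
      then have "real (Suc k) \<le> 2 ^ n" by simp
      moreover from this have "real k \<le> 2 ^ n" by linarith
      ultimately have "real (Suc k) * T \<le> 2 ^ n * T" "real k * T \<le> 2 ^ n * T" using T by (auto intro!: mult_right_mono simp del: of_nat_Suc)
      then show "real (Suc k) * T / 2 ^ n \<le> T" "real k * T / 2 ^ n \<le> T" by (auto simp: divide_le_eq mult.commute)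
    qed
    then have [measurable]: "f (real (Suc k) * T / 2 ^ n) \<in> borel_measurable M" "f (real k * T / 2 ^ n) \<in> borel_measurable M"
      using T by (auto intro!: meas)
    show ?thesis unfolding D_def by measurable
  qed
  define V where "V \<omega> = (\<Sum>n. \<Sum>k<2 ^ n. ennreal (2 ^ (n * p) * D n k \<omega> ^ (8 * p)))" for \<omega>
  have Vm [measurable]: "V \<in> borel_measurable M" unfolding V_def by measurable
  have EV: "(\<integral>\<^sup>+ \<omega>. V \<omega> \<partial>M) \<le> ennreal (C * 2)"
  proof -
    have "(\<integral>\<^sup>+ \<omega>. V \<omega> \<partial>M) = (\<Sum>n. \<Sum>k<2 ^ n. ennreal (2 ^ (n * p)) * (\<integral>\<^sup>+ \<omega>. ennreal (D n k \<omega> ^ (8 * p)) \<partial>M))"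
    proof -
      have "(\<integral>\<^sup>+ \<omega>. (\<Sum>k<2 ^ n. ennreal (2 ^ (n * p) * D n k \<omega> ^ (8 * p))) \<partial>M)
          = (\<Sum>k<2 ^ n. ennreal (2 ^ (n * p)) * (\<integral>\<^sup>+ \<omega>. ennreal (D n k \<omega> ^ (8 * p)) \<partial>M))" for n
      proof -
        have m: "(\<lambda>\<omega>. ennreal (D n k \<omega> ^ (8 * p))) \<in> borel_measurable M" if "k < 2 ^ n" for k
          using Dm[OF that] by measurable
        have eq: "ennreal (2 ^ (n * p) * D n k \<omega> ^ (8 * p)) = ennreal (2 ^ (n * p)) * ennreal (D n k \<omega> ^ (8 * p))" for k \<omega>
          by (rule ennreal_mult) (auto simp: D_def)
        show ?thesis unfolding eq using m by (subst nn_integral_sum) (auto intro!: sum.cong nn_integral_cmult)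
      qed
      then show ?thesis unfolding V_def by (subst nn_integral_suminf) auto
    qed
    also have "\<dots> \<le> (\<Sum>n. ennreal (C * (1/2) ^ n))"
    proof (rule suminf_le)
      fix n
      have "(\<Sum>k<2 ^ n. ennreal (2 ^ (n * p)) * (\<integral>\<^sup>+ \<omega>. ennreal (D n k \<omega> ^ (8 * p)) \<partial>M))
          \<le> (\<Sum>k<(2::nat) ^ n. ennreal (2 ^ (n * p)) * ennreal (C * (1 / 2 ^ n) ^ (4 * p)))"
        unfolding D_def by (intro sum_mono mult_left_mono mom) auto
      also have "\<dots> = ennreal (2 ^ n * (2 ^ (n * p) * (C * (1 / 2 ^ n) ^ (4 * p))))"
        using C by (simp add: ennreal_mult[symmetric] ennreal_of_nat_eq_real_of_nat)
      also have "\<dots> \<le> ennreal (C * (1/2) ^ n)"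
      proof (rule ennreal_leI)
        have "(2::real) ^ n * 2 ^ (n * p) * 2 ^ n \<le> 2 ^ (n * (4 * p))"
        proof -
          have "n * (p + 2) \<le> n * (4 * p)" using p by (intro mult_le_mono2) simp
          then show ?thesis unfolding power_add[symmetric] by (intro power_increasing) (auto simp: algebra_simps)
        qed
        then have "C * (2 ^ n * 2 ^ (n * p) * 2 ^ n) \<le> C * 2 ^ (n * (4 * p))" using C by (rule mult_left_mono)
        then show "2 ^ n * (2 ^ (n * p) * (C * (1 / 2 ^ n) ^ (4 * p))) \<le> C * (1/2) ^ n"
          by (simp add: power_divide power_mult[symmetric] field_simps)
      qed
      finally show "(\<Sum>k<2 ^ n. ennreal (2 ^ (n * p)) * (\<integral>\<^sup>+ \<omega>. ennreal (D n k \<omega> ^ (8 * p)) \<partial>M)) \<le> ennreal (C * (1/2) ^ n)" .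
    qed auto
    also have "\<dots> = ennreal (C * 2)"
    proof -
      have "(\<lambda>n. C * (1/2) ^ n) sums (C * (1 / (1 - 1/2)))"
        by (intro sums_mult geometric_sums) simp
      then have "(\<Sum>n. ennreal (C * (1/2) ^ n)) = ennreal (C * (1 / (1 - 1/2)))"
        using C by (intro suminf_ennreal_eq) auto
      then show ?thesis by simp
    qed
    finally show ?thesis .
  qed
  then have "(\<integral>\<^sup>+ \<omega>. V \<omega> \<partial>M) \<noteq> \<infinity>" by (auto simp: top_unique)
  then have fin: "AE \<omega> in M. V \<omega> \<noteq> \<infinity>" by (rule nn_integral_PInf_AE[OF Vm])
  obtain c where c: "0 \<le> c" and hoelder: "\<And>(g :: real \<Rightarrow> real^'m) S. continuous_on {0..T} g \<Longrightarrow> 0 \<le> S \<Longrightarrow>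
    (\<forall>n k. k < 2 ^ n \<longrightarrow> norm (g (real (Suc k) * T / 2 ^ n) - g (real k * T / 2 ^ n)) \<le> S * (2 powr (-1/8)) ^ n) \<Longrightarrow>
    (\<forall>s\<in>{0..T}. \<forall>t\<in>{0..T}. norm (g t - g s) \<le> c * S * \<bar>t - s\<bar> powr (1/8))"
    using dyadic_hoelder[OF T, where 'a = "real^'m"] by blast
  \<comment> \<open>Where \<open>V\<close> is infinite, \<open>enn2real\<close> returns 0 and
    \<open>R\<close> bounds nothing; such paths form a null set.\<close>
  define R where "R \<omega> = root (8 * p) (enn2real (V \<omega>))" for \<omega>
  have R: "0 \<le> R \<omega>" "R \<omega> ^ (8 * p) = enn2real (V \<omega>)" for \<omega>
    using p by (auto simp: R_def real_root_pow_pos2)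
  have Rm: "R \<in> borel_measurable M"
    unfolding R_def by (intro borel_measurable_continuous_on[OF continuous_on_real_root[OF continuous_on_id]]) measurable
  have bound: "D n k \<omega> \<le> R \<omega> * (2 powr (-1/8)) ^ n" if "V \<omega> \<noteq> \<infinity>" "k < 2 ^ n" for n k \<omega>
  proof -
    have "ennreal (2 ^ (n * p) * D n k \<omega> ^ (8 * p)) \<le> (\<Sum>k<2 ^ n. ennreal (2 ^ (n * p) * D n k \<omega> ^ (8 * p)))"
      using that by (intro member_le_sum) auto
    also have "\<dots> \<le> V \<omega>"
      unfolding V_def using sum_le_suminf[of "\<lambda>n. \<Sum>k<2 ^ n. ennreal (2 ^ (n * p) * D n k \<omega> ^ (8 * p))" "{n}"] by simp
    finally have "2 ^ (n * p) * D n k \<omega> ^ (8 * p) \<le> enn2real (V \<omega>)"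
      using that(1) by (cases "V \<omega>") (auto simp: ennreal_le_iff D_def)
    then have "2 ^ (n * p) * D n k \<omega> ^ (8 * p) \<le> R \<omega> ^ (8 * p)" by (simp add: R)
    then have "D n k \<omega> ^ (8 * p) \<le> R \<omega> ^ (8 * p) * (1 / 2 ^ (n * p))" by (simp add: field_simps)
    also have "1 / (2::real) ^ (n * p) = ((2 powr (-1/8)) ^ n) ^ (8 * p)"
    proof -
      have "((2 powr (-1/8)) ^ n) ^ (8 * p) = (2::real) powr (- real (n * p))"
        by (simp add: powr_realpow[symmetric] powr_powr)
      also have "\<dots> = 1 / 2 ^ (n * p)" using powr_minus_divide[of 2 "real (n * p)"] powr_realpow[of 2 "n * p"] by simp
      finally show ?thesis by simp
    qed
    also have "R \<omega> ^ (8 * p) * ((2 powr (-1/8)) ^ n) ^ (8 * p) = (R \<omega> * (2 powr (-1/8)) ^ n) ^ (8 * p)"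
      by (simp add: power_mult_distrib)
    finally show ?thesis using R p by (intro power_le_imp_le_base[of "D n k \<omega>" "8 * p - 1"]) auto
  qed
  show ?thesis
  proof (intro exI[of _ "\<lambda>\<omega>. c * R \<omega>"] exI[of _ "c ^ (8 * p) * (C * 2)"] conjI allI)
    show "(\<lambda>\<omega>. c * R \<omega>) \<in> borel_measurable M" using Rm by measurable
    show "0 \<le> c * R \<omega>" for \<omega> using c R by simp
    show "0 \<le> c ^ (8 * p) * (C * 2)" using c C by simp
    have "(\<integral>\<^sup>+ \<omega>. ennreal ((c * R \<omega>) ^ (8 * p)) \<partial>M) = (\<integral>\<^sup>+ \<omega>. ennreal (c ^ (8 * p)) * ennreal (enn2real (V \<omega>)) \<partial>M)"
      using c by (simp add: power_mult_distrib R ennreal_mult)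
    also have "\<dots> = ennreal (c ^ (8 * p)) * (\<integral>\<^sup>+ \<omega>. ennreal (enn2real (V \<omega>)) \<partial>M)"
      by (rule nn_integral_cmult) measurable
    also have "(\<integral>\<^sup>+ \<omega>. ennreal (enn2real (V \<omega>)) \<partial>M) = (\<integral>\<^sup>+ \<omega>. V \<omega> \<partial>M)"
      using fin by (intro nn_integral_cong_AE) (auto elim!: eventually_mono simp: top.not_eq_extremum)
    also have "ennreal (c ^ (8 * p)) * \<dots> \<le> ennreal (c ^ (8 * p)) * ennreal (C * 2)"
      by (intro mult_left_mono EV) simp
    also have "\<dots> = ennreal (c ^ (8 * p) * (C * 2))" using c C by (simp add: ennreal_mult)
    finally show "(\<integral>\<^sup>+ \<omega>. ennreal ((c * R \<omega>) ^ (8 * p)) \<partial>M) \<le> ennreal (c ^ (8 * p) * (C * 2))" .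
    show "AE \<omega> in M. \<forall>s\<in>{0..T}. \<forall>t\<in>{0..T}. norm (f t \<omega> - f s \<omega>) \<le> c * R \<omega> * \<bar>t - s\<bar> powr (1/8)"
      using fin AE_space
    proof eventually_elim
      case (elim \<omega>)
      show ?case
        by (rule hoelder[OF cont[OF elim(2)] R(1)]) (use bound[OF elim(1)] in \<open>auto simp: D_def\<close>)
    qed
  qed
qed

section \<open>Strong order of convergence\<close>

lemma norm_triangle3:
  fixes x y z :: "'a::real_normed_vector"
  shows "norm (x + y + z) \<le> norm x + norm y + norm z"
  by (rule order_trans[OF norm_triangle_ineq add_right_mono[OF norm_triangle_ineq]])

lemma norm_telescope3:
  fixes w x y z :: "'a::real_normed_vector"
  shows "norm (x - w) \<le> norm (x - y) + norm (y - z) + norm (w - z)"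
proof -
  have "norm (x - w) = norm ((x - y) + (y - z) + (z - w))" by simp
  also have "\<dots> \<le> norm (x - y) + norm (y - z) + norm (z - w)" by (rule norm_triangle3)
  finally show ?thesis by (simp only: norm_minus_commute[of z w])
qed

context sde_strong_solution
begin

text \<open>One unit of time beyond \<open>\<tau>\<close>: for \<open>h \<le> 1\<close> the step
  that straddles \<open>\<tau>\<close> still ends by \<open>T\<close>.\<close>

definition T where "T = \<tau> + 1"

lemma T: "1 \<le> T" "\<tau> \<le> T" "0 < T"
  using \<tau>_pos by (auto simp: T_def)

text \<open>The refinement bound is uniform in the number of substeps, and along a subsequence the
  refined schemes converge to \<open>X\<close> almost surely. Fatou's lemma thus gives strong order
  \<open>1/2\<close> with respect to \<open>X\<close> itself.\<close>

lemma euler_strong_order: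
  assumes q: "q \<ge> 1"
  shows "\<exists>C\<ge>0. \<forall>h k. 0 < h \<longrightarrow> h \<le> T \<longrightarrow> real k * h \<le> \<tau> \<longrightarrow>
     moment (2 * q) (\<lambda>\<omega>. X (real k * h) \<omega> - eul h \<omega> k) \<le> ennreal (C * h ^ q)"
proof -
  obtain C where C: "C \<ge> 0" and ref: "\<And>h l k. 0 < h \<Longrightarrow> h \<le> T \<Longrightarrow> 1 \<le> l \<Longrightarrow> real k * h \<le> T \<Longrightarrow>
     moment (2 * q) (\<lambda>\<omega>. eul (h / real l) \<omega> (k * l) - eul h \<omega> k)
       \<le> ennreal (C * h ^ q)"
    using euler_refinement[OF q T(1)] by blast
  show ?thesis
  proof (intro exI[of _ C] conjI allI impI C)
    fix h :: real and k assume h: "0 < h" "h \<le> T" and kh: "real k * h \<le> \<tau>"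
    show "moment (2 * q) (\<lambda>\<omega>. X (real k * h) \<omega> - eul h \<omega> k) \<le> ennreal (C * h ^ q)"
    proof (cases "k = 0")
      case True
      have "moment (2 * q) (\<lambda>\<omega>. X (real k * h) \<omega> - eul h \<omega> k) = (\<integral>\<^sup>+ \<omega>. 0 \<partial>M)"
        using X_initial True q by (intro nn_integral_cong_AE) (auto elim!: eventually_mono simp: power_0_left)
      then show ?thesis by simp
    next
      case False
      define t where "t = real k * h"
      have t: "0 < t" "t \<le> \<tau>" using False h kh by (auto simp: t_def)
      let ?Y = "\<lambda>n \<omega>. eul (h / real (Suc n)) \<omega> (k * Suc n)"
      have fl: "filterlim (\<lambda>n. k * Suc n) at_top sequentially"
        using False by (intro filterlim_subseq) (auto simp: strict_mono_def)
      have eq: "t / real (k * Suc n) = h / real (Suc n)" for n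
        using False unfolding t_def of_nat_mult by (simp del: of_nat_Suc)
      have "conv_in_prob M (\<lambda>n \<omega>. eul (t / real (k * Suc n)) \<omega> (k * Suc n)) (X t)"
        using conv_in_prob_subseq[OF euler_conv_in_prob[OF t] fl] .
      then have conv: "conv_in_prob M ?Y (X t)" unfolding eq .
      have Ym: "?Y n \<in> borel_measurable M" for n using h by (intro euler_measurable_M) auto
      have Xm: "X t \<in> borel_measurable M" using t by (intro X_measurable) auto
      have "\<exists>r :: nat \<Rightarrow> nat. strict_mono r \<and> (AE \<omega> in M. \<forall>i\<in>{()}. (\<lambda>n. ?Y (r n) \<omega>) \<longlonglongrightarrow> X t \<omega>)"
        by (rule conv_in_prob_AE_subseq) (use conv Ym Xm in auto)
      then obtain r :: "nat \<Rightarrow> nat" where r: "AE \<omega> in M. (\<lambda>n. ?Y (r n) \<omega>) \<longlonglongrightarrow> X t \<omega>" by auto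
      have "moment (2 * q) (\<lambda>\<omega>. X t \<omega> - eul h \<omega> k) \<le> ennreal (C * h ^ q)"
      proof (rule nn_integral_le_of_AE_tendsto)
        fix n
        note [measurable] = Ym[of "r n"]
        have [measurable]: "(\<lambda>\<omega>. eul h \<omega> k) \<in> borel_measurable M" using h by (intro euler_measurable_M) auto
        show "(\<lambda>\<omega>. ennreal (norm (?Y (r n) \<omega> - eul h \<omega> k) ^ (2 * q))) \<in> borel_measurable M"
          by measurable
        show "moment (2 * q) (\<lambda>\<omega>. ?Y (r n) \<omega> - eul h \<omega> k) \<le> ennreal (C * h ^ q)"
          using h kh T by (intro ref) auto
      next
        show "AE \<omega> in M. (\<lambda>n. ennreal (norm (?Y (r n) \<omega> - eul h \<omega> k) ^ (2 * q)))
           \<longlonglongrightarrow> ennreal (norm (X t \<omega> - eul h \<omega> k) ^ (2 * q))"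
          using r by eventually_elim (intro tendsto_intros tendsto_ennrealI)
      qed
      then show ?thesis by (simp add: t_def)
    qed
  qed
qed

lemma euler_increment_moment:
  assumes q: "q \<ge> 1"
  shows "\<exists>C\<ge>0. \<forall>h k. 0 < h \<longrightarrow> h \<le> T \<longrightarrow> real k * h \<le> T \<longrightarrow>
     moment (2 * q) (\<lambda>\<omega>. eul h \<omega> (Suc k) - eul h \<omega> k) \<le> ennreal (C * h ^ q)"
proof -
  obtain C1 where C1: "C1 \<ge> 0" and mom: "\<And>h j. 0 < h \<Longrightarrow> h \<le> T \<Longrightarrow> real j * h \<le> T \<Longrightarrow>
     moment (2 * (2 * q)) (\<lambda>\<omega>. eul h \<omega> j) \<le> ennreal C1"
    using euler_moments[of "2 * q" T] q T by auto
  obtain C2 where C2: "C2 \<ge> 0" and disp: "\<And>s t (Z :: _ \<Rightarrow> real^'m). 0 \<le> s \<Longrightarrow> s < t \<Longrightarrow> t - s \<le> T \<Longrightarrow> Z \<in> borel_measurable M \<Longrightarrow>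
     moment (2 * q) (\<lambda>\<omega>. \<sigma> (Z \<omega>) *v (\<omega> t - \<omega> s) + (t - s) *\<^sub>R b (Z \<omega>))
       \<le> ennreal (C2 * (t - s) ^ q) * (1 + moment (2 * (2 * q)) Z)"
    using displacement_moment[OF T(1), of q] by blast
  show ?thesis
  proof (intro exI[of _ "C2 * (1 + C1)"] conjI allI impI)
    show "0 \<le> C2 * (1 + C1)" using C1 C2 by simp
    fix h :: real and k assume h: "0 < h" "h \<le> T" "real k * h \<le> T"
    have d: "real (Suc k) * h - real k * h = h" by (simp add: distrib_right)
    have lt: "real k * h < real (Suc k) * h" using h by simp
    have "moment (2 * q) (\<lambda>\<omega>. eul h \<omega> (Suc k) - eul h \<omega> k)
       \<le> ennreal (C2 * h ^ q) * (1 + moment (2 * (2 * q)) (\<lambda>\<omega>. eul h \<omega> k))"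
      using disp[OF _ lt, of "\<lambda>\<omega>. eul h \<omega> k"] h euler_measurable_M[of h 0 x0 k] unfolding d
      by (simp del: of_nat_Suc)
    also have "\<dots> \<le> ennreal (C2 * h ^ q) * (1 + ennreal C1)"
      by (intro mult_left_mono add_left_mono mom h) auto
    also have "\<dots> = ennreal (C2 * (1 + C1) * h ^ q)"
      using C1 C2 h by (simp add: ennreal_mult ennreal_plus mult_ac)
    finally show "moment (2 * q) (\<lambda>\<omega>. eul h \<omega> (Suc k) - eul h \<omega> k)
       \<le> ennreal (C2 * (1 + C1) * h ^ q)" .
  qed
qed

text \<open>\<open>X\<close> borrows its increments from the Euler scheme with step
  \<open>h\<close>: the strong errors at the two ends and the increment of the scheme are all of
  order \<open>sqrt h\<close>.\<close>

lemma solution_increment_moment: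
  assumes q: "q \<ge> 1"
  shows "\<exists>C\<ge>0. \<forall>h k. 0 < h \<longrightarrow> real (Suc k) * h \<le> \<tau> \<longrightarrow>
     moment (2 * q) (\<lambda>\<omega>. X (real (Suc k) * h) \<omega> - X (real k * h) \<omega>) \<le> ennreal (C * h ^ q)"
proof -
  obtain C1 where C1: "C1 \<ge> 0" and ord: "\<And>h k. 0 < h \<Longrightarrow> h \<le> T \<Longrightarrow> real k * h \<le> \<tau> \<Longrightarrow>
     moment (2 * q) (\<lambda>\<omega>. X (real k * h) \<omega> - eul h \<omega> k) \<le> ennreal (C1 * h ^ q)"
    using euler_strong_order[OF q] by blast
  obtain C2 where C2: "C2 \<ge> 0" and inc: "\<And>h k. 0 < h \<Longrightarrow> h \<le> T \<Longrightarrow> real k * h \<le> T \<Longrightarrow>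
     moment (2 * q) (\<lambda>\<omega>. eul h \<omega> (Suc k) - eul h \<omega> k) \<le> ennreal (C2 * h ^ q)"
    using euler_increment_moment[OF q] by blast
  show ?thesis
  proof (intro exI[of _ "3 ^ (2 * q) * (C1 + C2 + C1)"] conjI allI impI)
    show "0 \<le> 3 ^ (2 * q) * (C1 + C2 + C1)" using C1 C2 by simp
    fix h :: real and k assume h: "0 < h" "real (Suc k) * h \<le> \<tau>"
    have k0: "0 \<le> real k * h" using h by simp
    have "real (Suc k) * h = real k * h + h" by (simp add: distrib_right)
    then have b': "h \<le> \<tau>" "real k * h \<le> \<tau>" "h \<le> T" "real k * h \<le> T" "0 \<le> real (Suc k) * h" using h k0 T by linarith+
    define a where "a \<omega> = norm (X (real (Suc k) * h) \<omega> - eul h \<omega> (Suc k))" for \<omega>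
    define c where "c \<omega> = norm (eul h \<omega> (Suc k) - eul h \<omega> k)" for \<omega>
    define d where "d \<omega> = norm (X (real k * h) \<omega> - eul h \<omega> k)" for \<omega>
    have [measurable]: "X (real (Suc k) * h) \<in> borel_measurable M" "X (real k * h) \<in> borel_measurable M"
      using h b' k0 by (auto intro!: X_measurable)
    have [measurable]: "(\<lambda>\<omega>. eul h \<omega> j) \<in> borel_measurable M" for j using h by (intro euler_measurable_M) auto
    have "moment (2 * q) (\<lambda>\<omega>. X (real (Suc k) * h) \<omega> - X (real k * h) \<omega>)
      \<le> ennreal (3 ^ (2 * q)) * ((\<integral>\<^sup>+ \<omega>. ennreal (a \<omega> ^ (2 * q)) \<partial>M) + (\<integral>\<^sup>+ \<omega>. ennreal (c \<omega> ^ (2 * q)) \<partial>M) + (\<integral>\<^sup>+ \<omega>. ennreal (d \<omega> ^ (2 * q)) \<partial>M))"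
    proof (rule nn_integral_power_sum3)
      show "a \<in> borel_measurable M" "c \<in> borel_measurable M" "d \<in> borel_measurable M"
        unfolding a_def c_def d_def by (measurable)
      show "AE \<omega> in M. 0 \<le> norm (X (real (Suc k) * h) \<omega> - X (real k * h) \<omega>) \<and> norm (X (real (Suc k) * h) \<omega> - X (real k * h) \<omega>) \<le> a \<omega> + c \<omega> + d \<omega>"
        unfolding a_def c_def d_def by (intro AE_I2 conjI norm_ge_zero norm_telescope3)
    qed (auto simp: a_def c_def d_def)
    also have "\<dots> \<le> ennreal (3 ^ (2 * q)) * (ennreal (C1 * h ^ q) + ennreal (C2 * h ^ q) + ennreal (C1 * h ^ q))"
      unfolding a_def c_def d_def using h b' by (intro mult_left_mono add_mono ord inc) auto
    also have "\<dots> = ennreal (3 ^ (2 * q) * (C1 + C2 + C1) * h ^ q)"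
      using C1 C2 h by (simp add: ennreal_mult[symmetric] ennreal_plus[symmetric] algebra_simps del: ennreal_plus)
    finally show "moment (2 * q) (\<lambda>\<omega>. X (real (Suc k) * h) \<omega> - X (real k * h) \<omega>)
      \<le> ennreal (3 ^ (2 * q) * (C1 + C2 + C1) * h ^ q)" .
  qed
qed

lemma solution_hoelder:
  assumes p: "1 \<le> p"
  shows "\<exists>S C. S \<in> borel_measurable M \<and> (\<forall>\<omega>. 0 \<le> S \<omega>) \<and> 0 \<le> C \<and> (\<integral>\<^sup>+ \<omega>. ennreal (S \<omega> ^ (8 * p)) \<partial>M) \<le> ennreal C \<and>
    (AE \<omega> in M. \<forall>s\<in>{0..\<tau>}. \<forall>t\<in>{0..\<tau>}. norm (X t \<omega> - X s \<omega>) \<le> S \<omega> * \<bar>t - s\<bar> powr (1/8))"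
proof -
  obtain C where C: "C \<ge> 0" and inc: "\<And>h k. 0 < h \<Longrightarrow> real (Suc k) * h \<le> \<tau> \<Longrightarrow>
     moment (2 * (4 * p)) (\<lambda>\<omega>. X (real (Suc k) * h) \<omega> - X (real k * h) \<omega>) \<le> ennreal (C * h ^ (4 * p))"
    using solution_increment_moment[of "4 * p"] p by auto
  show ?thesis
  proof (rule kolmogorov_hoelder[OF \<tau>_pos p, of "C * \<tau> ^ (4 * p)"])
    show "0 \<le> C * \<tau> ^ (4 * p)" using C \<tau>_pos by simp
    fix n k :: nat assume k: "k < 2 ^ n"
    have "real (Suc k) \<le> real (2 ^ n)" using k by (intro of_nat_mono) simp
    then have "real (Suc k) * (\<tau> / 2 ^ n) \<le> 2 ^ n * (\<tau> / 2 ^ n)" using \<tau>_pos by (intro mult_right_mono) auto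
    then have "real (Suc k) * (\<tau> / 2 ^ n) \<le> \<tau>" by simp
    from inc[OF _ this] show "moment (8 * p) (\<lambda>\<omega>. X (real (Suc k) * \<tau> / 2 ^ n) \<omega> - X (real k * \<tau> / 2 ^ n) \<omega>)
       \<le> ennreal (C * \<tau> ^ (4 * p) * (1 / 2 ^ n) ^ (4 * p))"
      using \<tau>_pos by (simp add: power_divide del: of_nat_Suc)
  qed (use X_measurable X_continuous in auto)
qed

text \<open>The same criterion for the driving path, with eighth moments. It gives the pathwise
  control of Brownian increments over arbitrary steps on which the almost sure comparison
  rests.\<close>

lemma wiener_hoelder:
  "\<exists>S. (\<forall>\<omega>. 0 \<le> S \<omega>) \<and>
    (AE \<omega> in M. \<forall>s\<in>{0..T}. \<forall>t\<in>{0..T}. norm (\<omega> t - \<omega> s) \<le> S \<omega> * \<bar>t - s\<bar> powr (1/8))"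
proof -
  obtain C where C: "C \<ge> 0" and mom: "\<And>s t. 0 \<le> s \<Longrightarrow> s < t \<Longrightarrow>
     (\<integral>\<^sup>+ \<omega>. ennreal ((1 + norm (\<omega> t - \<omega> s) / sqrt (t - s)) ^ (2 * 4)) \<partial>M) \<le> ennreal C"
    using increment_moment[of 4] by blast
  have inc: "moment 8 (\<lambda>\<omega>. \<omega> t - \<omega> s) \<le> ennreal (C * (t - s) ^ 4)" if st: "0 \<le> s" "s < t" for s t
  proof -
    have pw: "norm (\<omega> t - \<omega> s) ^ 8 \<le> (t - s) ^ 4 * (1 + norm (\<omega> t - \<omega> s) / sqrt (t - s)) ^ 8" for \<omega> :: "real \<Rightarrow> real^'d"
    proof -
      have "norm (\<omega> t - \<omega> s) \<le> sqrt (t - s) * (1 + norm (\<omega> t - \<omega> s) / sqrt (t - s))"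
        using st by (simp add: distrib_left)
      then have "norm (\<omega> t - \<omega> s) ^ 8 \<le> (sqrt (t - s) * (1 + norm (\<omega> t - \<omega> s) / sqrt (t - s))) ^ 8"
        by (intro power_mono) auto
      also have "\<dots> = (t - s) ^ 4 * (1 + norm (\<omega> t - \<omega> s) / sqrt (t - s)) ^ 8"
      proof -
        have "sqrt (t - s) ^ 8 = ((sqrt (t - s))\<^sup>2) ^ 4" by (simp add: power_mult[symmetric])
        then show ?thesis using st by (simp add: power_mult_distrib)
      qed
      finally show ?thesis .
    qed
    have "moment 8 (\<lambda>\<omega>. \<omega> t - \<omega> s)
        \<le> (\<integral>\<^sup>+ \<omega>. ennreal ((t - s) ^ 4) * ennreal ((1 + norm (\<omega> t - \<omega> s) / sqrt (t - s)) ^ 8) \<partial>M)"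
      using st by (intro nn_integral_mono) (auto simp: ennreal_mult[symmetric] intro!: ennreal_leI pw)
    also have "\<dots> = ennreal ((t - s) ^ 4) * (\<integral>\<^sup>+ \<omega>. ennreal ((1 + norm (\<omega> t - \<omega> s) / sqrt (t - s)) ^ 8) \<partial>M)"
    proof (rule nn_integral_cmult)
      have [measurable]: "(\<lambda>\<omega>. norm (\<omega> t - \<omega> s)) \<in> borel_measurable M"
        by (intro borel_measurable_norm[THEN measurable_compose[rotated]] borel_measurable_diff eval_measurable)
      show "(\<lambda>\<omega>. ennreal ((1 + norm (\<omega> t - \<omega> s) / sqrt (t - s)) ^ 8)) \<in> borel_measurable M" by measurable
    qed
    also have "\<dots> \<le> ennreal ((t - s) ^ 4) * ennreal C"
      using mom[OF st] by (intro mult_left_mono) auto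
    also have "\<dots> = ennreal (C * (t - s) ^ 4)" using C st by (simp add: ennreal_mult[symmetric] mult.commute)
    finally show ?thesis .
  qed
  have "\<exists>S C'. S \<in> borel_measurable M \<and> (\<forall>\<omega>. 0 \<le> S \<omega>) \<and> 0 \<le> C' \<and> (\<integral>\<^sup>+ \<omega>. ennreal (S \<omega> ^ (8 * 1)) \<partial>M) \<le> ennreal C' \<and>
    (AE \<omega> in M. \<forall>s\<in>{0..T}. \<forall>t\<in>{0..T}. norm (\<omega> t - \<omega> s) \<le> S \<omega> * \<bar>t - s\<bar> powr (1/8))"
  proof (rule kolmogorov_hoelder[OF T(3) order_refl, where C = "C * T ^ 4" and f = "\<lambda>t \<omega>. \<omega> t"])
    show "0 \<le> C * T ^ 4" using C T by simp
    fix n k :: nat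
    have d: "real (Suc k) * T / 2 ^ n - real k * T / 2 ^ n = T * (1 / 2 ^ n)"
      by (simp add: field_simps)
    have "real k * T / 2 ^ n < real (Suc k) * T / 2 ^ n" using T by (intro divide_strict_right_mono mult_strict_right_mono) auto
    from inc[OF _ this] show "moment (8 * 1) (\<lambda>\<omega>. \<omega> (real (Suc k) * T / 2 ^ n) - \<omega> (real k * T / 2 ^ n))
       \<le> ennreal (C * T ^ 4 * (1 / 2 ^ n) ^ (4 * 1))"
      unfolding d using T by (simp add: power_mult_distrib power_divide del: of_nat_Suc)
  next
    fix \<omega> assume "\<omega> \<in> space M"
    then show "continuous_on {0..T} \<omega>" using T by (auto simp: wiener_paths_def intro: continuous_on_subset)
  qed (use eval_measurable in auto)
  then show ?thesis by blast
qed

end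

text \<open>For \<open>h \<le> 1\<close> the weight \<open>hpow h \<alpha>\<close> is replaced by
  \<open>h powr \<gamma>\<close>, which covers infinite \<alpha> as well. With
  \<open>\<gamma> \<le> 1/8\<close> this rate also dominates the Hoelder modulus
  \<open>h powr (1/8)\<close> of the paths and the typical size \<open>sqrt h\<close> of Brownian
  increments, so it governs both parts of the bound on \<open>\<eta>\<close>.\<close>

locale perturbed_euler_scheme = sde_strong_solution M b \<sigma> K x0 \<tau> X
  for M :: "(real \<Rightarrow> real^'d::finite) measure" and b :: "real^'m::finite \<Rightarrow> real^'m" and \<sigma> and K and x0 and \<tau> and X +
  fixes \<eta> :: "real \<Rightarrow> real^'m \<Rightarrow> real^'d \<Rightarrow> real^'m" and \<gamma> :: real
  assumes \<gamma>: "0 < \<gamma>" "\<gamma> \<le> 1/8"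
    and \<eta>_measurable: "0 < h \<Longrightarrow> (\<lambda>(x, y). \<eta> h x y) \<in> borel_measurable borel"
    and \<eta>_bound: "0 < h \<Longrightarrow> h \<le> 1 \<Longrightarrow> norm (\<eta> h x y) \<le> K * (h powr \<gamma> * norm x + norm y)"
begin

abbreviation scheme :: "real \<Rightarrow> (real \<Rightarrow> real^'d) \<Rightarrow> nat \<Rightarrow> real^'m" where
  "scheme h \<omega> k \<equiv> Xgrid b \<sigma> \<eta> h x0 \<omega> k"

abbreviation interp :: "real \<Rightarrow> (real \<Rightarrow> real^'d) \<Rightarrow> real \<Rightarrow> real^'m" where
  "interp h \<omega> t \<equiv> Xbar b \<sigma> \<eta> h x0 \<omega> t"

lemma Xgrid_measurable:
  assumes h: "0 < h"
  shows "(\<lambda>\<omega>. scheme h \<omega> k) \<in> borel_measurable (nat_filtration (real k * h))"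
proof (induction k)
  case (Suc k)
  have t: "real k * h \<le> real (Suc k) * h" using h by (intro mult_right_mono) auto
  note [measurable] = measurable_nat_filtration_mono[OF Suc t] nat_filtration_eval[OF t] nat_filtration_eval[OF order_refl[of "real (Suc k) * h"]]
  have [measurable]: "(\<lambda>\<omega>. \<eta> h (scheme h \<omega> k) (\<omega> (real (Suc k) * h) - \<omega> (real k * h))) \<in> borel_measurable (nat_filtration (real (Suc k) * h))"
  proof -
    have "(\<lambda>\<omega>. (scheme h \<omega> k, \<omega> (real (Suc k) * h) - \<omega> (real k * h)))
       \<in> measurable (nat_filtration (real (Suc k) * h)) borel"
      unfolding borel_prod[symmetric] by measurable
    from measurable_compose[OF this \<eta>_measurable[OF h]] show ?thesis by simp
  qed
  show ?case unfolding Xgrid.simps U_step_def by measurable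
qed simp

lemma Xgrid_measurable_M: "0 < h \<Longrightarrow> (\<lambda>\<omega>. scheme h \<omega> k) \<in> borel_measurable M"
  by (rule measurable_from_filtration[OF Xgrid_measurable])

text \<open>In the bound on \<open>\<eta>\<close> the state is split into error plus Euler iterate:
  the error is absorbed by the recursion, the iterate becomes forcing of size
  \<open>h powr \<gamma>\<close>. The part \<open>norm y\<close> equals
  \<open>sqrt h * (norm y / sqrt h)\<close>, which is forcing of size \<open>sqrt h\<close> in the
  form that \<open>euler_type\<close> admits.\<close>

lemma Xgrid_euler_moment:
  assumes q: "q \<ge> 1"
  shows "\<exists>C\<ge>0. \<forall>h k. 0 < h \<longrightarrow> h \<le> 1 \<longrightarrow> real k * h \<le> T \<longrightarrow>
     moment (2 * q) (\<lambda>\<omega>. scheme h \<omega> k - eul h \<omega> k) \<le> ennreal (C * (h powr \<gamma>) ^ (2 * q))"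
proof -
  \<comment> \<open>One \<open>K\<close> for the Lipschitz bound of the drift and one for
    \<open>\<eta>\<close>.\<close>
  define L where "L = 2 * K"
  have L: "0 \<le> L" and K0: "0 \<le> K" using K1 by (auto simp: L_def)
  obtain C where C: "C \<ge> 0" and it: "\<And>s \<delta> N (e :: nat \<Rightarrow> _ \<Rightarrow> real^'m) A g \<gamma> a. 0 \<le> s \<Longrightarrow> 0 < \<delta> \<Longrightarrow> \<delta> \<le> T \<Longrightarrow>
     euler_type L s \<delta> N e A g \<Longrightarrow> (\<forall>a<N. (\<integral>\<^sup>+ \<omega>. ennreal (g a \<omega> ^ (2 * q)) \<partial>M) \<le> \<gamma>) \<Longrightarrow> a \<le> N \<Longrightarrow>
     moment (2 * q) (e a) + \<gamma>
        \<le> ennreal (exp (C * (real a * \<delta>))) * (moment (2 * q) (e 0) + \<gamma>)"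
    using moment_iterate[OF q T(1) L, where 'm = 'm] by blast
  obtain C1 where C1: "C1 \<ge> 0" and mom: "\<And>h j. 0 < h \<Longrightarrow> h \<le> T \<Longrightarrow> real j * h \<le> T \<Longrightarrow>
     moment (2 * q) (\<lambda>\<omega>. eul h \<omega> j) \<le> ennreal C1"
    using euler_moments[OF q T(1)] by blast
  define C2 where "C2 = 3 ^ (2 * q) * (C1 + 1)"
  have C2: "0 \<le> C2" using C1 by (simp add: C2_def)
  show ?thesis
  proof (intro exI[of _ "exp (C * T) * C2"] conjI allI impI)
    show "0 \<le> exp (C * T) * C2" using C2 by simp
    fix h :: real and k assume h: "0 < h" "h \<le> 1" and kh: "real k * h \<le> T"
    have hT: "h \<le> T" using h T by linarith
    define u where "u = h powr \<gamma>"
    have u: "0 \<le> u" "u \<le> 1" "sqrt h \<le> u"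
    proof -
      show "0 \<le> u" "u \<le> 1" using h \<gamma> by (auto simp: u_def powr_le1)
      have "sqrt h = h powr (1/2)" using h by (simp add: powr_half_sqrt)
      also have "\<dots> \<le> h powr \<gamma>" using h \<gamma> by (intro powr_mono') auto
      finally show "sqrt h \<le> u" by (simp add: u_def)
    qed
    define P where "P a \<omega> = scheme h \<omega> a" for a \<omega>
    define Y where "Y a \<omega> = eul h \<omega> a" for a \<omega>
    define e where "e a \<omega> = P a \<omega> - Y a \<omega>" for a \<omega>
    define g where "g a \<omega> = u * norm (Y a \<omega>) + sqrt h" for a \<omega>
    have Pm: "P a \<in> borel_measurable (nat_filtration (0 + real a * h))" for a
      unfolding P_def using Xgrid_measurable[OF h(1), of a] by simp
    have Ym: "Y a \<in> borel_measurable (nat_filtration (0 + real a * h))" for a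
      unfolding Y_def using euler_measurable[of h 0 x0 a] h by simp
    have g0: "0 \<le> g a \<omega>" for a \<omega> using u h by (simp add: g_def)
    have et: "euler_type L 0 h k e (\<lambda>a \<omega>. \<sigma> (P a \<omega>) - \<sigma> (Y a \<omega>)) g"
    proof (rule euler_typeI[OF L h(1), where c = "\<lambda>a \<omega>. b (P a \<omega>) - b (Y a \<omega>) + \<eta> h (P a \<omega>) (\<omega> (real (Suc a) * h) - \<omega> (real a * h))"])
      fix a
      note [measurable] = Pm[of a] Ym[of a]
      show "e a \<in> borel_measurable (nat_filtration (0 + real a * h))" unfolding e_def by measurable
      show "(\<lambda>\<omega>. \<sigma> (P a \<omega>) - \<sigma> (Y a \<omega>)) \<in> borel_measurable (nat_filtration (0 + real a * h))" by measurable
      show "g a \<in> borel_measurable (nat_filtration (0 + real a * h))" unfolding g_def by measurable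
      fix \<omega> :: "real \<Rightarrow> real^'d"
      define y where "y = \<omega> (real (Suc a) * h) - \<omega> (real a * h)"
      have le: "K * norm (P a \<omega> - Y a \<omega>) \<le> K * (norm (e a \<omega>) + norm (e 0 \<omega>) + g a \<omega>)"
        using K0 g0[of a \<omega>] unfolding e_def by (intro mult_left_mono) auto
      have S0: "0 \<le> norm (e a \<omega>) + norm (e 0 \<omega>) + g a \<omega>" using g0[of a \<omega>] by (intro add_nonneg_nonneg) auto
      show "norm (\<sigma> (P a \<omega>) - \<sigma> (Y a \<omega>)) \<le> L * (norm (e a \<omega>) + norm (e 0 \<omega>) + g a \<omega>)"
        unfolding L_def using order_trans[OF \<sigma>_lip le] mult_nonneg_nonneg[OF K0 S0] by linarith
      have "norm (\<eta> h (P a \<omega>) y) \<le> K * (u * norm (P a \<omega>) + norm y)"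
        unfolding u_def by (rule \<eta>_bound[OF h])
      also have "\<dots> \<le> K * ((norm (e a \<omega>) + norm (e 0 \<omega>) + g a \<omega>) * (1 + norm y / sqrt h))"
      proof (rule mult_left_mono[OF _ K0])
        have "norm (P a \<omega>) \<le> norm (e a \<omega>) + norm (Y a \<omega>)"
          unfolding e_def using norm_triangle_ineq[of "P a \<omega> - Y a \<omega>" "Y a \<omega>"] by simp
        then have "u * norm (P a \<omega>) \<le> u * (norm (e a \<omega>) + norm (Y a \<omega>))" using u by (intro mult_left_mono) auto
        also have "\<dots> \<le> norm (e a \<omega>) + u * norm (Y a \<omega>)"
          using u mult_right_mono[OF u(2), of "norm (e a \<omega>)"] by (simp add: distrib_left)
        finally have "u * norm (P a \<omega>) \<le> norm (e a \<omega>) + norm (e 0 \<omega>) + g a \<omega>"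
          using h norm_ge_zero[of "e 0 \<omega>"] real_sqrt_ge_zero[of h] unfolding g_def by linarith
        moreover have "norm y \<le> (norm (e a \<omega>) + norm (e 0 \<omega>) + g a \<omega>) * (norm y / sqrt h)"
        proof -
          have "norm y = sqrt h * (norm y / sqrt h)" using h by simp
          also have "\<dots> \<le> (norm (e a \<omega>) + norm (e 0 \<omega>) + g a \<omega>) * (norm y / sqrt h)"
            using h u by (intro mult_right_mono) (auto simp: g_def add_increasing)
          finally show ?thesis .
        qed
        ultimately show "u * norm (P a \<omega>) + norm y \<le> (norm (e a \<omega>) + norm (e 0 \<omega>) + g a \<omega>) * (1 + norm y / sqrt h)"
          by (simp add: distrib_left)
      qed
      finally have eta: "norm (\<eta> h (P a \<omega>) y) \<le> K * ((norm (e a \<omega>) + norm (e 0 \<omega>) + g a \<omega>) * (1 + norm y / sqrt h))" .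
      have "norm (b (P a \<omega>) - b (Y a \<omega>)) \<le> K * (norm (e a \<omega>) + norm (e 0 \<omega>) + g a \<omega>) * (1 + norm y / sqrt h)"
        by (rule le_mult_one_plus[OF order_trans[OF b_lip le]]) (use h K0 S0 in auto)
      then have "norm (b (P a \<omega>) - b (Y a \<omega>) + \<eta> h (P a \<omega>) y) \<le> L * (norm (e a \<omega>) + norm (e 0 \<omega>) + g a \<omega>) * (1 + norm y / sqrt h)"
        using eta norm_triangle_ineq[of "b (P a \<omega>) - b (Y a \<omega>)" "\<eta> h (P a \<omega>) y"] unfolding L_def by (simp only: mult.assoc)
      then show "norm (b (P a \<omega>) - b (Y a \<omega>) + \<eta> h (P a \<omega>) (\<omega> (real (Suc a) * h) - \<omega> (real a * h)))
          \<le> L * (norm (e a \<omega>) + norm (e 0 \<omega>) + g a \<omega>)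
          * (1 + norm (\<omega> (0 + real (Suc a) * h) - \<omega> (0 + real a * h)) / sqrt h)"
        by (simp add: y_def)
      show "e (Suc a) \<omega> = e a \<omega> + (\<sigma> (P a \<omega>) - \<sigma> (Y a \<omega>)) *v (\<omega> (0 + real (Suc a) * h) - \<omega> (0 + real a * h))
          + h *\<^sub>R (b (P a \<omega>) - b (Y a \<omega>) + \<eta> h (P a \<omega>) (\<omega> (real (Suc a) * h) - \<omega> (real a * h)))"
        unfolding e_def P_def Y_def by (simp add: U_step_def algebra_simps)
    qed (use g0 in auto)
    have Eg: "\<forall>a<k. (\<integral>\<^sup>+ \<omega>. ennreal (g a \<omega> ^ (2 * q)) \<partial>M) \<le> ennreal (C2 * u ^ (2 * q))"
    proof (intro allI impI)
      fix a assume a: "a < k"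
      then have "real a * h \<le> real k * h" using h by (intro mult_right_mono) auto
      then have ah: "real a * h \<le> T" using kh by linarith
      note [measurable] = measurable_from_filtration[OF Ym[of a]]
      have "(\<integral>\<^sup>+ \<omega>. ennreal (g a \<omega> ^ (2 * q)) \<partial>M)
        \<le> ennreal (3 ^ (2 * q)) * ((\<integral>\<^sup>+ \<omega>. ennreal ((u * norm (Y a \<omega>)) ^ (2 * q)) \<partial>M) + (\<integral>\<^sup>+ \<omega>. ennreal (u ^ (2 * q)) \<partial>M) + (\<integral>\<^sup>+ \<omega>. ennreal (0 ^ (2 * q)) \<partial>M))"
        by (rule nn_integral_power_sum3) (use u g0 in \<open>auto simp: g_def\<close>)
      also have "(\<integral>\<^sup>+ \<omega>. ennreal ((u * norm (Y a \<omega>)) ^ (2 * q)) \<partial>M) = ennreal (u ^ (2 * q)) * moment (2 * q) (Y a)"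
        using u by (simp add: power_mult_distrib ennreal_mult nn_integral_cmult)
      also have "\<dots> \<le> ennreal (u ^ (2 * q)) * ennreal C1"
        unfolding Y_def using h hT ah by (intro mult_left_mono mom) auto
      also have "(\<integral>\<^sup>+ \<omega>. ennreal (u ^ (2 * q)) \<partial>M) = ennreal (u ^ (2 * q))" by (simp add: emeasure_space_1[unfolded space_M])
      also have "(\<integral>\<^sup>+ \<omega>. ennreal (0 ^ (2 * q)) \<partial>M) = 0" using q by (simp add: power_0_left)
      also have "ennreal (3 ^ (2 * q)) * (ennreal (u ^ (2 * q)) * ennreal C1 + ennreal (u ^ (2 * q)) + 0) = ennreal (C2 * u ^ (2 * q))"
        using u C1 by (simp add: C2_def ennreal_mult[symmetric] ennreal_plus[symmetric] algebra_simps del: ennreal_plus)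
      finally show "(\<integral>\<^sup>+ \<omega>. ennreal (g a \<omega> ^ (2 * q)) \<partial>M) \<le> ennreal (C2 * u ^ (2 * q))"
        by (simp add: mult_left_mono add_mono)
    qed
    have "moment (2 * q) (e k) + ennreal (C2 * u ^ (2 * q))
      \<le> ennreal (exp (C * (real k * h))) * (moment (2 * q) (e 0) + ennreal (C2 * u ^ (2 * q)))"
      by (rule it[OF order_refl h(1) hT et Eg order_refl])
    also have "moment (2 * q) (e 0) = 0"
      using q by (simp add: e_def P_def Y_def power_0_left)
    also have "ennreal (exp (C * (real k * h))) * (0 + ennreal (C2 * u ^ (2 * q))) \<le> ennreal (exp (C * T)) * ennreal (C2 * u ^ (2 * q))"
      using C kh by (simp, intro mult_right_mono ennreal_leI) (auto intro!: mult_left_mono)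
    also have "\<dots> = ennreal (exp (C * T) * C2 * (h powr \<gamma>) ^ (2 * q))"
      using C2 u by (simp add: u_def ennreal_mult[symmetric] mult.assoc)
    finally show "moment (2 * q) (\<lambda>\<omega>. scheme h \<omega> k - eul h \<omega> k)
        \<le> ennreal (exp (C * T) * C2 * (h powr \<gamma>) ^ (2 * q))"
      unfolding e_def P_def Y_def by (rule order_trans[rotated]) simp
  qed
qed

end

section \<open>Convergence in mean\<close>

text \<open>Split at the threshold \<open>h powr (1 / Q)\<close>: below it the first summand
  suffices, above it the quotient of \<open>x\<close> by the threshold exceeds 1, so its power
  \<open>p\<close> is at most its power \<open>Q\<close>. For a variable whose moment of order
  \<open>Q\<close> is of order \<open>h\<close>, this yields a moment of order \<open>p\<close> that
  is at most of order \<open>h powr (p / Q)\<close>.\<close>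

lemma powr_le_interpolation:
  fixes x h p :: real
  assumes "0 \<le> x" "0 < h" "0 < p" "p \<le> real Q"
  shows "x powr p \<le> h powr (p / real Q) * (1 + x ^ Q / h)"
proof -
  define \<epsilon> where "\<epsilon> = h powr (1 / real Q)"
  have Q: "0 < real Q" using assms by linarith
  have \<epsilon>: "0 < \<epsilon>" "\<epsilon> powr p = h powr (p / real Q)" "\<epsilon> ^ Q = h"
    using assms Q by (auto simp: \<epsilon>_def powr_powr powr_realpow[symmetric])
  show ?thesis
  proof (cases "x \<le> \<epsilon>")
    case True
    then have "x powr p \<le> h powr (p / real Q) * 1" using assms by (simp add: \<epsilon>(2)[symmetric] powr_mono2)
    also have "\<dots> \<le> h powr (p / real Q) * (1 + x ^ Q / h)" using assms by (intro mult_left_mono) auto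
    finally show ?thesis .
  next
    case False
    then have x: "1 \<le> x / \<epsilon>" "0 < x" using \<epsilon>(1) by auto
    have "(x / \<epsilon>) powr p \<le> (x / \<epsilon>) powr real Q" using x assms by (intro powr_mono) auto
    also have "\<dots> = x ^ Q / h" using x \<epsilon> by (simp add: powr_realpow power_divide)
    finally have "\<epsilon> powr p * (x / \<epsilon>) powr p \<le> \<epsilon> powr p * (1 + x ^ Q / h)" by (intro mult_left_mono) auto
    moreover have "\<epsilon> powr p * (x / \<epsilon>) powr p = x powr p" using x \<epsilon>(1) by (simp add: powr_divide)
    ultimately show ?thesis by (simp only: \<epsilon>(2))
  qed
qed

lemma SUP_bounds:
  fixes u :: "'a \<Rightarrow> real"
  assumes "A \<noteq> {}" "\<And>t. t \<in> A \<Longrightarrow> 0 \<le> u t" "\<And>t. t \<in> A \<Longrightarrow> u t \<le> B"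
  shows "0 \<le> (SUP t\<in>A. u t)" "(SUP t\<in>A. u t) \<le> B"
proof -
  obtain t where t: "t \<in> A" using assms by blast
  have "bdd_above (u ` A)" using assms by (intro bdd_aboveI[of _ B]) auto
  then have "u t \<le> (SUP t\<in>A. u t)" using t by (rule cSUP_upper[rotated])
  then show "0 \<le> (SUP t\<in>A. u t)" using assms(2)[OF t] by linarith
  show "(SUP t\<in>A. u t) \<le> B" using assms by (intro cSUP_least) auto
qed

context perturbed_euler_scheme
begin

text \<open>The comparison takes place at the grid point to the left of \<open>t\<close>: the right
  neighbour may lie beyond \<open>\<tau>\<close>, where nothing is known about \<open>X\<close>. The
  interpolation then costs at most one step of the scheme.\<close>

lemma Xbar_error:
  assumes h: "0 < h" and t: "0 \<le> t" "t \<le> \<tau>"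
  shows "\<exists>k\<le>nat \<lfloor>\<tau> / h\<rfloor>. real k * h \<le> t \<and> t \<le> real k * h + h \<and>
    norm (X t \<omega> - interp h \<omega> t) \<le> norm (X t \<omega> - X (real k * h) \<omega>) + norm (X (real k * h) \<omega> - scheme h \<omega> k)
      + norm (scheme h \<omega> (Suc k) - scheme h \<omega> k)"
proof -
  define k where "k = nat \<lfloor>t / h\<rfloor>"
  define P where "P = scheme h \<omega> k"
  define D where "D = scheme h \<omega> (Suc k) - P"
  define c where "c = (t - real k * h) / h"
  have th: "0 \<le> t / h" using h t by simp
  then have "real k \<le> t / h" "t / h \<le> real k + 1" unfolding k_def by linarith+
  then have k: "real k * h \<le> t" "t \<le> real k * h + h" using h by (auto simp: field_simps)
  have "t / h \<le> \<tau> / h" using h t by (intro divide_right_mono) auto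
  then have kN: "k \<le> nat \<lfloor>\<tau> / h\<rfloor>" unfolding k_def by (intro nat_mono floor_mono)
  have c: "0 \<le> c" "c \<le> 1" using k h by (auto simp: c_def divide_le_eq)
  have "norm (X t \<omega> - interp h \<omega> t) = norm ((X t \<omega> - X (real k * h) \<omega>) + (X (real k * h) \<omega> - P) - c *\<^sub>R D)"
    unfolding Xbar_def Let_def k_def[symmetric] P_def c_def D_def by (simp del: Xgrid.simps add: diff_diff_eq)
  also have "\<dots> \<le> norm (X t \<omega> - X (real k * h) \<omega>) + norm (X (real k * h) \<omega> - P) + norm (c *\<^sub>R D)"
    by (intro order_trans[OF norm_triangle_ineq4] add_right_mono norm_triangle_ineq)
  also have "norm (c *\<^sub>R D) \<le> norm D" using c by (simp add: mult_left_le_one_le)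
  finally show ?thesis using k kN unfolding P_def D_def by (intro exI[of _ k]) auto
qed

text \<open>A maximum over the grid is at most the root \<open>rt\<close> of the sum of the powers
  \<open>2 * q\<close>. The sums have about \<open>\<tau> / h\<close> terms; the hypotheses on
  \<open>p\<close> make every term of order \<open>h\<^sup>2\<close>, so a factor \<open>h\<close>
  survives. \<open>B\<close> is a measurable majorant of the error, which avoids discussing the
  measurability of the supremum.\<close>

lemma moment_sup_error:
  assumes p: "1 \<le> p" "2 \<le> \<gamma> * real (8 * p)"
  shows "\<exists>C\<ge>0. \<forall>h. 0 < h \<longrightarrow> h \<le> 1 \<longrightarrow>
    (\<exists>B. B \<in> borel_measurable M \<and> (\<forall>\<omega>. 0 \<le> B \<omega>) \<and> (\<integral>\<^sup>+ \<omega>. ennreal (B \<omega> ^ (8 * p)) \<partial>M) \<le> ennreal (C * h) \<and>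
      (AE \<omega> in M. \<forall>t\<in>{0..\<tau>}. norm (X t \<omega> - interp h \<omega> t) \<le> B \<omega>))"
proof -
  define q where "q = 4 * p"
  have q: "q \<ge> 1" "2 * q = 8 * p" "2 \<le> q" using p by (auto simp: q_def)
  obtain S CS where S: "S \<in> borel_measurable M" "\<And>\<omega>. 0 \<le> S \<omega>" "0 \<le> CS" "(\<integral>\<^sup>+ \<omega>. ennreal (S \<omega> ^ (8 * p)) \<partial>M) \<le> ennreal CS"
    "AE \<omega> in M. \<forall>s\<in>{0..\<tau>}. \<forall>t\<in>{0..\<tau>}. norm (X t \<omega> - X s \<omega>) \<le> S \<omega> * \<bar>t - s\<bar> powr (1/8)"
    using solution_hoelder[OF p(1)] by blast
  obtain C1 where C1: "C1 \<ge> 0" and ord: "\<And>h k. 0 < h \<Longrightarrow> h \<le> T \<Longrightarrow> real k * h \<le> \<tau> \<Longrightarrow>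
     moment (2 * q) (\<lambda>\<omega>. X (real k * h) \<omega> - eul h \<omega> k) \<le> ennreal (C1 * h ^ q)"
    using euler_strong_order[OF q(1)] by blast
  obtain C2 where C2: "C2 \<ge> 0" and inc: "\<And>h k. 0 < h \<Longrightarrow> h \<le> T \<Longrightarrow> real k * h \<le> T \<Longrightarrow>
     moment (2 * q) (\<lambda>\<omega>. eul h \<omega> (Suc k) - eul h \<omega> k) \<le> ennreal (C2 * h ^ q)"
    using euler_increment_moment[OF q(1)] by blast
  obtain C3 where C3: "C3 \<ge> 0" and pert: "\<And>h k. 0 < h \<Longrightarrow> h \<le> 1 \<Longrightarrow> real k * h \<le> T \<Longrightarrow>
     moment (2 * q) (\<lambda>\<omega>. scheme h \<omega> k - eul h \<omega> k) \<le> ennreal (C3 * (h powr \<gamma>) ^ (2 * q))"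
    using Xgrid_euler_moment[OF q(1)] by blast
  define C where "C = 3 ^ (2 * q) * (CS + 5 ^ (2 * q) * ((\<tau> + 2) * (C1 + C3 + C2)))"
  show ?thesis
  proof (intro exI[of _ C] conjI allI impI)
    show "0 \<le> C" using S(3) C1 C2 C3 \<tau>_pos by (auto simp: C_def)
    fix h :: real assume h: "0 < h" "h \<le> 1"
    have hT: "h \<le> T" using h T by linarith
    define N where "N = nat \<lfloor>\<tau> / h\<rfloor>"
    have Nh: "real k * h \<le> \<tau>" if "k \<le> N" for k
    proof -
      have "0 \<le> \<tau> / h" using h \<tau>_pos by simp
      then have "real N \<le> \<tau> / h" unfolding N_def by linarith
      then have "real k \<le> \<tau> / h" using that by linarith
      then show ?thesis using h by (simp add: field_simps)
    qed
    have Nh1: "real k * h \<le> T" if "k \<le> Suc N" for k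
    proof -
      have "real k * h \<le> real (Suc N) * h" using that h by (intro mult_right_mono) auto
      also have "\<dots> = real N * h + h" by (simp add: distrib_right)
      finally show ?thesis using Nh[of N] h by (simp add: T_def)
    qed
    define a where "a k \<omega> = norm (X (real k * h) \<omega> - eul h \<omega> k)" for k \<omega>
    define e where "e k \<omega> = norm (scheme h \<omega> k - eul h \<omega> k)" for k \<omega>
    define d where "d k \<omega> = norm (eul h \<omega> (Suc k) - eul h \<omega> k)" for k \<omega>
    define R where "R \<omega> = (\<Sum>k\<le>N. a k \<omega> ^ (2 * q)) + (\<Sum>k\<le>Suc N. e k \<omega> ^ (2 * q)) + (\<Sum>k\<le>N. d k \<omega> ^ (2 * q))" for \<omega>
    define rt where "rt \<omega> = root (2 * q) (R \<omega>)" for \<omega>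
    \<comment> \<open>The first summand is the path modulus between \<open>t\<close> and its grid
      point. The factor 5 counts grid errors: two for comparing \<open>X\<close> with the scheme at
      that point, three for bounding one step of the scheme through Euler iterates.\<close>
    define B where "B \<omega> = S \<omega> * h powr (1/8) + 5 * rt \<omega>" for \<omega>
    have am: "a k \<in> borel_measurable M" if "k \<le> N" for k
    proof -
      have [measurable]: "X (real k * h) \<in> borel_measurable M" using Nh[OF that] h by (intro X_measurable) auto
      have [measurable]: "(\<lambda>\<omega>. eul h \<omega> k) \<in> borel_measurable M" using h by (intro euler_measurable_M) auto
      show ?thesis unfolding a_def by measurable
    qed
    have em: "e k \<in> borel_measurable M" and dm: "d k \<in> borel_measurable M" for k
    proof -
      note [measurable] = Xgrid_measurable_M[OF h(1), of k]
      have [measurable]: "(\<lambda>\<omega>. eul h \<omega> j) \<in> borel_measurable M" for j using h by (intro euler_measurable_M) auto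
      show "e k \<in> borel_measurable M" "d k \<in> borel_measurable M" unfolding e_def d_def by measurable
    qed
    have nn: "0 \<le> a k \<omega>" "0 \<le> e k \<omega>" "0 \<le> d k \<omega>" for k \<omega> by (auto simp: a_def e_def d_def)
    have Rm: "R \<in> borel_measurable M"
      unfolding R_def using am em dm by (intro borel_measurable_add borel_measurable_sum borel_measurable_power) auto
    have R0: "0 \<le> R \<omega>" for \<omega> unfolding R_def using nn by (intro add_nonneg_nonneg sum_nonneg) auto
    have rt: "0 \<le> rt \<omega>" "rt \<omega> ^ (2 * q) = R \<omega>" for \<omega>
      using R0 q by (auto simp: rt_def real_root_pow_pos2)
    have rtm: "rt \<in> borel_measurable M"
      unfolding rt_def by (intro borel_measurable_continuous_on[OF continuous_on_real_root[OF continuous_on_id]] Rm)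
    have le_rt: "x \<le> rt \<omega>" if "x ^ (2 * q) \<le> R \<omega>" "0 \<le> x" for x \<omega>
      using that rt q by (intro power_le_imp_le_base[of x "2 * q - 1"]) auto
    have comp: "a k \<omega> \<le> rt \<omega>" "d k \<omega> \<le> rt \<omega>" "e k \<omega> \<le> rt \<omega>" "e (Suc k) \<omega> \<le> rt \<omega>" if k: "k \<le> N" for k \<omega>
    proof -
      have s: "0 \<le> (\<Sum>k\<le>N. a k \<omega> ^ (2 * q))" "0 \<le> (\<Sum>k\<le>Suc N. e k \<omega> ^ (2 * q))" "0 \<le> (\<Sum>k\<le>N. d k \<omega> ^ (2 * q))"
        using nn by (auto intro!: sum_nonneg add_nonneg_nonneg)
      have "a k \<omega> ^ (2 * q) \<le> (\<Sum>k\<le>N. a k \<omega> ^ (2 * q))" "d k \<omega> ^ (2 * q) \<le> (\<Sum>k\<le>N. d k \<omega> ^ (2 * q))"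
        "e k \<omega> ^ (2 * q) \<le> (\<Sum>k\<le>Suc N. e k \<omega> ^ (2 * q))" "e (Suc k) \<omega> ^ (2 * q) \<le> (\<Sum>k\<le>Suc N. e k \<omega> ^ (2 * q))"
        using k nn by (auto intro!: member_le_sum simp del: sum.atMost_Suc)
      then show "a k \<omega> \<le> rt \<omega>" "d k \<omega> \<le> rt \<omega>" "e k \<omega> \<le> rt \<omega>" "e (Suc k) \<omega> \<le> rt \<omega>"
        using s nn by (auto intro!: le_rt simp: R_def simp del: sum.atMost_Suc)
    qed
    show "\<exists>B. B \<in> borel_measurable M \<and> (\<forall>\<omega>. 0 \<le> B \<omega>) \<and> (\<integral>\<^sup>+ \<omega>. ennreal (B \<omega> ^ (8 * p)) \<partial>M) \<le> ennreal (C * h) \<and>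
      (AE \<omega> in M. \<forall>t\<in>{0..\<tau>}. norm (X t \<omega> - interp h \<omega> t) \<le> B \<omega>)"
    proof (intro exI[of _ B] conjI allI)
      show "B \<in> borel_measurable M" unfolding B_def using S(1) rtm by measurable
      show "0 \<le> B \<omega>" for \<omega> using S(2) rt by (simp add: B_def)
      show "AE \<omega> in M. \<forall>t\<in>{0..\<tau>}. norm (X t \<omega> - interp h \<omega> t) \<le> B \<omega>"
        using S(5)
      proof (rule eventually_mono, intro ballI)
        fix \<omega> t assume hoel: "\<forall>s\<in>{0..\<tau>}. \<forall>t\<in>{0..\<tau>}. norm (X t \<omega> - X s \<omega>) \<le> S \<omega> * \<bar>t - s\<bar> powr (1/8)"
          and t: "t \<in> {0..\<tau>}"
        obtain k where k: "k \<le> N" "real k * h \<le> t" "t \<le> real k * h + h"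
          and le: "norm (X t \<omega> - interp h \<omega> t) \<le> norm (X t \<omega> - X (real k * h) \<omega>) + norm (X (real k * h) \<omega> - scheme h \<omega> k)
      + norm (scheme h \<omega> (Suc k) - scheme h \<omega> k)"
          using Xbar_error[OF h(1), of t \<omega>] t unfolding N_def by auto
        have "norm (X t \<omega> - X (real k * h) \<omega>) \<le> S \<omega> * \<bar>t - real k * h\<bar> powr (1/8)"
          using hoel[rule_format, of "real k * h" t] t k h by simp
        also have "\<dots> \<le> S \<omega> * h powr (1/8)"
          using k S(2) by (intro mult_left_mono powr_mono2) auto
        finally have 1: "norm (X t \<omega> - X (real k * h) \<omega>) \<le> S \<omega> * h powr (1/8)" .
        have 2: "norm (X (real k * h) \<omega> - scheme h \<omega> k) \<le> a k \<omega> + e k \<omega>"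
          unfolding a_def e_def using norm_telescope3[of "X (real k * h) \<omega>" "scheme h \<omega> k" "eul h \<omega> k" "eul h \<omega> k"] by simp
        have 3: "norm (scheme h \<omega> (Suc k) - scheme h \<omega> k) \<le> e (Suc k) \<omega> + d k \<omega> + e k \<omega>"
          unfolding d_def e_def by (rule norm_telescope3)
        show "norm (X t \<omega> - interp h \<omega> t) \<le> B \<omega>"
          using le 1 2 3 comp[OF k(1), of \<omega>] unfolding B_def by linarith
      qed
      have ER: "(\<integral>\<^sup>+ \<omega>. ennreal (R \<omega>) \<partial>M) \<le> ennreal ((\<tau> + 2) * (C1 + C3 + C2) * h)"
      proof -
        have "(\<integral>\<^sup>+ \<omega>. ennreal (R \<omega>) \<partial>M) = (\<Sum>k\<le>N. \<integral>\<^sup>+ \<omega>. ennreal (a k \<omega> ^ (2 * q)) \<partial>M)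
            + (\<Sum>k\<le>Suc N. \<integral>\<^sup>+ \<omega>. ennreal (e k \<omega> ^ (2 * q)) \<partial>M) + (\<Sum>k\<le>N. \<integral>\<^sup>+ \<omega>. ennreal (d k \<omega> ^ (2 * q)) \<partial>M)"
        proof -
          have am': "(\<lambda>\<omega>. ennreal (a k \<omega> ^ (2 * q))) \<in> borel_measurable M" if "k \<le> N" for k
            using am[OF that] by measurable
          have em': "(\<lambda>\<omega>. ennreal (e k \<omega> ^ (2 * q))) \<in> borel_measurable M" for k using em[of k] by measurable
          have dm': "(\<lambda>\<omega>. ennreal (d k \<omega> ^ (2 * q))) \<in> borel_measurable M" for k using dm[of k] by measurable
          have "(\<integral>\<^sup>+ \<omega>. ennreal (R \<omega>) \<partial>M) = (\<integral>\<^sup>+ \<omega>. (\<Sum>k\<le>N. ennreal (a k \<omega> ^ (2 * q))) + (\<Sum>k\<le>Suc N. ennreal (e k \<omega> ^ (2 * q)))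
             + (\<Sum>k\<le>N. ennreal (d k \<omega> ^ (2 * q))) \<partial>M)"
            unfolding R_def using nn by (intro nn_integral_cong) (simp add: sum_nonneg ennreal_plus sum_ennreal[symmetric] add_nonneg_nonneg del: sum_ennreal)
          also have "\<dots> = (\<integral>\<^sup>+ \<omega>. (\<Sum>k\<le>N. ennreal (a k \<omega> ^ (2 * q))) + (\<Sum>k\<le>Suc N. ennreal (e k \<omega> ^ (2 * q))) \<partial>M)
             + (\<integral>\<^sup>+ \<omega>. (\<Sum>k\<le>N. ennreal (d k \<omega> ^ (2 * q))) \<partial>M)"
            using am' em' dm' by (intro nn_integral_add borel_measurable_add borel_measurable_sum) auto
          also have "(\<integral>\<^sup>+ \<omega>. (\<Sum>k\<le>N. ennreal (a k \<omega> ^ (2 * q))) + (\<Sum>k\<le>Suc N. ennreal (e k \<omega> ^ (2 * q))) \<partial>M)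
             = (\<integral>\<^sup>+ \<omega>. (\<Sum>k\<le>N. ennreal (a k \<omega> ^ (2 * q))) \<partial>M) + (\<integral>\<^sup>+ \<omega>. (\<Sum>k\<le>Suc N. ennreal (e k \<omega> ^ (2 * q))) \<partial>M)"
            using am' em' by (intro nn_integral_add borel_measurable_sum) auto
          also have "(\<integral>\<^sup>+ \<omega>. (\<Sum>k\<le>N. ennreal (a k \<omega> ^ (2 * q))) \<partial>M) = (\<Sum>k\<le>N. \<integral>\<^sup>+ \<omega>. ennreal (a k \<omega> ^ (2 * q)) \<partial>M)"
            using am' by (intro nn_integral_sum) auto
          also have "(\<integral>\<^sup>+ \<omega>. (\<Sum>k\<le>Suc N. ennreal (e k \<omega> ^ (2 * q))) \<partial>M) = (\<Sum>k\<le>Suc N. \<integral>\<^sup>+ \<omega>. ennreal (e k \<omega> ^ (2 * q)) \<partial>M)"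
            using em' by (intro nn_integral_sum) auto
          also have "(\<integral>\<^sup>+ \<omega>. (\<Sum>k\<le>N. ennreal (d k \<omega> ^ (2 * q))) \<partial>M) = (\<Sum>k\<le>N. \<integral>\<^sup>+ \<omega>. ennreal (d k \<omega> ^ (2 * q)) \<partial>M)"
            using dm' by (intro nn_integral_sum) auto
          finally show ?thesis .
        qed
        also have "\<dots> \<le> (\<Sum>k\<le>N. ennreal (C1 * h ^ q)) + (\<Sum>k\<le>Suc N. ennreal (C3 * (h powr \<gamma>) ^ (2 * q))) + (\<Sum>k\<le>N. ennreal (C2 * h ^ q))"
          unfolding a_def e_def d_def using h hT Nh Nh1 by (intro add_mono sum_mono ord pert inc) auto
        also have "\<dots> = ennreal (real (Suc N) * (C1 * h ^ q) + real (Suc (Suc N)) * (C3 * (h powr \<gamma>) ^ (2 * q)) + real (Suc N) * (C2 * h ^ q))"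
        proof -
          have on: "(of_nat n :: ennreal) * ennreal x = ennreal (real n * x)" if "0 \<le> x" for n x
            using that by (simp add: ennreal_of_nat_eq_real_of_nat ennreal_mult)
          show ?thesis
            using C1 C2 C3 h by (simp add: on ennreal_plus[symmetric] del: ennreal_plus sum.atMost_Suc of_nat_Suc)
        qed
        also have "\<dots> \<le> ennreal ((\<tau> + 2) * (C1 + C3 + C2) * h)"
        proof (rule ennreal_leI)
          \<comment> \<open>The number of terms times \<open>h\<close> is bounded; this consumes one
            of the two factors \<open>h\<close> in each term.\<close>
          have N2: "real (Suc (Suc N)) * h \<le> \<tau> + 2" "real (Suc N) * h \<le> \<tau> + 2" using Nh[of N] h by (auto simp: distrib_right)
          have hq: "h ^ q \<le> h * h" using power_decreasing[of 2 q h] q h by (simp add: power2_eq_square)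
          have hg: "(h powr \<gamma>) ^ (2 * q) \<le> h * h"
          proof -
            have "(h powr \<gamma>) ^ (2 * q) = h powr (\<gamma> * real (2 * q))" using h by (simp add: powr_realpow[symmetric] powr_powr)
            also have "\<dots> \<le> h powr 2" using h p(2) unfolding q(2) by (intro powr_mono') auto
            also have "\<dots> = h * h" using h by (simp add: power2_eq_square)
            finally show ?thesis .
          qed
          have *: "n * (c * v) \<le> (\<tau> + 2) * c * h" if "n * h \<le> \<tau> + 2" "0 \<le> c" "0 \<le> n" "v \<le> h * h" for n c v :: real
          proof -
            have "n * (c * v) \<le> n * (c * (h * h))" using that by (intro mult_left_mono) auto
            also have "\<dots> = (n * h) * (c * h)" by simp
            also have "\<dots> \<le> (\<tau> + 2) * (c * h)" using that h by (intro mult_right_mono) auto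
            finally show ?thesis by simp
          qed
          have "real (Suc N) * (C1 * h ^ q) + real (Suc (Suc N)) * (C3 * (h powr \<gamma>) ^ (2 * q)) + real (Suc N) * (C2 * h ^ q)
             \<le> (\<tau> + 2) * C1 * h + (\<tau> + 2) * C3 * h + (\<tau> + 2) * C2 * h"
            using N2 hq hg C1 C2 C3 by (intro add_mono *) auto
          then show "real (Suc N) * (C1 * h ^ q) + real (Suc (Suc N)) * (C3 * (h powr \<gamma>) ^ (2 * q)) + real (Suc N) * (C2 * h ^ q)
             \<le> (\<tau> + 2) * (C1 + C3 + C2) * h"
            by (simp add: algebra_simps)
        qed
        finally show ?thesis .
      qed
      have "(\<integral>\<^sup>+ \<omega>. ennreal (B \<omega> ^ (2 * q)) \<partial>M)
        \<le> ennreal (3 ^ (2 * q)) * ((\<integral>\<^sup>+ \<omega>. ennreal ((S \<omega> * h powr (1/8)) ^ (2 * q)) \<partial>M) + (\<integral>\<^sup>+ \<omega>. ennreal ((5 * rt \<omega>) ^ (2 * q)) \<partial>M) + (\<integral>\<^sup>+ \<omega>. ennreal (0 ^ (2 * q)) \<partial>M))"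
        by (rule nn_integral_power_sum3) (use S rt rtm in \<open>auto simp: B_def\<close>)
      also have "(\<integral>\<^sup>+ \<omega>. ennreal (0 ^ (2 * q)) \<partial>M) = 0" using q by (simp add: power_0_left)
      also have "(\<integral>\<^sup>+ \<omega>. ennreal ((S \<omega> * h powr (1/8)) ^ (2 * q)) \<partial>M) \<le> ennreal (CS * h)"
      proof -
        have hp: "(h powr (1/8)) ^ (2 * q) \<le> h"
        proof -
          have "(h powr (1/8)) ^ (2 * q) = h powr real p" using h unfolding q(2) by (simp add: powr_realpow[symmetric] powr_powr)
          also have "\<dots> \<le> h powr 1" using h p(1) by (intro powr_mono') auto
          finally show ?thesis using h by simp
        qed
        have "(\<integral>\<^sup>+ \<omega>. ennreal ((S \<omega> * h powr (1/8)) ^ (2 * q)) \<partial>M) \<le> (\<integral>\<^sup>+ \<omega>. ennreal h * ennreal (S \<omega> ^ (8 * p)) \<partial>M)"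
        proof (rule nn_integral_mono)
          fix \<omega>
          have "(S \<omega> * h powr (1/8)) ^ (2 * q) \<le> h * S \<omega> ^ (8 * p)"
            using mult_left_mono[OF hp, of "S \<omega> ^ (2 * q)"] S(2)[of \<omega>] unfolding q(2) by (simp add: power_mult_distrib mult.commute)
          then show "ennreal ((S \<omega> * h powr (1/8)) ^ (2 * q)) \<le> ennreal h * ennreal (S \<omega> ^ (8 * p))"
            using h S(2)[of \<omega>] by (simp add: ennreal_mult[symmetric] ennreal_leI)
        qed
        also have "\<dots> = ennreal h * (\<integral>\<^sup>+ \<omega>. ennreal (S \<omega> ^ (8 * p)) \<partial>M)"
          using S(1) by (intro nn_integral_cmult) measurable
        also have "\<dots> \<le> ennreal h * ennreal CS" by (intro mult_left_mono S) auto
        also have "\<dots> = ennreal (CS * h)" using h S(3) by (simp add: ennreal_mult[symmetric] mult.commute)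
        finally show ?thesis .
      qed
      also have "(\<integral>\<^sup>+ \<omega>. ennreal ((5 * rt \<omega>) ^ (2 * q)) \<partial>M) = ennreal (5 ^ (2 * q)) * (\<integral>\<^sup>+ \<omega>. ennreal (R \<omega>) \<partial>M)"
        using Rm R0 by (simp add: power_mult_distrib rt ennreal_mult nn_integral_cmult)
      also have "\<dots> \<le> ennreal (5 ^ (2 * q)) * ennreal ((\<tau> + 2) * (C1 + C3 + C2) * h)"
        by (intro mult_left_mono ER) auto
      also have "ennreal (3 ^ (2 * q)) * (ennreal (CS * h) + ennreal (5 ^ (2 * q)) * ennreal ((\<tau> + 2) * (C1 + C3 + C2) * h) + 0) = ennreal (C * h)"
        using S(3) C1 C2 C3 \<tau>_pos h unfolding C_def
        by (simp add: ennreal_mult[symmetric] ennreal_plus[symmetric] distrib_left distrib_right mult.assoc del: ennreal_plus)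
      finally show "(\<integral>\<^sup>+ \<omega>. ennreal (B \<omega> ^ (8 * p)) \<partial>M) \<le> ennreal (C * h)"
        unfolding q(2) by (simp add: mult_left_mono add_mono)
    qed
  qed
qed

text \<open>Error moments of a fixed order \<open>Q\<close> decay like \<open>h\<close> once
  \<open>Q\<close> is large compared with \<open>1 / \<gamma>\<close>;
  \<open>powr_le_interpolation\<close> passes from \<open>Q\<close> to \<open>p\<close>.\<close>

theorem Lp_convergence:
  assumes p: "0 < p"
  shows "((\<lambda>h. \<integral>\<^sup>+ \<omega>. ennreal ((SUP t\<in>{0..\<tau>}. norm (X t \<omega> - interp h \<omega> t)) powr p) \<partial>M) \<longlongrightarrow> 0) (at_right 0)"
proof -
  obtain n :: nat where n: "max p (2 / \<gamma>) < real n" using reals_Archimedean2 by blast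
  define Q where "Q = 8 * Suc n"
  have pQ: "p \<le> real Q" "2 \<le> \<gamma> * real Q"
  proof -
    show "p \<le> real Q" using n by (simp add: Q_def)
    have "2 / \<gamma> \<le> real Q" using n by (simp add: Q_def)
    then show "2 \<le> \<gamma> * real Q" using \<gamma> by (simp add: divide_le_eq mult.commute)
  qed
  obtain C where C: "0 \<le> C" and bound: "\<And>h. 0 < h \<Longrightarrow> h \<le> 1 \<Longrightarrow>
    (\<exists>B. B \<in> borel_measurable M \<and> (\<forall>\<omega>. 0 \<le> B \<omega>) \<and> (\<integral>\<^sup>+ \<omega>. ennreal (B \<omega> ^ Q) \<partial>M) \<le> ennreal (C * h) \<and>
      (AE \<omega> in M. \<forall>t\<in>{0..\<tau>}. norm (X t \<omega> - interp h \<omega> t) \<le> B \<omega>))"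
    using moment_sup_error[of "Suc n"] pQ(2) unfolding Q_def by auto
  have le: "(\<integral>\<^sup>+ \<omega>. ennreal ((SUP t\<in>{0..\<tau>}. norm (X t \<omega> - interp h \<omega> t)) powr p) \<partial>M)
      \<le> ennreal (h powr (p / real Q) * (1 + C))" if h: "0 < h" "h \<le> 1" for h
  proof -
    obtain B where B: "B \<in> borel_measurable M" "\<And>\<omega>. 0 \<le> B \<omega>" "(\<integral>\<^sup>+ \<omega>. ennreal (B \<omega> ^ Q) \<partial>M) \<le> ennreal (C * h)"
      "AE \<omega> in M. \<forall>t\<in>{0..\<tau>}. norm (X t \<omega> - interp h \<omega> t) \<le> B \<omega>"
      using bound[OF h] by blast
    have "(\<integral>\<^sup>+ \<omega>. ennreal ((SUP t\<in>{0..\<tau>}. norm (X t \<omega> - interp h \<omega> t)) powr p) \<partial>M)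
        \<le> (\<integral>\<^sup>+ \<omega>. ennreal (h powr (p / real Q)) * (1 + ennreal (1 / h) * ennreal (B \<omega> ^ Q)) \<partial>M)"
    proof (rule nn_integral_mono_AE)
      show "AE \<omega> in M. ennreal ((SUP t\<in>{0..\<tau>}. norm (X t \<omega> - interp h \<omega> t)) powr p)
          \<le> ennreal (h powr (p / real Q)) * (1 + ennreal (1 / h) * ennreal (B \<omega> ^ Q))"
        using B(4)
      proof eventually_elim
        case (elim \<omega>)
        define x where "x = (SUP t\<in>{0..\<tau>}. norm (X t \<omega> - interp h \<omega> t))"
        have x: "0 \<le> x" "x \<le> B \<omega>" unfolding x_def using elim \<tau>_pos by (auto intro!: SUP_bounds)
        have "x powr p \<le> B \<omega> powr p" using x p by (intro powr_mono2) auto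
        also have "\<dots> \<le> h powr (p / real Q) * (1 + B \<omega> ^ Q / h)" by (rule powr_le_interpolation[OF B(2) h(1) p pQ(1)])
        finally have "ennreal (x powr p) \<le> ennreal (h powr (p / real Q) * (1 + B \<omega> ^ Q / h))" by (rule ennreal_leI)
        also have "\<dots> = ennreal (h powr (p / real Q)) * (1 + ennreal (1 / h) * ennreal (B \<omega> ^ Q))"
        proof -
          have e: "ennreal (1 / h) * ennreal (B \<omega> ^ Q) = ennreal (B \<omega> ^ Q / h)"
            using h B(2)[of \<omega>] by (simp add: ennreal_mult[symmetric])
          show ?thesis unfolding e using h B(2)[of \<omega>] by (simp add: ennreal_mult)
        qed
        finally show ?case unfolding x_def .
      qed
    qed
    also have "\<dots> = ennreal (h powr (p / real Q)) * (1 + ennreal (1 / h) * (\<integral>\<^sup>+ \<omega>. ennreal (B \<omega> ^ Q) \<partial>M))"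
    proof -
      note [measurable] = B(1)
      show ?thesis by (simp add: nn_integral_cmult nn_integral_add emeasure_space_1[unfolded space_M])
    qed
    also have "\<dots> \<le> ennreal (h powr (p / real Q)) * (1 + ennreal (1 / h) * ennreal (C * h))"
      by (intro mult_left_mono add_left_mono B) auto
    also have "\<dots> = ennreal (h powr (p / real Q) * (1 + C))"
    proof -
      have e: "ennreal (1 / h) * ennreal (C * h) = ennreal C" using h C by (simp add: ennreal_mult[symmetric])
      show ?thesis unfolding e using C by (simp add: ennreal_mult)
    qed
    finally show ?thesis .
  qed
  have Q0: "0 < real Q" by (simp add: Q_def)
  have "((\<lambda>h::real. h powr (p / real Q) * (1 + C)) \<longlongrightarrow> 0 powr (p / real Q) * (1 + C)) (at_right 0)"
    using p Q0 by (intro tendsto_mult tendsto_const tendsto_powr' tendsto_ident_at) (auto simp: eventually_at_filter)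
  then have "((\<lambda>h::real. h powr (p / real Q) * (1 + C)) \<longlongrightarrow> 0) (at_right 0)" using p Q0 by simp
  then have "((\<lambda>h::real. ennreal (h powr (p / real Q) * (1 + C))) \<longlongrightarrow> ennreal 0) (at_right 0)"
    by (rule tendsto_ennrealI)
  then have lim: "((\<lambda>h::real. ennreal (h powr (p / real Q) * (1 + C))) \<longlongrightarrow> 0) (at_right 0)" by simp
  have ev: "eventually (\<lambda>h::real. 0 < h \<and> h \<le> 1) (at_right 0)"
    by (auto simp: eventually_at_right_field intro!: exI[of _ 1])
  show ?thesis
  proof (rule tendsto_sandwich[OF _ _ tendsto_const lim])
    show "\<forall>\<^sub>F h in at_right 0. (\<integral>\<^sup>+ \<omega>. ennreal ((SUP t\<in>{0..\<tau>}. norm (X t \<omega> - interp h \<omega> t)) powr p) \<partial>M)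
        \<le> ennreal (h powr (p / real Q) * (1 + C))"
      using ev by (rule eventually_mono) (use le in blast)
  qed simp
qed

end

section \<open>Almost sure convergence\<close>

text \<open>Borel-Cantelli in terms of expectations: summable expectations make the series of the
  \<open>u n\<close> finite almost everywhere, so its terms tend to 0.\<close>

lemma AE_tendsto_zero_of_summable_moments:
  fixes u :: "nat \<Rightarrow> 'a \<Rightarrow> real"
  assumes [measurable]: "\<And>n. u n \<in> borel_measurable M" and nn: "\<And>n x. 0 \<le> u n x" and C: "0 \<le> C"
    and le: "\<And>n. (\<integral>\<^sup>+ x. ennreal (u n x) \<partial>M) \<le> ennreal (C / real (Suc n) ^ 2)"
  shows "AE x in M. (\<lambda>n. u n x) \<longlonglongrightarrow> 0"
proof -
  have "(\<integral>\<^sup>+ x. (\<Sum>n. ennreal (u n x)) \<partial>M) = (\<Sum>n. \<integral>\<^sup>+ x. ennreal (u n x) \<partial>M)"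
    by (rule nn_integral_suminf) measurable
  also have "\<dots> \<le> (\<Sum>n. ennreal (C / real (Suc n) ^ 2))" by (intro suminf_le le) auto
  also have "\<dots> < \<infinity>"
  proof -
    have "summable (\<lambda>n. inverse (real n ^ 2))" by (rule inverse_power_summable) simp
    then have "summable (\<lambda>n. inverse (real (Suc n) ^ 2))" by (rule summable_Suc_iff[THEN iffD2])
    then have "summable (\<lambda>n. C / real (Suc n) ^ 2)"
      unfolding divide_inverse by (rule summable_mult)
    then have "(\<Sum>n. ennreal (C / real (Suc n) ^ 2)) = ennreal (\<Sum>n. C / real (Suc n) ^ 2)"
      using C by (intro suminf_ennreal2) auto
    then show ?thesis by simp
  qed
  finally have "(\<integral>\<^sup>+ x. (\<Sum>n. ennreal (u n x)) \<partial>M) \<noteq> \<infinity>" by simp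
  then have "AE x in M. (\<Sum>n. ennreal (u n x)) \<noteq> \<infinity>" by (intro nn_integral_PInf_AE) auto
  then show ?thesis
  proof (rule eventually_mono)
    fix x assume "(\<Sum>n. ennreal (u n x)) \<noteq> \<infinity>"
    then have "summable (\<lambda>n. u n x)" using nn by (intro summable_suminf_not_top) auto
    then show "(\<lambda>n. u n x) \<longlonglongrightarrow> 0" by (rule summable_LIMSEQ_zero)
  qed
qed

section \<open>Rounding to a spatial grid and pathwise stability\<close>

definition int_cube :: "nat \<Rightarrow> (int^'m) set" where
  "int_cube N = {v. \<forall>i. v $ i \<in> {- int N..int N}}"

lemma int_cube_finite_card:
  "finite (int_cube N :: (int^'m::finite) set)" "card (int_cube N :: (int^'m) set) \<le> (2 * N + 1) ^ CARD('m)"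
proof -
  let ?P = "PiE (UNIV :: 'm set) (\<lambda>_. {- int N..int N})"
  have eq: "int_cube N \<subseteq> (\<lambda>f. \<chi> i. f i) ` ?P"
  proof
    fix v :: "int^'m" assume "v \<in> int_cube N"
    then have "(\<lambda>i. v $ i) \<in> ?P" "v = (\<chi> i. v $ i)" by (auto simp: int_cube_def)
    then show "v \<in> (\<lambda>f. \<chi> i. f i) ` ?P" by blast
  qed
  have fin: "finite ?P" by (intro finite_PiE) auto
  show "finite (int_cube N :: (int^'m) set)" using finite_subset[OF eq] fin by simp
  have "card (int_cube N :: (int^'m) set) \<le> card ((\<lambda>f. \<chi> i. f i) ` ?P)" using eq fin by (intro card_mono) auto
  also have "\<dots> \<le> card ?P" by (rule card_image_le[OF fin])
  also have "\<dots> = (2 * N + 1) ^ CARD('m)"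
    by (simp add: card_PiE nat_add_distrib nat_mult_distrib)
  finally show "card (int_cube N :: (int^'m) set) \<le> (2 * N + 1) ^ CARD('m)" .
qed

context perturbed_euler_scheme
begin

text \<open>The grid is centred at \<open>x0\<close>, so that the initial state is a grid point and
  the telescoping starts at the unperturbed scheme without a rounding error.\<close>

definition grid_point :: "real \<Rightarrow> int^'m \<Rightarrow> real^'m" where
  "grid_point h v = x0 + h\<^sup>2 *\<^sub>R (\<chi> i. of_int (v $ i))"

definition grid_round :: "real \<Rightarrow> real^'m \<Rightarrow> int^'m" where
  "grid_round h x = (\<chi> i. \<lfloor>(x $ i - x0 $ i) / h\<^sup>2\<rfloor>)"

lemma grid_round_x0: "grid_point h (grid_round h x0) = x0"
  by (simp add: grid_point_def grid_round_def vec_eq_iff)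

lemma grid_round_error:
  assumes h: "0 < h" shows "norm (x - grid_point h (grid_round h x)) \<le> real CARD('m) * h\<^sup>2"
proof -
  have "norm (x - grid_point h (grid_round h x)) \<le> (\<Sum>i\<in>UNIV. \<bar>(x - grid_point h (grid_round h x)) $ i\<bar>)"
    by (rule norm_le_l1_cart)
  also have "\<dots> \<le> (\<Sum>i\<in>(UNIV::'m set). h\<^sup>2)"
  proof (rule sum_mono)
    fix i
    define y where "y = (x $ i - x0 $ i) / h\<^sup>2"
    have "(x - grid_point h (grid_round h x)) $ i = h\<^sup>2 * (y - of_int \<lfloor>y\<rfloor>)"
    proof -
      have "h\<^sup>2 * y = x $ i - x0 $ i" using h by (simp add: y_def)
      then show ?thesis by (simp add: grid_point_def grid_round_def y_def[symmetric] right_diff_distrib)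
    qed
    moreover have "\<bar>y - of_int \<lfloor>y\<rfloor>\<bar> \<le> 1" by linarith
    ultimately show "\<bar>(x - grid_point h (grid_round h x)) $ i\<bar> \<le> h\<^sup>2"
      by (simp add: abs_mult mult_left_le)
  qed
  finally show ?thesis by simp
qed

lemma grid_round_in_cube:
  assumes h: "0 < h" and N: "norm (x - x0) / h\<^sup>2 + 1 \<le> real N"
  shows "grid_round h x \<in> int_cube N"
proof -
  have "\<lfloor>(x $ i - x0 $ i) / h\<^sup>2\<rfloor> \<in> {- int N..int N}" for i
  proof -
    have "\<bar>(x $ i - x0 $ i) / h\<^sup>2\<bar> \<le> norm (x - x0) / h\<^sup>2"
      using component_le_norm_cart[of "x - x0" i] h by (simp add: abs_divide divide_right_mono)
    then have "\<bar>(x $ i - x0 $ i) / h\<^sup>2\<bar> + 1 \<le> real N" using N by linarith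
    then show ?thesis by (simp, linarith)
  qed
  then show ?thesis by (simp add: int_cube_def grid_round_def)
qed

text \<open>After \<open>k\<close> steps, with \<open>k * h \<le> \<tau>\<close>, the grids of steps
  \<open>h\<close> and \<open>h'\<close> are apart by at most \<open>2 * \<tau> * h ^ 16\<close>,
  and the Hoelder exponent \<open>1/8\<close> turns \<open>h ^ 16\<close> into
  \<open>h\<^sup>2\<close>. This is the origin of the gap \<open>2 * h ^ 17\<close> between the step
  sizes.\<close>

lemma grid_time_shift:
  assumes h: "0 < h" "h \<le> h'" "h' \<le> h + 2 * h ^ 17" and kh: "real k * h' \<le> \<tau>"
  shows "real k * h \<le> \<tau>" "0 \<le> real k * h'" "\<bar>real k * h' - real k * h\<bar> powr (1/8) \<le> (1 + 2 * \<tau>) * h\<^sup>2"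
proof -
  have le: "real k * h \<le> real k * h'" using h by (intro mult_left_mono) auto
  then show t: "real k * h \<le> \<tau>" using kh by linarith
  show "0 \<le> real k * h'" using h by simp
  have "real k * h' - real k * h = real k * (h' - h)" by (simp add: algebra_simps)
  also have "\<dots> \<le> real k * (2 * h ^ 17)" using h by (intro mult_left_mono) auto
  also have "\<dots> = 2 * (real k * h) * h ^ 16" by (simp add: power_Suc[symmetric] algebra_simps)
  also have "\<dots> \<le> 2 * \<tau> * h ^ 16" using t h by (intro mult_right_mono mult_left_mono) auto
  finally have "\<bar>real k * h' - real k * h\<bar> powr (1/8) \<le> (2 * \<tau> * h ^ 16) powr (1/8)"
    using le by (intro powr_mono2) auto
  also have "\<dots> = (2 * \<tau>) powr (1/8) * h\<^sup>2"
  proof -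
    have "h ^ 16 = h powr 16" using h powr_realpow[of h 16] by simp
    then have "(h ^ 16) powr (1/8) = (h powr 16) powr (1/8)" by (simp only:)
    also have "\<dots> = h powr 2" by (simp only: powr_powr) simp
    also have "\<dots> = h\<^sup>2" using h by simp
    finally show ?thesis using h \<tau>_pos by (simp only: powr_mult)
  qed
  also have "\<dots> \<le> (1 + 2 * \<tau>) * h\<^sup>2"
  proof (rule mult_right_mono)
    have "(2 * \<tau>) powr (1/8) \<le> (1 + 2 * \<tau>) powr (1/8)" using \<tau>_pos by (intro powr_mono2) auto
    also have "\<dots> \<le> (1 + 2 * \<tau>) powr 1" using \<tau>_pos by (intro powr_mono) auto
    finally show "(2 * \<tau>) powr (1/8) \<le> 1 + 2 * \<tau>" using \<tau>_pos by simp
  qed simp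
  finally show "\<bar>real k * h' - real k * h\<bar> powr (1/8) \<le> (1 + 2 * \<tau>) * h\<^sup>2" .
qed

text \<open>Stability of the Euler flow (the last hypothesis) is only needed between points of a grid of mesh \<open>h\<^sup>2\<close>: replacing
  each iterate \<open>X'\<^sub>k\<close> of the perturbed scheme by its rounding \<open>z\<^sub>k\<close>, the points \<open>euler \<dots> k z\<^sub>k (n - k)\<close>
  telescope from the unperturbed \<open>n\<close>-th iterate to \<open>z\<^sub>n\<close>.\<close>

lemma pathwise_perturbation:
  assumes S: "0 \<le> S" and R: "0 \<le> R"
  shows "\<exists>c\<ge>0. \<forall>h h' N \<omega>. 0 < h \<longrightarrow> h \<le> h' \<longrightarrow> h' \<le> h + 2 * h ^ 17 \<longrightarrow> h' \<le> 1 \<longrightarrow> 1 / h ^ 16 \<le> real N \<longrightarrow>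
    c * h \<le> 1 \<longrightarrow> c * h powr (\<gamma> / 2) \<le> 1 \<longrightarrow>
    (\<forall>s\<in>{0..T}. \<forall>t\<in>{0..T}. norm (\<omega> t - \<omega> s) \<le> S * \<bar>t - s\<bar> powr (1/8)) \<longrightarrow>
    (\<forall>k. real k * h \<le> \<tau> \<longrightarrow> norm (eul h \<omega> k) \<le> R) \<longrightarrow>
    (\<forall>v\<in>int_cube N. \<forall>v'\<in>int_cube N. \<forall>k j. real (Suc k + j) * h \<le> \<tau> \<longrightarrow>
       norm (euler b \<sigma> h \<omega> (Suc k) (grid_point h v') j - euler b \<sigma> h \<omega> k (grid_point h v) (Suc j))
         \<le> h powr (- \<gamma> / 2) * max (norm (grid_point h v' - euler b \<sigma> h \<omega> k (grid_point h v) 1)) (h\<^sup>2)) \<longrightarrow>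
    (\<forall>n. real n * h' \<le> \<tau> \<longrightarrow> norm (scheme h' \<omega> n - eul h \<omega> n) \<le> c * h powr (\<gamma> / 2))"
proof -
  define m where "m = real CARD('m)"
  have K0: "0 \<le> K" using K1 by simp
  have m: "0 \<le> m" by (simp add: m_def)
  define c1 where "c1 = 2 * (S * (1 + 2 * \<tau>))"
  \<comment> \<open>Local error of one step in units of \<open>h powr (1 + \<gamma>)\<close>:
    mismatch of the Brownian increments, mismatch of the step sizes, and the contribution of
    \<open>\<eta>\<close>.\<close>
  define c2 where "c2 = K * (2 + R) * c1 + 2 * (K * (2 + R)) + 3 * (K * (3 * (R + 1) + 3 * S))"
  \<comment> \<open>Error of one step between rounded states: rounding at the new point, local
    error, and rounding at the old point pushed through one Euler step. The summand 1 lets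
    \<open>c3 * w\<close> dominate the floor \<open>h\<^sup>2\<close> as well.\<close>
  define c3 where "c3 = 1 + m + c2 + m * (1 + K * S + K)"
  define c4 where "c4 = m + \<tau> * c3"
  \<comment> \<open>Bounds the state one further step after a state of norm at most
    \<open>R + 1\<close>; \<open>norm x0\<close> is added because the cube is centred at
    \<open>x0\<close>.\<close>
  define R4 where "R4 = R + 1 + K * (2 + R) * (S + 1) + c2 + norm x0"
  \<comment> \<open>Each summand serves one smallness condition: with
    \<open>c * h powr (\<gamma> / 2) \<le> 1\<close> the part \<open>c4\<close> keeps the scheme
    within distance 1 of the Euler iterates, and with \<open>c * h \<le> 1\<close> the part
    \<open>R4 + 1\<close> keeps the rounded states inside the cube.\<close>
  define c where "c = c4 + (R4 + 1)"
  have c1: "0 \<le> c1" using S \<tau>_pos by (simp add: c1_def)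
  have c2: "0 \<le> c2" using c1 K0 R S by (simp add: c2_def)
  have c3: "1 \<le> c3" using c2 m K0 S by (simp add: c3_def)
  have c4: "0 \<le> c4" using c3 m \<tau>_pos by (simp add: c4_def)
  have R4: "0 \<le> R4" using R K0 S c2 by (simp add: R4_def)
  show ?thesis
  proof (intro exI[of _ c] conjI allI impI)
    show "0 \<le> c" using c4 R4 by (simp add: c_def)
    fix h h' :: real and N :: nat and \<omega> :: "real \<Rightarrow> real^'d" and n :: nat
    assume h: "0 < h" "h \<le> h'" "h' \<le> h + 2 * h ^ 17" "h' \<le> 1" and N: "1 / h ^ 16 \<le> real N"
      and small: "c * h \<le> 1" "c * h powr (\<gamma> / 2) \<le> 1"
      and hoel: "\<forall>s\<in>{0..T}. \<forall>t\<in>{0..T}. norm (\<omega> t - \<omega> s) \<le> S * \<bar>t - s\<bar> powr (1/8)"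
      and YR: "\<forall>k. real k * h \<le> \<tau> \<longrightarrow> norm (eul h \<omega> k) \<le> R"
      and flow: "\<forall>v\<in>int_cube N. \<forall>v'\<in>int_cube N. \<forall>k j. real (Suc k + j) * h \<le> \<tau> \<longrightarrow>
     norm (euler b \<sigma> h \<omega> (Suc k) (grid_point h v') j - euler b \<sigma> h \<omega> k (grid_point h v) (Suc j))
       \<le> h powr (- \<gamma> / 2) * max (norm (grid_point h v' - euler b \<sigma> h \<omega> k (grid_point h v) 1)) (h\<^sup>2)"
      and nh: "real n * h' \<le> \<tau>"
    have h1: "h \<le> 1" and h'0: "0 < h'" using h by linarith+
    define w where "w = h powr (1 + \<gamma>)"
    have w0: "0 < w" using h by (simp add: w_def)
    have hw: "h\<^sup>2 \<le> w" "h ^ 17 \<le> w" "h * h powr \<gamma> = w" "h powr (1/8) \<le> h powr \<gamma>" "h * h powr (1/8) \<le> w"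
    proof -
      have "h powr 2 \<le> h powr (1 + \<gamma>)" using h h1 \<gamma> by (intro powr_mono') auto
      then show 1: "h\<^sup>2 \<le> w" using h by (simp add: w_def)
      have "h ^ 17 \<le> h\<^sup>2" using h h1 by (intro power_decreasing) auto
      then show "h ^ 17 \<le> w" using 1 by linarith
      show 2: "h * h powr \<gamma> = w" using h by (simp add: w_def powr_add)
      show 3: "h powr (1/8) \<le> h powr \<gamma>" using h h1 \<gamma> by (intro powr_mono') auto
      show "h * h powr (1/8) \<le> w" unfolding 2[symmetric] using 3 h by (intro mult_left_mono) auto
    qed
    have h'3: "h' \<le> 3 * h"
    proof -
      have "h ^ 17 \<le> h ^ 1" using h h1 by (intro power_decreasing) auto
      then show ?thesis using h by simp
    qed
    have p3: "h' powr \<theta> \<le> 3 * h powr \<theta>" if "0 \<le> \<theta>" "\<theta> \<le> 1" for \<theta>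
    proof -
      have "h' powr \<theta> \<le> (3 * h) powr \<theta>" using h h'0 h'3 that by (intro powr_mono2) auto
      also have "\<dots> = 3 powr \<theta> * h powr \<theta>" using h by (simp add: powr_mult)
      also have "\<dots> \<le> 3 * h powr \<theta>" using powr_mono[of \<theta> 1 "3::real"] that by (intro mult_right_mono) auto
      finally show ?thesis .
    qed
    define P where "P k = scheme h' \<omega> k" for k
    define Y where "Y k = eul h \<omega> k" for k
    define y' where "y' k = \<omega> (real (Suc k) * h') - \<omega> (real k * h')" for k
    define y where "y k = \<omega> (real (Suc k) * h) - \<omega> (real k * h)" for k
    define F where "F k x = euler b \<sigma> h \<omega> k x 1" for k x
    define z where "z k = grid_point h (grid_round h (P k))" for k
    have F: "F k x = x + \<sigma> x *v y k + h *\<^sub>R b x" for k x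
      by (simp add: F_def y_def)
    have times: "real k * h \<le> \<tau>" "0 \<le> real k * h'" "real k * h' \<in> {0..T}" "real k * h \<in> {0..T}"
      if kh: "real k * h' \<le> \<tau>" for k
      using grid_time_shift(1,2)[OF h(1-3) kh] kh T(2) h by auto
    have dW: "norm (\<omega> (real k * h') - \<omega> (real k * h)) \<le> S * (1 + 2 * \<tau>) * h\<^sup>2" if kh: "real k * h' \<le> \<tau>" for k
    proof -
      have "norm (\<omega> (real k * h') - \<omega> (real k * h)) \<le> S * \<bar>real k * h' - real k * h\<bar> powr (1/8)"
        using hoel times(3,4)[OF kh] by blast
      also have "\<dots> \<le> S * ((1 + 2 * \<tau>) * h\<^sup>2)"
        using grid_time_shift(3)[OF h(1-3) kh] S by (intro mult_left_mono) auto
      finally show ?thesis by (simp add: mult.assoc)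
    qed
    have inc: "norm (y' k) \<le> 3 * S * h powr (1/8)" "norm (y k) \<le> S * h powr (1/8)" "norm (y' k - y k) \<le> c1 * h\<^sup>2"
      if kh: "real (Suc k) * h' \<le> \<tau>" for k
    proof -
      have e: "real (Suc k) * h' = real k * h' + h'" "real (Suc k) * h = real k * h + h" by (auto simp: distrib_right)
      have kh': "real k * h' \<le> \<tau>" using kh e h'0 by linarith
      have "norm (y' k) \<le> S * \<bar>real (Suc k) * h' - real k * h'\<bar> powr (1/8)"
        unfolding y'_def using hoel times(3)[OF kh] times(3)[OF kh'] by blast
      also have "\<dots> = S * h' powr (1/8)" using e h'0 by simp
      also have "\<dots> \<le> S * (3 * h powr (1/8))" using S by (intro mult_left_mono p3) auto
      finally show "norm (y' k) \<le> 3 * S * h powr (1/8)" by simp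
      have "norm (y k) \<le> S * \<bar>real (Suc k) * h - real k * h\<bar> powr (1/8)"
        unfolding y_def using hoel times(4)[OF kh] times(4)[OF kh'] by blast
      then show "norm (y k) \<le> S * h powr (1/8)" using e h by simp
      have "y' k - y k = (\<omega> (real (Suc k) * h') - \<omega> (real (Suc k) * h)) - (\<omega> (real k * h') - \<omega> (real k * h))"
        by (simp add: y'_def y_def)
      then have "norm (y' k - y k) \<le> S * (1 + 2 * \<tau>) * h\<^sup>2 + S * (1 + 2 * \<tau>) * h\<^sup>2"
        using order_trans[OF norm_triangle_ineq4 add_mono[OF dW[OF kh] dW[OF kh']]] by simp
      then show "norm (y' k - y k) \<le> c1 * h\<^sup>2" by (simp add: c1_def algebra_simps)
    qed
    have local: "norm (P (Suc k) - F k (P k)) \<le> c2 * w" if kh: "real (Suc k) * h' \<le> \<tau>" and Pk: "norm (P k) \<le> R + 1" for k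
    proof -
      have gr: "norm (\<sigma> (P k)) \<le> K * (2 + R)" "norm (b (P k)) \<le> K * (2 + R)"
        using order_trans[OF \<sigma>_growth mult_left_mono[OF _ K0]] order_trans[OF b_growth mult_left_mono[OF _ K0]] Pk by auto
      have KR: "0 \<le> K * (2 + R)" using K0 R by simp
      have t1: "norm (\<sigma> (P k) *v (y' k - y k)) \<le> K * (2 + R) * c1 * w"
      proof -
        have "norm (\<sigma> (P k) *v (y' k - y k)) \<le> norm (\<sigma> (P k)) * norm (y' k - y k)" by (rule vec_norm_mult_le)
        also have "\<dots> \<le> K * (2 + R) * (c1 * w)"
          using gr(1) KR inc(3)[OF kh] mult_left_mono[OF hw(1) c1] by (intro mult_mono) auto
        finally show ?thesis by (simp add: mult.assoc)
      qed
      have t2: "norm ((h' - h) *\<^sub>R b (P k)) \<le> 2 * (K * (2 + R)) * w"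
      proof -
        have "norm ((h' - h) *\<^sub>R b (P k)) = (h' - h) * norm (b (P k))" using h by simp
        also have "\<dots> \<le> (2 * w) * (K * (2 + R))" using h gr(2) KR hw(2) by (intro mult_mono) auto
        finally show ?thesis by (simp add: mult_ac)
      qed
      have t3: "norm (h' *\<^sub>R \<eta> h' (P k) (y' k)) \<le> 3 * (K * (3 * (R + 1) + 3 * S)) * w"
      proof -
        have "norm (\<eta> h' (P k) (y' k)) \<le> K * (h' powr \<gamma> * norm (P k) + norm (y' k))" by (rule \<eta>_bound[OF h'0 h(4)])
        also have "\<dots> \<le> K * (3 * h powr \<gamma> * (R + 1) + 3 * S * h powr \<gamma>)"
        proof (intro mult_left_mono add_mono mult_mono K0)
          show "h' powr \<gamma> \<le> 3 * h powr \<gamma>" using \<gamma> by (intro p3) auto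
          show "norm (y' k) \<le> 3 * S * h powr \<gamma>"
            using inc(1)[OF kh] mult_left_mono[OF hw(4), of "3 * S"] S by linarith
        qed (use Pk in auto)
        also have "\<dots> = K * (3 * (R + 1) + 3 * S) * h powr \<gamma>" by (simp add: algebra_simps)
        finally have "norm (h' *\<^sub>R \<eta> h' (P k) (y' k)) \<le> h' * (K * (3 * (R + 1) + 3 * S) * h powr \<gamma>)"
          using h'0 by (simp add: mult_left_mono)
        also have "\<dots> \<le> (3 * h) * (K * (3 * (R + 1) + 3 * S) * h powr \<gamma>)"
          using h'3 K0 R S by (intro mult_right_mono) auto
        also have "\<dots> = 3 * (K * (3 * (R + 1) + 3 * S)) * (h * h powr \<gamma>)" by simp
        finally show ?thesis unfolding hw(3) .
      qed
      have "P (Suc k) - F k (P k) = \<sigma> (P k) *v (y' k - y k) + (h' - h) *\<^sub>R b (P k) + h' *\<^sub>R \<eta> h' (P k) (y' k)"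
        unfolding F unfolding P_def y'_def Xgrid.simps U_step_def by (simp add: algebra_simps)
      then have "norm (P (Suc k) - F k (P k)) \<le> norm (\<sigma> (P k) *v (y' k - y k)) + norm ((h' - h) *\<^sub>R b (P k)) + norm (h' *\<^sub>R \<eta> h' (P k) (y' k))"
        by (simp only: norm_triangle3)
      then show ?thesis using t1 t2 t3 unfolding c2_def by (simp only: distrib_right)
    qed
    \<comment> \<open>The crude constant obtained from \<open>norm (y k) \<le> S\<close> is
      harmless, because it is used over one step only and never iterated.\<close>
    have F_lip: "norm (F k x - F k x') \<le> norm (x - x') * (1 + K * S + K)" if kh: "real (Suc k) * h' \<le> \<tau>" for k x x'
    proof -
      have "h powr (1/8) \<le> 1" using h h1 by (simp add: powr_le1)
      then have yk: "norm (y k) \<le> S" using inc(2)[OF kh] mult_left_le[of "h powr (1/8)" S] S by linarith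
      have "F k x - F k x' = (x - x') + (\<sigma> x - \<sigma> x') *v y k + h *\<^sub>R (b x - b x')"
        unfolding F by (simp add: algebra_simps)
      then have "norm (F k x - F k x') \<le> norm (x - x') + norm ((\<sigma> x - \<sigma> x') *v y k) + norm (h *\<^sub>R (b x - b x'))"
        by (simp only: norm_triangle3)
      also have "norm ((\<sigma> x - \<sigma> x') *v y k) \<le> (K * norm (x - x')) * S"
        by (rule order_trans[OF vec_norm_mult_le]) (use yk K0 in \<open>intro mult_mono \<sigma>_lip, auto\<close>)
      also have "norm (h *\<^sub>R (b x - b x')) \<le> 1 * (K * norm (x - x'))"
        using h h1 by (simp, intro mult_mono[of h 1, simplified] b_lip) auto
      finally show ?thesis by (simp add: algebra_simps)
    qed
    have R4h: "(R4 + 1) * h \<le> 1"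
    proof -
      have "0 \<le> c4 * h" "c * h = c4 * h + (R4 + 1) * h" using c4 h by (auto simp: c_def distrib_right)
      then show ?thesis using small(1) by linarith
    qed
    \<comment> \<open>Labels have size of order \<open>1 / h\<^sup>2\<close>; one factor
      \<open>1 / h\<close> more absorbs the constant \<open>R4 + 1\<close>, and
      \<open>1 / h ^ 3\<close> is still below the side \<open>N\<close> of the cube.\<close>
    have cube: "grid_round h (P k) \<in> int_cube N" if "norm (P k) \<le> R4 - norm x0" for k
    proof (rule grid_round_in_cube[OF h(1)])
      have "norm (P k - x0) \<le> R4" using that norm_triangle_ineq4[of "P k" x0] by linarith
      then have "norm (P k - x0) / h\<^sup>2 + 1 \<le> R4 / h\<^sup>2 + 1 / h\<^sup>2"
        using h h1 power_le_one[of h 2] by (intro add_mono divide_right_mono) auto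
      also have "\<dots> = (R4 + 1) * h * (1 / h ^ 3)" using h by (simp add: add_divide_distrib[symmetric] power3_eq_cube power2_eq_square)
      also have "\<dots> \<le> 1 * (1 / h ^ 3)" using R4h h by (intro mult_right_mono) auto
      also have "\<dots> \<le> 1 / h ^ 16" using h h1 by (simp add: frac_le power_decreasing)
      also have "\<dots> \<le> real N" by (rule N)
      finally show "norm (P k - x0) / h\<^sup>2 + 1 \<le> real N" .
    qed
    \<comment> \<open>Strong induction: the claim at smaller indices keeps those states below
      \<open>R + 1\<close>, as the local error estimate demands. The state of index \<open>n\<close>
      itself is only known to satisfy the weaker bound through \<open>R4\<close>, which is enough to
      round it inside the cube.\<close>
    have claim: "norm (P n - Y n) \<le> c4 * h powr (\<gamma> / 2)" if "real n * h' \<le> \<tau>" for n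
      using that
    proof (induction n rule: less_induct)
      case (less n)
      have kh: "real k * h' \<le> \<tau>" if "k \<le> n" for k
      proof -
        have "real k * h' \<le> real n * h'" using that h'0 by (intro mult_right_mono) auto
        then show ?thesis using less.prems by linarith
      qed
      have c4small: "c4 * h powr (\<gamma> / 2) \<le> 1"
      proof -
        have "0 \<le> (R4 + 1) * h powr (\<gamma> / 2)" "c * h powr (\<gamma> / 2) = c4 * h powr (\<gamma> / 2) + (R4 + 1) * h powr (\<gamma> / 2)"
          using R4 by (auto simp: c_def distrib_right)
        then show ?thesis using small(2) by linarith
      qed
      have PR: "norm (P k) \<le> R + 1" if "k < n" for k
      proof -
        have "norm (P k - Y k) \<le> 1" using less.IH[OF that kh] that c4small by linarith
        moreover have "norm (Y k) \<le> R" unfolding Y_def using YR times(1)[OF kh] that by auto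
        ultimately show ?thesis using norm_triangle_ineq2[of "P k" "Y k"] by linarith
      qed
      have w1: "w \<le> 1" using h h1 \<gamma> by (simp add: w_def powr_le1)
      have PR4: "norm (P k) \<le> R4 - norm x0" if "k \<le> n" for k
      proof (cases k)
        case 0
        have "0 \<le> K * (2 + R) * (S + 1)" using K0 R S by simp
        moreover have "norm x0 \<le> R" using YR[rule_format, of 0] \<tau>_pos by simp
        ultimately show ?thesis using 0 c2 by (simp add: P_def R4_def)
      next
        case (Suc j)
        then have j: "j < n" "real (Suc j) * h' \<le> \<tau>" using that kh[of "Suc j"] by auto
        have "norm (y j) \<le> S"
          using inc(2)[OF j(2)] h h1 S mult_left_le[of "h powr (1/8)" S] by (auto simp: powr_le1)
        have "norm (F j (P j)) \<le> norm (P j) + norm (\<sigma> (P j) *v y j) + norm (h *\<^sub>R b (P j))"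
          unfolding F by (simp only: norm_triangle3)
        also have "norm (\<sigma> (P j) *v y j) \<le> (K * (2 + R)) * S"
          by (rule order_trans[OF vec_norm_mult_le])
             (use \<open>norm (y j) \<le> S\<close> K0 R PR[OF j(1)] in \<open>intro mult_mono order_trans[OF \<sigma>_growth] mult_left_mono, auto\<close>)
        also have "norm (h *\<^sub>R b (P j)) \<le> 1 * (K * (2 + R))"
        proof -
          have "h * norm (b (P j)) \<le> 1 * (K * (2 + R))"
            using h h1 K0 R PR[OF j(1)] by (intro mult_mono order_trans[OF b_growth] mult_left_mono) auto
          then show ?thesis using h by simp
        qed
        finally have "norm (F j (P j)) \<le> R + 1 + K * (2 + R) * (S + 1)"
          using PR[OF j(1)] by (simp add: algebra_simps)
        moreover have "norm (P (Suc j) - F j (P j)) \<le> c2"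
          using local[OF j(2) PR[OF j(1)]] mult_left_mono[OF w1 c2] by simp
        ultimately show ?thesis
          using norm_triangle_ineq2[of "P (Suc j)" "F j (P j)"] unfolding Suc R4_def by linarith
      qed
      have zz: "norm (z (Suc k) - F k (z k)) \<le> c3 * w" if "k < n" for k
      proof -
        have k: "real (Suc k) * h' \<le> \<tau>" using that kh[of "Suc k"] by auto
        have "z (Suc k) - F k (z k) = (z (Suc k) - P (Suc k)) + (P (Suc k) - F k (P k)) + (F k (P k) - F k (z k))" by simp
        then have "norm (z (Suc k) - F k (z k)) \<le> norm (z (Suc k) - P (Suc k)) + norm (P (Suc k) - F k (P k)) + norm (F k (P k) - F k (z k))"
          by (metis norm_triangle3)
        then have "norm (z (Suc k) - F k (z k)) \<le> norm (P (Suc k) - z (Suc k)) + norm (P (Suc k) - F k (P k)) + norm (F k (P k) - F k (z k))"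
          by (simp only: norm_minus_commute[of "z (Suc k)"])
        also have "norm (P (Suc k) - z (Suc k)) \<le> m * h\<^sup>2" unfolding z_def m_def by (rule grid_round_error[OF h(1)])
        also have "m * h\<^sup>2 \<le> m * w" using m hw by (intro mult_left_mono)
        also have "norm (P (Suc k) - F k (P k)) \<le> c2 * w" by (rule local[OF k PR[OF that]])
        also have "norm (F k (P k) - F k (z k)) \<le> m * w * (1 + K * S + K)"
        proof (rule order_trans[OF F_lip[OF k] mult_right_mono])
          have "norm (P k - z k) \<le> m * h\<^sup>2" unfolding z_def m_def by (rule grid_round_error[OF h(1)])
          also have "m * h\<^sup>2 \<le> m * w" using m hw by (intro mult_left_mono)
          finally show "norm (P k - z k) \<le> m * w" .
        qed (use K0 S in simp)
        also have "m * w + c2 * w + m * w * (1 + K * S + K) = (c3 - 1) * w" by (simp add: c3_def algebra_simps)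
        also have "\<dots> \<le> c3 * w" using w0 by (simp add: left_diff_distrib)
        finally show ?thesis by simp
      qed
      define D where "D k = euler b \<sigma> h \<omega> k (z k) (n - k)" for k
      have step: "norm (D (Suc k) - D k) \<le> h powr (- \<gamma> / 2) * (c3 * w)" if "k < n" for k
      proof -
        define j where "j = n - Suc k"
        have j: "n - k = Suc j" "n - Suc k = j" "Suc k + j = n" using that by (auto simp: j_def)
        have "norm (D (Suc k) - D k) \<le> h powr (- \<gamma> / 2) * max (norm (z (Suc k) - euler b \<sigma> h \<omega> k (z k) 1)) (h\<^sup>2)"
          unfolding D_def j z_def
          using flow[rule_format, OF cube[OF PR4[of k]] cube[OF PR4[of "Suc k"]], of k j] that times(1)[OF kh[OF order_refl]] j(3)
          by auto
        also have "\<dots> \<le> h powr (- \<gamma> / 2) * (c3 * w)"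
        proof (intro mult_left_mono)
          have "1 * w \<le> c3 * w" using c3 w0 by (intro mult_right_mono) auto
          then have "h\<^sup>2 \<le> c3 * w" using hw(1) by linarith
          then show "max (norm (z (Suc k) - euler b \<sigma> h \<omega> k (z k) 1)) (h\<^sup>2) \<le> c3 * w"
            using zz[OF that] unfolding F_def by simp
        qed simp
        finally show ?thesis .
      qed
      have tel: "D n - D 0 = (\<Sum>k<n. D (Suc k) - D k)" by (simp add: sum_lessThan_telescope)
      have D0: "D 0 = Y n" "D n = z n" by (auto simp: D_def Y_def z_def P_def grid_round_x0)
      have "norm (z n - Y n) \<le> (\<Sum>k<n. h powr (- \<gamma> / 2) * (c3 * w))"
        unfolding D0[symmetric] tel by (rule sum_norm_le) (use step in auto)
      \<comment> \<open>The local error \<open>h powr (1 + \<gamma>)\<close> loses one factor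
        \<open>h\<close> to the number of steps and a factor \<open>h powr (\<gamma> / 2)\<close> to
        the instability of the flow.\<close>
      also have "\<dots> = (real n * h) * c3 * (h powr (- \<gamma> / 2) * h powr \<gamma>)" using hw(3) by (simp add: mult_ac)
      also have "h powr (- \<gamma> / 2) * h powr \<gamma> = h powr (\<gamma> / 2)" by (simp add: powr_add[symmetric])
      also have "(real n * h) * c3 * h powr (\<gamma> / 2) \<le> \<tau> * c3 * h powr (\<gamma> / 2)"
        using times(1)[OF less.prems] c3 by (intro mult_right_mono) auto
      finally have "norm (z n - Y n) \<le> \<tau> * c3 * h powr (\<gamma> / 2)" .
      moreover have "norm (P n - z n) \<le> m * h powr (\<gamma> / 2)"
      proof -
        have "norm (P n - z n) \<le> m * h\<^sup>2" unfolding z_def m_def by (rule grid_round_error[OF h(1)])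
        also have "h\<^sup>2 \<le> h powr (\<gamma> / 2)" using h h1 \<gamma> powr_mono'[of "\<gamma> / 2" 2 h] by simp
        finally show ?thesis using m by (simp add: mult_left_mono)
      qed
      ultimately show ?case
        using norm_triangle_ineq[of "P n - z n" "z n - Y n"] by (simp add: c4_def algebra_simps)
    qed
    have "c4 * h powr (\<gamma> / 2) \<le> c * h powr (\<gamma> / 2)" using R4 by (intro mult_right_mono) (auto simp: c_def)
    then show "norm (scheme h' \<omega> n - eul h \<omega> n) \<le> c * h powr (\<gamma> / 2)"
      using claim[OF nh] unfolding P_def Y_def by linarith
  qed
qed

end

section \<open>A countable net of step sizes and union bounds over its grids\<close>

lemma nn_integral_finite_sum_le:
  fixes g :: "'i \<Rightarrow> 'a \<Rightarrow> real"
  assumes fin: "finite I" and card: "real (card I) \<le> n" and B: "0 \<le> B"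
    and meas: "\<And>i. i \<in> I \<Longrightarrow> g i \<in> borel_measurable M"
    and nn: "\<And>i x. i \<in> I \<Longrightarrow> 0 \<le> g i x"
    and le: "\<And>i. i \<in> I \<Longrightarrow> (\<integral>\<^sup>+ x. ennreal (g i x) \<partial>M) \<le> ennreal B"
  shows "(\<integral>\<^sup>+ x. ennreal (\<Sum>i\<in>I. g i x) \<partial>M) \<le> ennreal (n * B)"
proof -
  have "(\<integral>\<^sup>+ x. ennreal (\<Sum>i\<in>I. g i x) \<partial>M) = (\<integral>\<^sup>+ x. (\<Sum>i\<in>I. ennreal (g i x)) \<partial>M)"
    using nn by simp
  also have "\<dots> = (\<Sum>i\<in>I. \<integral>\<^sup>+ x. ennreal (g i x) \<partial>M)"
    using meas by (intro nn_integral_sum) auto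
  also have "\<dots> \<le> (\<Sum>i\<in>I. ennreal B)" by (intro sum_mono le)
  also have "\<dots> = ennreal (real (card I) * B)"
    using B by (simp add: ennreal_of_nat_eq_real_of_nat ennreal_mult)
  also have "\<dots> \<le> ennreal (n * B)" using card B by (intro ennreal_leI mult_right_mono) auto
  finally show ?thesis .
qed

definition net :: "nat \<Rightarrow> real" where
  "net N = real (Suc N) powr (-1/16)"

lemma net: "0 < net N" "net N \<le> 1" "net N ^ 16 = 1 / real (Suc N)" "1 / net N \<le> real (Suc N)"
proof -
  show 1: "0 < net N" by (simp add: net_def)
  show 2: "net N \<le> 1"
    using powr_mono[of "-1/16" 0 "real (Suc N)"] by (simp add: net_def)
  show 3: "net N ^ 16 = 1 / real (Suc N)"
  proof -
    have "net N ^ 16 = net N powr 16" using 1 powr_realpow[of "net N" 16] by simp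
    also have "\<dots> = real (Suc N) powr (-1)" unfolding net_def by (simp only: powr_powr) simp
    also have "\<dots> = 1 / real (Suc N)" using powr_minus_divide[of "real (Suc N)" 1] by simp
    finally show ?thesis .
  qed
  have "net N ^ 16 \<le> net N ^ 1" using 1 2 by (intro power_decreasing) auto
  then show "1 / net N \<le> real (Suc N)" using 1 3 by (simp add: field_simps)
qed

text \<open>The net \<open>(n powr (-1/16))\<^sub>n\<close> is so fine that its gap at \<open>h\<close> is of order \<open>h\<^sup>1\<^sup>7\<close>, yet it has only polynomially many
  points above \<open>h\<close>.\<close>

lemma net_approximation:
  assumes h': "0 < h'" "h' < 1" and n: "Suc N = nat \<lceil>1 / h' ^ 16\<rceil>"
  shows "net N \<le> h'" "h' \<le> net N + 2 * net N ^ 17"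
proof -
  define n1 where "n1 = real (Suc N)"
  have n1: "1 / h' ^ 16 \<le> n1" "n1 < 1 / h' ^ 16 + 1" "2 \<le> n1"
  proof -
    have gt: "1 < 1 / h' ^ 16" using h' by (simp add: power_less_one_iff)
    then have "of_int \<lceil>1 / h' ^ 16\<rceil> = n1" unfolding n1_def n by (simp add: less_le_trans[OF zero_less_one] order_less_imp_le)
    then show "1 / h' ^ 16 \<le> n1" "n1 < 1 / h' ^ 16 + 1" by linarith+
    then have "1 < Suc N" using gt unfolding n1_def by linarith
    then show "2 \<le> n1" by (simp add: n1_def)
  qed
  have h16: "0 < h' ^ 16" using h' by simp
  have "net N ^ 16 \<le> h' ^ 16" unfolding net(3) n1_def[symmetric] using n1(1,3) h16 by (simp add: field_simps)
  then show "net N \<le> h'" using h' power_le_imp_le_base[of "net N" 15 h'] by simp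
  have "h' ^ 16 * (n1 - 1) \<le> 1" using n1(2) h16 by (simp add: field_simps)
  then have "h' ^ 16 \<le> 1 / (n1 - 1)" using n1(3) by (simp add: field_simps)
  \<comment> \<open>The generous 32 is fitted to Bernoulli's inequality with exponent 16 and
    relative gap \<open>2 * net N ^ 16\<close>, which is \<open>2 / n1\<close>.\<close>
  also have "\<dots> \<le> 1 / n1 * (1 + 32 * (1 / n1))"
    using n1(3) by (simp add: divide_simps) (simp add: algebra_simps)
  also have "\<dots> = net N ^ 16 * (1 + real 16 * (2 * net N ^ 16))"
    unfolding net(3) n1_def[symmetric] by simp
  also have "\<dots> \<le> net N ^ 16 * (1 + 2 * net N ^ 16) ^ 16"
    using net(1)[of N] by (intro mult_left_mono Bernoulli_inequality) (auto intro: order_trans[of _ 0])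
  also have "\<dots> = (net N + 2 * net N ^ 17) ^ 16"
  proof -
    have "net N ^ 17 = net N * net N ^ 16" using power_add[of "net N" 1 16] by simp
    then show ?thesis by (simp add: power_mult_distrib[symmetric] distrib_left mult.left_commute)
  qed
  finally show "h' \<le> net N + 2 * net N ^ 17"
    using net(1)[of N] power_le_imp_le_base[of h' 15 "net N + 2 * net N ^ 17"] by simp
qed

context perturbed_euler_scheme
begin

text \<open>The true number of steps is of order \<open>1 / net N\<close>, the sixteenth root of
  \<open>Suc N\<close>; the cruder linear bound keeps the counting in natural numbers and is still
  polynomial.\<close>

lemma net_index_bound:
  assumes "real k * net N \<le> \<tau>" shows "k < (nat \<lceil>\<tau>\<rceil> + 1) * Suc N"
proof -
  have "real k \<le> \<tau> * (1 / net N)" using assms net(1)[of N] by (simp add: field_simps)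
  also have "\<dots> \<le> \<tau> * real (Suc N)" using \<tau>_pos net(4) by (intro mult_left_mono) auto
  also have "\<dots> < (real (nat \<lceil>\<tau>\<rceil>) + 1) * real (Suc N)"
    by (intro mult_strict_right_mono) linarith+
  also have "\<dots> = real ((nat \<lceil>\<tau>\<rceil> + 1) * Suc N)" by (simp only: of_nat_mult of_nat_add of_nat_1)
  finally show ?thesis by (simp only: of_nat_less_iff)
qed

text \<open>A union bound over two grid points, a time index and a number of steps: at most of order
  \<open>(N + 1) ^ (2 * m + 2)\<close> quadruples, with \<open>m\<close> the dimension. The
  normalised quotient of each has a moment of order \<open>2 * q\<close> that is at most
  \<open>C * net N powr (\<gamma> * q)\<close>, which for large \<open>q\<close> is at most
  \<open>C / (N + 1) ^ (2 * m + 4)\<close>. The sums therefore have summable expectations.\<close>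

lemma net_flow_stability:
  "AE \<omega> in M. eventually (\<lambda>N. \<forall>v\<in>int_cube (Suc N). \<forall>v'\<in>int_cube (Suc N). \<forall>k j. real (Suc k + j) * net N \<le> \<tau> \<longrightarrow>
       norm (euler b \<sigma> (net N) \<omega> (Suc k) (grid_point (net N) v') j - euler b \<sigma> (net N) \<omega> k (grid_point (net N) v) (Suc j))
         \<le> net N powr (- \<gamma> / 2) * max (norm (grid_point (net N) v' - euler b \<sigma> (net N) \<omega> k (grid_point (net N) v) 1)) ((net N)\<^sup>2)) sequentially"
proof -
  define m where "m = CARD('m)"
  \<comment> \<open>Since \<open>net N\<close> is the power \<open>-1/16\<close> of
    \<open>N + 1\<close>, the condition \<open>16 * (2 * m + 4) \<le> \<gamma> * q\<close> beats the
    number of quadruples and leaves a spare factor \<open>1 / (N + 1) ^ 2\<close>.\<close>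
  obtain q0 :: nat where q0: "real (2 * m + 4) * 16 / \<gamma> < real q0" using reals_Archimedean2 by blast
  define q where "q = Suc q0"
  have q: "q \<ge> 1" "real (2 * m + 4) * 16 \<le> \<gamma> * real q"
  proof -
    show "q \<ge> 1" by (simp add: q_def)
    have "real (2 * m + 4) * 16 / \<gamma> \<le> real q" using q0 by (simp add: q_def)
    then show "real (2 * m + 4) * 16 \<le> \<gamma> * real q" using \<gamma> by (simp add: divide_le_eq mult.commute)
  qed
  obtain C where C: "C \<ge> 0" and flow: "\<And>h k j z z' r. 0 < h \<Longrightarrow> h \<le> T \<Longrightarrow> real j * h \<le> T \<Longrightarrow> 0 < r \<Longrightarrow>
     (\<integral>\<^sup>+ \<omega>. ennreal ((norm (euler b \<sigma> h \<omega> (Suc k) z' j - euler b \<sigma> h \<omega> k z (Suc j))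
          / max (norm (z' - euler b \<sigma> h \<omega> k z 1)) r) ^ (2 * q)) \<partial>M) \<le> ennreal C"
    using euler_flow_lipschitz[OF q(1) T(1)] by blast
  define c where "c = nat \<lceil>\<tau>\<rceil> + 1"
  define I where "I N = (int_cube (Suc N) :: (int^'m) set) \<times> (int_cube (Suc N) :: (int^'m) set) \<times> {..<c * Suc N} \<times> {j. j < c * Suc N \<and> real j * net N \<le> T}" for N
  define ratio where "ratio N \<omega> v v' k j =
      net N powr (\<gamma> / 2) * (norm (euler b \<sigma> (net N) \<omega> (Suc k) (grid_point (net N) v') j - euler b \<sigma> (net N) \<omega> k (grid_point (net N) v) (Suc j))
          / max (norm (grid_point (net N) v' - euler b \<sigma> (net N) \<omega> k (grid_point (net N) v) 1)) ((net N)\<^sup>2))" for N \<omega> v v' k j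
  define g where "g N p \<omega> = (case p of (v, v', k, j) \<Rightarrow> ratio N \<omega> v v' k j ^ (2 * q))" for N p \<omega>
  define u where "u N \<omega> = (\<Sum>p\<in>I N. g N p \<omega>)" for N \<omega>
  have ratio0: "0 \<le> ratio N \<omega> v v' k j" for N \<omega> v v' k j
    using net(1)[of N] by (auto simp: ratio_def intro!: mult_nonneg_nonneg divide_nonneg_nonneg le_max_iff_disj[THEN iffD2])
  have g0: "0 \<le> g N p \<omega>" for N p \<omega> by (auto simp: g_def split: prod.split)
  have fin: "finite (I N)" for N unfolding I_def by (intro finite_cartesian_product int_cube_finite_card(1)) auto
  have card: "real (card (I N)) \<le> 3 ^ (2 * m) * real c ^ 2 * real (Suc N) ^ (2 * m + 2)" for N
  proof -
    have cc: "card (int_cube (Suc N) :: (int^'m) set) \<le> (3 * Suc N) ^ m"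
      by (rule order_trans[OF int_cube_finite_card(2)]) (auto simp: m_def intro!: power_mono)
    have J: "card {j. j < c * Suc N \<and> real j * net N \<le> T} \<le> c * Suc N"
      using card_mono[of "{..<c * Suc N}" "{j. j < c * Suc N \<and> real j * net N \<le> T}"] by auto
    have "card (I N) \<le> (3 * Suc N) ^ m * ((3 * Suc N) ^ m * ((c * Suc N) * (c * Suc N)))"
      unfolding I_def card_cartesian_product by (intro mult_le_mono cc J) auto
    then have "real (card (I N)) \<le> real ((3 * Suc N) ^ m * ((3 * Suc N) ^ m * ((c * Suc N) * (c * Suc N))))"
      by (rule of_nat_mono)
    also have "\<dots> = 3 ^ (2 * m) * real c ^ 2 * real (Suc N) ^ (2 * m + 2)"
      unfolding of_nat_mult of_nat_power power_mult_distrib by (simp add: power_add power2_eq_square mult_2 del: of_nat_Suc)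
    finally show ?thesis .
  qed
  have gm: "g N p \<in> borel_measurable M" for N p
  proof -
    obtain v v' k j where p: "p = (v, v', k, j)" by (cases p) auto
    have [measurable]: "(\<lambda>\<omega>. euler b \<sigma> (net N) \<omega> i x l) \<in> borel_measurable M" for i x l
      using net(1)[of N] by (intro euler_measurable_M) auto
    show ?thesis unfolding g_def ratio_def p prod.case by (measurable)
  qed
  have Eg: "(\<integral>\<^sup>+ \<omega>. ennreal (g N p \<omega>) \<partial>M) \<le> ennreal (C / real (Suc N) ^ (2 * m + 4))" if p: "p \<in> I N" for N p
  proof -
    obtain v v' k j where p': "p = (v, v', k, j)" by (cases p) auto
    have j: "real j * net N \<le> T" using p unfolding p' I_def by auto
    let ?r = "\<lambda>\<omega>. norm (euler b \<sigma> (net N) \<omega> (Suc k) (grid_point (net N) v') j - euler b \<sigma> (net N) \<omega> k (grid_point (net N) v) (Suc j))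
          / max (norm (grid_point (net N) v' - euler b \<sigma> (net N) \<omega> k (grid_point (net N) v) 1)) ((net N)\<^sup>2)"
    have r0: "0 \<le> ?r \<omega>" for \<omega>
      using net(1)[of N] by (auto intro!: divide_nonneg_nonneg le_max_iff_disj[THEN iffD2])
    have small: "(net N powr (\<gamma> / 2)) ^ (2 * q) \<le> 1 / real (Suc N) ^ (2 * m + 4)"
    proof -
      have "(net N powr (\<gamma> / 2)) ^ (2 * q) = net N powr (\<gamma> / 2 * real (2 * q))"
        using net(1)[of N] by (simp add: powr_realpow[symmetric] powr_powr)
      also have "\<dots> \<le> net N powr real (16 * (2 * m + 4))"
        using net(1,2)[of N] q(2) by (intro powr_mono') (auto simp: mult.commute)
      also have "\<dots> = (net N ^ 16) ^ (2 * m + 4)"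
        using net(1)[of N] by (simp only: powr_realpow power_mult)
      also have "\<dots> = 1 / real (Suc N) ^ (2 * m + 4)" unfolding net(3) by (simp add: power_divide del: of_nat_Suc)
      finally show ?thesis .
    qed
    have "(\<integral>\<^sup>+ \<omega>. ennreal (g N p \<omega>) \<partial>M) \<le> (\<integral>\<^sup>+ \<omega>. ennreal (1 / real (Suc N) ^ (2 * m + 4)) * ennreal (?r \<omega> ^ (2 * q)) \<partial>M)"
    proof (rule nn_integral_mono)
      fix \<omega>
      have "g N p \<omega> = (net N powr (\<gamma> / 2)) ^ (2 * q) * ?r \<omega> ^ (2 * q)"
        by (simp only: g_def p' prod.case ratio_def power_mult_distrib)
      also have "\<dots> \<le> 1 / real (Suc N) ^ (2 * m + 4) * ?r \<omega> ^ (2 * q)"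
        by (rule mult_right_mono[OF small zero_le_power[OF r0]])
      finally have "ennreal (g N p \<omega>) \<le> ennreal (1 / real (Suc N) ^ (2 * m + 4) * ?r \<omega> ^ (2 * q))" by (rule ennreal_leI)
      also have "\<dots> = ennreal (1 / real (Suc N) ^ (2 * m + 4)) * ennreal (?r \<omega> ^ (2 * q))"
        by (rule ennreal_mult) (auto intro: zero_le_power[OF r0])
      finally show "ennreal (g N p \<omega>) \<le> ennreal (1 / real (Suc N) ^ (2 * m + 4)) * ennreal (?r \<omega> ^ (2 * q))" .
    qed
    also have "\<dots> = ennreal (1 / real (Suc N) ^ (2 * m + 4)) * (\<integral>\<^sup>+ \<omega>. ennreal (?r \<omega> ^ (2 * q)) \<partial>M)"
    proof (rule nn_integral_cmult)
      have [measurable]: "(\<lambda>\<omega>. euler b \<sigma> (net N) \<omega> i x l) \<in> borel_measurable M" for i x l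
        using net(1)[of N] by (intro euler_measurable_M) auto
      show "(\<lambda>\<omega>. ennreal (?r \<omega> ^ (2 * q))) \<in> borel_measurable M" by measurable
    qed
    also have "\<dots> \<le> ennreal (1 / real (Suc N) ^ (2 * m + 4)) * ennreal C"
      using net(1,2)[of N] T(1) j by (intro mult_left_mono flow) auto
    also have "\<dots> = ennreal (C / real (Suc N) ^ (2 * m + 4))" using C by (simp add: ennreal_mult[symmetric])
    finally show ?thesis .
  qed
  have um: "u N \<in> borel_measurable M" for N unfolding u_def using gm by (intro borel_measurable_sum) auto
  have Eu: "(\<integral>\<^sup>+ \<omega>. ennreal (u N \<omega>) \<partial>M) \<le> ennreal (3 ^ (2 * m) * real c ^ 2 * C / real (Suc N) ^ 2)" for N
  proof -
    have "(\<integral>\<^sup>+ \<omega>. ennreal (u N \<omega>) \<partial>M)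
        \<le> ennreal (3 ^ (2 * m) * real c ^ 2 * real (Suc N) ^ (2 * m + 2) * (C / real (Suc N) ^ (2 * m + 4)))"
      unfolding u_def using C by (intro nn_integral_finite_sum_le fin card gm g0 Eg) auto
    also have "3 ^ (2 * m) * real c ^ 2 * real (Suc N) ^ (2 * m + 2) * (C / real (Suc N) ^ (2 * m + 4))
       = 3 ^ (2 * m) * real c ^ 2 * C / real (Suc N) ^ 2"
    proof -
      have "real (Suc N) ^ (2 * m + 4) = real (Suc N) ^ (2 * m + 2) * real (Suc N) ^ 2"
      proof -
        have e: "2 * m + 4 = (2 * m + 2) + 2" by simp
        show ?thesis unfolding e by (rule power_add)
      qed
      moreover have "x * y * (C / (y * z)) = x * C / z" if "y \<noteq> 0" for x y z :: real using that by simp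
      ultimately show ?thesis by simp
    qed
    finally show ?thesis .
  qed
  have "AE \<omega> in M. (\<lambda>N. u N \<omega>) \<longlonglongrightarrow> 0"
    by (rule AE_tendsto_zero_of_summable_moments[OF um _ _ Eu]) (use C g0 in \<open>auto simp: u_def intro!: sum_nonneg\<close>)
  then show ?thesis
  proof (rule eventually_mono)
    fix \<omega> assume "(\<lambda>N. u N \<omega>) \<longlonglongrightarrow> 0"
    \<comment> \<open>A sum of nonnegative terms below 1 forces every normalised quotient below 1
      simultaneously.\<close>
    then have "eventually (\<lambda>N. u N \<omega> < 1) sequentially" by (rule order_tendstoD) simp
    then show "eventually (\<lambda>N. \<forall>v\<in>int_cube (Suc N). \<forall>v'\<in>int_cube (Suc N). \<forall>k j. real (Suc k + j) * net N \<le> \<tau> \<longrightarrow>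
       norm (euler b \<sigma> (net N) \<omega> (Suc k) (grid_point (net N) v') j - euler b \<sigma> (net N) \<omega> k (grid_point (net N) v) (Suc j))
         \<le> net N powr (- \<gamma> / 2) * max (norm (grid_point (net N) v' - euler b \<sigma> (net N) \<omega> k (grid_point (net N) v) 1)) ((net N)\<^sup>2)) sequentially"
    proof (rule eventually_mono, intro ballI allI impI)
      fix N and v v' :: "int^'m" and k j
      assume u1: "u N \<omega> < 1" and v: "v \<in> int_cube (Suc N)" "v' \<in> int_cube (Suc N)" and kj: "real (Suc k + j) * net N \<le> \<tau>"
      have "real k * net N \<le> real (Suc k + j) * net N" "real j * net N \<le> real (Suc k + j) * net N"
        using net(1)[of N] by (auto intro!: mult_right_mono)
      then have kj': "real k * net N \<le> \<tau>" "real j * net N \<le> \<tau>" using kj by linarith+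
      have pI: "(v, v', k, j) \<in> I N"
        unfolding I_def c_def using v net_index_bound[OF kj'(1)] net_index_bound[OF kj'(2)] kj'(2) T(2) by auto
      have "g N (v, v', k, j) \<omega> \<le> u N \<omega>" unfolding u_def using fin g0 pI by (intro member_le_sum) auto
      then have "ratio N \<omega> v v' k j ^ (2 * q) \<le> 1 ^ (2 * q)" using u1 by (simp add: g_def)
      then have r1: "ratio N \<omega> v v' k j \<le> 1" using ratio0 q(1) power_mono_iff[of "ratio N \<omega> v v' k j" 1 "2 * q"] by simp
      define mx where "mx = max (norm (grid_point (net N) v' - euler b \<sigma> (net N) \<omega> k (grid_point (net N) v) 1)) ((net N)\<^sup>2)"
      define nm where "nm = norm (euler b \<sigma> (net N) \<omega> (Suc k) (grid_point (net N) v') j - euler b \<sigma> (net N) \<omega> k (grid_point (net N) v) (Suc j))"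
      have mx: "0 < mx" unfolding mx_def using net(1)[of N] by (simp add: less_max_iff_disj)
      have hp: "0 < net N powr (\<gamma> / 2)" "net N powr (- \<gamma> / 2) = 1 / net N powr (\<gamma> / 2)"
        using net(1)[of N] powr_minus_divide[of "net N" "\<gamma> / 2"] by auto
      have "net N powr (\<gamma> / 2) * (nm / mx) \<le> 1" using r1 unfolding ratio_def nm_def mx_def .
      then have "nm \<le> net N powr (- \<gamma> / 2) * mx" unfolding hp(2) using mx hp(1) by (simp add: field_simps)
      then show "norm (euler b \<sigma> (net N) \<omega> (Suc k) (grid_point (net N) v') j - euler b \<sigma> (net N) \<omega> k (grid_point (net N) v) (Suc j))
         \<le> net N powr (- \<gamma> / 2) * max (norm (grid_point (net N) v' - euler b \<sigma> (net N) \<omega> k (grid_point (net N) v) 1)) ((net N)\<^sup>2)"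
        unfolding nm_def mx_def .
    qed
  qed
qed

text \<open>A union bound for the strong error: moments of order \<open>2 * 64\<close> give
  \<open>net N ^ 64 = 1 / (N + 1) ^ 4\<close> per grid time, and at most of order
  \<open>N + 1\<close> grid times leave a summable bound. \<open>\<delta>\<close> is the root of the
  sum over the grid times.\<close>

lemma net_strong_convergence:
  "AE \<omega> in M. \<exists>\<delta>. \<delta> \<longlonglongrightarrow> 0 \<and> (\<forall>N k. real k * net N \<le> \<tau> \<longrightarrow> norm (X (real k * net N) \<omega> - eul (net N) \<omega> k) \<le> \<delta> N)"
proof -
  obtain C where C: "C \<ge> 0" and ord: "\<And>h k. 0 < h \<Longrightarrow> h \<le> T \<Longrightarrow> real k * h \<le> \<tau> \<Longrightarrow>
     moment (2 * 64) (\<lambda>\<omega>. X (real k * h) \<omega> - eul h \<omega> k) \<le> ennreal (C * h ^ 64)"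
    using euler_strong_order[of 64] by auto
  define c where "c = nat \<lceil>\<tau>\<rceil> + 1"
  define I where "I N = {k. k < c * Suc N \<and> real k * net N \<le> \<tau>}" for N
  define g where "g N k \<omega> = norm (X (real k * net N) \<omega> - eul (net N) \<omega> k) ^ (2 * 64)" for N k \<omega>
  define u where "u N \<omega> = (\<Sum>k\<in>I N. g N k \<omega>)" for N \<omega>
  have fin: "finite (I N)" for N unfolding I_def by auto
  have card: "real (card (I N)) \<le> real c * real (Suc N)" for N
  proof -
    have "card (I N) \<le> c * Suc N" using card_mono[of "{..<c * Suc N}" "I N"] by (auto simp: I_def)
    then have "real (card (I N)) \<le> real (c * Suc N)" by (rule of_nat_mono)
    then show ?thesis by (simp only: of_nat_mult)
  qed
  have g0: "0 \<le> g N k \<omega>" for N k \<omega> by (simp add: g_def)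
  have gm: "g N k \<in> borel_measurable M" if "k \<in> I N" for N k
  proof -
    have [measurable]: "X (real k * net N) \<in> borel_measurable M" using that net(1)[of N] by (intro X_measurable) (auto simp: I_def)
    have [measurable]: "(\<lambda>\<omega>. eul (net N) \<omega> k) \<in> borel_measurable M" using net(1)[of N] by (intro euler_measurable_M) auto
    show ?thesis unfolding g_def by measurable
  qed
  have h64: "net N ^ 64 = 1 / real (Suc N) ^ 4" for N
  proof -
    have "net N ^ 64 = (net N ^ 16) ^ 4" by (simp only: power_mult[symmetric]) simp
    then show ?thesis unfolding net(3) by (simp add: power_divide del: of_nat_Suc)
  qed
  have Eg: "(\<integral>\<^sup>+ \<omega>. ennreal (g N k \<omega>) \<partial>M) \<le> ennreal (C / real (Suc N) ^ 4)" if "k \<in> I N" for N k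
  proof -
    have "(\<integral>\<^sup>+ \<omega>. ennreal (g N k \<omega>) \<partial>M) \<le> ennreal (C * net N ^ 64)"
      unfolding g_def using that net(1,2)[of N] T(1) by (intro ord) (auto simp: I_def)
    then show ?thesis unfolding h64 by simp
  qed
  have um: "u N \<in> borel_measurable M" for N unfolding u_def using gm by (intro borel_measurable_sum) auto
  have u0: "0 \<le> u N \<omega>" for N \<omega> unfolding u_def using g0 by (intro sum_nonneg) auto
  have Eu: "(\<integral>\<^sup>+ \<omega>. ennreal (u N \<omega>) \<partial>M) \<le> ennreal (real c * C / real (Suc N) ^ 2)" for N
  proof -
    have "(\<integral>\<^sup>+ \<omega>. ennreal (u N \<omega>) \<partial>M) \<le> ennreal (real c * real (Suc N) * (C / real (Suc N) ^ 4))"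
      unfolding u_def using C by (intro nn_integral_finite_sum_le fin card gm g0 Eg) auto
    also have "\<dots> \<le> ennreal (real c * C / real (Suc N) ^ 2)"
    proof (rule ennreal_leI)
      have "real (Suc N) * (C / real (Suc N) ^ 4) = C / real (Suc N) ^ 3"
        by (simp add: power_eq_if del: of_nat_Suc)
      also have "\<dots> \<le> C / real (Suc N) ^ 2" using C by (intro divide_left_mono power_increasing) auto
      finally show "real c * real (Suc N) * (C / real (Suc N) ^ 4) \<le> real c * C / real (Suc N) ^ 2"
        using mult_left_mono[of "real (Suc N) * (C / real (Suc N) ^ 4)" "C / real (Suc N) ^ 2" "real c"] by simp
    qed
    finally show ?thesis .
  qed
  have "AE \<omega> in M. (\<lambda>N. u N \<omega>) \<longlonglongrightarrow> 0"
    by (rule AE_tendsto_zero_of_summable_moments[OF um u0 _ Eu]) (use C in auto)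
  then show ?thesis
  proof (rule eventually_mono)
    fix \<omega> assume lim: "(\<lambda>N. u N \<omega>) \<longlonglongrightarrow> 0"
    show "\<exists>\<delta>. \<delta> \<longlonglongrightarrow> 0 \<and> (\<forall>N k. real k * net N \<le> \<tau> \<longrightarrow> norm (X (real k * net N) \<omega> - eul (net N) \<omega> k) \<le> \<delta> N)"
    proof (intro exI[of _ "\<lambda>N. root 128 (u N \<omega>)"] conjI allI impI)
      show "(\<lambda>N. root 128 (u N \<omega>)) \<longlonglongrightarrow> 0" using tendsto_real_root[OF lim, of 128] by simp
      fix N k assume k: "real k * net N \<le> \<tau>"
      then have "k \<in> I N" unfolding I_def c_def using net_index_bound[OF k] by auto
      then have "g N k \<omega> \<le> u N \<omega>" unfolding u_def using fin g0 by (intro member_le_sum) auto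
      then have "root 128 (g N k \<omega>) \<le> root 128 (u N \<omega>)" by (intro real_root_le_mono) auto
      moreover have "root 128 (g N k \<omega>) = norm (X (real k * net N) \<omega> - eul (net N) \<omega> k)"
        unfolding g_def by (simp add: real_root_power_cancel)
      ultimately show "norm (X (real k * net N) \<omega> - eul (net N) \<omega> k) \<le> root 128 (u N \<omega>)" by simp
    qed
  qed
qed

text \<open>All exceptional sets are fixed before \<open>h\<close> is chosen: those for the Hoelder
  bounds of \<open>X\<close> and of the driving path, and for stability and convergence along the
  net. Outside them the estimate for every small \<open>h\<close> is deterministic, so neither the
  uncountably many step sizes nor an arbitrary dependence of \<open>\<eta>\<close> on
  \<open>h\<close> does harm.\<close>

theorem almost_sure_convergence:
  "AE \<omega> in M. ((\<lambda>h. SUP t\<in>{0..\<tau>}. norm (X t \<omega> - interp h \<omega> t)) \<longlongrightarrow> 0) (at_right 0)"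
proof -
  obtain SX where SX: "\<And>\<omega>. 0 \<le> SX \<omega>"
    "AE \<omega> in M. \<forall>s\<in>{0..\<tau>}. \<forall>t\<in>{0..\<tau>}. norm (X t \<omega> - X s \<omega>) \<le> SX \<omega> * \<bar>t - s\<bar> powr (1/8)"
    using solution_hoelder[OF order_refl] by blast
  obtain SW where SW: "\<And>\<omega>. 0 \<le> SW \<omega>"
    "AE \<omega> in M. \<forall>s\<in>{0..T}. \<forall>t\<in>{0..T}. norm (\<omega> t - \<omega> s) \<le> SW \<omega> * \<bar>t - s\<bar> powr (1/8)"
    using wiener_hoelder by blast
  show ?thesis
    using SX(2) SW(2) net_flow_stability net_strong_convergence
  proof eventually_elim
    case (elim \<omega>)
    note hX = elim(1) and hW = elim(2) and flow = elim(3)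
    obtain \<delta> where \<delta>: "\<delta> \<longlonglongrightarrow> 0" "\<And>N k. real k * net N \<le> \<tau> \<Longrightarrow> norm (X (real k * net N) \<omega> - eul (net N) \<omega> k) \<le> \<delta> N"
      using elim(4) by blast
    have K0: "0 \<le> K" using K1 by simp
    define s where "s = SX \<omega>"
    define S where "S = SW \<omega>"
    have s: "0 \<le> s" and S: "0 \<le> S" using SX SW by (auto simp: s_def S_def)
    obtain D where D: "\<And>N. norm (\<delta> N) \<le> D"
      using convergent_imp_Bseq[of \<delta>] \<delta>(1) unfolding convergent_def Bseq_def by blast
    \<comment> \<open>Bounds all Euler iterates along the net by the size of \<open>X\<close> on
      \<open>{0..\<tau>}\<close> plus the bounded sequence \<open>\<delta>\<close>. It is
      independent of the step size, as it must be, because the constant of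
      \<open>pathwise_perturbation\<close> depends on it.\<close>
    define R where "R = norm (X 0 \<omega>) + s * \<tau> powr (1/8) + D"
    have D0: "0 \<le> D" using D[of 0] norm_ge_zero order_trans by blast
    have R: "0 \<le> R" using s D0 by (simp add: R_def)
    have XR: "norm (X t \<omega>) \<le> norm (X 0 \<omega>) + s * \<tau> powr (1/8)" if t: "0 \<le> t" "t \<le> \<tau>" for t
    proof -
      have "norm (X t \<omega> - X 0 \<omega>) \<le> s * \<bar>t - 0\<bar> powr (1/8)" unfolding s_def using hX[rule_format, of 0 t] t \<tau>_pos by simp
      also have "\<dots> \<le> s * \<tau> powr (1/8)" using t s by (intro mult_left_mono powr_mono2) auto
      finally show ?thesis using norm_triangle_ineq2[of "X t \<omega>" "X 0 \<omega>"] by linarith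
    qed
    have YR: "norm (eul (net N) \<omega> k) \<le> R" if k: "real k * net N \<le> \<tau>" for N k
    proof -
      have "norm (X (real k * net N) \<omega>) \<le> norm (X 0 \<omega>) + s * \<tau> powr (1/8)" using k net(1)[of N] by (intro XR) auto
      moreover have "norm (X (real k * net N) \<omega> - eul (net N) \<omega> k) \<le> D" using \<delta>(2)[OF k] D[of N] by simp
      ultimately show ?thesis
        using norm_triangle_ineq2[of "eul (net N) \<omega> k" "X (real k * net N) \<omega>"] norm_minus_commute[of "eul (net N) \<omega> k"]
        unfolding R_def by (simp add: norm_minus_commute)
    qed
    obtain c where c: "0 \<le> c" and pert0: "\<forall>h h' N \<omega>. 0 < h \<longrightarrow> h \<le> h' \<longrightarrow> h' \<le> h + 2 * h ^ 17 \<longrightarrow> h' \<le> 1 \<longrightarrow> 1 / h ^ 16 \<le> real N \<longrightarrow>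
    c * h \<le> 1 \<longrightarrow> c * h powr (\<gamma> / 2) \<le> 1 \<longrightarrow>
    (\<forall>s\<in>{0..T}. \<forall>t\<in>{0..T}. norm (\<omega> t - \<omega> s) \<le> S * \<bar>t - s\<bar> powr (1/8)) \<longrightarrow>
    (\<forall>k. real k * h \<le> \<tau> \<longrightarrow> norm (eul h \<omega> k) \<le> R) \<longrightarrow>
    (\<forall>v\<in>int_cube N. \<forall>v'\<in>int_cube N. \<forall>k j. real (Suc k + j) * h \<le> \<tau> \<longrightarrow>
       norm (euler b \<sigma> h \<omega> (Suc k) (grid_point h v') j - euler b \<sigma> h \<omega> k (grid_point h v) (Suc j))
         \<le> h powr (- \<gamma> / 2) * max (norm (grid_point h v' - euler b \<sigma> h \<omega> k (grid_point h v) 1)) (h\<^sup>2)) \<longrightarrow>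
    (\<forall>n. real n * h' \<le> \<tau> \<longrightarrow> norm (scheme h' \<omega> n - eul h \<omega> n) \<le> c * h powr (\<gamma> / 2))"
      using pathwise_perturbation[OF S R] by (elim exE conjE) (rule that)
    note pert = pert0[THEN spec, THEN spec, THEN spec, THEN spec, THEN mp, THEN mp, THEN mp, THEN mp, THEN mp, THEN mp, THEN mp,
      THEN mp, THEN mp, THEN mp, THEN spec, THEN mp]
    \<comment> \<open>The index for which \<open>net (Nf h)\<close> is the largest point of the net
      not exceeding \<open>h\<close>; the shift by one matches the use of \<open>Suc N\<close> in
      \<open>net\<close>.\<close>
    define Nf where "Nf h = nat \<lceil>1 / h ^ 16\<rceil> - 1" for h :: real
    have Nf_lim: "filterlim Nf at_top (at_right 0)"
      unfolding filterlim_at_top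
    proof
      fix Z :: nat
      show "eventually (\<lambda>h. Z \<le> Nf h) (at_right 0)"
        unfolding eventually_at_right_field
      proof (intro exI[of _ "1 / real (Suc Z)"] conjI allI impI)
        fix h :: real assume h: "0 < h" "h < 1 / real (Suc Z)"
        have "1 / real (Suc Z) \<le> 1" by simp
        then have h1: "h < 1" using h by linarith
        have "real (Suc Z) \<le> 1 / h" using h by (simp add: field_simps)
        also have "\<dots> \<le> 1 / h ^ 16" using h h1 power_decreasing[of 1 16 h] by (intro divide_left_mono) auto
        finally have "int (Suc Z) \<le> \<lceil>1 / h ^ 16\<rceil>" by linarith
        then show "Z \<le> Nf h" unfolding Nf_def by linarith
      qed simp
    qed
    \<comment> \<open>Collects, in this order, the path modulus from \<open>t\<close> to its grid
      point, the shift between the two time grids, the pathwise perturbation, and one step of the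
      scheme.\<close>
    define A where "A = s + s * (1 + 2 * \<tau>) + c + (K * (2 + R) * S + K * (2 + R) + K * (R + 1 + S))"
    have lim_h: "((\<lambda>h::real. h powr (\<gamma> / 2)) \<longlongrightarrow> 0) (at_right 0)"
    proof -
      have "((\<lambda>h::real. h powr (\<gamma> / 2)) \<longlongrightarrow> 0 powr (\<gamma> / 2)) (at_right 0)"
        using \<gamma> by (intro tendsto_powr' tendsto_const tendsto_ident_at) (auto simp: eventually_at_filter)
      then show ?thesis using \<gamma> by simp
    qed
    have lim_id: "((\<lambda>h::real. h) \<longlongrightarrow> 0) (at_right 0)" by (rule tendsto_ident_at)
    have ev: "eventually (\<lambda>h::real. 0 < h \<and> h < 1) (at_right 0)"
      by (auto simp: eventually_at_right_field intro!: exI[of _ 1])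
    have ev1: "eventually (\<lambda>h::real. c * h < 1) (at_right 0)"
      using tendsto_mult_left[OF lim_id, of c] by (rule order_tendstoD) simp
    have ev2: "eventually (\<lambda>h::real. c * h powr (\<gamma> / 2) < 1) (at_right 0)"
      using tendsto_mult_left[OF lim_h, of c] by (rule order_tendstoD) simp
    have ev3: "eventually (\<lambda>h. \<forall>v\<in>int_cube (Suc (Nf h)). \<forall>v'\<in>int_cube (Suc (Nf h)). \<forall>k j. real (Suc k + j) * net (Nf h) \<le> \<tau> \<longrightarrow>
       norm (euler b \<sigma> (net (Nf h)) \<omega> (Suc k) (grid_point (net (Nf h)) v') j - euler b \<sigma> (net (Nf h)) \<omega> k (grid_point (net (Nf h)) v) (Suc j))
         \<le> net (Nf h) powr (- \<gamma> / 2) * max (norm (grid_point (net (Nf h)) v' - euler b \<sigma> (net (Nf h)) \<omega> k (grid_point (net (Nf h)) v) 1)) ((net (Nf h))\<^sup>2)) (at_right 0)"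
      by (rule eventually_compose_filterlim[OF flow Nf_lim])
    have key: "eventually (\<lambda>h. \<forall>t\<in>{0..\<tau>}. norm (X t \<omega> - interp h \<omega> t) \<le> A * h powr (\<gamma> / 2) + \<delta> (Nf h)) (at_right 0)"
      using ev ev1 ev2 ev3
    proof eventually_elim
      case (elim h')
      define N where "N = Nf h'"
      define h where "h = net N"
      have h': "0 < h'" "h' < 1" using elim by auto
      have "0 < 1 / h' ^ 16" using h' by simp
      then have "0 < \<lceil>1 / h' ^ 16\<rceil>" by (simp only: zero_less_ceiling)
      then have "Suc N = nat \<lceil>1 / h' ^ 16\<rceil>" by (simp add: N_def Nf_def)
      from net_approximation[OF h' this] have h: "0 < h" "h \<le> h'" "h' \<le> h + 2 * h ^ 17" "h \<le> 1"
        using net[of N] by (auto simp: h_def)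
      have p_le: "h' powr (1/8) \<le> h' powr (\<gamma> / 2)" "h' \<le> h' powr (\<gamma> / 2)" "h\<^sup>2 \<le> h' powr (\<gamma> / 2)" "h powr (\<gamma> / 2) \<le> h' powr (\<gamma> / 2)"
      proof -
        show "h' powr (1/8) \<le> h' powr (\<gamma> / 2)" using h' \<gamma> by (intro powr_mono') auto
        show "h' \<le> h' powr (\<gamma> / 2)" using h' \<gamma> powr_mono'[of "\<gamma> / 2" 1 h'] by simp
        show 1: "h powr (\<gamma> / 2) \<le> h' powr (\<gamma> / 2)" using h \<gamma> by (intro powr_mono2) auto
        have "h powr 2 \<le> h powr (\<gamma> / 2)" using h \<gamma> by (intro powr_mono') auto
        then show "h\<^sup>2 \<le> h' powr (\<gamma> / 2)" using 1 h by simp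
      qed
      have small: "c * h \<le> 1" "c * h powr (\<gamma> / 2) \<le> 1"
        using mult_left_mono[OF h(2) c] mult_left_mono[OF p_le(4) c] elim(2,3) by linarith+
      have N16: "1 / h ^ 16 \<le> real (Suc N)" unfolding h_def net(3) by simp
      have pert': "norm (scheme h' \<omega> k - eul h \<omega> k) \<le> c * h powr (\<gamma> / 2)" if "real k * h' \<le> \<tau>" for k
      proof (rule pert[OF h(1-3) _ N16 small _ _ _ that])
        show "\<forall>s\<in>{0..T}. \<forall>t\<in>{0..T}. norm (\<omega> t - \<omega> s) \<le> S * \<bar>t - s\<bar> powr (1/8)" using hW unfolding S_def .
        show "\<forall>k. real k * h \<le> \<tau> \<longrightarrow> norm (eul h \<omega> k) \<le> R" unfolding h_def using YR by blast
      qed (use h' elim(4) in \<open>auto simp: h_def N_def\<close>)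
      show ?case
      proof
        fix t assume t: "t \<in> {0..\<tau>}"
        obtain k where k: "real k * h' \<le> t" "t \<le> real k * h' + h'"
          and le: "norm (X t \<omega> - interp h' \<omega> t) \<le> norm (X t \<omega> - X (real k * h') \<omega>) + norm (X (real k * h') \<omega> - scheme h' \<omega> k)
      + norm (scheme h' \<omega> (Suc k) - scheme h' \<omega> k)"
          using Xbar_error[OF h'(1), of t \<omega>] t by auto
        have kh: "real k * h' \<le> \<tau>" using k t by auto
        note shift = grid_time_shift[OF h(1-3) kh]
        define u where "u = h' powr (\<gamma> / 2)"
        define P where "P = scheme h' \<omega> k"
        define y where "y = \<omega> (real (Suc k) * h') - \<omega> (real k * h')"
        have e1: "norm (X t \<omega> - X (real k * h') \<omega>) \<le> s * u"
        proof -
          have "norm (X t \<omega> - X (real k * h') \<omega>) \<le> s * \<bar>t - real k * h'\<bar> powr (1/8)"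
            unfolding s_def using hX t kh shift(2) by auto
          also have "\<dots> \<le> s * h' powr (1/8)" using k s by (intro mult_left_mono powr_mono2) auto
          also have "\<dots> \<le> s * u" unfolding u_def using s p_le by (intro mult_left_mono)
          finally show ?thesis .
        qed
        have e2: "norm (X (real k * h') \<omega> - X (real k * h) \<omega>) \<le> s * (1 + 2 * \<tau>) * u"
        proof -
          have "norm (X (real k * h') \<omega> - X (real k * h) \<omega>) \<le> s * \<bar>real k * h' - real k * h\<bar> powr (1/8)"
            unfolding s_def using hX kh shift h by auto
          also have "\<dots> \<le> s * ((1 + 2 * \<tau>) * h\<^sup>2)" using s shift(3) by (intro mult_left_mono)
          also have "\<dots> \<le> s * ((1 + 2 * \<tau>) * u)" unfolding u_def using s \<tau>_pos p_le by (intro mult_left_mono) auto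
          finally show ?thesis by (simp add: mult.assoc)
        qed
        have e3: "norm (X (real k * h) \<omega> - eul h \<omega> k) \<le> \<delta> N" unfolding h_def by (rule \<delta>(2)) (use shift(1) in \<open>simp add: h_def\<close>)
        have e4: "norm (P - eul h \<omega> k) \<le> c * u"
          unfolding P_def u_def using pert'[OF kh] mult_left_mono[OF p_le(4) c] by linarith
        have PR: "norm P \<le> R + 1"
        proof -
          have "norm (P - eul h \<omega> k) \<le> 1" unfolding P_def using pert'[OF kh] small(2) by linarith
          moreover have "norm (eul h \<omega> k) \<le> R" unfolding h_def by (rule YR) (use shift(1) in \<open>simp add: h_def\<close>)
          ultimately show ?thesis using norm_triangle_ineq2[of P "eul h \<omega> k"] by linarith
        qed
        have yS: "norm y \<le> S * h' powr (1/8)"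
        proof -
          have d: "real (Suc k) * h' - real k * h' = h'" by (simp add: distrib_right)
          have "real k * h' \<in> {0..T}" "real (Suc k) * h' \<in> {0..T}"
            using shift(2) kh h' d T_def by auto
          then have "norm y \<le> S * \<bar>real (Suc k) * h' - real k * h'\<bar> powr (1/8)"
            unfolding y_def S_def using hW by blast
          then show ?thesis unfolding d using h' by simp
        qed
        have yS1: "norm y \<le> S"
          using yS S h' mult_left_le[of "h' powr (1/8)" S] by (auto simp: powr_le1)
        have e5: "norm (scheme h' \<omega> (Suc k) - P) \<le> (K * (2 + R) * S + K * (2 + R) + K * (R + 1 + S)) * u"
        proof -
          have KR: "K * (1 + norm P) \<le> K * (2 + R)" using PR K0 by (intro mult_left_mono) auto
          have "scheme h' \<omega> (Suc k) - P = \<sigma> P *v y + h' *\<^sub>R b P + h' *\<^sub>R \<eta> h' P y"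
            unfolding P_def y_def by (simp add: U_step_def)
          then have "norm (scheme h' \<omega> (Suc k) - P) \<le> norm (\<sigma> P *v y) + norm (h' *\<^sub>R b P) + norm (h' *\<^sub>R \<eta> h' P y)"
            by (simp only: norm_triangle3)
          also have "norm (\<sigma> P *v y) \<le> K * (2 + R) * S * u"
          proof -
            have "norm (\<sigma> P *v y) \<le> norm (\<sigma> P) * norm y" by (rule vec_norm_mult_le)
            also have "\<dots> \<le> K * (2 + R) * (S * h' powr (1/8))"
              using order_trans[OF \<sigma>_growth KR] yS K0 R by (intro mult_mono) auto
            also have "\<dots> \<le> K * (2 + R) * (S * u)" unfolding u_def using K0 R S p_le by (intro mult_left_mono) auto
            finally show ?thesis by (simp add: mult.assoc)
          qed
          also have "norm (h' *\<^sub>R b P) \<le> K * (2 + R) * u"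
          proof -
            have "norm (h' *\<^sub>R b P) = norm (b P) * h'" using h' by simp
            also have "\<dots> \<le> K * (2 + R) * u"
              unfolding u_def using order_trans[OF b_growth KR] h' p_le K0 R by (intro mult_mono) auto
            finally show ?thesis .
          qed
          also have "norm (h' *\<^sub>R \<eta> h' P y) \<le> K * (R + 1 + S) * u"
          proof -
            have "norm (\<eta> h' P y) \<le> K * (h' powr \<gamma> * norm P + norm y)" using h' by (intro \<eta>_bound) auto
            also have "\<dots> \<le> K * (1 * (R + 1) + S)"
              using K0 R PR yS1 h' \<gamma> by (intro mult_left_mono add_mono mult_mono) (auto simp: powr_le1)
            finally have "norm (\<eta> h' P y) * h' \<le> K * (R + 1 + S) * u"
              unfolding u_def using h' p_le K0 R S by (intro mult_mono) auto
            then show ?thesis using h' by (simp add: mult.commute)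
          qed
          finally show ?thesis by (simp only: distrib_right)
        qed
        have "norm (X (real k * h') \<omega> - P) \<le> norm (X (real k * h') \<omega> - X (real k * h) \<omega>) + norm (X (real k * h) \<omega> - eul h \<omega> k) + norm (P - eul h \<omega> k)"
          by (rule norm_telescope3)
        then have "norm (X t \<omega> - interp h' \<omega> t) \<le> s * u + (s * (1 + 2 * \<tau>) * u + \<delta> N + c * u) + (K * (2 + R) * S + K * (2 + R) + K * (R + 1 + S)) * u"
          using le e1 e2 e3 e4 e5 unfolding P_def by linarith
        also have "\<dots> = A * u + \<delta> N" by (simp add: A_def algebra_simps)
        finally show "norm (X t \<omega> - interp h' \<omega> t) \<le> A * h' powr (\<gamma> / 2) + \<delta> (Nf h')" unfolding u_def N_def .
      qed
    qed
    have "((\<lambda>h. A * h powr (\<gamma> / 2) + \<delta> (Nf h)) \<longlongrightarrow> A * 0 + 0) (at_right 0)"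
      by (intro tendsto_add tendsto_mult tendsto_const lim_h filterlim_compose[OF \<delta>(1) Nf_lim])
    then have lim: "((\<lambda>h. A * h powr (\<gamma> / 2) + \<delta> (Nf h)) \<longlongrightarrow> 0) (at_right 0)" by simp
    show ?case
    proof (rule tendsto_sandwich[OF _ _ tendsto_const lim])
      show "\<forall>\<^sub>F h in at_right 0. 0 \<le> (SUP t\<in>{0..\<tau>}. norm (X t \<omega> - interp h \<omega> t))"
        using key by eventually_elim (rule SUP_bounds, use \<tau>_pos in auto)
      show "\<forall>\<^sub>F h in at_right 0. (SUP t\<in>{0..\<tau>}. norm (X t \<omega> - interp h \<omega> t)) \<le> A * h powr (\<gamma> / 2) + \<delta> (Nf h)"
        using key by eventually_elim (rule SUP_bounds, use \<tau>_pos in auto)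
    qed
  qed
qed

end

section \<open>Reduction of the hypotheses to one constant and one rate\<close>

lemma hpow_le_powr:
  assumes "0 < \<alpha>"
  shows "\<exists>\<gamma>. 0 < \<gamma> \<and> \<gamma> \<le> 1/8 \<and> (\<forall>h. 0 < h \<longrightarrow> h \<le> 1 \<longrightarrow> 0 \<le> hpow h \<alpha> \<and> hpow h \<alpha> \<le> h powr \<gamma>)"
proof (cases "\<alpha> = \<infinity>")
  case True
  then show ?thesis by (intro exI[of _ "1/8"]) (auto simp: hpow_def)
next
  case False
  define a where "a = real_of_ereal \<alpha>"
  have a: "0 < a" using assms False unfolding a_def by (cases \<alpha>) auto
  have "hpow h \<alpha> \<le> h powr min a (1/8)" if "0 < h" "h \<le> 1" for h
    using that False a by (auto simp: hpow_def a_def[symmetric] intro!: powr_mono')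
  then show ?thesis using a False by (intro exI[of _ "min a (1/8)"]) (auto simp: hpow_def)
qed

theorem theorem5p3:
  fixes M :: "(real \<Rightarrow> real^'d::finite) measure"
    and b :: "real^'m::finite \<Rightarrow> real^'m"
    and \<sigma> :: "real^'m \<Rightarrow> real^'d^'m"
    and \<eta> :: "real \<Rightarrow> real^'m \<Rightarrow> real^'d \<Rightarrow> real^'m"
    and \<alpha> :: ereal and K0 K2 \<tau> :: real and x0 :: "real^'m"
    and X :: "real \<Rightarrow> (real \<Rightarrow> real^'d) \<Rightarrow> real^'m"
  assumes wiener: "is_wiener_measure M"
    and b_lip: "\<And>x y. norm (b x - b y) \<le> K0 * norm (x - y)"
    and \<sigma>_lip: "\<And>x y. norm (\<sigma> x - \<sigma> y) \<le> K0 * norm (x - y)"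
    and \<alpha>_pos: "0 < \<alpha>"
    and \<eta>_meas: "\<And>h. 0 < h \<Longrightarrow> (\<lambda>(x, y). \<eta> h x y) \<in> borel_measurable borel"
    and \<eta>_bound: "\<And>h x y. 0 < h \<Longrightarrow> norm (\<eta> h x y) \<le> K2 * (hpow h \<alpha> * norm x + norm y)"
    and \<tau>_pos: "0 < \<tau>"
    and sol: "sde_solution M b \<sigma> x0 \<tau> X"
  shows "(\<forall>p>2. ((\<lambda>h. \<integral>\<^sup>+ \<omega>. ennreal ((SUP t\<in>{0..\<tau>}. norm (X t \<omega> - Xbar b \<sigma> \<eta> h x0 \<omega> t)) powr p) \<partial>M)
                 \<longlongrightarrow> 0) (at_right 0))
         \<and> (AE \<omega> in M. ((\<lambda>h. SUP t\<in>{0..\<tau>}. norm (X t \<omega> - Xbar b \<sigma> \<eta> h x0 \<omega> t)) \<longlongrightarrow> 0) (at_right 0))"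
proof -
  obtain \<gamma> where \<gamma>: "0 < \<gamma>" "\<gamma> \<le> 1/8" "\<And>h. 0 < h \<Longrightarrow> h \<le> 1 \<Longrightarrow> 0 \<le> hpow h \<alpha> \<and> hpow h \<alpha> \<le> h powr \<gamma>"
    using hpow_le_powr[OF \<alpha>_pos] by blast
  \<comment> \<open>\<open>K0\<close> and \<open>K2\<close> carry no sign, hence the absolute
    values. The values of the coefficients at 0 turn the Lipschitz bounds into linear growth, and
    the summand 1 provides \<open>1 \<le> K\<close>.\<close>
  define K where "K = 1 + \<bar>K0\<bar> + \<bar>K2\<bar> + norm (b 0) + norm (\<sigma> 0)"
  have K: "1 \<le> K" "\<bar>K0\<bar> \<le> K" "\<bar>K2\<bar> \<le> K" "norm (b 0) \<le> K" "norm (\<sigma> 0) \<le> K"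
    by (auto simp: K_def)
  have K0: "K0 * r \<le> K * r" if "0 \<le> r" for r
    using that K(2) by (intro mult_right_mono) auto
  have b_growth: "norm (b x) \<le> K * (1 + norm x)" for x
    using order_trans[OF b_lip[of x 0] K0] K(4) norm_triangle_ineq2[of "b x" "b 0"] by (simp add: distrib_left)
  have \<sigma>_growth: "norm (\<sigma> x) \<le> K * (1 + norm x)" for x
    using order_trans[OF \<sigma>_lip[of x 0] K0] K(5) norm_triangle_ineq2[of "\<sigma> x" "\<sigma> 0"] by (simp add: distrib_left)
  have eta: "norm (\<eta> h x y) \<le> K * (h powr \<gamma> * norm x + norm y)" if h: "0 < h" "h \<le> 1" for h x y
  proof -
    have nn: "0 \<le> hpow h \<alpha> * norm x + norm y" using \<gamma>(3)[OF h] by simp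
    have "norm (\<eta> h x y) \<le> K2 * (hpow h \<alpha> * norm x + norm y)" by (rule \<eta>_bound[OF h(1)])
    also have "\<dots> \<le> K * (hpow h \<alpha> * norm x + norm y)" using K(3) nn by (intro mult_right_mono) auto
    also have "\<dots> \<le> K * (h powr \<gamma> * norm x + norm y)"
      using K(1) \<gamma>(3)[OF h] by (intro mult_left_mono add_right_mono mult_right_mono) auto
    finally show ?thesis .
  qed
  interpret perturbed_euler_scheme M b \<sigma> K x0 \<tau> X \<eta> \<gamma>
  proof
    show "norm (b x - b y) \<le> K * norm (x - y)" for x y by (rule order_trans[OF b_lip K0]) simp
    show "norm (\<sigma> x - \<sigma> y) \<le> K * norm (x - y)" for x y by (rule order_trans[OF \<sigma>_lip K0]) simp
  qed (fact wiener K b_growth \<sigma>_growth \<tau>_pos sol \<gamma> \<eta>_meas eta)+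
  show ?thesis using Lp_convergence almost_sure_convergence by auto
qed

end
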